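(* Let $\Gamma$ be a finitely generated, recursively presented group that is residually finite. Then there exist a finitely generated, residually finite, free-by-free group $M_\Gamma$ of the form $M_\Gamma = F_\infty \rtimes F_4$ and an injective homomorphism $M_\Gamma \hookrightarrow (F_4 \ast \Gamma)\times F_4$ such that the induced homomorphism of profinite completions $\widehat{M}_\Gamma \to \widehat{(F_4\ast\Gamma)\times F_4}$ is an isomorphism.
   Context: $F_4$ denotes the free group of rank $4$, and $F_\infty$ the free group of countably infinite rank. $F_\infty\rtimes F_4$ means a semidirect product with normal subgroup $F_\infty$ and quotient $F_4$, for some action of $F_4$ on $F_\infty$. A group is free-by-free if it has a free normal subgroup such that the quotient is free. $\ast$ denotes the free product of groups. The profinite completion of a group $G$ is $\widehat{G}=\varprojlim G/N$, the inverse limit over all finite-index normal subgroups $N$ of $G$; a homomorphism $G\to H$ induces a continuous homomorphism $\widehat{G}\to\widehat{H}$. A finitely generated group is recursively presented if it has a presentation with finitely many generators and a recursively enumerable set of defining relators. *)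

theory Defs
  imports
    "HOL-Algebra.Bij"
    "HOL-Algebra.Generated_Groups"
    "HOL-Algebra.Product_Groups"
    "HOL-Analysis.Analysis"
    "HOL-Library.Nat_Bijection"
begin

section \<open>Free groups\<close>

text \<open>
  The free group on \<open>S\<close> is realised on reduced words. A letter \<open>(x, True)\<close> stands for
  \<open>x\<close> and \<open>(x, False)\<close> for its formal inverse. \<open>free_cons\<close> is left multiplication of a
  reduced word by a single letter.
\<close>

definition free_reduced :: "('a \<times> bool) list \<Rightarrow> bool" where
  "free_reduced w \<longleftrightarrow> successively (\<lambda>l l'. \<not> (fst l = fst l' \<and> snd l \<noteq> snd l')) w"

fun free_cons :: "'a \<times> bool \<Rightarrow> ('a \<times> bool) list \<Rightarrow> ('a \<times> bool) list" where
  "free_cons l [] = [l]"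
| "free_cons l (l' # w) = (if fst l = fst l' \<and> snd l \<noteq> snd l' then w else l # l' # w)"

definition free_group :: "'a set \<Rightarrow> ('a \<times> bool) list monoid" where
  "free_group S =
     \<lparr>carrier = {w. fst ` set w \<subseteq> S \<and> free_reduced w},
      monoid.mult = foldr free_cons,
      one = []\<rparr>"

text \<open>
  A basis can always be chosen inside the group, so letting \<open>S\<close> range over sets of the
  carrier type is no restriction.
\<close>

definition is_free_group :: "('a, 'm) monoid_scheme \<Rightarrow> bool" where
  "is_free_group G \<longleftrightarrow> group G \<and> (\<exists>S :: 'a set. G \<cong> free_group S)"

definition free_by_free :: "('a, 'm) monoid_scheme \<Rightarrow> bool" where
  "free_by_free G \<longleftrightarrow>
     (\<exists>N. N \<lhd> G \<and> is_free_group (G\<lparr>carrier := N\<rparr>) \<and> is_free_group (G Mod N))"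


section \<open>Free products\<close>

text \<open>
  The free product is realised on normal forms: words of non-identity elements taken alternately
  from the two factors. \<open>free_product_cons\<close> is left multiplication of a normal form by a single
  non-identity element of a factor.
\<close>

fun free_product_cons ::
  "('a, 'm) monoid_scheme \<Rightarrow> ('b, 'n) monoid_scheme \<Rightarrow> 'a + 'b \<Rightarrow> ('a + 'b) list \<Rightarrow> ('a + 'b) list"
where
  "free_product_cons G H (Inl a) (Inl a' # w) =
     (if a \<otimes>\<^bsub>G\<^esub> a' = \<one>\<^bsub>G\<^esub> then w else Inl (a \<otimes>\<^bsub>G\<^esub> a') # w)"
| "free_product_cons G H (Inr b) (Inr b' # w) =
     (if b \<otimes>\<^bsub>H\<^esub> b' = \<one>\<^bsub>H\<^esub> then w else Inr (b \<otimes>\<^bsub>H\<^esub> b') # w)"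
| "free_product_cons G H l w = l # w"

definition free_product ::
  "('a, 'm) monoid_scheme \<Rightarrow> ('b, 'n) monoid_scheme \<Rightarrow> ('a + 'b) list monoid"
where
  "free_product G H =
     \<lparr>carrier = {w. set w \<subseteq> Inl ` (carrier G - {\<one>\<^bsub>G\<^esub>}) \<union> Inr ` (carrier H - {\<one>\<^bsub>H\<^esub>})
                  \<and> successively (\<lambda>l l'. isl l \<noteq> isl l') w},
      monoid.mult = foldr (free_product_cons G H),
      one = []\<rparr>"


section \<open>Semidirect products\<close>

text \<open>Here \<open>H\<close> acts on the normal factor \<open>N\<close> through \<open>\<alpha> \<in> hom H (AutoGroup N)\<close>.\<close>

definition semidirect_product ::
  "('a, 'm) monoid_scheme \<Rightarrow> ('b, 'n) monoid_scheme \<Rightarrow> ('b \<Rightarrow> 'a \<Rightarrow> 'a) \<Rightarrow> ('a \<times> 'b) monoid"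
where
  "semidirect_product N H \<alpha> =
     \<lparr>carrier = carrier N \<times> carrier H,
      monoid.mult = (\<lambda>(n, h) (n', h'). (n \<otimes>\<^bsub>N\<^esub> \<alpha> h n', h \<otimes>\<^bsub>H\<^esub> h')),
      one = (\<one>\<^bsub>N\<^esub>, \<one>\<^bsub>H\<^esub>)\<rparr>"


section \<open>Finite generation and recursive presentations\<close>

definition finitely_generated :: "('a, 'm) monoid_scheme \<Rightarrow> bool" where
  "finitely_generated G \<longleftrightarrow> (\<exists>S. finite S \<and> S \<subseteq> carrier G \<and> generate G S = carrier G)"

definition normal_closure :: "('a, 'm) monoid_scheme \<Rightarrow> 'a set \<Rightarrow> 'a set" where
  "normal_closure G R = \<Inter>{N. N \<lhd> G \<and> R \<subseteq> N}"

text \<open>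
  Partial recursive functions: terms built from the basic functions by composition, primitive
  recursion (on the first argument) and unbounded minimisation (over the first argument).
  \<open>rec_eval f xs y\<close> says that \<open>f\<close> is defined on the argument tuple \<open>xs\<close> with value \<open>y\<close>.
\<close>

datatype rec_fun =
    Zero_fun
  | Succ_fun
  | Proj_fun nat
  | Comp_fun rec_fun "rec_fun list"
  | Prim_rec rec_fun rec_fun
  | Minim rec_fun

inductive rec_eval :: "rec_fun \<Rightarrow> nat list \<Rightarrow> nat \<Rightarrow> bool" where
  "rec_eval Zero_fun xs 0"
| "rec_eval Succ_fun (x # xs) (Suc x)"
| "i < length xs \<Longrightarrow> rec_eval (Proj_fun i) xs (xs ! i)"
| "\<lbrakk>list_all2 (\<lambda>g y. rec_eval g xs y) gs ys; rec_eval f ys z\<rbrakk> \<Longrightarrow> rec_eval (Comp_fun f gs) xs z"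
| "rec_eval f xs y \<Longrightarrow> rec_eval (Prim_rec f g) (0 # xs) y"
| "\<lbrakk>rec_eval (Prim_rec f g) (n # xs) r; rec_eval g (n # r # xs) y\<rbrakk>
     \<Longrightarrow> rec_eval (Prim_rec f g) (Suc n # xs) y"
| "\<lbrakk>rec_eval f (n # xs) 0; \<And>m. m < n \<Longrightarrow> \<exists>k. rec_eval f (m # xs) (Suc k)\<rbrakk>
     \<Longrightarrow> rec_eval (Minim f) xs n"

definition recursively_enumerable :: "nat set \<Rightarrow> bool" where
  "recursively_enumerable A \<longleftrightarrow> (\<exists>f. A = {x. \<exists>y. rec_eval f [x] y})"

text \<open>
  Words are turned into numbers by an explicit computable bijection. (The function \<open>to_nat\<close>
  of class \<open>countable\<close> would not do: it is an arbitrary injection.)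
\<close>

definition word_code :: "(nat \<times> bool) list \<Rightarrow> nat" where
  "word_code w = list_encode (map (\<lambda>(i, b). prod_encode (i, of_bool b)) w)"

text \<open>
  Relators are taken to be reduced words. This is no restriction, as free reduction is computable.
\<close>

definition recursively_presented :: "('a, 'm) monoid_scheme \<Rightarrow> bool" where
  "recursively_presented G \<longleftrightarrow> group G \<and>
     (\<exists>n R. R \<subseteq> carrier (free_group {..<n}) \<and> recursively_enumerable (word_code ` R)
          \<and> G \<cong> free_group {..<n} Mod normal_closure (free_group {..<n}) R)"


section \<open>Residual finiteness and profinite completions\<close>

definition finite_index_normal :: "('a, 'm) monoid_scheme \<Rightarrow> 'a set set" where
  "finite_index_normal G = {N. N \<lhd> G \<and> finite (rcosets\<^bsub>G\<^esub> N)}"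

definition residually_finite :: "('a, 'm) monoid_scheme \<Rightarrow> bool" where
  "residually_finite G \<longleftrightarrow>
     (\<forall>g \<in> carrier G. g \<noteq> \<one>\<^bsub>G\<^esub> \<longrightarrow> (\<exists>N \<in> finite_index_normal G. g \<notin> N))"

text \<open>
  The inverse limit of the finite quotients, inside their product. For \<open>N \<subseteq> N'\<close> the transition
  map from \<open>G Mod N\<close> to \<open>G Mod N'\<close> sends a coset \<open>C\<close> to \<open>N' <#>\<^bsub>G\<^esub> C\<close>.
\<close>

definition profinite_completion :: "('a, 'm) monoid_scheme \<Rightarrow> ('a set \<Rightarrow> 'a set) monoid" where
  "profinite_completion G =
     (product_group (finite_index_normal G) (\<lambda>N. G Mod N))
       \<lparr>carrier := {x \<in> \<Pi>\<^sub>E N \<in> finite_index_normal G. carrier (G Mod N).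
          \<forall>N \<in> finite_index_normal G. \<forall>N' \<in> finite_index_normal G.
             N \<subseteq> N' \<longrightarrow> x N' = N' <#>\<^bsub>G\<^esub> x N}\<rparr>"

definition profinite_topology :: "('a, 'm) monoid_scheme \<Rightarrow> ('a set \<Rightarrow> 'a set) topology" where
  "profinite_topology G =
     subtopology
       (product_topology (\<lambda>N. discrete_topology (carrier (G Mod N))) (finite_index_normal G))
       (carrier (profinite_completion G))"

text \<open>
  The map induced by a homomorphism \<open>\<phi>\<close>: its component at \<open>K\<close> is the component at the
  preimage of \<open>K\<close>, followed by the homomorphism of finite quotients induced by \<open>\<phi>\<close>, which
  sends a coset \<open>C\<close> to the coset \<open>K <#>\<^bsub>H\<^esub> \<phi> ` C\<close>.
\<close>

definition profinite_map ::
  "('a, 'm) monoid_scheme \<Rightarrow> ('b, 'n) monoid_scheme \<Rightarrow> ('a \<Rightarrow> 'b)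
     \<Rightarrow> ('a set \<Rightarrow> 'a set) \<Rightarrow> ('b set \<Rightarrow> 'b set)"
where
  "profinite_map G H \<phi> x =
     (\<lambda>K \<in> finite_index_normal H. K <#>\<^bsub>H\<^esub> \<phi> ` x {g \<in> carrier G. \<phi> g \<in> K})"

text \<open>Isomorphisms of profinite completions are isomorphisms of topological groups.\<close>

definition induces_profinite_iso ::
  "('a, 'm) monoid_scheme \<Rightarrow> ('b, 'n) monoid_scheme \<Rightarrow> ('a \<Rightarrow> 'b) \<Rightarrow> bool"
where
  "induces_profinite_iso G H \<phi> \<longleftrightarrow>
     profinite_map G H \<phi> \<in> iso (profinite_completion G) (profinite_completion H)
     \<and> homeomorphic_map (profinite_topology G) (profinite_topology H) (profinite_map G H \<phi>)"

end

theory Submission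
  imports Defs "HOL-Number_Theory.Residues"
begin

text \<open>
  Write \<open>P\<close> for the free product of \<open>F\<close> and \<open>\<Gamma>\<close>, with \<open>F\<close> free of rank four. We choose a finite set \<open>R\<close> of relators such that
  the quotient \<open>Q\<close> of \<open>P\<close> by the normal closure \<open>N1\<close> of \<open>R\<close> is infinite, is generated by the image of \<open>F\<close>,
  contains \<open>\<Gamma>\<close>, has no proper subgroup of finite index and splits off every finite kernel. Then \<open>M\<close> is the
  fibre product of \<open>P\<close> and \<open>F\<close> over \<open>Q\<close>, that is, a semidirect product of \<open>N1\<close> and \<open>F\<close>, embedded in \<open>P \<times> F\<close>. It is finitely generated because
  \<open>N1\<close> is finitely generated as a normal subgroup, and \<open>N1\<close> is free of infinite rank because it meets the
  conjugates of \<open>\<Gamma>\<close> trivially and \<open>Q\<close> is infinite. As \<open>Q\<close> has no finite quotients, \<open>M\<close> is dense in the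
  profinite topology of \<open>P \<times> F\<close>; the splitting property makes this topology induce the full profinite topology
  on \<open>M\<close>. This is the argument of Platonov--Tavgen and Bridson, with an explicit group \<open>Q\<close> containing the
  given \<open>\<Gamma>\<close>: a swindle kills \<open>D = \<langle>b, c\<rangle>\<close> in finite quotients and at the same time writes the elements of \<open>D\<close> as
  commutators, which depend only on images in a central quotient; hence the relators lift to central extensions.
\<close>

section \<open>Groups\<close>

text \<open>That \<open>Q\<close> has no finite quotients only gives density. For the topology on
  \<open>M\<close>, the classical criterion asks in addition for \<open>H_2(Q, Z) = 0\<close>; here
  its consequence is proved directly. The kernel of a finite extension of \<open>Q\<close> is first
  made central: its centraliser has finite index and so still maps onto \<open>Q\<close>. What
  remains is to lift the relators to central extensions, and they are shaped for this. In the
  relations defining \<open>s\<close> and \<open>x\<close>, the right-hand sides contain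
  \<open>s\<close> and \<open>x\<close> only as conjugators or inside commutators, where central
  changes are invisible; so the right-hand side, evaluated at arbitrary lifts, is already a correct
  lift. The torsion relators of \<open>D\<close> have the exponents \<open>N\<close>,
  \<open>N - 2\<close> and 6, the orders of two cycles and of their quotient;
  \<open>N mod 6 = 1\<close> makes them pairwise coprime, hence \<open>D\<close> perfect. No normal
  form for \<open>Q\<close> is needed: that \<open>Q\<close> is infinite and contains \<Gamma>
  follows from one explicit permutation model. The obstacle there is to have \<Gamma> and all
  auxiliary permutations inside a two-generator group with such orders, and to let \<open>D\<close>,
  which lives in one region, produce the permutations of the regions as well.\<close>

context group begin

lemma inv_mult_cancel [simp]:
  "\<lbrakk>x \<in> carrier G; y \<in> carrier G\<rbrakk> \<Longrightarrow> inv x \<otimes> (x \<otimes> y) = y"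
  "\<lbrakk>x \<in> carrier G; y \<in> carrier G\<rbrakk> \<Longrightarrow> x \<otimes> (inv x \<otimes> y) = y"
  by (simp_all flip: m_assoc)

end

lemma hom_eq_on_generate:
  assumes "group G" "group H" "f \<in> hom G H" "g \<in> hom G H" "S \<subseteq> carrier G"
    "\<And>x. x \<in> S \<Longrightarrow> f x = g x" "x \<in> generate G S"
  shows "f x = g x"
proof -
  interpret G: group G by fact
  interpret H: group H by fact
  interpret f: group_hom G H f by unfold_locales fact
  interpret g: group_hom G H g by unfold_locales fact
  have in_G: "generate G S \<subseteq> carrier G" using G.generate_incl assms(5) .
  from assms(7) show ?thesis
  proof induction
    case (inv h) then show ?case using assms(5,6) by auto
  next
    case (eng h1 h2)
    then have "h1 \<in> carrier G" "h2 \<in> carrier G" using in_G by auto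
    then show ?case using eng by simp
  qed (use assms(5,6) in auto)
qed

section \<open>Free groups\<close>

abbreviation free_flip :: "'a \<times> bool \<Rightarrow> 'a \<times> bool" where
  "free_flip l \<equiv> (fst l, \<not> snd l)"

abbreviation free_gen :: "'a \<Rightarrow> ('a \<times> bool) list" where
  "free_gen x \<equiv> [(x, True)]"

lemma free_reduced_Nil [simp]: "free_reduced []"
  by (simp add: free_reduced_def)

lemma free_reduced_single [simp]: "free_reduced [l]"
  by (simp add: free_reduced_def)

lemma free_reduced_Cons_Cons [simp]:
  "free_reduced (l # l' # w) \<longleftrightarrow> \<not> (fst l = fst l' \<and> snd l \<noteq> snd l') \<and> free_reduced (l' # w)"
  by (simp add: free_reduced_def)

lemma free_reduced_tl: "free_reduced (l # w) \<Longrightarrow> free_reduced w"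
  by (cases w) auto

lemma free_cons_eq_Cons: "free_reduced (l # w) \<Longrightarrow> free_cons l w = l # w"
  by (cases w) auto

lemma free_reduced_free_cons: "free_reduced w \<Longrightarrow> free_reduced (free_cons l w)"
  by (cases w) (auto dest: free_reduced_tl)

lemma set_free_cons: "set (free_cons l w) \<subseteq> insert l (set w)"
  by (cases w) auto

text \<open>Reducedness matters when \<open>(x, b)\<close> cancels the head of \<open>w\<close>: the
  letter put back must not cancel again with the new head.\<close>

lemma free_cons_cancel:
  assumes "free_reduced w"
  shows "free_cons (x, \<not> b) (free_cons (x, b) w) = w"
  using assms by (cases w; cases "tl w") (auto split: if_splits)

lemma carrier_free_group: "carrier (free_group S) = {w. fst ` set w \<subseteq> S \<and> free_reduced w}"
  and mult_free_group: "u \<otimes>\<^bsub>free_group S\<^esub> v = foldr free_cons u v"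
  and one_free_group [simp]: "\<one>\<^bsub>free_group S\<^esub> = []"
  by (simp_all add: free_group_def)

lemma free_reduced_foldr: "free_reduced v \<Longrightarrow> free_reduced (foldr free_cons u v)"
  by (induction u) (auto intro: free_reduced_free_cons)

lemma set_foldr_free_cons: "set (foldr free_cons u v) \<subseteq> set u \<union> set v"
proof (induction u)
  case (Cons a u)
  then show ?case using set_free_cons[of a "foldr free_cons u v"] by auto
qed auto

lemma fst_set_foldr_free_cons:
  "fst ` set u \<subseteq> S \<Longrightarrow> fst ` set v \<subseteq> S \<Longrightarrow> fst ` set (foldr free_cons u v) \<subseteq> S"
  using set_foldr_free_cons[of u v] by (force simp: image_subset_iff)

text \<open>The core of van der Waerden's argument for associativity: words act on reduced words
  letter by letter, and a cancellation inside the acting word is undone by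
  \<open>free_cons_cancel\<close>.\<close>

lemma foldr_free_cons_free_cons:
  assumes "free_reduced v"
  shows "foldr free_cons (free_cons l u) v = free_cons l (foldr free_cons u v)"
proof (cases u)
  case (Cons l' u')
  show ?thesis
  proof (cases "fst l = fst l' \<and> snd l \<noteq> snd l'")
    case True
    then have l: "l = (fst l', \<not> snd l')" by (cases l; cases l') auto
    then show ?thesis using Cons True
      free_cons_cancel[OF free_reduced_foldr[OF assms], of "fst l'" "snd l'"] by simp
  qed (use Cons in auto)
qed auto

lemma foldr_free_cons_assoc:
  assumes "free_reduced w"
  shows "foldr free_cons (foldr free_cons u v) w = foldr free_cons u (foldr free_cons v w)"
  by (induction u) (simp_all add: foldr_free_cons_free_cons assms)

lemma foldr_free_cons_Nil: "free_reduced w \<Longrightarrow> foldr free_cons w [] = w"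
proof (induction w)
  case (Cons l w)
  then show ?case using free_reduced_tl[OF Cons.prems] by (simp add: free_cons_eq_Cons)
qed simp

lemma foldr_free_cons_flip:
  assumes "free_reduced v"
  shows "foldr free_cons (rev (map free_flip w)) (foldr free_cons w v) = v"
  using assms
proof (induction w arbitrary: v)
  case (Cons l w)
  then show ?case
    using free_cons_cancel[OF free_reduced_foldr, of v "fst l" "snd l" w] by simp
qed simp

lemma free_reduced_rev: "free_reduced (rev (map free_flip w)) \<longleftrightarrow> free_reduced w"
  by (auto simp: free_reduced_def successively_map intro!: successively_cong)

lemma group_free_group: "group (free_group S)"
proof (rule groupI)
  fix u v w
  assume "u \<in> carrier (free_group S)" "v \<in> carrier (free_group S)" "w \<in> carrier (free_group S)"
  then show "u \<otimes>\<^bsub>free_group S\<^esub> v \<otimes>\<^bsub>free_group S\<^esub> w = u \<otimes>\<^bsub>free_group S\<^esub> (v \<otimes>\<^bsub>free_group S\<^esub> w)"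
    by (simp add: carrier_free_group mult_free_group foldr_free_cons_assoc)
next
  fix u v assume "u \<in> carrier (free_group S)" "v \<in> carrier (free_group S)"
  then show "u \<otimes>\<^bsub>free_group S\<^esub> v \<in> carrier (free_group S)"
    by (simp add: carrier_free_group mult_free_group free_reduced_foldr fst_set_foldr_free_cons del: image_subset_iff)
next
  fix u assume u: "u \<in> carrier (free_group S)"
  let ?v = "rev (map free_flip u)"
  have "?v \<in> carrier (free_group S)" using u by (auto simp: carrier_free_group free_reduced_rev)
  moreover have "?v \<otimes>\<^bsub>free_group S\<^esub> u = []"
    using foldr_free_cons_flip[of "[]" u] u by (simp add: carrier_free_group mult_free_group foldr_free_cons_Nil)
  ultimately show "\<exists>v\<in>carrier (free_group S). v \<otimes>\<^bsub>free_group S\<^esub> u = \<one>\<^bsub>free_group S\<^esub>" by auto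
qed (auto simp: carrier_free_group mult_free_group)

lemma inv_free_group:
  assumes "u \<in> carrier (free_group S)"
  shows "inv\<^bsub>free_group S\<^esub> u = rev (map free_flip u)"
proof -
  interpret group "free_group S" by (rule group_free_group)
  show ?thesis
  proof (rule inv_equality)
    show "rev (map free_flip u) \<otimes>\<^bsub>free_group S\<^esub> u = \<one>\<^bsub>free_group S\<^esub>"
      using foldr_free_cons_flip[of "[]" u] assms by (simp add: carrier_free_group mult_free_group foldr_free_cons_Nil)
  qed (use assms in \<open>auto simp: carrier_free_group free_reduced_rev\<close>)
qed

lemma free_gen_closed [simp]: "x \<in> S \<Longrightarrow> free_gen x \<in> carrier (free_group S)"
  by (simp add: carrier_free_group)

definition free_letter_val :: "('b, 'm) monoid_scheme \<Rightarrow> ('a \<Rightarrow> 'b) \<Rightarrow> 'a \<times> bool \<Rightarrow> 'b" where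
  "free_letter_val H f l = (if snd l then f (fst l) else inv\<^bsub>H\<^esub> f (fst l))"

definition free_hom :: "('b, 'm) monoid_scheme \<Rightarrow> ('a \<Rightarrow> 'b) \<Rightarrow> ('a \<times> bool) list \<Rightarrow> 'b" where
  "free_hom H f w = foldr (\<lambda>l. (\<otimes>\<^bsub>H\<^esub>) (free_letter_val H f l)) w \<one>\<^bsub>H\<^esub>"

lemma free_hom_Nil [simp]: "free_hom H f [] = \<one>\<^bsub>H\<^esub>"
  and free_hom_Cons: "free_hom H f (l # w) = free_letter_val H f l \<otimes>\<^bsub>H\<^esub> free_hom H f w"
  by (simp_all add: free_hom_def)

context
  fixes H :: "('b, 'm) monoid_scheme" and f :: "'a \<Rightarrow> 'b" and S
  assumes H: "group H" and f: "\<And>x. x \<in> S \<Longrightarrow> f x \<in> carrier H"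
begin

interpretation H: group H by (rule H)

lemma free_letter_val_closed: "fst l \<in> S \<Longrightarrow> free_letter_val H f l \<in> carrier H"
  by (simp add: free_letter_val_def f)

lemma free_hom_closed: "fst ` set w \<subseteq> S \<Longrightarrow> free_hom H f w \<in> carrier H"
  by (induction w) (auto simp: free_hom_Cons free_letter_val_closed)

lemma free_hom_free_cons:
  assumes "fst l \<in> S" "fst ` set w \<subseteq> S"
  shows "free_hom H f (free_cons l w) = free_letter_val H f l \<otimes>\<^bsub>H\<^esub> free_hom H f w"
proof (cases w)
  case Nil
  then show ?thesis by (simp add: free_hom_Cons)
next
  case (Cons l' w')
  have w': "free_hom H f w' \<in> carrier H" using assms Cons free_hom_closed[of w'] by auto
  show ?thesis
  proof (cases "fst l = fst l' \<and> snd l \<noteq> snd l'")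
    case True
    then have "free_letter_val H f l \<otimes>\<^bsub>H\<^esub> (free_letter_val H f l' \<otimes>\<^bsub>H\<^esub> free_hom H f w') = free_hom H f w'"
      using assms w' f by (auto simp: free_letter_val_def)
    then show ?thesis using True Cons by (simp add: free_hom_Cons)
  qed (use Cons in \<open>auto simp: free_hom_Cons\<close>)
qed

lemma free_hom_hom: "free_hom H f \<in> hom (free_group S) H"
proof (rule homI)
  fix u v assume uv: "u \<in> carrier (free_group S)" "v \<in> carrier (free_group S)"
  then have v: "fst ` set v \<subseteq> S" and "fst ` set u \<subseteq> S" by (auto simp: carrier_free_group)
  from this(2) have "free_hom H f (foldr free_cons u v) = free_hom H f u \<otimes>\<^bsub>H\<^esub> free_hom H f v"
  proof (induction u)
    case Nil
    then show ?case using free_hom_closed v by simp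
  next
    case (Cons l u)
    have "fst ` set (foldr free_cons u v) \<subseteq> S" using fst_set_foldr_free_cons[of u S v] v Cons by simp
    then show ?case using Cons v
      by (simp add: free_hom_free_cons free_hom_Cons H.m_assoc free_letter_val_closed free_hom_closed)
  qed
  then show "free_hom H f (u \<otimes>\<^bsub>free_group S\<^esub> v) = free_hom H f u \<otimes>\<^bsub>H\<^esub> free_hom H f v"
    by (simp add: mult_free_group)
qed (auto simp: carrier_free_group free_hom_closed)

lemma free_hom_gen: "x \<in> S \<Longrightarrow> free_hom H f (free_gen x) = f x"
  by (simp add: free_hom_Cons free_letter_val_def f)

end

lemma generate_free_group: "generate (free_group S) (free_gen ` S) = carrier (free_group S)"
proof
  interpret group "free_group S" by (rule group_free_group)
  show "generate (free_group S) (free_gen ` S) \<subseteq> carrier (free_group S)"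
    by (rule generate_incl) auto
  have l: "[l] \<in> generate (free_group S) (free_gen ` S)" if "fst l \<in> S" for l
  proof (cases "snd l")
    case True then show ?thesis using that by (intro generate.incl) (cases l, auto)
  next
    case False
    then have "[l] = inv\<^bsub>free_group S\<^esub> (free_gen (fst l))" using that by (cases l) (simp add: inv_free_group)
    then show ?thesis using that by (auto intro: generate.inv)
  qed
  show "carrier (free_group S) \<subseteq> generate (free_group S) (free_gen ` S)"
  proof
    fix w assume "w \<in> carrier (free_group S)"
    then show "w \<in> generate (free_group S) (free_gen ` S)"
    proof (induction w)
      case Nil
      then show ?case using generate.one[of "free_group S"] by simp
    next
      case (Cons l w)
      then have w: "w \<in> generate (free_group S) (free_gen ` S)" "fst l \<in> S"
        by (auto simp: carrier_free_group dest: free_reduced_tl)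
      have "[l] \<otimes>\<^bsub>free_group S\<^esub> w = l # w"
        using Cons by (simp add: mult_free_group carrier_free_group free_cons_eq_Cons)
      then show ?case using generate.eng[OF l[OF w(2)] w(1)] by simp
    qed
  qed
qed

text \<open>Allows a basis to be relabelled: a countable basis of edges becomes the set of naturals,
  and an abstract basis can be moved into the group itself.\<close>

lemma free_group_iso_bij:
  assumes "bij_betw g S T"
  shows "free_group S \<cong> free_group T"
proof -
  let ?m = "map (apfst g)"
  have inj: "inj_on g S" and im: "g ` S = T" using assms by (auto simp: bij_betw_def)
  have eq: "fst (apfst g x) = fst (apfst g y) \<longleftrightarrow> fst x = fst y"
    if "fst x \<in> S" "fst y \<in> S" for x y :: "'a \<times> bool"
    using inj_on_eq_iff[OF inj that] by simp
  have red: "free_reduced (?m w) \<longleftrightarrow> free_reduced w" if "fst ` set w \<subseteq> S" for w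
  proof -
    have "fst (apfst g x) = fst (apfst g y) \<longleftrightarrow> fst x = fst y" if "x \<in> set w" "y \<in> set w" for x y
      by (rule eq) (use that \<open>fst ` set w \<subseteq> S\<close> in blast)+
    then show ?thesis
      unfolding free_reduced_def successively_map by (intro successively_cong) simp_all
  qed
  have cons: "?m (free_cons l w) = free_cons (apfst g l) (?m w)"
    if "fst ` set w \<subseteq> S" "fst l \<in> S" for l w
  proof (cases w)
    case (Cons l' w')
    then have "fst l' \<in> S" using that by simp
    then show ?thesis using Cons eq[OF that(2)] by simp
  qed simp
  have mult: "?m (foldr free_cons u v) = foldr free_cons (?m u) (?m v)"
    if "fst ` set u \<subseteq> S" "fst ` set v \<subseteq> S" for u v
    using that(1)
  proof (induction u)
    case (Cons l u)
    have "fst ` set (foldr free_cons u v) \<subseteq> S" using fst_set_foldr_free_cons[of u S v] that Cons by simp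
    then show ?case using Cons by (simp add: cons)
  qed simp
  have "?m \<in> iso (free_group S) (free_group T)"
  proof (rule isoI)
    show hom: "?m \<in> hom (free_group S) (free_group T)"
    proof (rule homI)
      show "?m w \<in> carrier (free_group T)" if "w \<in> carrier (free_group S)" for w
        using that im red[of w] unfolding carrier_free_group by force
      show "?m (u \<otimes>\<^bsub>free_group S\<^esub> v) = ?m u \<otimes>\<^bsub>free_group T\<^esub> ?m v"
        if "u \<in> carrier (free_group S)" "v \<in> carrier (free_group S)" for u v
        using that mult[of u v] by (simp add: carrier_free_group mult_free_group)
    qed
    show "bij_betw ?m (carrier (free_group S)) (carrier (free_group T))"
    proof (rule bij_betw_byWitness[where f' = "map (apfst (inv_into S g))"])
      show "\<forall>a\<in>carrier (free_group S). map (apfst (inv_into S g)) (?m a) = a"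
      proof
        fix a assume "a \<in> carrier (free_group S)"
        then have "\<forall>l\<in>set a. fst l \<in> S" by (auto simp: carrier_free_group)
        then show "map (apfst (inv_into S g)) (?m a) = a"
          using inj by (auto intro!: map_idI)
      qed
      show inv_inv: "\<forall>a\<in>carrier (free_group T). ?m (map (apfst (inv_into S g)) a) = a"
      proof
        fix a assume "a \<in> carrier (free_group T)"
        then have "\<forall>l\<in>set a. fst l \<in> g ` S" using im by (auto simp: carrier_free_group)
        then show "?m (map (apfst (inv_into S g)) a) = a"
          by (auto intro!: map_idI simp: f_inv_into_f)
      qed
      show "?m ` carrier (free_group S) \<subseteq> carrier (free_group T)"
        using hom unfolding hom_def by blast
      show "map (apfst (inv_into S g)) ` carrier (free_group T) \<subseteq> carrier (free_group S)"
      proof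
        fix w assume "w \<in> map (apfst (inv_into S g)) ` carrier (free_group T)"
        then obtain a where a: "a \<in> carrier (free_group T)" "w = map (apfst (inv_into S g)) a" by auto
        then have S: "fst ` set w \<subseteq> S"
          using im inv_into_into[of _ g S] unfolding carrier_free_group by force
        moreover have "?m w = a" using inv_inv a by auto
        ultimately show "w \<in> carrier (free_group S)" using a red[OF S] by (simp add: carrier_free_group)
      qed
    qed
  qed
  then show ?thesis by (auto simp: is_iso_def)
qed

section \<open>Free products\<close>

locale group_pair = G: group G + H: group H
  for G :: "('a, 'm) monoid_scheme" and H :: "('b, 'n) monoid_scheme"
begin

abbreviation "P \<equiv> free_product G H"
abbreviation "pcons \<equiv> free_product_cons G H"

definition letters :: "('a + 'b) set" where
  "letters = Inl ` (carrier G - {\<one>\<^bsub>G\<^esub>}) \<union> Inr ` (carrier H - {\<one>\<^bsub>H\<^esub>})"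

lemma Inl_letters [simp]: "Inl a \<in> letters \<longleftrightarrow> a \<in> carrier G \<and> a \<noteq> \<one>\<^bsub>G\<^esub>"
  and Inr_letters [simp]: "Inr b \<in> letters \<longleftrightarrow> b \<in> carrier H \<and> b \<noteq> \<one>\<^bsub>H\<^esub>"
  by (auto simp: letters_def)

lemma Nil_P [simp]: "[] \<in> carrier P"
  and one_P [simp]: "\<one>\<^bsub>P\<^esub> = []"
  and mult_P: "u \<otimes>\<^bsub>P\<^esub> v = foldr pcons u v"
  by (simp_all add: free_product_def)

lemma Cons_P: "l # w \<in> carrier P \<longleftrightarrow>
    l \<in> letters \<and> w \<in> carrier P \<and> (w \<noteq> [] \<longrightarrow> isl l \<noteq> isl (hd w))"
  by (cases w) (auto simp: free_product_def letters_def)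

lemma pcons_eq_Cons: "l # w \<in> carrier P \<Longrightarrow> pcons l w = l # w"
  by (cases w; cases l; cases "hd w") (auto simp: Cons_P)

lemma pcons_closed:
  assumes "l \<in> letters" "w \<in> carrier P"
  shows "pcons l w \<in> carrier P"
  using assms by (cases w; cases l; cases "hd w") (auto simp: Cons_P)

text \<open>Two letters of the same factor acting in succession are the only critical case of
  associativity, since each of them may merge with or cancel the head of \<open>w\<close>.\<close>

lemma pcons_Inl_Inl:
  assumes "a \<in> carrier G" "a \<noteq> \<one>\<^bsub>G\<^esub>" "a' \<in> carrier G" "a' \<noteq> \<one>\<^bsub>G\<^esub>" "w \<in> carrier P"
  shows "pcons (Inl a) (pcons (Inl a') w) =
    (if a \<otimes>\<^bsub>G\<^esub> a' = \<one>\<^bsub>G\<^esub> then w else pcons (Inl (a \<otimes>\<^bsub>G\<^esub> a')) w)"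
proof (cases "w \<noteq> [] \<and> isl (hd w)")
  case True
  then obtain x w' where w: "w = Inl x # w'" by (cases w; cases "hd w") auto
  have x: "x \<in> carrier G" "x \<noteq> \<one>\<^bsub>G\<^esub>" "w' \<noteq> [] \<longrightarrow> \<not> isl (hd w')"
    using assms w by (auto simp: Cons_P)
  have w': "pcons (Inl c) w' = Inl c # w'" for c
    using x(3) by (cases w'; cases "hd w'") auto
  have ass: "a \<otimes>\<^bsub>G\<^esub> (a' \<otimes>\<^bsub>G\<^esub> x) = (a \<otimes>\<^bsub>G\<^esub> a') \<otimes>\<^bsub>G\<^esub> x"
    using assms x by (simp add: G.m_assoc)
  \<comment> \<open>When \<open>a'\<close> cancels \<open>x\<close> and \<open>a\<close> cancels
    \<open>a'\<close>, the letter put back in front has to be the one that was removed.\<close>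
  have 1: "a = x" if "a' \<otimes>\<^bsub>G\<^esub> x = \<one>\<^bsub>G\<^esub>" "a \<otimes>\<^bsub>G\<^esub> a' = \<one>\<^bsub>G\<^esub>"
    using that assms x by (metis G.inv_equality G.inv_inv)
  show ?thesis
  proof (cases "a' \<otimes>\<^bsub>G\<^esub> x = \<one>\<^bsub>G\<^esub>")
    case True
    then have "(a \<otimes>\<^bsub>G\<^esub> a') \<otimes>\<^bsub>G\<^esub> x = a" using ass assms by simp
    then show ?thesis using True assms 1 by (simp add: w w')
  next
    case False
    then show ?thesis using assms x by (simp add: w w' ass)
  qed
next
  case False
  then have w': "pcons (Inl c) w = Inl c # w" for c
    by (cases w; cases "hd w") auto
  show ?thesis using assms by (simp add: w')
qed

lemma pcons_Inr_Inr:
  assumes "a \<in> carrier H" "a \<noteq> \<one>\<^bsub>H\<^esub>" "a' \<in> carrier H" "a' \<noteq> \<one>\<^bsub>H\<^esub>" "w \<in> carrier P"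
  shows "pcons (Inr a) (pcons (Inr a') w) =
    (if a \<otimes>\<^bsub>H\<^esub> a' = \<one>\<^bsub>H\<^esub> then w else pcons (Inr (a \<otimes>\<^bsub>H\<^esub> a')) w)"
proof (cases "w \<noteq> [] \<and> \<not> isl (hd w)")
  case True
  then obtain x w' where w: "w = Inr x # w'" by (cases w; cases "hd w") auto
  have x: "x \<in> carrier H" "x \<noteq> \<one>\<^bsub>H\<^esub>" "w' \<noteq> [] \<longrightarrow> isl (hd w')"
    using assms w by (auto simp: Cons_P)
  have w': "pcons (Inr c) w' = Inr c # w'" for c
    using x(3) by (cases w'; cases "hd w'") auto
  have ass: "a \<otimes>\<^bsub>H\<^esub> (a' \<otimes>\<^bsub>H\<^esub> x) = (a \<otimes>\<^bsub>H\<^esub> a') \<otimes>\<^bsub>H\<^esub> x"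
    using assms x by (simp add: H.m_assoc)
  have 1: "a = x" if "a' \<otimes>\<^bsub>H\<^esub> x = \<one>\<^bsub>H\<^esub>" "a \<otimes>\<^bsub>H\<^esub> a' = \<one>\<^bsub>H\<^esub>"
    using that assms x by (metis H.inv_equality H.inv_inv)
  show ?thesis
  proof (cases "a' \<otimes>\<^bsub>H\<^esub> x = \<one>\<^bsub>H\<^esub>")
    case True
    then have "(a \<otimes>\<^bsub>H\<^esub> a') \<otimes>\<^bsub>H\<^esub> x = a" using ass assms by simp
    then show ?thesis using True assms 1 by (simp add: w w')
  next
    case False
    then show ?thesis using assms x by (simp add: w w' ass)
  qed
next
  case False
  then have w': "pcons (Inr c) w = Inr c # w" for c
    by (cases w; cases "hd w") auto
  show ?thesis using assms by (simp add: w')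
qed

lemma set_P: "w \<in> carrier P \<Longrightarrow> set w \<subseteq> letters"
  by (auto simp: free_product_def letters_def)

lemma foldr_pcons_closed: "set u \<subseteq> letters \<Longrightarrow> v \<in> carrier P \<Longrightarrow> foldr pcons u v \<in> carrier P"
  by (induction u) (auto intro: pcons_closed)

lemma foldr_pcons_pcons:
  assumes "l \<in> letters" "set u \<subseteq> letters" "v \<in> carrier P"
  shows "foldr pcons (pcons l u) v = pcons l (foldr pcons u v)"
proof (cases u)
  case (Cons l' u')
  then have "foldr pcons u' v \<in> carrier P" "l' \<in> letters" using assms foldr_pcons_closed by auto
  then show ?thesis using assms Cons
    by (cases l; cases l') (auto simp: pcons_Inl_Inl pcons_Inr_Inr)
qed auto

lemma foldr_pcons_assoc:
  assumes "set u \<subseteq> letters" "v \<in> carrier P" "w \<in> carrier P"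
  shows "foldr pcons (foldr pcons u v) w = foldr pcons u (foldr pcons v w)"
  using assms(1)
proof (induction u)
  case (Cons l u)
  then show ?case using assms set_P[OF foldr_pcons_closed[of u v]] by (simp add: foldr_pcons_pcons)
qed simp

lemma P_left_inverse: "u \<in> carrier P \<Longrightarrow> \<exists>v\<in>carrier P. foldr pcons v u = []"
proof (induction u)
  case (Cons l u)
  then have u: "u \<in> carrier P" "l \<in> letters" by (auto simp: Cons_P)
  then obtain v where v: "v \<in> carrier P" "foldr pcons v u = []" using Cons by auto
  obtain l' where l': "l' \<in> letters" "pcons l' (l # u) = u"
  proof (cases l)
    case (Inl a)
    then have "inv\<^bsub>G\<^esub> a \<otimes>\<^bsub>G\<^esub> a = \<one>\<^bsub>G\<^esub>" "inv\<^bsub>G\<^esub> a \<noteq> \<one>\<^bsub>G\<^esub>" using u by (auto simp: G.inv_eq_1_iff)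
    then show ?thesis using Inl u that[of "Inl (inv\<^bsub>G\<^esub> a)"] by auto
  next
    case (Inr a)
    then have "inv\<^bsub>H\<^esub> a \<otimes>\<^bsub>H\<^esub> a = \<one>\<^bsub>H\<^esub>" "inv\<^bsub>H\<^esub> a \<noteq> \<one>\<^bsub>H\<^esub>" using u by (auto simp: H.inv_eq_1_iff)
    then show ?thesis using Inr u that[of "Inr (inv\<^bsub>H\<^esub> a)"] by auto
  qed
  have l'1: "[l'] \<in> carrier P" using l' by (simp add: Cons_P)
  have "foldr pcons (foldr pcons v [l']) (l # u) = []"
    using foldr_pcons_assoc[OF set_P[OF v(1)] l'1 Cons.prems] l' v by simp
  then show ?case using foldr_pcons_closed[OF set_P[OF v(1)] l'1] by blast
qed (auto intro: bexI[of _ "[]"])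

lemma group_P: "group P"
  by (rule groupI)
    (auto simp: mult_P foldr_pcons_closed foldr_pcons_assoc set_P P_left_inverse)

definition inl :: "'a \<Rightarrow> ('a + 'b) list" where
  "inl a = (if a = \<one>\<^bsub>G\<^esub> then [] else [Inl a])"

definition inr :: "'b \<Rightarrow> ('a + 'b) list" where
  "inr b = (if b = \<one>\<^bsub>H\<^esub> then [] else [Inr b])"

lemma inl_hom: "inl \<in> hom G P"
  by (rule homI) (auto simp: inl_def Cons_P mult_P)

lemma inr_hom: "inr \<in> hom H P"
  by (rule homI) (auto simp: inr_def Cons_P mult_P)

lemma inj_inl: "inj_on inl (carrier G)"
  by (auto simp: inl_def inj_on_def split: if_splits)

lemma generate_P: "generate P (inl ` carrier G \<union> inr ` carrier H) = carrier P"
proof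
  interpret P: group P by (rule group_P)
  let ?S = "inl ` carrier G \<union> inr ` carrier H"
  show "generate P ?S \<subseteq> carrier P"
    using hom_carrier[OF inl_hom] hom_carrier[OF inr_hom] by (intro P.generate_incl) auto
  have l: "[l] \<in> generate P ?S" if "l \<in> letters" for l
  proof (cases l)
    case (Inl a)
    then have "[l] = inl a" "a \<in> carrier G" using that by (auto simp: inl_def)
    then show ?thesis by (auto intro: generate.incl)
  next
    case (Inr a)
    then have "[l] = inr a" "a \<in> carrier H" using that by (auto simp: inr_def)
    then show ?thesis by (auto intro: generate.incl)
  qed
  show "carrier P \<subseteq> generate P ?S"
  proof
    fix w assume "w \<in> carrier P"
    then show "w \<in> generate P ?S"
    proof (induction w)
      case Nil then show ?case using generate.one[of P] by simp
    next
      case (Cons x w)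
      then have "[x] \<otimes>\<^bsub>P\<^esub> w = x # w" "w \<in> generate P ?S" "x \<in> letters"
        by (auto simp: mult_P pcons_eq_Cons Cons_P)
      then show ?case using generate.eng[OF l, of x w] by simp
    qed
  qed
qed

end

definition fp_letter :: "('a \<Rightarrow> 'c) \<Rightarrow> ('b \<Rightarrow> 'c) \<Rightarrow> 'a + 'b \<Rightarrow> 'c" where
  "fp_letter f g l = (case l of Inl a \<Rightarrow> f a | Inr b \<Rightarrow> g b)"

definition fp_hom :: "('c, 'k) monoid_scheme \<Rightarrow> ('a \<Rightarrow> 'c) \<Rightarrow> ('b \<Rightarrow> 'c) \<Rightarrow> ('a + 'b) list \<Rightarrow> 'c" where
  "fp_hom K f g w = foldr (\<lambda>l. (\<otimes>\<^bsub>K\<^esub>) (fp_letter f g l)) w \<one>\<^bsub>K\<^esub>"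

lemma fp_hom_Nil [simp]: "fp_hom K f g [] = \<one>\<^bsub>K\<^esub>"
  and fp_hom_Cons: "fp_hom K f g (l # w) = fp_letter f g l \<otimes>\<^bsub>K\<^esub> fp_hom K f g w"
  by (simp_all add: fp_hom_def)

context group_pair begin

context
  fixes K :: "('c, 'k) monoid_scheme" and f g
  assumes K: "group K" and f: "f \<in> hom G K" and g: "g \<in> hom H K"
begin

interpretation K: group K by (rule K)
interpretation f: group_hom G K f by unfold_locales (rule f)
interpretation g: group_hom H K g by unfold_locales (rule g)

lemma fp_letter_closed: "l \<in> letters \<Longrightarrow> fp_letter f g l \<in> carrier K"
  by (cases l) (auto simp: fp_letter_def)

lemma fp_hom_closed: "set w \<subseteq> letters \<Longrightarrow> fp_hom K f g w \<in> carrier K"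
  by (induction w) (auto simp: fp_hom_Cons fp_letter_closed)

lemma fp_hom_pcons:
  assumes "l \<in> letters" "set w \<subseteq> letters"
  shows "fp_hom K f g (pcons l w) = fp_letter f g l \<otimes>\<^bsub>K\<^esub> fp_hom K f g w"
proof (cases w)
  case Nil
  then show ?thesis by (cases l) (auto simp: fp_hom_Cons)
next
  case (Cons l' w')
  have w': "fp_hom K f g w' \<in> carrier K" "l' \<in> letters" using assms Cons fp_hom_closed[of w'] by auto
  show ?thesis
  proof (cases l; cases l')
    fix a a' assume l: "l = Inl a" "l' = Inl a'"
    then have a: "a \<in> carrier G" "a' \<in> carrier G" using assms w' by auto
    have "f a \<otimes>\<^bsub>K\<^esub> (f a' \<otimes>\<^bsub>K\<^esub> fp_hom K f g w') = f (a \<otimes>\<^bsub>G\<^esub> a') \<otimes>\<^bsub>K\<^esub> fp_hom K f g w'"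
      using a w' by (simp add: K.m_assoc)
    then show ?thesis using w' by (auto simp: l Cons fp_hom_Cons fp_letter_def)
  next
    fix a a' assume l: "l = Inr a" "l' = Inr a'"
    then have a: "a \<in> carrier H" "a' \<in> carrier H" using assms w' by auto
    have "g a \<otimes>\<^bsub>K\<^esub> (g a' \<otimes>\<^bsub>K\<^esub> fp_hom K f g w') = g (a \<otimes>\<^bsub>H\<^esub> a') \<otimes>\<^bsub>K\<^esub> fp_hom K f g w'"
      using a w' by (simp add: K.m_assoc)
    then show ?thesis using w' by (auto simp: l Cons fp_hom_Cons fp_letter_def)
  qed (auto simp: Cons fp_hom_Cons)
qed

lemma fp_hom_hom: "fp_hom K f g \<in> hom P K"
proof (rule homI)
  fix u v assume "u \<in> carrier P" and v: "v \<in> carrier P"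
  from set_P[OF this(1)] have "fp_hom K f g (foldr pcons u v) = fp_hom K f g u \<otimes>\<^bsub>K\<^esub> fp_hom K f g v"
  proof (induction u)
    case Nil
    then show ?case using fp_hom_closed[OF set_P[OF v]] by simp
  next
    case (Cons l u)
    then show ?case using set_P[OF v] set_P[OF foldr_pcons_closed[OF _ v, of u]]
      by (simp add: fp_hom_pcons fp_hom_Cons K.m_assoc fp_letter_closed fp_hom_closed)
  qed
  then show "fp_hom K f g (u \<otimes>\<^bsub>P\<^esub> v) = fp_hom K f g u \<otimes>\<^bsub>K\<^esub> fp_hom K f g v" by (simp add: mult_P)
qed (auto simp: fp_hom_closed set_P)

lemma fp_hom_inl: "a \<in> carrier G \<Longrightarrow> fp_hom K f g (inl a) = f a"
  by (auto simp: inl_def fp_hom_Cons fp_letter_def)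

lemma fp_hom_inr: "b \<in> carrier H \<Longrightarrow> fp_hom K f g (inr b) = g b"
  by (auto simp: inr_def fp_hom_Cons fp_letter_def)

end

end

section \<open>Subgroups of finite index and residual finiteness\<close>

text \<open>The separating invariant \<open>h\<close> may be any function with finite image. This
  freedom is used below, where \<open>h\<close> depends on chosen representatives and is no
  homomorphism.\<close>

lemma finite_rcosetsI:
  assumes "group G" "subgroup N G" "finite (h ` carrier G)"
    "\<And>x y. \<lbrakk>x \<in> carrier G; y \<in> carrier G; h x = h y\<rbrakk> \<Longrightarrow> x \<otimes>\<^bsub>G\<^esub> inv\<^bsub>G\<^esub> y \<in> N"
  shows "finite (rcosets\<^bsub>G\<^esub> N)"
proof -
  interpret group G by fact
  interpret N: subgroup N G by fact
  let ?r = "\<lambda>z. N #>\<^bsub>G\<^esub> (SOME x. x \<in> carrier G \<and> h x = z)"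
  have "N #>\<^bsub>G\<^esub> x = ?r (h x)" if x: "x \<in> carrier G" for x
  proof -
    define y where "y = (SOME y. y \<in> carrier G \<and> h y = h x)"
    have "y \<in> carrier G \<and> h y = h x" unfolding y_def by (rule someI[of _ x]) (use x in auto)
    then have "y \<in> carrier G" "x \<otimes>\<^bsub>G\<^esub> inv\<^bsub>G\<^esub> y \<in> N" using assms(4)[of x y] x by auto
    then have "N #>\<^bsub>G\<^esub> x = N #>\<^bsub>G\<^esub> y"
      using repr_independence[of x N y] N.rcos_module[OF is_group, of y x] x assms(2) by simp
    then show ?thesis by (simp add: y_def)
  qed
  then have "rcosets\<^bsub>G\<^esub> N \<subseteq> ?r ` h ` carrier G" by (auto simp: RCOSETS_def)
  then show ?thesis using assms(3) finite_surj by blast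
qed

lemma finite_index_kernel:
  assumes "group G" "group K" "h \<in> hom G K" "finite (h ` carrier G)"
  shows "kernel G K h \<in> finite_index_normal G"
proof -
  interpret group_hom G K h using assms by (simp add: group_hom_def group_hom_axioms_def)
  have "finite (rcosets\<^bsub>G\<^esub> (kernel G K h))"
    by (rule finite_rcosetsI[OF assms(1) subgroup_kernel assms(4)]) (auto simp: kernel_def)
  then show ?thesis by (simp add: finite_index_normal_def normal_kernel)
qed

lemma finite_index_normalD:
  assumes "N \<in> finite_index_normal G"
  shows "N \<lhd> G" "finite (rcosets\<^bsub>G\<^esub> N)"
  using assms by (auto simp: finite_index_normal_def)

lemma hom_coset: "N \<lhd> G \<Longrightarrow> (\<lambda>x. N #>\<^bsub>G\<^esub> x) \<in> hom G (G Mod N)"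
  by (rule normal.r_coset_hom_Mod)

lemma carrier_Mod: "carrier (G Mod N) = (\<lambda>x. N #>\<^bsub>G\<^esub> x) ` carrier G"
  and one_Mod: "\<one>\<^bsub>G Mod N\<^esub> = N"
  by (auto simp: FactGroup_def RCOSETS_def)

lemma coset_eq_iff:
  assumes "N \<lhd> G" "x \<in> carrier G" "y \<in> carrier G"
  shows "N #>\<^bsub>G\<^esub> x = N #>\<^bsub>G\<^esub> y \<longleftrightarrow> x \<otimes>\<^bsub>G\<^esub> inv\<^bsub>G\<^esub> y \<in> N"
proof -
  interpret normal N G by fact
  show ?thesis
  proof
    assume "N #>\<^bsub>G\<^esub> x = N #>\<^bsub>G\<^esub> y"
    then have "x \<in> N #>\<^bsub>G\<^esub> y" using rcos_self[OF assms(2) is_subgroup] by simp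
    then show "x \<otimes>\<^bsub>G\<^esub> inv\<^bsub>G\<^esub> y \<in> N" using rcos_module[OF is_group] assms by simp
  next
    assume "x \<otimes>\<^bsub>G\<^esub> inv\<^bsub>G\<^esub> y \<in> N"
    then have "x \<in> N #>\<^bsub>G\<^esub> y" using rcos_module[OF is_group] assms by simp
    then show "N #>\<^bsub>G\<^esub> x = N #>\<^bsub>G\<^esub> y"
      using repr_independence[OF _ assms(3) is_subgroup] by simp
  qed
qed

lemma coset_eq_self_iff:
  assumes "N \<lhd> G" "x \<in> carrier G"
  shows "N #>\<^bsub>G\<^esub> x = N \<longleftrightarrow> x \<in> N"
proof -
  interpret normal N G by fact
  show ?thesis using coset_eq_iff[OF assms(1,2) one_closed] assms(2) subset coset_mult_one by auto
qed

lemma coset_image_finite: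
  assumes "N \<in> finite_index_normal G"
  shows "finite ((\<lambda>x. N #>\<^bsub>G\<^esub> x) ` carrier G)"
proof -
  have "(\<lambda>x. N #>\<^bsub>G\<^esub> x) ` carrier G = rcosets\<^bsub>G\<^esub> N" by (auto simp: RCOSETS_def)
  then show ?thesis using finite_index_normalD(2)[OF assms] by simp
qed

lemma finite_index_Int:
  assumes "group G" "N \<in> finite_index_normal G" "N' \<in> finite_index_normal G"
  shows "N \<inter> N' \<in> finite_index_normal G"
proof -
  interpret group G by fact
  have n: "N \<lhd> G" "N' \<lhd> G" using assms finite_index_normalD by blast+
  then have norm: "N \<inter> N' \<lhd> G"
    by (auto simp: normal_inv_iff intro: subgroups_Inter_pair)
  have "finite (rcosets\<^bsub>G\<^esub> (N \<inter> N'))"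
  proof (rule finite_rcosetsI[where h = "\<lambda>x. (N #>\<^bsub>G\<^esub> x, N' #>\<^bsub>G\<^esub> x)"])
    show "subgroup (N \<inter> N') G" using norm by (simp add: normal_def)
    have "(\<lambda>x. (N #>\<^bsub>G\<^esub> x, N' #>\<^bsub>G\<^esub> x)) ` carrier G
        \<subseteq> (\<lambda>x. N #>\<^bsub>G\<^esub> x) ` carrier G \<times> (\<lambda>x. N' #>\<^bsub>G\<^esub> x) ` carrier G" by auto
    then show "finite ((\<lambda>x. (N #>\<^bsub>G\<^esub> x, N' #>\<^bsub>G\<^esub> x)) ` carrier G)"
      using finite_subset coset_image_finite[OF assms(2)] coset_image_finite[OF assms(3)] by blast
    show "x \<otimes>\<^bsub>G\<^esub> inv\<^bsub>G\<^esub> y \<in> N \<inter> N'"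
      if "x \<in> carrier G" "y \<in> carrier G"
        "(N #>\<^bsub>G\<^esub> x, N' #>\<^bsub>G\<^esub> x) = (N #>\<^bsub>G\<^esub> y, N' #>\<^bsub>G\<^esub> y)" for x y
      using that coset_eq_iff[OF n(1) that(1,2)] coset_eq_iff[OF n(2) that(1,2)] by simp
  qed (rule assms(1))
  then show ?thesis using norm by (simp add: finite_index_normal_def)
qed

lemma finite_index_carrier:
  assumes "group G"
  shows "carrier G \<in> finite_index_normal G"
proof -
  interpret group G by fact
  have "finite (rcosets\<^bsub>G\<^esub> (carrier G))"
    by (rule finite_rcosetsI[where h = "\<lambda>_. ()"]) (auto intro: subgroup_self assms)
  then show ?thesis by (simp add: finite_index_normal_def normal_self)
qed

text \<open>The type of the target is a parameter, because the finite images arise both as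
  permutation groups and as factor groups.\<close>

lemma residually_finiteI:
  assumes "group G" "\<And>g. \<lbrakk>g \<in> carrier G; g \<noteq> \<one>\<^bsub>G\<^esub>\<rbrakk> \<Longrightarrow>
     \<exists>K :: 'k monoid. \<exists>h. group K \<and> h \<in> hom G K \<and> finite (h ` carrier G) \<and> h g \<noteq> \<one>\<^bsub>K\<^esub>"
  shows "residually_finite G"
  unfolding residually_finite_def
proof (intro ballI impI)
  fix g assume "g \<in> carrier G" "g \<noteq> \<one>\<^bsub>G\<^esub>"
  then obtain K :: "'k monoid" and h
    where "group K" "h \<in> hom G K" "finite (h ` carrier G)" "h g \<noteq> \<one>\<^bsub>K\<^esub>" using assms(2) by blast
  then show "\<exists>N\<in>finite_index_normal G. g \<notin> N"
    using finite_index_kernel[OF assms(1)] by (intro bexI[of _ "kernel G K h"]) (auto simp: kernel_def)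
qed

text \<open>By intersecting, one finite quotient keeps finitely many elements non-trivial at once:
  later, all letters of a normal form.\<close>

lemma residually_finite_avoid:
  assumes "group G" "residually_finite G" "finite F" "F \<subseteq> carrier G - {\<one>\<^bsub>G\<^esub>}"
  shows "\<exists>N \<in> finite_index_normal G. N \<inter> F = {}"
  using assms(3,4)
proof (induction F rule: finite_induct)
  case empty
  then show ?case using finite_index_carrier[OF assms(1)] by auto
next
  case (insert x F)
  then obtain N where N: "N \<in> finite_index_normal G" "N \<inter> F = {}" by auto
  obtain N' where N': "N' \<in> finite_index_normal G" "x \<notin> N'"
    using insert assms(2) by (auto simp: residually_finite_def)
  then show ?case using finite_index_Int[OF assms(1) N(1) N'(1)] N by (intro bexI[of _ "N \<inter> N'"]) auto
qed

lemma residually_finite_mon: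
  fixes M :: "('a, 'm) monoid_scheme" and G :: "('b, 'n) monoid_scheme"
  assumes "group M" "group G" "\<phi> \<in> mon M G" "residually_finite G"
  shows "residually_finite M"
proof (rule residually_finiteI[OF assms(1)])
  interpret \<phi>: group_hom M G \<phi> using assms by (simp add: group_hom_def group_hom_axioms_def mon_def)
  fix g assume g: "g \<in> carrier M" "g \<noteq> \<one>\<^bsub>M\<^esub>"
  then have "\<phi> g \<noteq> \<one>\<^bsub>G\<^esub>"
    using assms(3) inj_onD[of \<phi> "carrier M" g "\<one>\<^bsub>M\<^esub>"] by (auto simp: mon_def)
  then obtain N where N: "N \<in> finite_index_normal G" "\<phi> g \<notin> N"
    using assms(4) g by (auto simp: residually_finite_def)
  note n = finite_index_normalD(1)[OF N(1)]
  have "(\<lambda>x. N #>\<^bsub>G\<^esub> \<phi> x) \<in> hom M (G Mod N)"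
    using hom_compose[OF \<phi>.homh hom_coset[OF n]] by (simp add: o_def)
  moreover have "(\<lambda>x. N #>\<^bsub>G\<^esub> \<phi> x) ` carrier M \<subseteq> (\<lambda>x. N #>\<^bsub>G\<^esub> x) ` carrier G" by auto
  then have "finite ((\<lambda>x. N #>\<^bsub>G\<^esub> \<phi> x) ` carrier M)"
    using finite_subset coset_image_finite[OF N(1)] by blast
  moreover have "N #>\<^bsub>G\<^esub> \<phi> g \<noteq> \<one>\<^bsub>G Mod N\<^esub>"
    using N(2) g coset_eq_self_iff[OF n] by (simp add: one_Mod)
  ultimately show "\<exists>K :: 'b set monoid. \<exists>h. group K \<and> h \<in> hom M K \<and> finite (h ` carrier M) \<and> h g \<noteq> \<one>\<^bsub>K\<^esub>"
    using normal.factorgroup_is_group[OF n] by blast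
qed

lemma residually_finite_DirProd:
  assumes "group G" "group H" "residually_finite G" "residually_finite H"
  shows "residually_finite (G \<times>\<times> H)"
  unfolding residually_finite_def
proof (intro ballI impI)
  interpret G: group G by fact
  interpret H: group H by fact
  have gGH: "group (G \<times>\<times> H)" by (rule DirProd_group) fact+
  fix g assume g: "g \<in> carrier (G \<times>\<times> H)" "g \<noteq> \<one>\<^bsub>G \<times>\<times> H\<^esub>"
  have mem: "fst g \<in> carrier G" "snd g \<in> carrier H" using g by auto
  show "\<exists>N\<in>finite_index_normal (G \<times>\<times> H). g \<notin> N"
  proof (cases "fst g = \<one>\<^bsub>G\<^esub>")
    case False
    then obtain N where N: "N \<in> finite_index_normal G" "fst g \<notin> N"
      using assms(3) mem unfolding residually_finite_def by blast
    note n = finite_index_normalD(1)[OF N(1)]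
    have "kernel (G \<times>\<times> H) (G Mod N) (\<lambda>x. N #>\<^bsub>G\<^esub> fst x) \<in> finite_index_normal (G \<times>\<times> H)"
    proof (rule finite_index_kernel[OF gGH normal.factorgroup_is_group[OF n]])
      show "(\<lambda>x. N #>\<^bsub>G\<^esub> fst x) \<in> hom (G \<times>\<times> H) (G Mod N)"
        using hom_coset[OF n] by (auto simp: hom_def)
      have "(\<lambda>x. N #>\<^bsub>G\<^esub> fst x) ` carrier (G \<times>\<times> H) \<subseteq> (\<lambda>x. N #>\<^bsub>G\<^esub> x) ` carrier G" by auto
      then show "finite ((\<lambda>x. N #>\<^bsub>G\<^esub> fst x) ` carrier (G \<times>\<times> H))"
        using finite_subset coset_image_finite[OF N(1)] by blast
    qed
    moreover have "g \<notin> kernel (G \<times>\<times> H) (G Mod N) (\<lambda>x. N #>\<^bsub>G\<^esub> fst x)"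
      using N(2) mem coset_eq_self_iff[OF n] by (simp add: kernel_def one_Mod)
    ultimately show ?thesis by blast
  next
    case True
    then have "snd g \<noteq> \<one>\<^bsub>H\<^esub>" using g by (cases g) (auto simp: DirProd_def)
    then obtain N where N: "N \<in> finite_index_normal H" "snd g \<notin> N"
      using assms(4) mem unfolding residually_finite_def by blast
    note n = finite_index_normalD(1)[OF N(1)]
    have "kernel (G \<times>\<times> H) (H Mod N) (\<lambda>x. N #>\<^bsub>H\<^esub> snd x) \<in> finite_index_normal (G \<times>\<times> H)"
    proof (rule finite_index_kernel[OF gGH normal.factorgroup_is_group[OF n]])
      show "(\<lambda>x. N #>\<^bsub>H\<^esub> snd x) \<in> hom (G \<times>\<times> H) (H Mod N)"
        using hom_coset[OF n] by (auto simp: hom_def)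
      have "(\<lambda>x. N #>\<^bsub>H\<^esub> snd x) ` carrier (G \<times>\<times> H) \<subseteq> (\<lambda>x. N #>\<^bsub>H\<^esub> x) ` carrier H" by auto
      then show "finite ((\<lambda>x. N #>\<^bsub>H\<^esub> snd x) ` carrier (G \<times>\<times> H))"
        using finite_subset coset_image_finite[OF N(1)] by blast
    qed
    moreover have "g \<notin> kernel (G \<times>\<times> H) (H Mod N) (\<lambda>x. N #>\<^bsub>H\<^esub> snd x)"
      using N(2) mem coset_eq_self_iff[OF n] by (simp add: kernel_def one_Mod)
    ultimately show ?thesis by blast
  qed
qed

section \<open>Permutation actions and residual finiteness of free groups\<close>

lemma BijGroup_mult_apply:
  "\<lbrakk>f \<in> Bij S; g \<in> Bij S; x \<in> S\<rbrakk> \<Longrightarrow> (f \<otimes>\<^bsub>BijGroup S\<^esub> g) x = f (g x)"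
  by (simp add: BijGroup_def compose_def)

lemma finite_carrier_BijGroup: "finite S \<Longrightarrow> finite (carrier (BijGroup S))"
  by (rule finite_subset[OF _ finite_PiE[of S "\<lambda>_. S"]])
    (auto simp: BijGroup_def PiE_def dest: Bij_imp_extensional Bij_imp_funcset)

text \<open>Elements of \<open>Bij W\<close> are extensional, hence the restriction. Bijectivity
  need not be assumed, as the inverse group element acts as the inverse map.\<close>

lemma hom_BijGroupI:
  assumes "group K" "\<And>a u. \<lbrakk>a \<in> carrier K; u \<in> W\<rbrakk> \<Longrightarrow> act a u \<in> W"
    "\<And>u. u \<in> W \<Longrightarrow> act \<one>\<^bsub>K\<^esub> u = u"
    "\<And>a b u. \<lbrakk>a \<in> carrier K; b \<in> carrier K; u \<in> W\<rbrakk> \<Longrightarrow> act (a \<otimes>\<^bsub>K\<^esub> b) u = act a (act b u)"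
  shows "(\<lambda>a. restrict (act a) W) \<in> hom K (BijGroup W)"
proof -
  interpret group K by fact
  have bij: "restrict (act a) W \<in> Bij W" if a: "a \<in> carrier K" for a
  proof -
    have "act (inv\<^bsub>K\<^esub> a) (act a u) = u" "act a (act (inv\<^bsub>K\<^esub> a) u) = u" if "u \<in> W" for u
      using assms(3)[OF that] assms(4)[of "inv\<^bsub>K\<^esub> a" a u] assms(4)[of a "inv\<^bsub>K\<^esub> a" u] a that by auto
    then have "bij_betw (restrict (act a) W) W W"
      by (intro bij_betw_byWitness[where f' = "act (inv\<^bsub>K\<^esub> a)"]) (use a assms(2) in auto)
    then show ?thesis by (simp add: Bij_def)
  qed
  show ?thesis
  proof (rule homI)
    fix a b assume "a \<in> carrier K" "b \<in> carrier K"
    then show "restrict (act (a \<otimes>\<^bsub>K\<^esub> b)) W = restrict (act a) W \<otimes>\<^bsub>BijGroup W\<^esub> restrict (act b) W"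
      using bij assms(2,4) by (auto simp: BijGroup_def compose_def fun_eq_iff)
  qed (use bij in \<open>simp add: BijGroup_def\<close>)
qed

text \<open>In a finite set the complements of the domain and of the range of an injective partial
  map have the same size, so any bijection between them completes the map.\<close>

lemma extend_partial_bij:
  assumes "finite S" "R \<subseteq> S \<times> S" "single_valued R" "single_valued (R\<inverse>)"
  shows "\<exists>g \<in> Bij S. \<forall>(a, b) \<in> R. g a = b"
proof -
  define f where "f a = (THE b. (a, b) \<in> R)" for a
  have f: "f a = b" if "(a, b) \<in> R" for a b
    unfolding f_def using that assms(3) by (auto dest: single_valuedD)
  have sub: "Domain R \<subseteq> S" "Range R \<subseteq> S" using assms(2) by auto
  have bf: "bij_betw f (Domain R) (Range R)"
  proof (rule bij_betw_imageI)
    show "inj_on f (Domain R)"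
    proof (rule inj_onI)
      fix x y assume "x \<in> Domain R" "y \<in> Domain R" "f x = f y"
      then have "(f x, x) \<in> R\<inverse>" "(f x, y) \<in> R\<inverse>" using f by auto
      then show "x = y" using assms(4) by (blast dest: single_valuedD)
    qed
    show "f ` Domain R = Range R" using f by force
  qed
  then have "card (S - Domain R) = card (S - Range R)"
    using sub assms(1) by (simp add: card_Diff_subset finite_subset bij_betw_same_card)
  then obtain h where h: "bij_betw h (S - Domain R) (S - Range R)"
    using assms(1) finite_same_card_bij[of "S - Domain R" "S - Range R"] by auto
  define g where "g = restrict (\<lambda>a. if a \<in> Domain R then f a else h a) S"
  have "bij_betw g (Domain R \<union> (S - Domain R)) (Range R \<union> (S - Range R))"
  proof (rule bij_betw_combine)
    show "bij_betw g (Domain R) (Range R)"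
      using bf sub by (subst bij_betw_cong[of _ _ f]) (auto simp: g_def)
    show "bij_betw g (S - Domain R) (S - Range R)"
      using h by (subst bij_betw_cong[of _ _ h]) (auto simp: g_def)
  qed auto
  then have "g \<in> Bij S" using sub by (simp add: Bij_def Un_absorb1 g_def)
  moreover have "g a = b" if "(a, b) \<in> R" for a b
  proof -
    have "a \<in> Domain R" "a \<in> S" using that assms(2) by auto
    then show ?thesis using f[OF that] by (simp add: g_def)
  qed
  ultimately show ?thesis by blast
qed

lemma carrier_BijGroup: "carrier (BijGroup S) = Bij S"
  by (simp add: BijGroup_def)

lemma residually_finite_free_group: "residually_finite (free_group S)"
proof (rule residually_finiteI[OF group_free_group])
  fix w assume w: "w \<in> carrier (free_group S)" "w \<noteq> \<one>\<^bsub>free_group S\<^esub>"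
  define n where "n = length w"
  \<comment> \<open>the letter at position \<open>i\<close> moves \<open>i + 1\<close> to \<open>i\<close>, so \<open>w\<close> moves \<open>n\<close> to \<open>0\<close>\<close>
  define R where "R x = {(Suc i, i) | i. i < n \<and> w ! i = (x, True)} \<union> {(i, Suc i) | i. i < n \<and> w ! i = (x, False)}" for x
  have red: "\<not> (fst (w ! i) = fst (w ! Suc i) \<and> snd (w ! i) \<noteq> snd (w ! Suc i))" if "Suc i < n" for i
    using w that successively_nth[of _ w i] unfolding carrier_free_group free_reduced_def n_def by auto
  \<comment> \<open>A conflict between two constraints can only come from adjacent positions
    carrying inverse letters, which a reduced word does not contain.\<close>
  have "\<exists>g \<in> Bij {..n}. \<forall>(a, b) \<in> R x. g a = b" for x
  proof (rule extend_partial_bij)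
    have R_iff: "(a, b) \<in> R x \<longleftrightarrow> (a = Suc b \<and> b < n \<and> w ! b = (x, True)) \<or> (b = Suc a \<and> a < n \<and> w ! a = (x, False))"
      for a b by (auto simp: R_def)
    show "single_valued (R x)"
    proof (rule single_valuedI)
      fix a b c assume "(a, b) \<in> R x" "(a, c) \<in> R x"
      then show "b = c" using red[of b] red[of c] unfolding R_iff by auto
    qed
    show "single_valued ((R x)\<inverse>)"
    proof (rule single_valuedI)
      fix a b c assume "(a, b) \<in> (R x)\<inverse>" "(a, c) \<in> (R x)\<inverse>"
      then show "b = c" using red[of b] red[of c] unfolding converse_iff R_iff by auto
    qed
  qed (auto simp: R_def)
  then have "\<forall>x. \<exists>g. g \<in> Bij {..n} \<and> (\<forall>(a, b) \<in> R x. g a = b)" by blast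
  from choice[OF this] obtain g
    where "\<forall>x. g x \<in> Bij {..n} \<and> (\<forall>(a, b) \<in> R x. g x a = b)" by blast
  then have g: "\<And>x. g x \<in> Bij {..n}" "\<And>x a b. (a, b) \<in> R x \<Longrightarrow> g x a = b" by fast+
  let ?B = "BijGroup {..n}"
  have gB: "\<And>x. g x \<in> carrier ?B" using g by (simp add: carrier_BijGroup)
  interpret B: group ?B by (rule group_BijGroup)
  have letter: "free_letter_val ?B g (w ! i) (Suc i) = i" if "i < n" for i
  proof (cases "snd (w ! i)")
    case True
    then have "(Suc i, i) \<in> R (fst (w ! i))" using that by (cases "w ! i") (auto simp: R_def)
    then show ?thesis using g True by (simp add: free_letter_val_def)
  next
    case False
    then have "(i, Suc i) \<in> R (fst (w ! i))" using that by (cases "w ! i") (auto simp: R_def)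
    then have gi: "g (fst (w ! i)) i = Suc i" using g by blast
    have "inj_on (g (fst (w ! i))) {..n}" using g(1) by (auto simp: Bij_def bij_betw_def)
    then have "inv_into {..n} (g (fst (w ! i))) (Suc i) = i" using gi that by (metis inv_into_f_f atMost_iff less_imp_le)
    then show ?thesis using False that g(1) by (simp add: free_letter_val_def inv_BijGroup)
  qed
  have "free_hom ?B g (drop (n - k) w) n = n - k" if "k \<le> n" for k
    using that
  proof (induction k)
    case 0
    then show ?case by (simp add: n_def BijGroup_def)
  next
    case (Suc k)
    define i where "i = n - Suc k"
    have i: "i < n" "Suc i = n - k" using Suc by (auto simp: i_def)
    have "drop i w = w ! i # drop (n - k) w" using i by (metis Cons_nth_drop_Suc n_def)
    moreover have "free_letter_val ?B g (w ! i) \<in> Bij {..n}"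
      unfolding carrier_BijGroup[symmetric]
      by (rule free_letter_val_closed[where S = UNIV]) (use gB B.group_axioms in auto)
    moreover have "free_hom ?B g (drop (n - k) w) \<in> Bij {..n}"
      unfolding carrier_BijGroup[symmetric]
      by (rule free_hom_closed[where S = UNIV]) (use gB B.group_axioms in auto)
    ultimately show ?case using Suc i letter[OF i(1)]
      by (simp add: free_hom_Cons BijGroup_mult_apply flip: i_def)
  qed
  from this[of n] have "free_hom ?B g w n = 0" by (simp add: n_def)
  moreover have "\<one>\<^bsub>?B\<^esub> n = n" by (simp add: BijGroup_def)
  moreover have "n \<noteq> 0" using w by (simp add: n_def)
  ultimately have "free_hom ?B g w \<noteq> \<one>\<^bsub>?B\<^esub>" by auto
  moreover have "free_hom ?B g \<in> hom (free_group S) ?B"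
    by (rule free_hom_hom) (use gB B.group_axioms in auto)
  moreover from hom_carrier[OF this] have "finite (free_hom ?B g ` carrier (free_group S))"
    using finite_carrier_BijGroup finite_subset by blast
  ultimately show "\<exists>K :: (nat \<Rightarrow> nat) monoid. \<exists>h. group K \<and> h \<in> hom (free_group S) K
      \<and> finite (h ` carrier (free_group S)) \<and> h w \<noteq> \<one>\<^bsub>K\<^esub>"
    using B.group_axioms by blast
qed

section \<open>Residual finiteness of free products\<close>

context group_pair begin

text \<open>The action of a factor on the normal forms of length at most \<open>n\<close>: a normal form that would
  become too long is left fixed. This is still an action, since a whole orbit is fixed then.\<close>

definition trunc_cons :: "nat \<Rightarrow> 'a + 'b \<Rightarrow> ('a + 'b) list \<Rightarrow> ('a + 'b) list" where
  "trunc_cons n l w = (let v = pcons l w in if length v \<le> n then v else w)"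

definition trunc_P :: "nat \<Rightarrow> ('a + 'b) list set" where
  "trunc_P n = {w \<in> carrier P. length w \<le> n}"

definition act_l :: "nat \<Rightarrow> 'a \<Rightarrow> ('a + 'b) list \<Rightarrow> ('a + 'b) list" where
  "act_l n a w = (if a = \<one>\<^bsub>G\<^esub> then w else trunc_cons n (Inl a) w)"

definition act_r :: "nat \<Rightarrow> 'b \<Rightarrow> ('a + 'b) list \<Rightarrow> ('a + 'b) list" where
  "act_r n b w = (if b = \<one>\<^bsub>H\<^esub> then w else trunc_cons n (Inr b) w)"

lemma act_l_mult:
  assumes "a \<in> carrier G" "b \<in> carrier G" "w \<in> trunc_P n"
  shows "act_l n (a \<otimes>\<^bsub>G\<^esub> b) w = act_l n a (act_l n b w)"
proof (cases "(w \<noteq> [] \<and> isl (hd w)) \<or> length w < n")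
  case True
  \<comment> \<open>A set stable under \<open>G\<close> on which truncation never takes effect: a
    left head is replaced or removed without lengthening, and otherwise there is room for one more
    letter.\<close>
  define ok where "ok v \<longleftrightarrow> length v \<le> n \<and> ((v \<noteq> [] \<and> isl (hd v)) \<or> length v < n)" for v :: "('a + 'b) list"
  define A where "A c v = (if c = \<one>\<^bsub>G\<^esub> then v else pcons (Inl c) v)" for c v
  have pc: "ok (pcons (Inl c) v)" if "ok v" for c v
    using that unfolding ok_def by (cases v; cases "hd v") auto
  have act: "act_l n c v = A c v" if "ok v" for c v
    using pc[OF that, of c] by (simp add: act_l_def A_def trunc_cons_def Let_def ok_def)
  have okA: "ok (A c v)" if "ok v" for c v using that pc by (simp add: A_def)
  have w: "w \<in> carrier P" "ok w" using assms True by (auto simp: trunc_P_def ok_def)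
  have "A (a \<otimes>\<^bsub>G\<^esub> b) w = A a (A b w)"
    using assms w(1) by (simp add: A_def pcons_Inl_Inl)
  then show ?thesis using act[OF w(2)] act[OF okA[OF w(2)]] by simp
next
  case False
  have "pcons (Inl c) w = Inl c # w" for c using False by (cases w; cases "hd w") auto
  then have "trunc_cons n (Inl c) w = w" for c using False assms by (auto simp: trunc_cons_def trunc_P_def)
  then show ?thesis by (simp add: act_l_def)
qed

lemma act_r_mult:
  assumes "a \<in> carrier H" "b \<in> carrier H" "w \<in> trunc_P n"
  shows "act_r n (a \<otimes>\<^bsub>H\<^esub> b) w = act_r n a (act_r n b w)"
proof (cases "(w \<noteq> [] \<and> \<not> isl (hd w)) \<or> length w < n")
  case True
  define ok where "ok v \<longleftrightarrow> length v \<le> n \<and> ((v \<noteq> [] \<and> \<not> isl (hd v)) \<or> length v < n)" for v :: "('a + 'b) list"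
  define A where "A c v = (if c = \<one>\<^bsub>H\<^esub> then v else pcons (Inr c) v)" for c v
  have pc: "ok (pcons (Inr c) v)" if "ok v" for c v
    using that unfolding ok_def by (cases v; cases "hd v") auto
  have act: "act_r n c v = A c v" if "ok v" for c v
    using pc[OF that, of c] by (simp add: act_r_def A_def trunc_cons_def Let_def ok_def)
  have okA: "ok (A c v)" if "ok v" for c v using that pc by (simp add: A_def)
  have w: "w \<in> carrier P" "ok w" using assms True by (auto simp: trunc_P_def ok_def)
  have "A (a \<otimes>\<^bsub>H\<^esub> b) w = A a (A b w)"
    using assms w(1) by (simp add: A_def pcons_Inr_Inr)
  then show ?thesis using act[OF w(2)] act[OF okA[OF w(2)]] by simp
next
  case False
  have "pcons (Inr c) w = Inr c # w" for c using False by (cases w; cases "hd w") auto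
  then have "trunc_cons n (Inr c) w = w" for c using False assms by (auto simp: trunc_cons_def trunc_P_def)
  then show ?thesis by (simp add: act_r_def)
qed

lemma act_l_hom: "(\<lambda>a. restrict (act_l n a) (trunc_P n)) \<in> hom G (BijGroup (trunc_P n))"
  by (rule hom_BijGroupI[OF G.group_axioms _ _ act_l_mult])
    (auto simp: act_l_def trunc_cons_def trunc_P_def Let_def pcons_closed)

lemma act_r_hom: "(\<lambda>a. restrict (act_r n a) (trunc_P n)) \<in> hom H (BijGroup (trunc_P n))"
  by (rule hom_BijGroupI[OF H.group_axioms _ _ act_r_mult])
    (auto simp: act_r_def trunc_cons_def trunc_P_def Let_def pcons_closed)

lemma finite_trunc_P:
  assumes "finite (carrier G)" "finite (carrier H)"
  shows "finite (trunc_P n)"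
proof (rule finite_subset)
  show "trunc_P n \<subseteq> {xs. set xs \<subseteq> letters \<and> length xs \<le> n}" using set_P by (auto simp: trunc_P_def)
  have "finite letters" using assms by (simp add: letters_def)
  then show "finite {xs. set xs \<subseteq> letters \<and> length xs \<le> n}" by (rule finite_lists_length_le)
qed

text \<open>In suitable finite quotients of the factors all letters of \<open>w\<close> stay
  non-trivial. Their free product acts on a finite set of truncated normal forms, and there
  \<open>w\<close> moves the empty word to the image of \<open>w\<close>, letter by letter.\<close>

lemma residually_finite_P:
  assumes "residually_finite G" "residually_finite H"
  shows "residually_finite P"
proof (rule residually_finiteI[OF group_P])
  fix w assume w: "w \<in> carrier P" "w \<noteq> \<one>\<^bsub>P\<^esub>"
  define n where "n = length w"
  have "finite (Inl -` set w)" "finite (Inr -` set w)" by (simp_all add: finite_vimageI)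
  moreover have "Inl -` set w \<subseteq> carrier G - {\<one>\<^bsub>G\<^esub>}" "Inr -` set w \<subseteq> carrier H - {\<one>\<^bsub>H\<^esub>}"
    using set_P[OF w(1)] by (auto simp: subset_iff)
  ultimately obtain N N' where
    N: "N \<in> finite_index_normal G" "N \<inter> Inl -` set w = {}" and
    N': "N' \<in> finite_index_normal H" "N' \<inter> Inr -` set w = {}"
    using residually_finite_avoid[OF G.group_axioms assms(1)] residually_finite_avoid[OF H.group_axioms assms(2)]
    by meson
  note n = finite_index_normalD(1)[OF N(1)] and n' = finite_index_normalD(1)[OF N'(1)]
  interpret Q: group_pair "G Mod N" "H Mod N'"
    using normal.factorgroup_is_group[OF n] normal.factorgroup_is_group[OF n'] by (simp add: group_pair_def)
  let ?W = "Q.trunc_P n"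
  let ?B = "BijGroup ?W"
  interpret B: group ?B by (rule group_BijGroup)
  define f where "f a = restrict (Q.act_l n (N #>\<^bsub>G\<^esub> a)) ?W" for a
  define g where "g b = restrict (Q.act_r n (N' #>\<^bsub>H\<^esub> b)) ?W" for b
  have f: "f \<in> hom G ?B" using hom_compose[OF hom_coset[OF n] Q.act_l_hom] by (simp add: f_def[abs_def] o_def)
  have g: "g \<in> hom H ?B" using hom_compose[OF hom_coset[OF n'] Q.act_r_hom] by (simp add: g_def[abs_def] o_def)
  let ?\<Phi> = "fp_hom ?B f g"
  let ?q = "map_sum (\<lambda>a. N #>\<^bsub>G\<^esub> a) (\<lambda>b. N' #>\<^bsub>H\<^esub> b)"
  have \<Phi>: "?\<Phi> \<in> hom P ?B" by (rule fp_hom_hom[OF B.group_axioms f g])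
  have "?\<Phi> v [] = map ?q v \<and> map ?q v \<in> ?W" if "v \<in> carrier P" "set v \<subseteq> set w" "length v \<le> n" for v
    using that
  proof (induction v)
    case Nil
    then show ?case by (simp add: BijGroup_def Q.trunc_P_def)
  next
    case (Cons l v)
    then have v: "v \<in> carrier P" "?\<Phi> v [] = map ?q v" "map ?q v \<in> ?W" "l \<in> letters" "l \<in> set w"
      by (auto simp: Cons_P)
    have l: "?q l \<in> Q.letters"
    proof (cases l)
      case (Inl a)
      then have "a \<notin> N" "a \<in> carrier G" using v N(2) by auto
      then have "N #>\<^bsub>G\<^esub> a \<noteq> N" using coset_eq_self_iff[OF n] by auto
      then show ?thesis using Inl \<open>a \<in> carrier G\<close> by (simp add: carrier_Mod one_Mod)
    next
      case (Inr a)
      then have "a \<notin> N'" "a \<in> carrier H" using v N'(2) by auto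
      then have "N' #>\<^bsub>H\<^esub> a \<noteq> N'" using coset_eq_self_iff[OF n'] by auto
      then show ?thesis using Inr \<open>a \<in> carrier H\<close> by (simp add: carrier_Mod one_Mod)
    qed
    have isl_q: "isl (?q l) = isl l" for l by (cases l) auto
    have P: "?q l # map ?q v \<in> carrier Q.P"
      using Cons.prems(1) l v by (auto simp: Q.Cons_P Cons_P Q.trunc_P_def hd_map isl_q)
    then have W: "?q l # map ?q v \<in> ?W" using Cons.prems(3) by (simp add: Q.trunc_P_def)
    have "fp_letter f g l (map ?q v) = ?q l # map ?q v"
      using l Q.pcons_eq_Cons[OF P] v(3) Cons.prems(3)
      by (cases l) (auto simp: fp_letter_def f_def g_def Q.act_l_def Q.act_r_def Q.trunc_cons_def)
    moreover have "fp_letter f g l \<in> Bij ?W"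
      using fp_letter_closed[OF B.group_axioms f g v(4)] by (simp only: carrier_BijGroup)
    moreover have "?\<Phi> v \<in> Bij ?W"
      using fp_hom_closed[OF B.group_axioms f g set_P[OF v(1)]] by (simp only: carrier_BijGroup)
    moreover have "[] \<in> ?W" by (simp add: Q.trunc_P_def)
    ultimately show ?case using W v by (simp add: fp_hom_Cons BijGroup_mult_apply)
  qed
  from this[of w] have "?\<Phi> w [] = map ?q w" using w by (simp add: n_def)
  moreover have "\<one>\<^bsub>?B\<^esub> [] = []" by (simp add: BijGroup_def Q.trunc_P_def)
  ultimately have "?\<Phi> w \<noteq> \<one>\<^bsub>?B\<^esub>" using w by auto
  moreover have "finite (?\<Phi> ` carrier P)"
  proof -
    have "finite ?W" using finite_index_normalD(2)[OF N(1)] finite_index_normalD(2)[OF N'(1)]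
      by (intro Q.finite_trunc_P) (simp_all add: FactGroup_def)
    then show ?thesis using hom_carrier[OF \<Phi>] finite_carrier_BijGroup finite_subset by blast
  qed
  ultimately show "\<exists>K :: (('a set + 'b set) list \<Rightarrow> ('a set + 'b set) list) monoid. \<exists>h. group K \<and> h \<in> hom P K
      \<and> finite (h ` carrier P) \<and> h w \<noteq> \<one>\<^bsub>K\<^esub>"
    using B.group_axioms \<Phi> by blast
qed

end

section \<open>Profinite completions\<close>

lemma set_mult_coset:
  assumes "N \<lhd> G" "N' \<lhd> G" "N \<subseteq> N'" "g \<in> carrier G"
  shows "N' <#>\<^bsub>G\<^esub> (N #>\<^bsub>G\<^esub> g) = N' #>\<^bsub>G\<^esub> g"
proof -
  interpret N: normal N G by fact
  interpret N': normal N' G by fact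
  have "N' <#>\<^bsub>G\<^esub> N = N'"
  proof
    show "N' <#>\<^bsub>G\<^esub> N \<subseteq> N'" using assms(3) subgroup.m_closed[OF N'.is_subgroup] by (auto simp: set_mult_def)
    show "N' \<subseteq> N' <#>\<^bsub>G\<^esub> N"
    proof
      fix x assume "x \<in> N'"
      then have "x \<otimes>\<^bsub>G\<^esub> \<one>\<^bsub>G\<^esub> = x" using N'.subset by (simp add: subsetD)
      moreover have "x \<otimes>\<^bsub>G\<^esub> \<one>\<^bsub>G\<^esub> \<in> N' <#>\<^bsub>G\<^esub> N"
        unfolding set_mult_def by (rule UN_I[OF \<open>x \<in> N'\<close>], rule UN_I[OF subgroup.one_closed[OF N.is_subgroup]], simp)
      ultimately show "x \<in> N' <#>\<^bsub>G\<^esub> N" by simp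
    qed
  qed
  then show ?thesis using N.setmult_rcos_assoc[OF N'.subset N.subset assms(4)] by simp
qed

lemma normal_coset_mult:
  assumes "N \<lhd> G" "x \<in> carrier G" "y \<in> carrier G"
  shows "(N #>\<^bsub>G\<^esub> x) <#>\<^bsub>G\<^esub> (N #>\<^bsub>G\<^esub> y) = N #>\<^bsub>G\<^esub> (x \<otimes>\<^bsub>G\<^esub> y)"
  using normal.rcos_sum[OF assms] .

text \<open>Membership in the inverse limit with transition maps eliminated: a single representative
  serves all the quotients above \<open>N\<close>.\<close>

definition coherent :: "('a, 'm) monoid_scheme \<Rightarrow> ('a set \<Rightarrow> 'a set) \<Rightarrow> bool" where
  "coherent G x \<longleftrightarrow> (\<forall>N \<in> finite_index_normal G. \<exists>g \<in> carrier G.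
     \<forall>N' \<in> finite_index_normal G. N \<subseteq> N' \<longrightarrow> x N' = N' #>\<^bsub>G\<^esub> g)"

lemma coherentE:
  assumes "coherent G x" "N \<in> finite_index_normal G"
  obtains g where "g \<in> carrier G"
    "\<And>N'. \<lbrakk>N' \<in> finite_index_normal G; N \<subseteq> N'\<rbrakk> \<Longrightarrow> x N' = N' #>\<^bsub>G\<^esub> g"
proof -
  have "\<exists>g \<in> carrier G. \<forall>N' \<in> finite_index_normal G. N \<subseteq> N' \<longrightarrow> x N' = N' #>\<^bsub>G\<^esub> g"
    using assms(1) unfolding coherent_def by (rule bspec) (rule assms(2))
  then show thesis using that by (elim bexE) simp
qed

lemma mem_profinite_completion:
  "x \<in> carrier (profinite_completion G) \<longleftrightarrow>
    x \<in> extensional (finite_index_normal G)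
    \<and> (\<forall>N \<in> finite_index_normal G. x N \<in> carrier (G Mod N))
    \<and> (\<forall>N \<in> finite_index_normal G. \<forall>N' \<in> finite_index_normal G.
          N \<subseteq> N' \<longrightarrow> x N' = N' <#>\<^bsub>G\<^esub> x N)"
  unfolding profinite_completion_def PiE_def by (auto simp: Pi_iff)

lemma profinite_completion_coset:
  assumes "x \<in> carrier (profinite_completion G)" "N \<in> finite_index_normal G"
  shows "x N \<in> carrier (G Mod N)"
  using assms(1) unfolding mem_profinite_completion by (elim conjE) (erule bspec[OF _ assms(2)])

lemma profinite_completion_compat:
  assumes "x \<in> carrier (profinite_completion G)" "N \<in> finite_index_normal G"
    "N' \<in> finite_index_normal G" "N \<subseteq> N'"
  shows "x N' = N' <#>\<^bsub>G\<^esub> x N"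
proof -
  have "\<forall>N \<in> finite_index_normal G. \<forall>N' \<in> finite_index_normal G. N \<subseteq> N' \<longrightarrow> x N' = N' <#>\<^bsub>G\<^esub> x N"
    using assms(1) unfolding mem_profinite_completion by (elim conjE)
  from bspec[OF bspec[OF this assms(2)] assms(3)] assms(4) show ?thesis by (rule mp)
qed

lemma carrier_profinite_completion:
  "carrier (profinite_completion G) = {x \<in> extensional (finite_index_normal G). coherent G x}"
proof (intro Set.set_eqI iffI)
  fix x assume x: "x \<in> carrier (profinite_completion G)"
  have "\<exists>g\<in>carrier G. \<forall>N'\<in>finite_index_normal G. N \<subseteq> N' \<longrightarrow> x N' = N' #>\<^bsub>G\<^esub> g"
    if N: "N \<in> finite_index_normal G" for N
  proof -
    obtain g where g: "g \<in> carrier G" "x N = N #>\<^bsub>G\<^esub> g"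
      using profinite_completion_coset[OF x N] unfolding carrier_Mod by (elim imageE) simp
    have "x N' = N' #>\<^bsub>G\<^esub> g" if "N' \<in> finite_index_normal G" "N \<subseteq> N'" for N'
    proof -
      have "x N' = N' <#>\<^bsub>G\<^esub> x N" using profinite_completion_compat[OF x N that] .
      then show ?thesis
        using g set_mult_coset[OF finite_index_normalD(1)[OF N] finite_index_normalD(1)[OF that(1)] that(2)] by simp
    qed
    then show ?thesis using g by blast
  qed
  then show "x \<in> {x \<in> extensional (finite_index_normal G). coherent G x}"
    unfolding coherent_def using x[unfolded mem_profinite_completion, THEN conjunct1] by simp
next
  fix x assume x: "x \<in> {x \<in> extensional (finite_index_normal G). coherent G x}"
  have A: "x N \<in> carrier (G Mod N)" if "N \<in> finite_index_normal G" for N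
  proof -
    from x have "\<forall>N \<in> finite_index_normal G. \<exists>g \<in> carrier G.
        \<forall>N' \<in> finite_index_normal G. N \<subseteq> N' \<longrightarrow> x N' = N' #>\<^bsub>G\<^esub> g"
      by (simp add: coherent_def)
    from bspec[OF this that] obtain g where g: "g \<in> carrier G"
      "\<forall>N' \<in> finite_index_normal G. N \<subseteq> N' \<longrightarrow> x N' = N' #>\<^bsub>G\<^esub> g" by (rule bexE)
    have "x N = N #>\<^bsub>G\<^esub> g" by (rule g(2)[rule_format, OF that order_refl])
    then show ?thesis using g(1) by (simp add: carrier_Mod)
  qed
  have B: "x N' = N' <#>\<^bsub>G\<^esub> x N"
    if "N \<in> finite_index_normal G" "N' \<in> finite_index_normal G" "N \<subseteq> N'" for N N'
  proof -
    from x have "\<forall>N \<in> finite_index_normal G. \<exists>g \<in> carrier G.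
        \<forall>N' \<in> finite_index_normal G. N \<subseteq> N' \<longrightarrow> x N' = N' #>\<^bsub>G\<^esub> g"
      by (simp add: coherent_def)
    from bspec[OF this that(1)] obtain g where g: "g \<in> carrier G"
      "\<forall>N' \<in> finite_index_normal G. N \<subseteq> N' \<longrightarrow> x N' = N' #>\<^bsub>G\<^esub> g" by (rule bexE)
    show ?thesis
      unfolding g(2)[rule_format, OF that(1) order_refl] g(2)[rule_format, OF that(2,3)]
      by (rule set_mult_coset[symmetric]) (use that g finite_index_normalD(1) in auto)
  qed
  show "x \<in> carrier (profinite_completion G)"
    unfolding mem_profinite_completion
  proof (intro conjI ballI impI)
    show "x \<in> extensional (finite_index_normal G)" using x by simp
  qed (rule A B; assumption)+
qed

lemma mult_profinite_completion:
  "x \<otimes>\<^bsub>profinite_completion G\<^esub> y = (\<lambda>N \<in> finite_index_normal G. x N <#>\<^bsub>G\<^esub> y N)"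
  by (simp add: profinite_completion_def product_group_def FactGroup_def)

lemma topspace_profinite_topology [simp]:
  "topspace (profinite_topology G) = carrier (profinite_completion G)"
proof -
  have "carrier (profinite_completion G) \<subseteq> (\<Pi>\<^sub>E N \<in> finite_index_normal G. carrier (G Mod N))"
  proof (intro subsetI PiE_I)
    fix x N assume "x \<in> carrier (profinite_completion G)" "N \<notin> finite_index_normal G"
    then show "x N = undefined"
      using mem_profinite_completion[of x G, THEN iffD1, THEN conjunct1] extensional_arb by metis
  qed (rule profinite_completion_coset)
  then show ?thesis by (simp add: profinite_topology_def Int_absorb1)
qed

lemma continuous_map_profinite_proj:
  assumes "N \<in> finite_index_normal G"
  shows "continuous_map (profinite_topology G) (discrete_topology (carrier (G Mod N))) (\<lambda>x. x N)"
  unfolding profinite_topology_def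
  by (intro continuous_map_from_subtopology continuous_map_product_projection assms)

lemma continuous_map_into_profinite:
  assumes "f ` topspace X \<subseteq> carrier (profinite_completion G)"
    "\<And>N. N \<in> finite_index_normal G \<Longrightarrow>
       continuous_map X (discrete_topology (carrier (G Mod N))) (\<lambda>x. f x N)"
  shows "continuous_map X (profinite_topology G) f"
  using assms by (auto simp: profinite_topology_def continuous_map_in_subtopology
      continuous_map_componentwise carrier_profinite_completion)

section \<open>Dense and cofinal homomorphisms induce isomorphisms of profinite completions\<close>

context
  fixes M :: "('a, 'm) monoid_scheme" and G :: "('b, 'n) monoid_scheme" and \<phi>
  assumes M: "group M" and G: "group G" and \<phi>: "\<phi> \<in> hom M G"
    and dense: "\<And>K g. \<lbrakk>K \<in> finite_index_normal G; g \<in> carrier G\<rbrakk> \<Longrightarrow>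
      \<exists>m \<in> carrier M. K #>\<^bsub>G\<^esub> g = K #>\<^bsub>G\<^esub> \<phi> m"
    and cofinal: "\<And>L. L \<in> finite_index_normal M \<Longrightarrow>
      \<exists>K \<in> finite_index_normal G. {m \<in> carrier M. \<phi> m \<in> K} \<subseteq> L"
begin

interpretation M: group M by (rule M)
interpretation G: group G by (rule G)
interpretation \<phi>: group_hom M G \<phi> by unfold_locales (rule \<phi>)

private abbreviation "pre K \<equiv> {m \<in> carrier M. \<phi> m \<in> K}"

lemma pre_finite_index: assumes "K \<in> finite_index_normal G" shows "pre K \<in> finite_index_normal M"
proof -
  note K = finite_index_normalD(1)[OF assms]
  have "(\<lambda>x. K #>\<^bsub>G\<^esub> \<phi> x) \<in> hom M (G Mod K)"
    using hom_compose[OF \<phi> hom_coset[OF K]] by (simp add: o_def)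
  moreover have "(\<lambda>x. K #>\<^bsub>G\<^esub> \<phi> x) ` carrier M \<subseteq> (\<lambda>x. K #>\<^bsub>G\<^esub> x) ` carrier G" by auto
  then have "finite ((\<lambda>x. K #>\<^bsub>G\<^esub> \<phi> x) ` carrier M)"
    using finite_subset coset_image_finite[OF assms] by blast
  ultimately have "kernel M (G Mod K) (\<lambda>x. K #>\<^bsub>G\<^esub> \<phi> x) \<in> finite_index_normal M"
    by (intro finite_index_kernel M normal.factorgroup_is_group[OF K])
  moreover have "kernel M (G Mod K) (\<lambda>x. K #>\<^bsub>G\<^esub> \<phi> x) = pre K"
    using coset_eq_self_iff[OF K] by (simp add: kernel_def one_Mod cong: conj_cong)
  ultimately show ?thesis by simp
qed

lemma image_pre_coset:
  assumes "K \<in> finite_index_normal G" "m \<in> carrier M"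
  shows "K <#>\<^bsub>G\<^esub> \<phi> ` (pre K #>\<^bsub>M\<^esub> m) = K #>\<^bsub>G\<^esub> \<phi> m"
proof -
  interpret K: normal K G by (rule finite_index_normalD(1)[OF assms(1)])
  show ?thesis
  proof (intro equalityI subsetI)
    fix z assume "z \<in> K <#>\<^bsub>G\<^esub> \<phi> ` (pre K #>\<^bsub>M\<^esub> m)"
    then obtain k x where kx: "k \<in> K" "x \<in> pre K" "z = k \<otimes>\<^bsub>G\<^esub> \<phi> (x \<otimes>\<^bsub>M\<^esub> m)"
      unfolding set_mult_def r_coset_def by blast
    then have "k \<in> carrier G" "x \<in> carrier M" "k \<otimes>\<^bsub>G\<^esub> \<phi> x \<in> K" using K.subset by auto
    then have "z = (k \<otimes>\<^bsub>G\<^esub> \<phi> x) \<otimes>\<^bsub>G\<^esub> \<phi> m"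
      using assms(2) by (simp add: kx(3) G.m_assoc)
    then show "z \<in> K #>\<^bsub>G\<^esub> \<phi> m"
      using \<open>k \<otimes>\<^bsub>G\<^esub> \<phi> x \<in> K\<close> unfolding r_coset_def by blast
  next
    fix z assume "z \<in> K #>\<^bsub>G\<^esub> \<phi> m"
    then obtain k where k: "k \<in> K" "z = k \<otimes>\<^bsub>G\<^esub> \<phi> m" unfolding r_coset_def by blast
    have "\<one>\<^bsub>M\<^esub> \<in> pre K" by simp
    then have "\<one>\<^bsub>M\<^esub> \<otimes>\<^bsub>M\<^esub> m \<in> pre K #>\<^bsub>M\<^esub> m" unfolding r_coset_def by blast
    then have "m \<in> pre K #>\<^bsub>M\<^esub> m" using assms(2) by simp
    then show "z \<in> K <#>\<^bsub>G\<^esub> \<phi> ` (pre K #>\<^bsub>M\<^esub> m)"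
      using k unfolding set_mult_def by blast
  qed
qed

lemma profinite_map_apply:
  assumes "K \<in> finite_index_normal G" "m \<in> carrier M" "x (pre K) = pre K #>\<^bsub>M\<^esub> m"
  shows "profinite_map M G \<phi> x K = K #>\<^bsub>G\<^esub> \<phi> m"
  using assms image_pre_coset by (simp add: profinite_map_def)

lemma profinite_map_closed:
  assumes "x \<in> carrier (profinite_completion M)"
  shows "profinite_map M G \<phi> x \<in> carrier (profinite_completion G)"
proof -
  have "coherent G (profinite_map M G \<phi> x)"
    unfolding coherent_def
  proof
    fix K assume K: "K \<in> finite_index_normal G"
    obtain m where m: "m \<in> carrier M"
      "\<And>N'. N' \<in> finite_index_normal M \<Longrightarrow> pre K \<subseteq> N' \<Longrightarrow> x N' = N' #>\<^bsub>M\<^esub> m"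
      using coherentE[OF _ pre_finite_index[OF K], of x] assms unfolding carrier_profinite_completion
      by (metis (no_types, lifting) mem_Collect_eq)
    have "profinite_map M G \<phi> x K' = K' #>\<^bsub>G\<^esub> \<phi> m" if "K' \<in> finite_index_normal G" "K \<subseteq> K'" for K'
      using that m pre_finite_index[OF that(1)] by (intro profinite_map_apply) auto
    then show "\<exists>g\<in>carrier G. \<forall>N'\<in>finite_index_normal G. K \<subseteq> N' \<longrightarrow>
        profinite_map M G \<phi> x N' = N' #>\<^bsub>G\<^esub> g"
      using m(1) by (intro bexI[of _ "\<phi> m"]) auto
  qed
  then show ?thesis by (simp add: carrier_profinite_completion profinite_map_def)
qed

lemma coherent_coset:
  assumes "coherent H x" "N \<in> finite_index_normal H"
  obtains g where "g \<in> carrier H" "x N = N #>\<^bsub>H\<^esub> g"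
  using coherentE[OF assms] assms(2) by (metis order_refl)

lemma profinite_map_hom:
  "profinite_map M G \<phi> \<in> hom (profinite_completion M) (profinite_completion G)"
proof (rule homI)
  fix x y assume xy: "x \<in> carrier (profinite_completion M)" "y \<in> carrier (profinite_completion M)"
  have "profinite_map M G \<phi> (x \<otimes>\<^bsub>profinite_completion M\<^esub> y) K
      = profinite_map M G \<phi> x K <#>\<^bsub>G\<^esub> profinite_map M G \<phi> y K"
    if K: "K \<in> finite_index_normal G" for K
  proof -
    note pK = pre_finite_index[OF K]
    obtain m m' where m: "m \<in> carrier M" "m' \<in> carrier M" "x (pre K) = pre K #>\<^bsub>M\<^esub> m" "y (pre K) = pre K #>\<^bsub>M\<^esub> m'"
    proof -
      have "coherent M x" "coherent M y" using xy by (simp_all add: carrier_profinite_completion)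
      then obtain m m' where "m \<in> carrier M" "x (pre K) = pre K #>\<^bsub>M\<^esub> m" "m' \<in> carrier M" "y (pre K) = pre K #>\<^bsub>M\<^esub> m'"
        by (elim coherent_coset[OF _ pK])
      then show thesis using that by simp
    qed
    then have xy_K: "(x \<otimes>\<^bsub>profinite_completion M\<^esub> y) (pre K) = pre K #>\<^bsub>M\<^esub> (m \<otimes>\<^bsub>M\<^esub> m')"
      using pK normal_coset_mult[OF finite_index_normalD(1)[OF pK]] by (simp add: mult_profinite_completion)
    show ?thesis
      using profinite_map_apply[where x = "x \<otimes>\<^bsub>profinite_completion M\<^esub> y" and K = K, OF K M.m_closed[OF m(1,2)] xy_K] profinite_map_apply[where x = x and K = K, OF K m(1,3)]
        profinite_map_apply[where x = y and K = K, OF K m(2,4)] normal_coset_mult[OF finite_index_normalD(1)[OF K], of "\<phi> m" "\<phi> m'"] m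
      by simp
  qed
  then show "profinite_map M G \<phi> (x \<otimes>\<^bsub>profinite_completion M\<^esub> y)
      = profinite_map M G \<phi> x \<otimes>\<^bsub>profinite_completion G\<^esub> profinite_map M G \<phi> y"
    unfolding mult_profinite_completion[where x = "profinite_map M G \<phi> x"]
    by (intro extensionalityI[of _ "finite_index_normal G"]) (auto simp: profinite_map_def)
qed (rule profinite_map_closed)

definition pre_index :: "'a set \<Rightarrow> 'b set" where
  "pre_index L = (SOME K. K \<in> finite_index_normal G \<and> pre K \<subseteq> L)"

definition lift_coset :: "'b set \<Rightarrow> 'b set \<Rightarrow> 'a" where
  "lift_coset K C = (SOME m. m \<in> carrier M \<and> C = K #>\<^bsub>G\<^esub> \<phi> m)"

definition profinite_inv :: "('b set \<Rightarrow> 'b set) \<Rightarrow> ('a set \<Rightarrow> 'a set)" where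
  "profinite_inv y = (\<lambda>L \<in> finite_index_normal M. L #>\<^bsub>M\<^esub> lift_coset (pre_index L) (y (pre_index L)))"

lemma pre_index:
  assumes "L \<in> finite_index_normal M"
  shows "pre_index L \<in> finite_index_normal G" "pre (pre_index L) \<subseteq> L"
proof -
  have "pre_index L \<in> finite_index_normal G \<and> pre (pre_index L) \<subseteq> L"
    unfolding pre_index_def using cofinal[OF assms] by (intro someI_ex[of "\<lambda>K. K \<in> finite_index_normal G \<and> pre K \<subseteq> L"]) blast
  then show "pre_index L \<in> finite_index_normal G" "pre (pre_index L) \<subseteq> L" by auto
qed

lemma lift_coset:
  assumes "K \<in> finite_index_normal G" "C \<in> carrier (G Mod K)"
  shows "lift_coset K C \<in> carrier M" "K #>\<^bsub>G\<^esub> \<phi> (lift_coset K C) = C"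
proof -
  obtain g where "g \<in> carrier G" "C = K #>\<^bsub>G\<^esub> g" using assms(2) by (auto simp: carrier_Mod)
  then have "\<exists>m. m \<in> carrier M \<and> C = K #>\<^bsub>G\<^esub> \<phi> m" using dense[OF assms(1)] by blast
  from someI_ex[OF this] show "lift_coset K C \<in> carrier M" "K #>\<^bsub>G\<^esub> \<phi> (lift_coset K C) = C"
    unfolding lift_coset_def by auto
qed

lemma coset_pre_eq:
  assumes "K \<in> finite_index_normal G" "L \<in> finite_index_normal M" "pre K \<subseteq> L"
    "m \<in> carrier M" "m' \<in> carrier M" "K #>\<^bsub>G\<^esub> \<phi> m = K #>\<^bsub>G\<^esub> \<phi> m'"
  shows "L #>\<^bsub>M\<^esub> m = L #>\<^bsub>M\<^esub> m'"
proof -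
  have "\<phi> m \<otimes>\<^bsub>G\<^esub> inv\<^bsub>G\<^esub> \<phi> m' \<in> K"
    using assms coset_eq_iff[OF finite_index_normalD(1)[OF assms(1)], of "\<phi> m" "\<phi> m'"] by simp
  then have "m \<otimes>\<^bsub>M\<^esub> inv\<^bsub>M\<^esub> m' \<in> pre K" using assms by simp
  then show ?thesis
    using assms coset_eq_iff[OF finite_index_normalD(1)[OF assms(2)], of m m'] by blast
qed

text \<open>Independence of the choices made in \<open>profinite_inv\<close>. Two admissible indices
  are compared through their intersection, where density provides one representative for
  both.\<close>

lemma profinite_inv_apply:
  assumes "y \<in> carrier (profinite_completion G)" "K \<in> finite_index_normal G" "L \<in> finite_index_normal M"
    "pre K \<subseteq> L" "m \<in> carrier M" "y K = K #>\<^bsub>G\<^esub> \<phi> m"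
  shows "profinite_inv y L = L #>\<^bsub>M\<^esub> m"
proof -
  define K' where "K' = pre_index L"
  have K': "K' \<in> finite_index_normal G" "pre K' \<subseteq> L" using pre_index[OF assms(3)] by (auto simp: K'_def)
  have coh: "coherent G y" using assms(1) by (simp add: carrier_profinite_completion)
  have KK': "K \<inter> K' \<in> finite_index_normal G" using finite_index_Int G assms(2) K'(1) by blast
  obtain g where g: "g \<in> carrier G" "y K = K #>\<^bsub>G\<^esub> g" "y K' = K' #>\<^bsub>G\<^esub> g"
    using coherentE[OF coh KK'] assms(2) K'(1) by (metis Int_lower1 Int_lower2)
  obtain m' where m': "m' \<in> carrier M" "(K \<inter> K') #>\<^bsub>G\<^esub> g = (K \<inter> K') #>\<^bsub>G\<^esub> \<phi> m'"
    using dense[OF KK' g(1)] by blast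
  have "g \<otimes>\<^bsub>G\<^esub> inv\<^bsub>G\<^esub> \<phi> m' \<in> K \<inter> K'"
    using m' g coset_eq_iff[OF finite_index_normalD(1)[OF KK'], of g "\<phi> m'"] by simp
  then have yK: "y K = K #>\<^bsub>G\<^esub> \<phi> m'" "y K' = K' #>\<^bsub>G\<^esub> \<phi> m'"
    using m' g coset_eq_iff[OF finite_index_normalD(1), of K G g "\<phi> m'"]
      coset_eq_iff[OF finite_index_normalD(1), of K' G g "\<phi> m'"] assms(2) K' by auto
  have "y K' \<in> carrier (G Mod K')" using g by (simp add: carrier_Mod)
  note l = lift_coset[OF K'(1) this]
  have "profinite_inv y L = L #>\<^bsub>M\<^esub> lift_coset K' (y K')"
    using assms(3) by (simp add: profinite_inv_def K'_def)
  also have "\<dots> = L #>\<^bsub>M\<^esub> m'"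
    by (rule coset_pre_eq[OF K'(1) assms(3) K'(2) l(1) m'(1)]) (use l yK in simp)
  also have "\<dots> = L #>\<^bsub>M\<^esub> m"
    by (rule coset_pre_eq[OF assms(2,3,4) m'(1) assms(5)]) (use yK assms in simp)
  finally show ?thesis .
qed

lemma profinite_inv_closed:
  assumes y: "y \<in> carrier (profinite_completion G)"
  shows "profinite_inv y \<in> carrier (profinite_completion M)"
proof -
  have coh: "coherent G y" using y by (simp add: carrier_profinite_completion)
  have "coherent M (profinite_inv y)"
    unfolding coherent_def
  proof
    fix L assume L: "L \<in> finite_index_normal M"
    note p = pre_index[OF L]
    obtain g where g: "g \<in> carrier G" "y (pre_index L) = pre_index L #>\<^bsub>G\<^esub> g" using coherent_coset[OF coh p(1)] .
    obtain m where m: "m \<in> carrier M" "pre_index L #>\<^bsub>G\<^esub> g = pre_index L #>\<^bsub>G\<^esub> \<phi> m" using dense[OF p(1) g(1)] by blast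
    have "profinite_inv y L' = L' #>\<^bsub>M\<^esub> m" if "L' \<in> finite_index_normal M" "L \<subseteq> L'" for L'
      by (rule profinite_inv_apply[OF y p(1) that(1)]) (use that p m g in auto)
    then show "\<exists>g\<in>carrier M. \<forall>N'\<in>finite_index_normal M. L \<subseteq> N' \<longrightarrow> profinite_inv y N' = N' #>\<^bsub>M\<^esub> g"
      using m(1) by blast
  qed
  then show ?thesis by (simp add: carrier_profinite_completion profinite_inv_def)
qed

lemma profinite_map_inv:
  assumes y: "y \<in> carrier (profinite_completion G)"
  shows "profinite_map M G \<phi> (profinite_inv y) = y"
proof (rule extensionalityI[of _ "finite_index_normal G"])
  fix K assume K: "K \<in> finite_index_normal G"
  have coh: "coherent G y" using y by (simp add: carrier_profinite_completion)
  obtain g where g: "g \<in> carrier G" "y K = K #>\<^bsub>G\<^esub> g" using coherent_coset[OF coh K] .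
  obtain m where m: "m \<in> carrier M" "K #>\<^bsub>G\<^esub> g = K #>\<^bsub>G\<^esub> \<phi> m" using dense[OF K g(1)] by blast
  have "profinite_inv y (pre K) = pre K #>\<^bsub>M\<^esub> m"
    by (rule profinite_inv_apply[OF y K pre_finite_index[OF K]]) (use g m in auto)
  then show "profinite_map M G \<phi> (profinite_inv y) K = y K"
    using profinite_map_apply[OF K m(1)] g m by simp
qed (use y in \<open>auto simp: profinite_map_def carrier_profinite_completion\<close>)

lemma profinite_inv_map:
  assumes x: "x \<in> carrier (profinite_completion M)"
  shows "profinite_inv (profinite_map M G \<phi> x) = x"
proof (rule extensionalityI[of _ "finite_index_normal M"])
  fix L assume L: "L \<in> finite_index_normal M"
  have coh: "coherent M x" using x by (simp add: carrier_profinite_completion)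
  note p = pre_index[OF L]
  note pp = pre_finite_index[OF p(1)]
  obtain m where m: "m \<in> carrier M" "x (pre (pre_index L)) = pre (pre_index L) #>\<^bsub>M\<^esub> m" "x L = L #>\<^bsub>M\<^esub> m"
    using coherentE[OF coh pp] pp L p(2) by (metis (no_types, lifting) order_refl)
  show "profinite_inv (profinite_map M G \<phi> x) L = x L"
    using profinite_inv_apply[OF profinite_map_closed[OF x] p(1) L p(2) m(1) profinite_map_apply[where x = x and K = "pre_index L", OF p(1) m(1,2)]] m
    by simp
qed (use x in \<open>auto simp: profinite_inv_def carrier_profinite_completion\<close>)

text \<open>Each component of the map and of its inverse depends on a single coordinate, hence
  factors through a discrete space; this gives continuity in both directions.\<close>

theorem induces_profinite_isoI: "induces_profinite_iso M G \<phi>"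
proof -
  have "homeomorphic_maps (profinite_topology M) (profinite_topology G) (profinite_map M G \<phi>) profinite_inv"
    unfolding homeomorphic_maps_def topspace_profinite_topology
  proof (intro conjI ballI)
    show "continuous_map (profinite_topology M) (profinite_topology G) (profinite_map M G \<phi>)"
    proof (rule continuous_map_into_profinite)
      show "profinite_map M G \<phi> ` topspace (profinite_topology M) \<subseteq> carrier (profinite_completion G)"
        using profinite_map_closed by auto
      fix K assume K: "K \<in> finite_index_normal G"
      have "continuous_map (discrete_topology (carrier (M Mod pre K))) (discrete_topology (carrier (G Mod K)))
          (\<lambda>C. K <#>\<^bsub>G\<^esub> \<phi> ` C)"
        using image_pre_coset[OF K] by (auto simp: carrier_Mod)
      from continuous_map_compose[OF continuous_map_profinite_proj[OF pre_finite_index[OF K]] this]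
      show "continuous_map (profinite_topology M) (discrete_topology (carrier (G Mod K)))
          (\<lambda>x. profinite_map M G \<phi> x K)"
        using K by (simp add: o_def profinite_map_def)
    qed
    show "continuous_map (profinite_topology G) (profinite_topology M) profinite_inv"
    proof (rule continuous_map_into_profinite)
      show "profinite_inv ` topspace (profinite_topology G) \<subseteq> carrier (profinite_completion M)"
        using profinite_inv_closed by auto
      fix L assume L: "L \<in> finite_index_normal M"
      note p = pre_index[OF L]
      have "continuous_map (discrete_topology (carrier (G Mod pre_index L))) (discrete_topology (carrier (M Mod L)))
          (\<lambda>C. L #>\<^bsub>M\<^esub> lift_coset (pre_index L) C)"
        using lift_coset(1)[OF p(1)] by (auto simp: carrier_Mod[of M])
      from continuous_map_compose[OF continuous_map_profinite_proj[OF p(1)] this]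
      show "continuous_map (profinite_topology G) (discrete_topology (carrier (M Mod L))) (\<lambda>y. profinite_inv y L)"
        using L by (simp add: o_def profinite_inv_def)
    qed
  qed (simp_all add: profinite_inv_map profinite_map_inv)
  moreover have "bij_betw (profinite_map M G \<phi>) (carrier (profinite_completion M)) (carrier (profinite_completion G))"
    by (rule bij_betw_byWitness[where f' = profinite_inv])
      (use profinite_inv_map profinite_map_inv profinite_map_closed profinite_inv_closed in auto)
  ultimately show ?thesis
    using profinite_map_hom unfolding induces_profinite_iso_def iso_def homeomorphic_map_maps by blast
qed

end

section \<open>Normal subgroups of free products with a free factor\<close>

text \<open>A transversal \<open>\<tau>\<close> of the kernel of \<open>q\<close> whose elements are connected to \<open>\<one>\<close> within its range: this is
  a maximal tree in the quotient by the kernel of the Bass--Serre tree of the free product.\<close>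

definition tree_transversal ::
  "('p, 'm) monoid_scheme \<Rightarrow> ('q, 'n) monoid_scheme \<Rightarrow> ('p \<Rightarrow> 'q) \<Rightarrow> 'p set \<Rightarrow> 'p set \<Rightarrow> ('q \<Rightarrow> 'p) \<Rightarrow> bool"
where
  "tree_transversal P Q q H X \<tau> \<longleftrightarrow>
     (\<forall>a \<in> carrier Q. \<tau> a \<in> carrier P \<and> q (\<tau> a) = a) \<and>
     (\<forall>a \<in> carrier Q. \<forall>h \<in> H. \<tau> (a \<otimes>\<^bsub>Q\<^esub> q h) = \<tau> a \<otimes>\<^bsub>P\<^esub> h) \<and>
     \<tau> \<one>\<^bsub>Q\<^esub> = \<one>\<^bsub>P\<^esub> \<and>
     (\<forall>R. R \<one>\<^bsub>P\<^esub> \<longrightarrow>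
        (\<forall>\<beta> \<in> \<tau> ` carrier Q. \<forall>h \<in> H. R \<beta> \<longrightarrow> R (\<beta> \<otimes>\<^bsub>P\<^esub> h)) \<longrightarrow>
        (\<forall>\<beta> \<in> \<tau> ` carrier Q. \<forall>x \<in> X. R \<beta> \<longrightarrow> \<beta> \<otimes>\<^bsub>P\<^esub> x \<in> \<tau> ` carrier Q \<longrightarrow> R (\<beta> \<otimes>\<^bsub>P\<^esub> x)) \<longrightarrow>
        (\<forall>\<beta> \<in> \<tau> ` carrier Q. \<forall>x \<in> X. R \<beta> \<longrightarrow> \<beta> \<otimes>\<^bsub>P\<^esub> inv\<^bsub>P\<^esub> x \<in> \<tau> ` carrier Q \<longrightarrow> R (\<beta> \<otimes>\<^bsub>P\<^esub> inv\<^bsub>P\<^esub> x)) \<longrightarrow>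
        (\<forall>a \<in> carrier Q. R (\<tau> a)))"

text \<open>Breadth-first search among the cosets \<open>cl a\<close> of the image of
  \<open>H\<close>: \<open>V n\<close> collects those reached by \<open>n\<close> edges from
  \<open>X\<close>. Each coset except the base one takes its representative from a neighbour of
  lower level, and injectivity of \<open>q\<close> on \<open>H\<close> extends this representative
  uniquely to the elements of the coset.\<close>

lemma tree_transversal_exists:
  fixes P :: "('p, 'm) monoid_scheme" and Q :: "('q, 'n) monoid_scheme"
  assumes "group P" "group Q" "q \<in> hom P Q" "q ` carrier P = carrier Q"
    and "subgroup H P" "inj_on q H" "X \<subseteq> carrier P" "generate P (X \<union> H) = carrier P"
  shows "\<exists>\<tau>. tree_transversal P Q q H X \<tau>"
proof -
  interpret P: group P by fact
  interpret Q: group Q by fact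
  interpret q: group_hom P Q q by unfold_locales fact
  interpret H: subgroup H P by fact
  have H1: "\<one>\<^bsub>P\<^esub> \<in> H" and Hm: "\<And>h h'. \<lbrakk>h \<in> H; h' \<in> H\<rbrakk> \<Longrightarrow> h \<otimes>\<^bsub>P\<^esub> h' \<in> H"
    and Hi: "\<And>h. h \<in> H \<Longrightarrow> inv\<^bsub>P\<^esub> h \<in> H" and Hc: "\<And>h. h \<in> H \<Longrightarrow> h \<in> carrier P"
    using subgroup.one_closed[OF assms(5)] subgroup.m_closed[OF assms(5)] subgroup.m_inv_closed[OF assms(5)]
      H.subset by auto
  have Xc: "x \<in> carrier P" if "x \<in> X" for x using assms(7) that by auto
  define cl where "cl a = (\<lambda>h. a \<otimes>\<^bsub>Q\<^esub> q h) ` H" for a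
  have cl_self: "a \<in> cl a" if "a \<in> carrier Q" for a
    using that H1 unfolding cl_def by (intro image_eqI[of _ _ "\<one>\<^bsub>P\<^esub>"]) auto
  have cl_sub: "cl (a \<otimes>\<^bsub>Q\<^esub> q h) \<subseteq> cl a" if "a \<in> carrier Q" "h \<in> H" for a h
    unfolding cl_def
  proof
    fix z assume "z \<in> (\<lambda>h'. a \<otimes>\<^bsub>Q\<^esub> q h \<otimes>\<^bsub>Q\<^esub> q h') ` H"
    then obtain h' where "h' \<in> H" "z = a \<otimes>\<^bsub>Q\<^esub> q h \<otimes>\<^bsub>Q\<^esub> q h'" by blast
    then have "z = a \<otimes>\<^bsub>Q\<^esub> q (h \<otimes>\<^bsub>P\<^esub> h')" "h \<otimes>\<^bsub>P\<^esub> h' \<in> H" using that Hc Hm by (auto simp: Q.m_assoc)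
    then show "z \<in> (\<lambda>h. a \<otimes>\<^bsub>Q\<^esub> q h) ` H" by blast
  qed
  have cl_eq: "cl (a \<otimes>\<^bsub>Q\<^esub> q h) = cl a" if "a \<in> carrier Q" "h \<in> H" for a h
  proof
    have "a \<otimes>\<^bsub>Q\<^esub> q h \<otimes>\<^bsub>Q\<^esub> q (inv\<^bsub>P\<^esub> h) = a" using that Hc by (simp add: Q.m_assoc)
    then show "cl a \<subseteq> cl (a \<otimes>\<^bsub>Q\<^esub> q h)" using cl_sub[of "a \<otimes>\<^bsub>Q\<^esub> q h" "inv\<^bsub>P\<^esub> h"] that Hc Hi by simp
  qed (rule cl_sub[OF that])
  have cl_mem: "cl b = cl a" if a: "a \<in> carrier Q" and b: "b \<in> cl a" for a b
  proof -
    obtain h where "h \<in> H" "b = a \<otimes>\<^bsub>Q\<^esub> q h" using b unfolding cl_def by blast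
    then show ?thesis using cl_eq a by simp
  qed
  have cl_carrier: "b \<in> carrier Q" if "a \<in> carrier Q" "b \<in> cl a" for a b
    using that Hc unfolding cl_def by auto
  define V where "V = rec_nat (cl \<one>\<^bsub>Q\<^esub>)
    (\<lambda>_ V. {c. \<exists>b \<in> V. \<exists>x \<in> X. c \<in> cl (b \<otimes>\<^bsub>Q\<^esub> q x) \<or> c \<in> cl (b \<otimes>\<^bsub>Q\<^esub> inv\<^bsub>Q\<^esub> q x)})"
  have V0: "V 0 = cl \<one>\<^bsub>Q\<^esub>"
    and VSuc: "V (Suc n) = {c. \<exists>b \<in> V n. \<exists>x \<in> X. c \<in> cl (b \<otimes>\<^bsub>Q\<^esub> q x) \<or> c \<in> cl (b \<otimes>\<^bsub>Q\<^esub> inv\<^bsub>Q\<^esub> q x)}" for n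
    by (simp_all add: V_def)
  have V_carrier: "V n \<subseteq> carrier Q" for n
  proof (induction n)
    case 0 then show ?case using cl_carrier by (auto simp: V0)
  next
    case (Suc n)
    show ?case
    proof
      fix c assume "c \<in> V (Suc n)"
      then obtain b x where "b \<in> V n" "x \<in> X" "c \<in> cl (b \<otimes>\<^bsub>Q\<^esub> q x) \<or> c \<in> cl (b \<otimes>\<^bsub>Q\<^esub> inv\<^bsub>Q\<^esub> q x)"
        unfolding VSuc by blast
      then show "c \<in> carrier Q" using Suc Xc cl_carrier[of "b \<otimes>\<^bsub>Q\<^esub> q x" c] cl_carrier[of "b \<otimes>\<^bsub>Q\<^esub> inv\<^bsub>Q\<^esub> q x" c]
        by auto
    qed
  qed
  have V_cl: "cl b \<subseteq> V n" if b: "b \<in> V n" for b n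
  proof (cases n)
    case 0 then show ?thesis using b cl_mem by (auto simp: V0)
  next
    case (Suc m)
    then obtain b' x where b': "b' \<in> V m" "x \<in> X" "b \<in> cl (b' \<otimes>\<^bsub>Q\<^esub> q x) \<or> b \<in> cl (b' \<otimes>\<^bsub>Q\<^esub> inv\<^bsub>Q\<^esub> q x)"
      using b unfolding Suc VSuc by blast
    have "b' \<in> carrier Q" "q x \<in> carrier Q" using b' V_carrier Xc by auto
    then have "cl b = cl (b' \<otimes>\<^bsub>Q\<^esub> q x) \<or> cl b = cl (b' \<otimes>\<^bsub>Q\<^esub> inv\<^bsub>Q\<^esub> q x)"
      using b'(3) cl_mem[of "b' \<otimes>\<^bsub>Q\<^esub> q x" b] cl_mem[of "b' \<otimes>\<^bsub>Q\<^esub> inv\<^bsub>Q\<^esub> q x" b] by auto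
    then show ?thesis unfolding Suc VSuc using b'(1,2) by blast
  qed
  have V_all: "\<exists>n. a \<in> V n" if a: "a \<in> carrier Q" for a
  proof -
    obtain \<alpha> where \<alpha>: "\<alpha> \<in> generate P (X \<union> H)" "a = q \<alpha>" using a assms(4,8) by auto
    from \<alpha>(1) have "\<forall>b n. b \<in> V n \<longrightarrow> (\<exists>m. b \<otimes>\<^bsub>Q\<^esub> q \<alpha> \<in> V m)"
    proof induction
      case one
      then show ?case using V_carrier by (auto simp: subset_iff)
    next
      case (incl h)
      show ?case
      proof (intro allI impI)
        fix b n assume b: "b \<in> V n"
        then have bc: "b \<in> carrier Q" using V_carrier by auto
        show "\<exists>m. b \<otimes>\<^bsub>Q\<^esub> q h \<in> V m"
        proof (cases "h \<in> H")
          case True then show ?thesis using V_cl[OF b] unfolding cl_def by blast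
        next
          case False
          then have "h \<in> X" using incl by simp
          moreover have "b \<otimes>\<^bsub>Q\<^esub> q h \<in> cl (b \<otimes>\<^bsub>Q\<^esub> q h)" by (rule cl_self) (use bc Xc \<open>h \<in> X\<close> in auto)
          ultimately have "b \<otimes>\<^bsub>Q\<^esub> q h \<in> V (Suc n)" using b unfolding VSuc by blast
          then show ?thesis ..
        qed
      qed
    next
      case (inv h)
      show ?case
      proof (intro allI impI)
        fix b n assume b: "b \<in> V n"
        then have bc: "b \<in> carrier Q" using V_carrier by auto
        show "\<exists>m. b \<otimes>\<^bsub>Q\<^esub> q (inv\<^bsub>P\<^esub> h) \<in> V m"
        proof (cases "h \<in> H")
          case True then show ?thesis using V_cl[OF b] Hi[OF True] unfolding cl_def by blast
        next
          case False
          then have h: "h \<in> X" using inv by simp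
          moreover have "b \<otimes>\<^bsub>Q\<^esub> inv\<^bsub>Q\<^esub> q h \<in> cl (b \<otimes>\<^bsub>Q\<^esub> inv\<^bsub>Q\<^esub> q h)" by (rule cl_self) (use bc Xc h in auto)
          ultimately have "b \<otimes>\<^bsub>Q\<^esub> inv\<^bsub>Q\<^esub> q h \<in> V (Suc n)" using b unfolding VSuc by blast
          then show ?thesis using Xc h by auto
        qed
      qed
    next
      case (eng h1 h2)
      have "h1 \<in> carrier P" "h2 \<in> carrier P" using eng assms(8) by auto
      show ?case
      proof (intro allI impI)
        fix b n assume b: "b \<in> V n"
        then have bc: "b \<in> carrier Q" using V_carrier by auto
        from eng b obtain m where "b \<otimes>\<^bsub>Q\<^esub> q h1 \<in> V m" by blast
        with eng obtain m' where "b \<otimes>\<^bsub>Q\<^esub> q h1 \<otimes>\<^bsub>Q\<^esub> q h2 \<in> V m'" by blast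
        then show "\<exists>m. b \<otimes>\<^bsub>Q\<^esub> q (h1 \<otimes>\<^bsub>P\<^esub> h2) \<in> V m"
          using bc \<open>h1 \<in> carrier P\<close> \<open>h2 \<in> carrier P\<close> by (auto simp: Q.m_assoc)
      qed
    qed
    moreover have "\<one>\<^bsub>Q\<^esub> \<in> V 0" using cl_self by (simp add: V0)
    ultimately obtain m where "\<one>\<^bsub>Q\<^esub> \<otimes>\<^bsub>Q\<^esub> q \<alpha> \<in> V m" by blast
    then show ?thesis using a \<alpha>(2) by auto
  qed
  define lev where "lev C = (LEAST n. C \<inter> V n \<noteq> {})" for C
  \<comment> \<open>Only values of \<open>f\<close> at cosets of lower level are mentioned, so
    \<open>good\<close> is a legitimate specification for choice along a well-founded
    relation.\<close>
  define step where "step f C r \<longleftrightarrow> (\<exists>b x h. b \<in> carrier Q \<and> lev (cl b) < lev C \<and> x \<in> X \<and> h \<in> H \<and>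
      (r = f (cl b) \<otimes>\<^bsub>P\<^esub> h \<otimes>\<^bsub>P\<^esub> x \<or> r = f (cl b) \<otimes>\<^bsub>P\<^esub> h \<otimes>\<^bsub>P\<^esub> inv\<^bsub>P\<^esub> x))" for f :: "'q set \<Rightarrow> 'p" and C r
  define good where "good f C r \<longleftrightarrow> (C \<in> cl ` carrier Q \<longrightarrow> r \<in> carrier P \<and> q r \<in> C \<and>
      (if C = cl \<one>\<^bsub>Q\<^esub> then r = \<one>\<^bsub>P\<^esub> else step f C r))" for f :: "'q set \<Rightarrow> 'p" and C r
  have "\<exists>T. \<forall>C. good T C (T C)"
  proof (rule dependent_wf_choice[of "Wellfounded.measure lev"])
    show "wf (Wellfounded.measure lev)" by simp
    show "good f C r = good g C r" if fg: "\<And>D. (D, C) \<in> Wellfounded.measure lev \<Longrightarrow> f D = g D" for f g :: "'q set \<Rightarrow> 'p" and C r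
    proof -
      have "step f C r = step g C r" using fg unfolding step_def by (metis in_measure)
      then show ?thesis by (simp add: good_def)
    qed
    fix C and f :: "'q set \<Rightarrow> 'p" assume f: "\<And>D. (D, C) \<in> Wellfounded.measure lev \<Longrightarrow> good f D (f D)"
    show "\<exists>r. good f C r"
    proof (cases "C \<in> cl ` carrier Q \<and> C \<noteq> cl \<one>\<^bsub>Q\<^esub>")
      case False
      show ?thesis
        by (rule exI[of _ "\<one>\<^bsub>P\<^esub>"]) (use False cl_self[of "\<one>\<^bsub>Q\<^esub>"] in \<open>auto simp: good_def\<close>)
    next
      case True
      then obtain a where a: "a \<in> carrier Q" "C = cl a" by auto
      obtain n where "a \<in> V n" using V_all a by auto
      then have "C \<inter> V n \<noteq> {}" using cl_self a by auto
      then have ex: "C \<inter> V (lev C) \<noteq> {}" unfolding lev_def by (rule LeastI)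
      have "lev C \<noteq> 0"
      proof
        assume "lev C = 0"
        then obtain b where "b \<in> cl a" "b \<in> cl \<one>\<^bsub>Q\<^esub>" using ex a by (auto simp: V0)
        then have "cl b = cl a" "cl b = cl \<one>\<^bsub>Q\<^esub>" using cl_mem[of a b] cl_mem[of "\<one>\<^bsub>Q\<^esub>" b] a by auto
        then show False using True a by auto
      qed
      then obtain m where m: "lev C = Suc m" by (cases "lev C") auto
      obtain c where c: "c \<in> C" "c \<in> V (Suc m)" using ex m by auto
      then obtain b x where b: "b \<in> V m" "x \<in> X" "c \<in> cl (b \<otimes>\<^bsub>Q\<^esub> q x) \<or> c \<in> cl (b \<otimes>\<^bsub>Q\<^esub> inv\<^bsub>Q\<^esub> q x)"
        unfolding VSuc by blast
      have bc: "b \<in> carrier Q" using b V_carrier by auto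
      have "cl b \<inter> V m \<noteq> {}" using b cl_self[OF bc] by auto
      then have "lev (cl b) \<le> m" unfolding lev_def by (rule Least_le)
      then have lt: "lev (cl b) < lev C" using m by simp
      then have "good f (cl b) (f (cl b))" using f by simp
      then have fb: "f (cl b) \<in> carrier P" "q (f (cl b)) \<in> cl b" using bc by (auto simp: good_def)
      then have "b \<in> cl (q (f (cl b)))" using cl_mem[OF bc fb(2)] cl_self[OF bc] by simp
      then obtain h where h: "h \<in> H" "b = q (f (cl b)) \<otimes>\<^bsub>Q\<^esub> q h" unfolding cl_def by blast
      have C: "C = cl c" using cl_mem[OF a(1)] c a by auto
      have hx: "h \<in> carrier P" "x \<in> carrier P" using h Hc b Xc by auto
      show ?thesis
      proof (cases "c \<in> cl (b \<otimes>\<^bsub>Q\<^esub> q x)")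
        case True
        have "q (f (cl b) \<otimes>\<^bsub>P\<^esub> h \<otimes>\<^bsub>P\<^esub> x) = b \<otimes>\<^bsub>Q\<^esub> q x" using h(2) fb hx by simp
        moreover have "b \<otimes>\<^bsub>Q\<^esub> q x \<in> C" using cl_mem[OF _ True] cl_self[of "b \<otimes>\<^bsub>Q\<^esub> q x"] C bc hx by simp
        moreover have "step f C (f (cl b) \<otimes>\<^bsub>P\<^esub> h \<otimes>\<^bsub>P\<^esub> x)" unfolding step_def using bc lt b(2) h(1) by blast
        ultimately show ?thesis using fb hx \<open>C \<in> cl ` carrier Q \<and> C \<noteq> cl \<one>\<^bsub>Q\<^esub>\<close>
          by (intro exI[of _ "f (cl b) \<otimes>\<^bsub>P\<^esub> h \<otimes>\<^bsub>P\<^esub> x"]) (simp add: good_def)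
      next
        case False
        then have c': "c \<in> cl (b \<otimes>\<^bsub>Q\<^esub> inv\<^bsub>Q\<^esub> q x)" using b(3) by simp
        have "q (f (cl b) \<otimes>\<^bsub>P\<^esub> h \<otimes>\<^bsub>P\<^esub> inv\<^bsub>P\<^esub> x) = b \<otimes>\<^bsub>Q\<^esub> inv\<^bsub>Q\<^esub> q x" using h(2) fb hx by simp
        moreover have "b \<otimes>\<^bsub>Q\<^esub> inv\<^bsub>Q\<^esub> q x \<in> C" using cl_mem[OF _ c'] cl_self[of "b \<otimes>\<^bsub>Q\<^esub> inv\<^bsub>Q\<^esub> q x"] C bc hx by simp
        moreover have "step f C (f (cl b) \<otimes>\<^bsub>P\<^esub> h \<otimes>\<^bsub>P\<^esub> inv\<^bsub>P\<^esub> x)" unfolding step_def using bc lt b(2) h(1) by blast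
        ultimately show ?thesis using fb hx \<open>C \<in> cl ` carrier Q \<and> C \<noteq> cl \<one>\<^bsub>Q\<^esub>\<close>
          by (intro exI[of _ "f (cl b) \<otimes>\<^bsub>P\<^esub> h \<otimes>\<^bsub>P\<^esub> inv\<^bsub>P\<^esub> x"]) (simp add: good_def)
      qed
    qed
  qed
  then obtain T where T: "\<And>C. good T C (T C)" by blast
  have Tc: "T (cl a) \<in> carrier P" "q (T (cl a)) \<in> cl a" if "a \<in> carrier Q" for a
    using T[of "cl a"] that by (auto simp: good_def)
  have T1: "T (cl \<one>\<^bsub>Q\<^esub>) = \<one>\<^bsub>P\<^esub>" using T[of "cl \<one>\<^bsub>Q\<^esub>"] by (auto simp: good_def)
  have Tstep: "step T (cl a) (T (cl a))" if "a \<in> carrier Q" "cl a \<noteq> cl \<one>\<^bsub>Q\<^esub>" for a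
    using T[of "cl a"] that by (auto simp: good_def)
  have ex_h: "\<exists>h. h \<in> H \<and> a = q (T (cl a)) \<otimes>\<^bsub>Q\<^esub> q h" if a: "a \<in> carrier Q" for a
  proof -
    have "a \<in> cl (q (T (cl a)))" using cl_mem[OF a Tc(2)[OF a]] cl_self[OF a] by simp
    then show ?thesis unfolding cl_def[of "q (T (cl a))"] by blast
  qed
  define \<eta> where "\<eta> a = (SOME h. h \<in> H \<and> a = q (T (cl a)) \<otimes>\<^bsub>Q\<^esub> q h)" for a
  have \<eta>: "\<eta> a \<in> H" "a = q (T (cl a)) \<otimes>\<^bsub>Q\<^esub> q (\<eta> a)" if "a \<in> carrier Q" for a
    using someI_ex[OF ex_h[OF that]] unfolding \<eta>_def by auto
  define \<tau> where "\<tau> a = T (cl a) \<otimes>\<^bsub>P\<^esub> \<eta> a" for a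
  have \<tau>_unique: "\<tau> a = T (cl a) \<otimes>\<^bsub>P\<^esub> h" if "a \<in> carrier Q" "h \<in> H" "a = q (T (cl a)) \<otimes>\<^bsub>Q\<^esub> q h" for a h
  proof -
    have "q (T (cl a)) \<in> carrier Q" "q (\<eta> a) \<in> carrier Q" "q h \<in> carrier Q"
      using \<eta>(1)[OF that(1)] that(2) Tc[OF that(1)] Hc by auto
    then have "q (\<eta> a) = q h"
      using Q.inv_mult_cancel(1) \<eta>(2)[OF that(1)] that(3) by metis
    then have "\<eta> a = h" using inj_onD[OF assms(6)] \<eta>(1)[OF that(1)] that(2) by blast
    then show ?thesis by (simp add: \<tau>_def)
  qed
  have \<tau>c: "\<tau> a \<in> carrier P" "q (\<tau> a) = a" if "a \<in> carrier Q" for a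
    using \<eta>[OF that] Tc[OF that] Hc by (auto simp: \<tau>_def)
  have \<tau>H: "\<tau> (a \<otimes>\<^bsub>Q\<^esub> q h) = \<tau> a \<otimes>\<^bsub>P\<^esub> h" if a: "a \<in> carrier Q" and h: "h \<in> H" for a h
  proof -
    have "\<tau> (a \<otimes>\<^bsub>Q\<^esub> q h) = T (cl (a \<otimes>\<^bsub>Q\<^esub> q h)) \<otimes>\<^bsub>P\<^esub> (\<eta> a \<otimes>\<^bsub>P\<^esub> h)"
    proof (rule \<tau>_unique)
      have "a \<otimes>\<^bsub>Q\<^esub> q h = q (T (cl a)) \<otimes>\<^bsub>Q\<^esub> q (\<eta> a) \<otimes>\<^bsub>Q\<^esub> q h" using \<eta>(2)[OF a] by simp
      then show "a \<otimes>\<^bsub>Q\<^esub> q h = q (T (cl (a \<otimes>\<^bsub>Q\<^esub> q h))) \<otimes>\<^bsub>Q\<^esub> q (\<eta> a \<otimes>\<^bsub>P\<^esub> h)"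
        using cl_eq[OF a h] \<eta>(1)[OF a] Hc h Tc[OF a] by (simp add: Q.m_assoc)
    qed (use a h Hc Hm \<eta>(1) in auto)
    then show ?thesis using cl_eq[OF a h] \<eta>(1)[OF a] Hc h Tc[OF a] by (simp add: \<tau>_def P.m_assoc)
  qed
  have \<tau>1: "\<tau> \<one>\<^bsub>Q\<^esub> = \<one>\<^bsub>P\<^esub>"
    using \<tau>_unique[of "\<one>\<^bsub>Q\<^esub>" "\<one>\<^bsub>P\<^esub>"] T1 H1 by simp
  have T\<tau>: "T (cl a) = \<tau> (q (T (cl a)))" if a: "a \<in> carrier Q" for a
  proof -
    have "cl (q (T (cl a))) = cl a" using cl_mem[OF a Tc(2)[OF a]] .
    then show ?thesis
      using \<tau>_unique[of "q (T (cl a))" "\<one>\<^bsub>P\<^esub>"] Tc[OF a] H1 by simp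
  qed
  \<comment> \<open>Connectedness of the tree, by descent on levels: the representative of a coset
    is one edge away from some \<open>\<tau> c\<close> of lower level, and a move by
    \<open>H\<close> reaches the rest of the coset.\<close>
  have ind: "R (\<tau> a)"
    if R1: "R \<one>\<^bsub>P\<^esub>"
    and RH: "\<And>\<beta> h. \<beta> \<in> \<tau> ` carrier Q \<Longrightarrow> h \<in> H \<Longrightarrow> R \<beta> \<Longrightarrow> R (\<beta> \<otimes>\<^bsub>P\<^esub> h)"
    and RX: "\<And>\<beta> x. \<beta> \<in> \<tau> ` carrier Q \<Longrightarrow> x \<in> X \<Longrightarrow> R \<beta> \<Longrightarrow> \<beta> \<otimes>\<^bsub>P\<^esub> x \<in> \<tau> ` carrier Q \<Longrightarrow> R (\<beta> \<otimes>\<^bsub>P\<^esub> x)"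
    and RX': "\<And>\<beta> x. \<beta> \<in> \<tau> ` carrier Q \<Longrightarrow> x \<in> X \<Longrightarrow> R \<beta> \<Longrightarrow> \<beta> \<otimes>\<^bsub>P\<^esub> inv\<^bsub>P\<^esub> x \<in> \<tau> ` carrier Q \<Longrightarrow> R (\<beta> \<otimes>\<^bsub>P\<^esub> inv\<^bsub>P\<^esub> x)"
    and a: "a \<in> carrier Q" for R a
    using a
  proof (induction "lev (cl a)" arbitrary: a rule: less_induct)
    case less
    have "R (T (cl a))"
    proof (cases "cl a = cl \<one>\<^bsub>Q\<^esub>")
      case True then show ?thesis using T1 R1 by simp
    next
      case False
      from Tstep[OF less.prems False] obtain b x h where b: "b \<in> carrier Q" "lev (cl b) < lev (cl a)" "x \<in> X" "h \<in> H"
        "T (cl a) = T (cl b) \<otimes>\<^bsub>P\<^esub> h \<otimes>\<^bsub>P\<^esub> x \<or> T (cl a) = T (cl b) \<otimes>\<^bsub>P\<^esub> h \<otimes>\<^bsub>P\<^esub> inv\<^bsub>P\<^esub> x"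
        unfolding step_def by blast
      define c where "c = q (T (cl b)) \<otimes>\<^bsub>Q\<^esub> q h"
      have Tb: "q (T (cl b)) \<in> carrier Q" using Tc[OF b(1)] by simp
      have c: "c \<in> carrier Q" using Tb b Hc by (simp add: c_def)
      have clc: "cl c = cl b" using cl_eq[OF Tb b(4)] cl_mem[OF b(1) Tc(2)[OF b(1)]] by (simp add: c_def)
      have \<tau>c': "\<tau> c = T (cl b) \<otimes>\<^bsub>P\<^esub> h" using \<tau>H[OF Tb b(4)] T\<tau>[OF b(1)] by (simp add: c_def)
      have "R (\<tau> c)" using less.hyps[of c] b(2) c clc by simp
      moreover have "\<tau> c \<in> \<tau> ` carrier Q" "T (cl a) \<in> \<tau> ` carrier Q"
        using c T\<tau>[OF less.prems] Tc[OF less.prems] by auto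
      ultimately show ?thesis using RX[of "\<tau> c" x] RX'[of "\<tau> c" x] b(3,5) \<tau>c' by auto
    qed
    moreover have "T (cl a) \<in> \<tau> ` carrier Q" using T\<tau>[OF less.prems] Tc[OF less.prems] by auto
    ultimately show ?case using RH[of "T (cl a)" "\<eta> a"] \<eta>(1)[OF less.prems] by (simp add: \<tau>_def)
  qed
  have "tree_transversal P Q q H X \<tau>"
    unfolding tree_transversal_def
  proof (intro conjI ballI allI impI)
    fix R a assume "R \<one>\<^bsub>P\<^esub>" and 1: "\<forall>\<beta> \<in> \<tau> ` carrier Q. \<forall>h \<in> H. R \<beta> \<longrightarrow> R (\<beta> \<otimes>\<^bsub>P\<^esub> h)"
      and 2: "\<forall>\<beta> \<in> \<tau> ` carrier Q. \<forall>x \<in> X. R \<beta> \<longrightarrow> \<beta> \<otimes>\<^bsub>P\<^esub> x \<in> \<tau> ` carrier Q \<longrightarrow> R (\<beta> \<otimes>\<^bsub>P\<^esub> x)"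
      and 3: "\<forall>\<beta> \<in> \<tau> ` carrier Q. \<forall>x \<in> X. R \<beta> \<longrightarrow> \<beta> \<otimes>\<^bsub>P\<^esub> inv\<^bsub>P\<^esub> x \<in> \<tau> ` carrier Q \<longrightarrow> R (\<beta> \<otimes>\<^bsub>P\<^esub> inv\<^bsub>P\<^esub> x)"
      and a: "a \<in> carrier Q"
    show "R (\<tau> a)"
      by (rule ind[of R, OF \<open>R \<one>\<^bsub>P\<^esub>\<close> _ _ _ a]) (use 1 2 3 in blast)+
  qed (use \<tau>c \<tau>H \<tau>1 in auto)
  then show ?thesis by blast
qed

lemma tree_transversal_induct:
  assumes tr: "tree_transversal P Q q H X \<tau>" and "R \<one>\<^bsub>P\<^esub>"
    and "\<And>\<beta> h. \<lbrakk>\<beta> \<in> \<tau> ` carrier Q; h \<in> H; R \<beta>\<rbrakk> \<Longrightarrow> R (\<beta> \<otimes>\<^bsub>P\<^esub> h)"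
    and "\<And>\<beta> x. \<lbrakk>\<beta> \<in> \<tau> ` carrier Q; x \<in> X; R \<beta>; \<beta> \<otimes>\<^bsub>P\<^esub> x \<in> \<tau> ` carrier Q\<rbrakk> \<Longrightarrow> R (\<beta> \<otimes>\<^bsub>P\<^esub> x)"
    and "\<And>\<beta> x. \<lbrakk>\<beta> \<in> \<tau> ` carrier Q; x \<in> X; R \<beta>; \<beta> \<otimes>\<^bsub>P\<^esub> inv\<^bsub>P\<^esub> x \<in> \<tau> ` carrier Q\<rbrakk>
      \<Longrightarrow> R (\<beta> \<otimes>\<^bsub>P\<^esub> inv\<^bsub>P\<^esub> x)"
    and a: "a \<in> carrier Q"
  shows "R (\<tau> a)"
proof -
  note * = tr[unfolded tree_transversal_def, THEN conjunct2, THEN conjunct2, THEN conjunct2, THEN spec, of R]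
  show ?thesis
    by (rule *[THEN mp, THEN mp, THEN mp, THEN mp, THEN bspec, OF _ _ _ _ a])
      (intro ballI impI assms(2-5); assumption)+
qed

section \<open>Freeness of kernels that meet the conjugates of the second factor trivially\<close>

locale free_pair = H: group H
  for H :: "('b, 'n) monoid_scheme" +
  fixes S :: "'s set"
begin

sublocale group_pair "free_group S" H
  by (intro group_pair.intro group_free_group H.group_axioms)

sublocale P: group P by (rule group_P)

declare one_P [simp del]

definition gen :: "'s \<Rightarrow> (('s \<times> bool) list + 'b) list" where
  "gen i = inl (free_gen i)"

lemma gen_closed [simp]: "i \<in> S \<Longrightarrow> gen i \<in> carrier P"
  unfolding gen_def by (rule hom_in_carrier[OF inl_hom]) simp

lemma inr_closed [simp]: "h \<in> carrier H \<Longrightarrow> inr h \<in> carrier P"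
  by (rule hom_in_carrier[OF inr_hom])

lemma inr_mult: "h \<in> carrier H \<Longrightarrow> h' \<in> carrier H \<Longrightarrow> inr (h \<otimes>\<^bsub>H\<^esub> h') = inr h \<otimes>\<^bsub>P\<^esub> inr h'"
  by (rule hom_mult[OF inr_hom])

lemma inr_inv: "h \<in> carrier H \<Longrightarrow> inr (inv\<^bsub>H\<^esub> h) = inv\<^bsub>P\<^esub> inr h"
  using group_hom.hom_inv[of H P inr h] inr_hom H.group_axioms P.group_axioms
  by (simp add: group_hom_def group_hom_axioms_def)

lemma generate_gens: "generate P (gen ` S \<union> inr ` carrier H) = carrier P"
proof
  let ?X = "gen ` S \<union> inr ` carrier H"
  show "generate P ?X \<subseteq> carrier P" by (rule P.generate_incl) auto
  have sub: "subgroup (generate P ?X) P" by (rule P.generate_is_subgroup) auto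
  interpret inl: group_hom "free_group S" P inl
    using inl_hom P.group_axioms group_free_group by (simp add: group_hom_def group_hom_axioms_def)
  have "inl ` carrier (free_group S) = generate P (inl ` free_gen ` S)"
    unfolding generate_free_group[symmetric] by (rule inl.generate_img[symmetric]) auto
  also have "\<dots> \<subseteq> generate P ?X" by (rule P.mono_generate) (auto simp: gen_def)
  finally have "inl ` carrier (free_group S) \<union> inr ` carrier H \<subseteq> generate P ?X"
    by (auto intro: generate.incl)
  from P.generate_subgroup_incl[OF this sub] show "carrier P \<subseteq> generate P ?X" by (simp add: generate_P)
qed

text \<open>A right action is a homomorphism into the opposite group. The universal property is
  stated for left actions, so \<alpha> is made to act as the image of its inverse.\<close>

lemma right_action:
  assumes \<pi>: "\<And>i. i \<in> S \<Longrightarrow> bij_betw (\<pi> i) W W"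
    and act: "\<And>h w. \<lbrakk>h \<in> carrier H; w \<in> W\<rbrakk> \<Longrightarrow> act h w \<in> W" "\<And>w. w \<in> W \<Longrightarrow> act \<one>\<^bsub>H\<^esub> w = w"
      "\<And>h h' w. \<lbrakk>h \<in> carrier H; h' \<in> carrier H; w \<in> W\<rbrakk> \<Longrightarrow> act (h \<otimes>\<^bsub>H\<^esub> h') w = act h' (act h w)"
  shows "\<exists>R. (\<forall>\<alpha> \<in> carrier P. \<forall>w \<in> W. R \<alpha> w \<in> W)
    \<and> (\<forall>\<alpha> \<in> carrier P. \<forall>\<beta> \<in> carrier P. \<forall>w \<in> W. R (\<alpha> \<otimes>\<^bsub>P\<^esub> \<beta>) w = R \<beta> (R \<alpha> w))
    \<and> (\<forall>w \<in> W. R \<one>\<^bsub>P\<^esub> w = w)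
    \<and> (\<forall>i \<in> S. \<forall>w \<in> W. R (gen i) w = \<pi> i w)
    \<and> (\<forall>h \<in> carrier H. \<forall>w \<in> W. R (inr h) w = act h w)"
proof -
  let ?B = "BijGroup W"
  interpret B: group ?B by (rule group_BijGroup)
  define r where "r i = restrict (inv_into W (\<pi> i)) W" for i
  have r: "r i \<in> Bij W" if "i \<in> S" for i
    using bij_betw_inv_into[OF \<pi>[OF that]] by (simp add: r_def Bij_def)
  define l where "l h = restrict (act (inv\<^bsub>H\<^esub> h)) W" for h
  have l: "l \<in> hom H ?B"
    unfolding l_def[abs_def]
    by (rule hom_BijGroupI[OF H.group_axioms]) (simp_all add: act H.inv_mult_group)
  have fr: "free_hom ?B r \<in> hom (free_group S) ?B"
    by (rule free_hom_hom) (use r B.group_axioms in \<open>auto simp: carrier_BijGroup\<close>)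
  define \<Phi> where "\<Phi> = fp_hom ?B (free_hom ?B r) l"
  have \<Phi>: "\<Phi> \<in> hom P ?B" unfolding \<Phi>_def by (rule fp_hom_hom[OF B.group_axioms fr l])
  interpret \<Phi>: group_hom P ?B \<Phi> by unfold_locales (rule \<Phi>)
  have \<Phi>B: "\<Phi> \<alpha> \<in> Bij W" if "\<alpha> \<in> carrier P" for \<alpha>
    using \<Phi>.hom_closed[OF that] by (simp only: carrier_BijGroup)
  define R where "R \<alpha> = \<Phi> (inv\<^bsub>P\<^esub> \<alpha>)" for \<alpha>
  have R: "R \<alpha> \<in> Bij W" if "\<alpha> \<in> carrier P" for \<alpha>
    unfolding R_def by (rule \<Phi>B) (simp add: that)
  have "R \<alpha> w \<in> W" if "\<alpha> \<in> carrier P" "w \<in> W" for \<alpha> w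
    using Bij_imp_funcset[OF R[OF that(1)]] that(2) by auto
  moreover have "R (\<alpha> \<otimes>\<^bsub>P\<^esub> \<beta>) w = R \<beta> (R \<alpha> w)" if "\<alpha> \<in> carrier P" "\<beta> \<in> carrier P" "w \<in> W" for \<alpha> \<beta> w
  proof -
    have "R (\<alpha> \<otimes>\<^bsub>P\<^esub> \<beta>) = R \<beta> \<otimes>\<^bsub>?B\<^esub> R \<alpha>" using that by (simp add: R_def P.inv_mult_group del: \<Phi>.hom_inv)
    then show ?thesis using BijGroup_mult_apply[OF R[OF that(2)] R[OF that(1)] that(3)] by simp
  qed
  moreover have "R \<one>\<^bsub>P\<^esub> w = w" if "w \<in> W" for w
    unfolding R_def P.inv_one \<Phi>.hom_one using that by (simp add: BijGroup_def)
  moreover have "R (gen i) w = \<pi> i w" if i: "i \<in> S" and w: "w \<in> W" for i w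
  proof -
    have "\<Phi> (gen i) = r i"
      unfolding \<Phi>_def gen_def using fp_hom_inl[OF B.group_axioms fr l, of "free_gen i"] i
        free_hom_gen[OF B.group_axioms, of S r i] r by (simp add: carrier_BijGroup)
    then have Ri: "R (gen i) = restrict (inv_into W (r i)) W"
      using i inv_BijGroup[OF r[OF i]] by (simp add: R_def)
    have \<pi>w: "\<pi> i w \<in> W" using \<pi>[OF i] w by (auto dest: bij_betwE)
    have "r i (\<pi> i w) = w" using \<pi>[OF i] w \<pi>w by (simp add: r_def bij_betw_def)
    moreover have "inj_on (r i) W" using r[OF i] by (auto simp: Bij_def bij_betw_def)
    ultimately have "inv_into W (r i) w = \<pi> i w" using \<pi>w by (metis inv_into_f_f)
    then show ?thesis using Ri w by simp
  qed
  moreover have "R (inr h) w = act h w" if "h \<in> carrier H" "w \<in> W" for h w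
  proof -
    have "R (inr h) = \<Phi> (inr (inv\<^bsub>H\<^esub> h))" using that by (simp add: R_def inr_inv)
    also have "\<dots> = l (inv\<^bsub>H\<^esub> h)"
      unfolding \<Phi>_def using fp_hom_inr[OF B.group_axioms fr l] that by simp
    finally show ?thesis using that by (simp add: l_def)
  qed
  ultimately show ?thesis by (intro exI[of _ R]) blast
qed

text \<open>The kernel acts freely on the Bass-Serre tree; the edges in \<open>E\<close> are those
  outside the maximal tree, and their Schreier generators form a basis. To see freeness without a
  covering space, \<open>P\<close> acts on pairs of a word in the edges and a vertex in
  \<open>Q\<close>; the word records the edges of \<open>E\<close> that have been crossed.\<close>

theorem kernel_free:
  fixes Q :: "('q, 'z) monoid_scheme"
  assumes "group Q" "q \<in> hom P Q" "q ` carrier P = carrier Q" "inj_on q (inr ` carrier H)"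
    and tr: "tree_transversal P Q q (inr ` carrier H) (gen ` S) \<tau>"
  defines "E \<equiv> {(a, i). a \<in> carrier Q \<and> i \<in> S \<and> \<tau> a \<otimes>\<^bsub>P\<^esub> gen i \<noteq> \<tau> (a \<otimes>\<^bsub>Q\<^esub> q (gen i))}"
  shows "\<exists>\<psi>. \<psi> \<in> iso (free_group E) (P\<lparr>carrier := kernel P Q q\<rparr>)"
proof -
  interpret Q: group Q by fact
  interpret q: group_hom P Q q by unfold_locales fact
  have \<tau>c [simp]: "\<tau> a \<in> carrier P" "q (\<tau> a) = a" if "a \<in> carrier Q" for a
    using tr that by (auto simp: tree_transversal_def)
  have \<tau>H: "\<tau> (a \<otimes>\<^bsub>Q\<^esub> q (inr h)) = \<tau> a \<otimes>\<^bsub>P\<^esub> inr h" if "a \<in> carrier Q" "h \<in> carrier H" for a h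
    using tr that by (auto simp: tree_transversal_def)
  have \<tau>1: "\<tau> \<one>\<^bsub>Q\<^esub> = \<one>\<^bsub>P\<^esub>" using tr by (simp add: tree_transversal_def)
  define Fr where "Fr = free_group E"
  interpret Fr: group Fr unfolding Fr_def by (rule group_free_group)
  \<comment> \<open>Edges inside the maximal tree carry the trivial label.\<close>
  define e where "e a i = (if (a, i) \<in> E then free_gen (a, i) else \<one>\<^bsub>Fr\<^esub>)" for a i
  have e [simp]: "e a i \<in> carrier Fr" for a i
    using Fr.one_closed by (simp add: e_def Fr_def)
  define f where "f = (\<lambda>(a, i). \<tau> a \<otimes>\<^bsub>P\<^esub> gen i \<otimes>\<^bsub>P\<^esub> inv\<^bsub>P\<^esub> \<tau> (a \<otimes>\<^bsub>Q\<^esub> q (gen i)))"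
  have f: "f ai \<in> carrier P" if "ai \<in> E" for ai using that by (auto simp: f_def E_def)
  define \<psi> where "\<psi> = free_hom P f"
  have \<psi>hom: "\<psi> \<in> hom Fr P" unfolding \<psi>_def Fr_def by (rule free_hom_hom[OF P.group_axioms f])
  interpret \<psi>: group_hom Fr P \<psi> by unfold_locales (rule \<psi>hom)
  have \<psi>gen: "\<psi> (free_gen ai) = f ai" if "ai \<in> E" for ai
    unfolding \<psi>_def by (rule free_hom_gen[OF P.group_axioms f that])
  have \<psi>e: "\<psi> (e a i) = f (a, i)" if "a \<in> carrier Q" "i \<in> S" for a i
  proof (cases "(a, i) \<in> E")
    case False
    then have "\<tau> a \<otimes>\<^bsub>P\<^esub> gen i = \<tau> (a \<otimes>\<^bsub>Q\<^esub> q (gen i))" using that by (simp add: E_def)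
    then show ?thesis using False that by (simp add: e_def f_def)
  qed (simp add: e_def \<psi>gen)
  define W where "W = carrier Fr \<times> carrier Q"
  define \<pi> where "\<pi> i = (\<lambda>(u, a). (u \<otimes>\<^bsub>Fr\<^esub> e a i, a \<otimes>\<^bsub>Q\<^esub> q (gen i)))" for i
  define \<pi>' where "\<pi>' i = (\<lambda>(u, a). (u \<otimes>\<^bsub>Fr\<^esub> inv\<^bsub>Fr\<^esub> e (a \<otimes>\<^bsub>Q\<^esub> inv\<^bsub>Q\<^esub> q (gen i)) i, a \<otimes>\<^bsub>Q\<^esub> inv\<^bsub>Q\<^esub> q (gen i)))" for i
  define act where "act h = (\<lambda>(u :: (('q \<times> 's) \<times> bool) list, a). (u, a \<otimes>\<^bsub>Q\<^esub> q (inr h)))" for h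
  have "\<exists>R. (\<forall>\<alpha> \<in> carrier P. \<forall>w \<in> W. R \<alpha> w \<in> W)
    \<and> (\<forall>\<alpha> \<in> carrier P. \<forall>\<beta> \<in> carrier P. \<forall>w \<in> W. R (\<alpha> \<otimes>\<^bsub>P\<^esub> \<beta>) w = R \<beta> (R \<alpha> w))
    \<and> (\<forall>w \<in> W. R \<one>\<^bsub>P\<^esub> w = w)
    \<and> (\<forall>i \<in> S. \<forall>w \<in> W. R (gen i) w = \<pi> i w)
    \<and> (\<forall>h \<in> carrier H. \<forall>w \<in> W. R (inr h) w = act h w)"
  proof (rule right_action)
    fix i assume i: "i \<in> S"
    show "bij_betw (\<pi> i) W W"
      by (rule bij_betw_byWitness[where f' = "\<pi>' i"])
        (use i in \<open>auto simp: W_def \<pi>_def \<pi>'_def Fr.m_assoc Q.m_assoc\<close>)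
  next
    show "act \<one>\<^bsub>H\<^esub> w = w" if "w \<in> W" for w
      using that group_hom.hom_one[of H P inr] inr_hom H.group_axioms P.group_axioms
      by (auto simp: W_def act_def group_hom_def group_hom_axioms_def)
  qed (auto simp: W_def act_def inr_mult Q.m_assoc)
  then obtain R where R:
    "\<forall>\<alpha> \<in> carrier P. \<forall>w \<in> W. R \<alpha> w \<in> W"
    "\<forall>\<alpha> \<in> carrier P. \<forall>\<beta> \<in> carrier P. \<forall>w \<in> W. R (\<alpha> \<otimes>\<^bsub>P\<^esub> \<beta>) w = R \<beta> (R \<alpha> w)"
    "\<forall>w \<in> W. R \<one>\<^bsub>P\<^esub> w = w"
    "\<forall>i \<in> S. \<forall>w \<in> W. R (gen i) w = \<pi> i w"
    "\<forall>h \<in> carrier H. \<forall>w \<in> W. R (inr h) w = act h w"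
    by (elim exE conjE) (rule that)
  have RW: "\<And>\<alpha> w. \<lbrakk>\<alpha> \<in> carrier P; w \<in> W\<rbrakk> \<Longrightarrow> R \<alpha> w \<in> W"
    and Rm: "\<And>\<alpha> \<beta> w. \<lbrakk>\<alpha> \<in> carrier P; \<beta> \<in> carrier P; w \<in> W\<rbrakk> \<Longrightarrow> R (\<alpha> \<otimes>\<^bsub>P\<^esub> \<beta>) w = R \<beta> (R \<alpha> w)"
    and R1: "\<And>w. w \<in> W \<Longrightarrow> R \<one>\<^bsub>P\<^esub> w = w"
    and Rg: "\<And>i w. \<lbrakk>i \<in> S; w \<in> W\<rbrakk> \<Longrightarrow> R (gen i) w = \<pi> i w"
    and Rh: "\<And>h w. \<lbrakk>h \<in> carrier H; w \<in> W\<rbrakk> \<Longrightarrow> R (inr h) w = act h w"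
    using R by blast+
  have Rinv: "R (inv\<^bsub>P\<^esub> \<alpha>) w' = w" if "\<alpha> \<in> carrier P" "w \<in> W" "R \<alpha> w = w'" for \<alpha> w w'
    using Rm[of \<alpha> "inv\<^bsub>P\<^esub> \<alpha>" w] R1 that by simp
  have Rinv': "R \<alpha> (R (inv\<^bsub>P\<^esub> \<alpha>) w) = w" if "\<alpha> \<in> carrier P" "w \<in> W" for \<alpha> w
    using Rm[of "inv\<^bsub>P\<^esub> \<alpha>" \<alpha> w] R1 that by simp
  \<comment> \<open>The invariant of the action: under \<alpha>, the product of the evaluated label
    and the representative of the vertex is multiplied by \<alpha> on the right. At the base point
    this makes \<psi> surjective onto the kernel.\<close>
  have track: "snd (R \<alpha> w) = snd w \<otimes>\<^bsub>Q\<^esub> q \<alpha> \<and>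
      \<psi> (fst (R \<alpha> w)) \<otimes>\<^bsub>P\<^esub> \<tau> (snd w \<otimes>\<^bsub>Q\<^esub> q \<alpha>) = \<psi> (fst w) \<otimes>\<^bsub>P\<^esub> \<tau> (snd w) \<otimes>\<^bsub>P\<^esub> \<alpha>"
    if "\<alpha> \<in> carrier P" "w \<in> W" for \<alpha> w
  proof -
    define good where "good \<alpha> \<longleftrightarrow> (\<forall>w \<in> W. snd (R \<alpha> w) = snd w \<otimes>\<^bsub>Q\<^esub> q \<alpha> \<and>
      \<psi> (fst (R \<alpha> w)) \<otimes>\<^bsub>P\<^esub> \<tau> (snd w \<otimes>\<^bsub>Q\<^esub> q \<alpha>) = \<psi> (fst w) \<otimes>\<^bsub>P\<^esub> \<tau> (snd w) \<otimes>\<^bsub>P\<^esub> \<alpha>)" for \<alpha>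
    have W: "fst w \<in> carrier Fr" "snd w \<in> carrier Q" if "w \<in> W" for w using that by (auto simp: W_def)
    have g_gen: "good (gen i)" if i: "i \<in> S" for i
      unfolding good_def
    proof
      fix w assume w: "w \<in> W"
      have "R (gen i) w = (fst w \<otimes>\<^bsub>Fr\<^esub> e (snd w) i, snd w \<otimes>\<^bsub>Q\<^esub> q (gen i))"
        using Rg[OF i w] by (simp add: \<pi>_def split_beta)
      then show "snd (R (gen i) w) = snd w \<otimes>\<^bsub>Q\<^esub> q (gen i) \<and>
        \<psi> (fst (R (gen i) w)) \<otimes>\<^bsub>P\<^esub> \<tau> (snd w \<otimes>\<^bsub>Q\<^esub> q (gen i)) = \<psi> (fst w) \<otimes>\<^bsub>P\<^esub> \<tau> (snd w) \<otimes>\<^bsub>P\<^esub> gen i"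
        using W[OF w] i by (simp add: \<psi>e f_def P.m_assoc)
    qed
    have g_inr: "good (inr h)" if h: "h \<in> carrier H" for h
      unfolding good_def
    proof
      fix w assume w: "w \<in> W"
      have "R (inr h) w = (fst w, snd w \<otimes>\<^bsub>Q\<^esub> q (inr h))"
        using Rh[OF h w] by (simp add: act_def split_beta)
      then show "snd (R (inr h) w) = snd w \<otimes>\<^bsub>Q\<^esub> q (inr h) \<and>
        \<psi> (fst (R (inr h) w)) \<otimes>\<^bsub>P\<^esub> \<tau> (snd w \<otimes>\<^bsub>Q\<^esub> q (inr h)) = \<psi> (fst w) \<otimes>\<^bsub>P\<^esub> \<tau> (snd w) \<otimes>\<^bsub>P\<^esub> inr h"
        using W[OF w] h by (simp add: \<tau>H P.m_assoc)
    qed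
    have g_inv: "good (inv\<^bsub>P\<^esub> \<alpha>)" if \<alpha>: "\<alpha> \<in> carrier P" "good \<alpha>" for \<alpha>
      unfolding good_def
    proof
      fix w assume w: "w \<in> W"
      define w' where "w' = R (inv\<^bsub>P\<^esub> \<alpha>) w"
      have w': "w' \<in> W" "R \<alpha> w' = w" using RW w \<alpha> Rinv' by (auto simp: w'_def)
      have 1: "snd w = snd w' \<otimes>\<^bsub>Q\<^esub> q \<alpha>"
        "\<psi> (fst w) \<otimes>\<^bsub>P\<^esub> \<tau> (snd w' \<otimes>\<^bsub>Q\<^esub> q \<alpha>) = \<psi> (fst w') \<otimes>\<^bsub>P\<^esub> \<tau> (snd w') \<otimes>\<^bsub>P\<^esub> \<alpha>"
        using \<alpha>(2) w' unfolding good_def by auto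
      have 2: "snd w' = snd w \<otimes>\<^bsub>Q\<^esub> q (inv\<^bsub>P\<^esub> \<alpha>)" using 1(1) W[OF w'(1)] \<alpha> by (simp add: Q.m_assoc)
      have "\<psi> (fst w) \<otimes>\<^bsub>P\<^esub> \<tau> (snd w) \<otimes>\<^bsub>P\<^esub> inv\<^bsub>P\<^esub> \<alpha> = \<psi> (fst w') \<otimes>\<^bsub>P\<^esub> \<tau> (snd w') \<otimes>\<^bsub>P\<^esub> \<alpha> \<otimes>\<^bsub>P\<^esub> inv\<^bsub>P\<^esub> \<alpha>"
        using 1 by simp
      also have "\<dots> = \<psi> (fst w') \<otimes>\<^bsub>P\<^esub> \<tau> (snd w')" using W[OF w'(1)] \<alpha> by (simp add: P.m_assoc)
      finally show "snd (R (inv\<^bsub>P\<^esub> \<alpha>) w) = snd w \<otimes>\<^bsub>Q\<^esub> q (inv\<^bsub>P\<^esub> \<alpha>) \<and>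
        \<psi> (fst (R (inv\<^bsub>P\<^esub> \<alpha>) w)) \<otimes>\<^bsub>P\<^esub> \<tau> (snd w \<otimes>\<^bsub>Q\<^esub> q (inv\<^bsub>P\<^esub> \<alpha>)) = \<psi> (fst w) \<otimes>\<^bsub>P\<^esub> \<tau> (snd w) \<otimes>\<^bsub>P\<^esub> inv\<^bsub>P\<^esub> \<alpha>"
        using 2 unfolding w'_def by simp
    qed
    have "good \<alpha>" if "\<alpha> \<in> generate P (gen ` S \<union> inr ` carrier H)" for \<alpha>
      using that
    proof induction
      case one then show ?case using R1 W by (simp add: good_def)
    next
      case (incl h) then show ?case using g_gen g_inr by auto
    next
      case (inv h) then show ?case using g_gen g_inr g_inv by auto
    next
      case (eng \<alpha> \<beta>)
      then have c: "\<alpha> \<in> carrier P" "\<beta> \<in> carrier P" by (simp_all only: generate_gens)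
      show ?case
        unfolding good_def
      proof
        fix w assume w: "w \<in> W"
        define w' where "w' = R \<alpha> w"
        have w': "w' \<in> W" using RW w c by (simp add: w'_def)
        have 1: "snd w' = snd w \<otimes>\<^bsub>Q\<^esub> q \<alpha>"
          "\<psi> (fst w') \<otimes>\<^bsub>P\<^esub> \<tau> (snd w \<otimes>\<^bsub>Q\<^esub> q \<alpha>) = \<psi> (fst w) \<otimes>\<^bsub>P\<^esub> \<tau> (snd w) \<otimes>\<^bsub>P\<^esub> \<alpha>"
          using eng(3) w unfolding good_def w'_def by auto
        have 2: "snd (R \<beta> w') = snd w' \<otimes>\<^bsub>Q\<^esub> q \<beta>"
          "\<psi> (fst (R \<beta> w')) \<otimes>\<^bsub>P\<^esub> \<tau> (snd w' \<otimes>\<^bsub>Q\<^esub> q \<beta>) = \<psi> (fst w') \<otimes>\<^bsub>P\<^esub> \<tau> (snd w') \<otimes>\<^bsub>P\<^esub> \<beta>"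
          using eng(4) w' unfolding good_def by auto
        have 3: "R (\<alpha> \<otimes>\<^bsub>P\<^esub> \<beta>) w = R \<beta> w'" using Rm c w by (simp add: w'_def)
        have 4: "snd w \<otimes>\<^bsub>Q\<^esub> q (\<alpha> \<otimes>\<^bsub>P\<^esub> \<beta>) = snd w' \<otimes>\<^bsub>Q\<^esub> q \<beta>"
          using 1(1) c W[OF w] by (simp add: Q.m_assoc)
        have "\<psi> (fst w') \<otimes>\<^bsub>P\<^esub> \<tau> (snd w') \<otimes>\<^bsub>P\<^esub> \<beta> = \<psi> (fst w) \<otimes>\<^bsub>P\<^esub> \<tau> (snd w) \<otimes>\<^bsub>P\<^esub> (\<alpha> \<otimes>\<^bsub>P\<^esub> \<beta>)"
          using 1 c W[OF w] by (simp add: P.m_assoc)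
        then show "snd (R (\<alpha> \<otimes>\<^bsub>P\<^esub> \<beta>) w) = snd w \<otimes>\<^bsub>Q\<^esub> q (\<alpha> \<otimes>\<^bsub>P\<^esub> \<beta>) \<and>
          \<psi> (fst (R (\<alpha> \<otimes>\<^bsub>P\<^esub> \<beta>) w)) \<otimes>\<^bsub>P\<^esub> \<tau> (snd w \<otimes>\<^bsub>Q\<^esub> q (\<alpha> \<otimes>\<^bsub>P\<^esub> \<beta>)) = \<psi> (fst w) \<otimes>\<^bsub>P\<^esub> \<tau> (snd w) \<otimes>\<^bsub>P\<^esub> (\<alpha> \<otimes>\<^bsub>P\<^esub> \<beta>)"
          unfolding 3 4 using 2 by simp
      qed
    qed
    then show ?thesis using that unfolding good_def generate_gens by blast
  qed
  have W1: "(u, \<one>\<^bsub>Q\<^esub>) \<in> W" if "u \<in> carrier Fr" for u using that by (simp add: W_def)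
  \<comment> \<open>A walk inside the maximal tree does not change the label.\<close>
  have tree: "\<forall>u \<in> carrier Fr. R (\<tau> a) (u, \<one>\<^bsub>Q\<^esub>) = (u, q (\<tau> a))" if a: "a \<in> carrier Q" for a
  proof -
    define T where "T \<beta> \<longleftrightarrow> (\<forall>u \<in> carrier Fr. R \<beta> (u, \<one>\<^bsub>Q\<^esub>) = (u, q \<beta>))" for \<beta>
    have no_e: "e b i = \<one>\<^bsub>Fr\<^esub>" if "\<tau> b \<otimes>\<^bsub>P\<^esub> gen i = \<tau> (b \<otimes>\<^bsub>Q\<^esub> q (gen i))" for b i
      using that by (simp add: e_def E_def)
    have T1: "T \<one>\<^bsub>P\<^esub>" using R1 W1 by (simp add: T_def)
    have TH: "T (\<beta> \<otimes>\<^bsub>P\<^esub> h)" if "\<beta> \<in> \<tau> ` carrier Q" "h \<in> inr ` carrier H" "T \<beta>" for \<beta> h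
    proof -
      obtain k where "h = inr k" "k \<in> carrier H" using \<open>h \<in> inr ` carrier H\<close> by auto
      moreover have "\<beta> \<in> carrier P" using that by auto
      ultimately show ?thesis using \<open>T \<beta>\<close> W1 by (auto simp: T_def Rm Rh act_def W_def)
    qed
    have TX: "T (\<beta> \<otimes>\<^bsub>P\<^esub> x)"
      if \<beta>: "\<beta> \<in> \<tau> ` carrier Q" "x \<in> gen ` S" "T \<beta>" "\<beta> \<otimes>\<^bsub>P\<^esub> x \<in> \<tau> ` carrier Q" for \<beta> x
    proof -
      obtain b i c where b: "b \<in> carrier Q" "\<beta> = \<tau> b" "i \<in> S" "x = gen i" "c \<in> carrier Q" "\<beta> \<otimes>\<^bsub>P\<^esub> x = \<tau> c"
        using \<beta> by auto
      then have "c = b \<otimes>\<^bsub>Q\<^esub> q (gen i)" by (metis \<tau>c gen_closed q.hom_mult)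
      then have "e b i = \<one>\<^bsub>Fr\<^esub>" using b by (intro no_e) simp
      moreover have "R (\<tau> b) (u, \<one>\<^bsub>Q\<^esub>) = (u, b)" if "u \<in> carrier Fr" for u
        using \<open>T \<beta>\<close> b(1,2) that by (simp add: T_def)
      ultimately have "R (\<tau> b \<otimes>\<^bsub>P\<^esub> gen i) (u, \<one>\<^bsub>Q\<^esub>) = (u, q (\<tau> b \<otimes>\<^bsub>P\<^esub> gen i))" if "u \<in> carrier Fr" for u
        using W1 b(1,3) that by (simp add: Rm Rg \<pi>_def W_def)
      then show ?thesis using b(2,4) by (simp add: T_def)
    qed
    have TX': "T (\<beta> \<otimes>\<^bsub>P\<^esub> inv\<^bsub>P\<^esub> x)"
      if \<beta>: "\<beta> \<in> \<tau> ` carrier Q" "x \<in> gen ` S" "T \<beta>" "\<beta> \<otimes>\<^bsub>P\<^esub> inv\<^bsub>P\<^esub> x \<in> \<tau> ` carrier Q" for \<beta> x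
    proof -
      obtain b i c where b: "b \<in> carrier Q" "\<beta> = \<tau> b" "i \<in> S" "x = gen i" "c \<in> carrier Q" "\<beta> \<otimes>\<^bsub>P\<^esub> inv\<^bsub>P\<^esub> x = \<tau> c"
        using \<beta> by auto
      then have \<beta>c: "\<tau> c \<otimes>\<^bsub>P\<^esub> gen i = \<tau> b" by (metis P.inv_closed P.l_inv P.m_assoc P.r_one \<tau>c(1) gen_closed)
      then have bc: "b = c \<otimes>\<^bsub>Q\<^esub> q (gen i)" using b by (metis \<tau>c gen_closed q.hom_mult)
      then have "e c i = \<one>\<^bsub>Fr\<^esub>" using \<beta>c by (intro no_e) simp
      then have "R (gen i) (u, c) = (u, b)" if "u \<in> carrier Fr" for u
        using that b bc by (simp add: Rg \<pi>_def W_def)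
      then have "R (inv\<^bsub>P\<^esub> gen i) (u, b) = (u, c)" if "u \<in> carrier Fr" for u
        using that b by (intro Rinv) (auto simp: W_def)
      moreover have "R (\<tau> b) (u, \<one>\<^bsub>Q\<^esub>) = (u, b)" if "u \<in> carrier Fr" for u
        using \<open>T \<beta>\<close> b(1,2) that by (simp add: T_def)
      moreover have "q (\<tau> b \<otimes>\<^bsub>P\<^esub> inv\<^bsub>P\<^esub> gen i) = c" using \<tau>c(2)[OF b(5)] b(2,4,6) by metis
      ultimately have "R (\<tau> b \<otimes>\<^bsub>P\<^esub> inv\<^bsub>P\<^esub> gen i) (u, \<one>\<^bsub>Q\<^esub>) = (u, q (\<tau> b \<otimes>\<^bsub>P\<^esub> inv\<^bsub>P\<^esub> gen i))" if "u \<in> carrier Fr" for u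
        using W1 b(1,3) that by (simp add: Rm W_def)
      then show ?thesis using b(2,4) by (simp add: T_def)
    qed
    have "T (\<tau> a)" by (rule tree_transversal_induct[where R = T, OF tr T1 TH TX TX' a])
    then show ?thesis by (simp add: T_def)
  qed
  \<comment> \<open>A Schreier generator walks out in the tree, crosses one edge of \<open>E\<close>
    and walks back in the tree. Hence the action recovers a word from its image under \<psi>, which
    gives injectivity.\<close>
  have ret: "\<forall>u \<in> carrier Fr. R (\<psi> c) (u, \<one>\<^bsub>Q\<^esub>) = (u \<otimes>\<^bsub>Fr\<^esub> c, \<one>\<^bsub>Q\<^esub>)" if "c \<in> carrier Fr" for c
  proof -
    have gen_ret: "R (f (a, i)) (u, \<one>\<^bsub>Q\<^esub>) = (u \<otimes>\<^bsub>Fr\<^esub> free_gen (a, i), \<one>\<^bsub>Q\<^esub>)"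
      if E: "(a, i) \<in> E" and u: "u \<in> carrier Fr" for a i u
    proof -
      have a: "a \<in> carrier Q" "i \<in> S" using E by (auto simp: E_def)
      define u' where "u' = u \<otimes>\<^bsub>Fr\<^esub> free_gen (a, i)"
      have u': "u' \<in> carrier Fr" using u e[of a i] E by (simp add: u'_def e_def)
      have "R (\<tau> a) (u, \<one>\<^bsub>Q\<^esub>) = (u, a)" using tree[OF a(1)] u a by simp
      moreover have "R (gen i) (u, a) = (u', a \<otimes>\<^bsub>Q\<^esub> q (gen i))"
        using a u E by (simp add: Rg \<pi>_def W_def e_def u'_def)
      moreover have "R (inv\<^bsub>P\<^esub> \<tau> (a \<otimes>\<^bsub>Q\<^esub> q (gen i))) (u', a \<otimes>\<^bsub>Q\<^esub> q (gen i)) = (u', \<one>\<^bsub>Q\<^esub>)"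
        using a u' tree[of "a \<otimes>\<^bsub>Q\<^esub> q (gen i)"] by (intro Rinv) (auto simp: W_def)
      ultimately show ?thesis using a u by (simp add: f_def Rm W_def u'_def)
    qed
    have "c \<in> generate Fr (free_gen ` E)" using that by (simp add: Fr_def generate_free_group)
    then show ?thesis
    proof induction
      case one then show ?case using R1 W1 by simp
    next
      case (incl h) then show ?case using gen_ret \<psi>gen by auto
    next
      case (inv h)
      then obtain a i where h: "h = free_gen (a, i)" "(a, i) \<in> E" by auto
      have hc: "h \<in> carrier Fr" using h e[of a i] by (simp add: e_def)
      show ?case
      proof
        fix u assume u: "u \<in> carrier Fr"
        have "R (\<psi> h) (u \<otimes>\<^bsub>Fr\<^esub> inv\<^bsub>Fr\<^esub> h, \<one>\<^bsub>Q\<^esub>) = (u, \<one>\<^bsub>Q\<^esub>)"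
          using gen_ret[OF h(2), of "u \<otimes>\<^bsub>Fr\<^esub> inv\<^bsub>Fr\<^esub> h"] \<psi>gen[OF h(2)] h(1) u hc by (simp add: Fr.m_assoc)
        then show "R (\<psi> (inv\<^bsub>Fr\<^esub> h)) (u, \<one>\<^bsub>Q\<^esub>) = (u \<otimes>\<^bsub>Fr\<^esub> inv\<^bsub>Fr\<^esub> h, \<one>\<^bsub>Q\<^esub>)"
          using Rinv[of "\<psi> h" "(u \<otimes>\<^bsub>Fr\<^esub> inv\<^bsub>Fr\<^esub> h, \<one>\<^bsub>Q\<^esub>)" "(u, \<one>\<^bsub>Q\<^esub>)"] u hc W1 by simp
      qed
    next
      case (eng h1 h2)
      then have "h1 \<in> carrier Fr" "h2 \<in> carrier Fr" by (simp_all add: Fr_def generate_free_group)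
      then show ?case using eng W1 by (simp add: Rm Fr.m_assoc)
    qed
  qed
  have inj: "inj_on \<psi> (carrier Fr)"
  proof (rule inj_onI)
    fix c c' assume c: "c \<in> carrier Fr" "c' \<in> carrier Fr" "\<psi> c = \<psi> c'"
    then have "(\<one>\<^bsub>Fr\<^esub> \<otimes>\<^bsub>Fr\<^esub> c, \<one>\<^bsub>Q\<^esub>) = (\<one>\<^bsub>Fr\<^esub> \<otimes>\<^bsub>Fr\<^esub> c', \<one>\<^bsub>Q\<^esub>)"
      using ret[OF c(1)] ret[OF c(2)] by (metis Fr.one_closed)
    then show "c = c'" using c by simp
  qed
  have q\<psi>: "q (\<psi> c) = \<one>\<^bsub>Q\<^esub>" if c: "c \<in> carrier Fr" for c
    using track[of "\<psi> c" "(\<one>\<^bsub>Fr\<^esub>, \<one>\<^bsub>Q\<^esub>)"] ret[OF c] c W1 by simp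
  have "bij_betw \<psi> (carrier Fr) (kernel P Q q)"
    unfolding bij_betw_def
  proof (intro conjI inj equalityI subsetI)
    fix \<nu> assume "\<nu> \<in> \<psi> ` carrier Fr" then show "\<nu> \<in> kernel P Q q" using q\<psi> by (auto simp: kernel_def)
  next
    fix \<nu> assume \<nu>: "\<nu> \<in> kernel P Q q"
    then have n: "\<nu> \<in> carrier P" "q \<nu> = \<one>\<^bsub>Q\<^esub>" by (simp_all add: kernel_def)
    have "R \<nu> (\<one>\<^bsub>Fr\<^esub>, \<one>\<^bsub>Q\<^esub>) \<in> W" by (rule RW[OF n(1) W1]) simp
    then have u: "fst (R \<nu> (\<one>\<^bsub>Fr\<^esub>, \<one>\<^bsub>Q\<^esub>)) \<in> carrier Fr" by (auto simp: W_def)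
    then have "\<psi> (fst (R \<nu> (\<one>\<^bsub>Fr\<^esub>, \<one>\<^bsub>Q\<^esub>))) = \<nu>"
      using track[OF n(1) W1[OF Fr.one_closed]] n \<tau>1 by simp
    then show "\<nu> \<in> \<psi> ` carrier Fr" using u by (metis image_eqI)
  qed
  moreover have "\<psi> \<in> hom Fr (P\<lparr>carrier := kernel P Q q\<rparr>)"
    using \<psi>hom q\<psi> by (auto simp: hom_def kernel_def)
  ultimately have "\<psi> \<in> iso Fr (P\<lparr>carrier := kernel P Q q\<rparr>)" by (simp add: iso_def)
  then show ?thesis unfolding Fr_def by blast
qed

end

section \<open>Two-generated permutation groups\<close>

abbreviation "Perm \<equiv> BijGroup UNIV"

abbreviation pinv :: "('a \<Rightarrow> 'a) \<Rightarrow> 'a \<Rightarrow> 'a" where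
  "pinv \<equiv> inv_into UNIV"

lemma carrier_Perm [simp]: "f \<in> carrier Perm \<longleftrightarrow> bij f"
  by (simp add: BijGroup_def Bij_def)

lemma mult_Perm [simp]: "\<lbrakk>bij f; bij g\<rbrakk> \<Longrightarrow> f \<otimes>\<^bsub>Perm\<^esub> g = f \<circ> g"
  by (auto simp: BijGroup_def Bij_def compose_def)

lemma one_Perm: "\<one>\<^bsub>Perm\<^esub> = id"
  by (auto simp: BijGroup_def)

lemma inv_Perm [simp]: "bij f \<Longrightarrow> inv\<^bsub>Perm\<^esub> f = pinv f"
  using inv_BijGroup[of f UNIV] by (simp add: Bij_def restrict_def)

lemma group_Perm: "group Perm" by (rule group_BijGroup)

lemma generate_Perm:
  assumes "\<And>f. f \<in> X \<Longrightarrow> bij f"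
  shows "f \<in> generate Perm X \<Longrightarrow> bij f"
    and "\<lbrakk>f \<in> generate Perm X; g \<in> generate Perm X\<rbrakk> \<Longrightarrow> f \<circ> g \<in> generate Perm X"
    and "f \<in> generate Perm X \<Longrightarrow> pinv f \<in> generate Perm X"
    and "id \<in> generate Perm X"
    and "f \<in> generate Perm X \<Longrightarrow> f ^^ n \<in> generate Perm X"
proof -
  interpret group "BijGroup (UNIV :: 'a set)" by (rule group_Perm)
  have X: "X \<subseteq> carrier Perm" using assms by auto
  show b: "bij f" if "f \<in> generate Perm X" for f using generate_incl[OF X] that by auto
  show c: "f \<circ> g \<in> generate Perm X" if "f \<in> generate Perm X" "g \<in> generate Perm X" for f g
    using generate.eng[OF that] b[OF that(1)] b[OF that(2)] by simp
  show "pinv f \<in> generate Perm X" if "f \<in> generate Perm X" for f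
    using generate_m_inv_closed[OF X that] b[OF that] by simp
  show i: "id \<in> generate Perm X" using generate.one[of "BijGroup (UNIV :: 'a set)" X] by (simp add: one_Perm)
  show "f ^^ n \<in> generate Perm X" if "f \<in> generate Perm X" for f
  proof (induction n)
    case 0 show ?case unfolding funpow.simps(1) by (rule i)
  next
    case (Suc n) show ?case unfolding funpow.simps(2) by (rule c[OF that Suc])
  qed
qed

lemma inv_eqI: "f \<circ> g = id \<Longrightarrow> g \<circ> f = id \<Longrightarrow> pinv f = g"
  by (metis inv_unique_comp)

text \<open>Second components are thought of as sites. Site 0 is kept apart, as the only place where
  two supports will be allowed to meet; there the map acts by \<open>u\<close> on the fibre.\<close>

definition supported :: "('y \<times> nat \<Rightarrow> 'y \<times> nat) \<Rightarrow> nat set \<Rightarrow> ('y \<Rightarrow> 'y) \<Rightarrow> bool" where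
  "supported f U u \<longleftrightarrow> (\<forall>y p. p \<notin> U \<longrightarrow> f (y, p) = (y, p)) \<and>
     (\<forall>y p. p \<in> U - {0} \<longrightarrow> snd (f (y, p)) \<in> U - {0}) \<and> (\<forall>y. f (y, 0) = (u y, 0))"

lemma supported_comp:
  assumes "supported f U u" "supported g V v"
  shows "supported (f \<circ> g) (U \<union> V) (u \<circ> v)"
  unfolding supported_def
proof (intro conjI allI impI)
  fix y p assume p: "p \<in> U \<union> V - {0}"
  show "snd ((f \<circ> g) (y, p)) \<in> U \<union> V - {0}"
  proof (cases "p \<in> V")
    case True
    then have 1: "snd (g (y, p)) \<in> V - {0}" using assms(2) p by (auto simp: supported_def)
    obtain y' p' where g: "g (y, p) = (y', p')" by fastforce
    show ?thesis
      using 1 assms(1) unfolding supported_def g comp_def by (cases "p' \<in> U") (auto simp: g)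
  next
    case False
    then have "g (y, p) = (y, p)" "p \<in> U - {0}" using assms(2) p by (auto simp: supported_def)
    then show ?thesis using assms(1) by (auto simp: supported_def)
  qed
qed (use assms in \<open>auto simp: supported_def\<close>)

definition at_zero :: "('y \<Rightarrow> 'y) \<Rightarrow> 'y \<times> nat \<Rightarrow> 'y \<times> nat" where
  "at_zero z = (\<lambda>(y, p). if p = 0 then (z y, p) else (y, p))"

text \<open>Away from site 0 the supports are disjoint and the maps commute, so only the commutator
  over site 0 survives.\<close>

lemma supported_commutator:
  assumes "supported f U u" "supported g V v" "U \<inter> V \<subseteq> {0}"
    and "bij f" "bij g" "bij u" "bij v"
  shows "pinv f \<circ> pinv g \<circ> f \<circ> g = at_zero (pinv u \<circ> pinv v \<circ> u \<circ> v)"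
proof -
  have "f (g (y, p)) = g (f (at_zero (pinv u \<circ> pinv v \<circ> u \<circ> v) (y, p)))" for y p
  proof (cases "p = 0")
    case True
    have "u (pinv u z) = z" "v (pinv v z) = z" for z using assms by (simp_all add: bij_is_surj surj_f_inv_f)
    then show ?thesis using assms(1,2) True by (simp add: supported_def at_zero_def)
  next
    case p: False
    show ?thesis
    proof (cases "p \<in> V")
      case True
      then have "snd (g (y, p)) \<in> V - {0}" "p \<notin> U" using assms p by (auto simp: supported_def)
      moreover obtain y' p' where g: "g (y, p) = (y', p')" by fastforce
      ultimately have "p' \<notin> U" using assms(3) by auto
      then show ?thesis using assms(1) \<open>p \<notin> U\<close> p g by (simp add: supported_def at_zero_def)
    next
      case nV: False
      then have g: "g (y, p) = (y, p)" using assms(2) by (simp add: supported_def)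
      show ?thesis
      proof (cases "p \<in> U")
        case True
        then have "snd (f (y, p)) \<in> U - {0}" using assms p by (auto simp: supported_def)
        moreover obtain y' p' where f: "f (y, p) = (y', p')" by fastforce
        ultimately have "p' \<notin> V" using assms(3) by auto
        then show ?thesis using assms(2) f g p by (simp add: supported_def at_zero_def)
      next
        case False
        then show ?thesis using assms(1) g p by (simp add: supported_def at_zero_def)
      qed
    qed
  qed
  then have "f \<circ> g = g \<circ> f \<circ> at_zero (pinv u \<circ> pinv v \<circ> u \<circ> v)" by auto
  then have "pinv f \<circ> (pinv g \<circ> (f \<circ> g)) = pinv f \<circ> (pinv g \<circ> (g \<circ> f \<circ> at_zero (pinv u \<circ> pinv v \<circ> u \<circ> v)))" by simp
  then show ?thesis using assms(4,5) by (simp add: bij_is_inj o_assoc[symmetric] fun_eq_iff)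
qed

text \<open>The values of \<open>mark\<close> form a Golomb ruler: all nonzero differences are distinct.\<close>

definition mark :: "nat \<Rightarrow> nat" where
  "mark e = 10 ^ Suc e"

lemma mark_less: "e < e' \<Longrightarrow> 10 * mark e \<le> mark e'"
  unfolding mark_def by (metis Suc_le_eq power_Suc power_increasing_iff Suc_less_eq one_less_numeral_iff semiring_norm(76))

lemma mark_ge: "10 \<le> mark e"
  unfolding mark_def by simp

lemma mark_less_iff: "mark e < mark e' \<longleftrightarrow> e < e'"
  unfolding mark_def by simp

lemma mark_le_iff: "mark e \<le> mark e' \<longleftrightarrow> e \<le> e'"
  unfolding mark_def by simp

text \<open>The ruler must tolerate the extra points 0, 1 and 2, which are the sites moved by
  \<open>three\<close>. The ratio 10 between consecutive marks leaves room for them and for sums of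
  two terms.\<close>

lemma mark_diff:
  assumes "x \<in> {0, 1, 2} \<union> range mark" "y \<in> {0, 1, 2} \<union> range mark" "e \<noteq> l" "x + mark l = y + mark e"
  shows "x = mark e"
proof -
  have main: "x = mark e \<and> y = mark l"
    if x: "x \<in> {0, 1, 2} \<union> range mark" and y: "y \<in> {0, 1, 2} \<union> range mark"
      and lt: "e < l" and eq: "x + mark l = y + mark e" for x y e l
  proof -
    have el: "10 * mark e \<le> mark l" using mark_less[OF lt] .
    have "y \<notin> {0, 1, 2}" using eq el mark_ge[of l] mark_ge[of e] by auto
    then obtain j where j: "y = mark j" using y by auto
    show ?thesis
    proof (cases j l rule: linorder_cases)
      case less
      then show ?thesis using mark_less[OF less] eq el mark_ge[of l] j by linarith
    next
      case equal
      then show ?thesis using eq j by simp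
    next
      case greater
      have jl: "10 * mark l \<le> mark j" using mark_less[OF greater] .
      then have "x \<notin> {0, 1, 2}" using eq j mark_ge[of l] by auto
      then obtain k where k: "x = mark k" using x by auto
      have "x < mark j" using eq j el mark_ge[of e] by linarith
      then have "10 * x \<le> mark j" using k mark_less mark_less_iff by metis
      then show ?thesis using eq j jl el mark_ge[of e] by linarith
    qed
  qed
  show ?thesis
  proof (cases "e < l")
    case True then show ?thesis using main[OF assms(1,2) True assms(4)] by simp
  next
    case False
    then show ?thesis using main[OF assms(2,1), of l e] assms(3,4) by simp
  qed
qed

section \<open>A cycle and a twisted cycle whose group contains prescribed commutators\<close>

context
  fixes w :: "nat \<Rightarrow> 'y \<Rightarrow> 'y" and r N :: nat
begin

definition inside :: "nat \<Rightarrow> nat \<Rightarrow> bool" where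
  "inside p k \<longleftrightarrow> k < r \<and> mark (2 * k) \<le> p \<and> p < mark (Suc (2 * k))"

text \<open>A change of coordinate in the fibre over each site, equal to \<open>w k\<close> between
  two consecutive marks and trivial elsewhere. Only its jumps, at the two ends of each interval,
  will be visible. The intervals are disjoint, so the choice is unambiguous.\<close>

definition gauge :: "nat \<Rightarrow> 'y \<Rightarrow> 'y" where
  "gauge p = (if \<exists>k. inside p k then w (SOME k. inside p k) else id)"

definition nxt :: "nat \<Rightarrow> nat" where
  "nxt p = (if p < N then (if Suc p = N then 0 else Suc p) else p)"

definition prv :: "nat \<Rightarrow> nat" where
  "prv p = (if p < N then (if p = 0 then N - 1 else p - 1) else p)"

definition cyc :: "nat \<Rightarrow> nat" where
  "cyc p = (if 2 \<le> p \<and> p < N then (if Suc p = N then 2 else Suc p) else p)"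

definition rot :: "'y \<times> nat \<Rightarrow> 'y \<times> nat" where
  "rot = (\<lambda>(y, p). (y, nxt p))"

text \<open>The cycle \<open>cyc\<close> of length \<open>N - 2\<close>, conjugated by the gauge. It
  keeps the order of \<open>cyc\<close>, and yet its quotient by \<open>rot\<close> exhibits all the
  involutions.\<close>

definition twist :: "'y \<times> nat \<Rightarrow> 'y \<times> nat" where
  "twist = (\<lambda>(y, p). (gauge (cyc p) (gauge p y), cyc p))"

definition three :: "nat \<Rightarrow> nat" where
  "three p = (if p = 0 then 2 else if p = 1 then 0 else if p = 2 then 1 else p)"

text \<open>The quotient of the two generators: a 3-cycle on the sites where \<open>nxt\<close> and
  \<open>cyc\<close> disagree, together with the jumps of the gauge, which are involutions at the
  marks. This is why its order divides 6.\<close>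

definition diff :: "'y \<times> nat \<Rightarrow> 'y \<times> nat" where
  "diff = (\<lambda>(y, p). if p < 3 then (y, three p) else if p < N then (gauge p (gauge (p - 1) y), p) else (y, p))"

definition marks :: "nat set" where
  "marks = {0, 1, 2} \<union> mark ` {..<2 * r}"

definition shifted :: "nat \<Rightarrow> nat set" where
  "shifted m = {p. p < N \<and> (p + m) mod N \<in> marks}"

definition shift_conj :: "nat \<Rightarrow> 'y \<times> nat \<Rightarrow> 'y \<times> nat" where
  "shift_conj m = pinv (rot ^^ m) \<circ> diff \<circ> (rot ^^ m)"

definition on_sites :: "('y \<Rightarrow> 'y) \<Rightarrow> 'y \<times> nat \<Rightarrow> 'y \<times> nat" where
  "on_sites z = (\<lambda>(y, p). if p < N then (z y, p) else (y, p))"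

context
  assumes w: "\<And>k. k < r \<Longrightarrow> w k \<circ> w k = id"
    and N: "2 * mark (2 * r) + 5 < N"
begin

lemma gauge_invol: "gauge p (gauge p y) = y"
proof (cases "\<exists>k. inside p k")
  case True
  then have "(SOME k. inside p k) < r" using someI_ex[OF True] by (simp add: inside_def)
  then show ?thesis using True w by (simp add: gauge_def pointfree_idE)
qed (simp add: gauge_def)

lemma gauge_id: "(\<And>k. \<not> inside p k) \<Longrightarrow> gauge p = id"
  by (simp add: gauge_def)

lemma gauge_start:
  assumes "k < r"
  shows "gauge (mark (2 * k)) = w k" "gauge (mark (2 * k) - 1) = id"
proof -
  have "inside (mark (2 * k)) = (\<lambda>j. j = k)"
    using assms unfolding inside_def mark_less_iff mark_le_iff by auto
  then show "gauge (mark (2 * k)) = w k" by (simp add: gauge_def)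
  show "gauge (mark (2 * k) - 1) = id"
  proof (rule gauge_id)
    fix j
    have "\<not> (mark (2 * j) < mark (2 * k) \<and> mark (2 * k) \<le> mark (Suc (2 * j)))"
      unfolding mark_less_iff mark_le_iff by auto
    then show "\<not> inside (mark (2 * k) - 1) j"
      unfolding inside_def using mark_ge[of "2 * k"] by linarith
  qed
qed

lemma gauge_end: "gauge (mark (Suc (2 * k))) = id"
  by (rule gauge_id) (auto simp: inside_def mark_less_iff mark_le_iff)

lemma gauge_const: "(\<And>e. e < 2 * r \<Longrightarrow> p \<noteq> mark e) \<Longrightarrow> gauge p = gauge (p - 1)"
proof -
  assume p: "\<And>e. e < 2 * r \<Longrightarrow> p \<noteq> mark e"
  have "inside p k \<longleftrightarrow> inside (p - 1) k" for k
  proof (cases "k < r")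
    case True
    then have "p \<noteq> mark (2 * k)" "p \<noteq> mark (Suc (2 * k))" using p[of "2 * k"] p[of "Suc (2 * k)"] by auto
    then show ?thesis unfolding inside_def using mark_ge[of "2 * k"] mark_ge[of "Suc (2 * k)"] by linarith
  qed (simp add: inside_def)
  then have "inside p = inside (p - 1)" by (rule ext)
  then show ?thesis by (simp add: gauge_def)
qed

lemma gauge_bounds: "p < 3 \<or> N \<le> Suc p \<Longrightarrow> gauge p = id"
proof (rule gauge_id)
  fix k assume p: "p < 3 \<or> N \<le> Suc p"
  show "\<not> inside p k"
  proof
    assume "inside p k"
    then have "mark (Suc (2 * k)) \<le> mark (2 * r)" "mark (2 * k) \<le> p" "p < mark (Suc (2 * k))"
      by (auto simp: inside_def mark_le_iff)
    then show False using p N mark_ge[of "2 * k"] by linarith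
  qed
qed

lemma nxt_prv: "nxt (prv p) = p" "prv (nxt p) = p"
  using N by (auto simp: nxt_def prv_def)

lemma bij_rot: "bij rot" and inv_rot: "pinv rot = (\<lambda>(y, p). (y, prv p))"
proof -
  have 1: "rot \<circ> (\<lambda>(y, p). (y, prv p)) = id" "(\<lambda>(y, p). (y, prv p)) \<circ> rot = id"
    by (auto simp: rot_def nxt_prv)
  show "bij rot" by (rule o_bij[OF 1(2,1)])
  show "pinv rot = (\<lambda>(y, p). (y, prv p))" by (rule inv_eqI[OF 1])
qed

lemma nxt_funpow: "p < N \<Longrightarrow> (nxt ^^ m) p = (p + m) mod N"
proof (induction m)
  case (Suc m)
  have "(p + m) mod N < N" using N by simp
  then show ?case using Suc mod_Suc[of "p + m" N] by (auto simp: nxt_def)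
qed simp

lemma nxt_funpow_out: "N \<le> p \<Longrightarrow> (nxt ^^ m) p = p"
  by (induction m) (auto simp: nxt_def)

lemma rot_funpow: "(rot ^^ m) (y, p) = (y, (nxt ^^ m) p)"
  by (induction m) (auto simp: rot_def)

lemma rot_order: "rot ^^ N = id"
proof
  fix z :: "'y \<times> nat"
  obtain y p where z: "z = (y, p)" by fastforce
  show "(rot ^^ N) z = id z"
    by (cases "p < N") (simp_all add: z rot_funpow nxt_funpow nxt_funpow_out)
qed

lemma cyc_funpow: "m + 2 \<le> N \<Longrightarrow> 2 \<le> p \<Longrightarrow> p < N \<Longrightarrow> (cyc ^^ m) p = (if p + m < N then p + m else p + m - (N - 2))"
proof (induction m)
  case (Suc m)
  then show ?case by (auto simp: cyc_def)
qed simp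

lemma twist_funpow: "(twist ^^ m) (y, p) = (gauge ((cyc ^^ m) p) (gauge p y), (cyc ^^ m) p)"
  by (induction m) (auto simp: twist_def gauge_invol)

lemma twist_order: "twist ^^ (N - 2) = id"
proof
  fix z :: "'y \<times> nat"
  obtain y p where z: "z = (y, p)" by fastforce
  have "(cyc ^^ (N - 2)) p = p"
  proof (cases "2 \<le> p \<and> p < N")
    case True then show ?thesis using cyc_funpow[of "N - 2" p] N by auto
  next
    case False
    then have "cyc p = p" by (auto simp: cyc_def)
    then have "(cyc ^^ m) p = p" for m by (induction m) auto
    then show ?thesis .
  qed
  then show "(twist ^^ (N - 2)) z = id z" by (simp add: z twist_funpow gauge_invol)
qed

lemma bij_twist: "bij twist"
proof (rule o_bij[of "twist ^^ (N - 3)"])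
  have "N - 2 = Suc (N - 3)" using N by simp
  then have "twist \<circ> twist ^^ (N - 3) = id" "twist ^^ (N - 3) \<circ> twist = id"
    using twist_order by (metis funpow.simps(2), metis funpow_Suc_right)
  then show "twist ^^ (N - 3) \<circ> twist = id" "twist \<circ> twist ^^ (N - 3) = id" by auto
qed

lemma twist_rot: "twist \<circ> pinv rot = diff"
proof
  fix z :: "'y \<times> nat"
  obtain y p where z: "z = (y, p)" by fastforce
  consider "p = 0" | "p = 1" | "p = 2" | "3 \<le> p" "p < N" | "N \<le> p" by linarith
  then show "(twist \<circ> pinv rot) z = diff z"
  proof cases
    case 4
    then have "prv p = p - 1" "cyc (p - 1) = p" by (auto simp: prv_def cyc_def)
    then show ?thesis using 4 by (simp add: z inv_rot twist_def diff_def)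
  next
    case 5
    then show ?thesis using gauge_bounds[of p] N by (simp add: z inv_rot twist_def diff_def prv_def cyc_def)
  next
    case 1
    then show ?thesis using gauge_bounds[of "N - 1"] gauge_bounds[of 2] N
      by (simp add: z inv_rot twist_def diff_def prv_def cyc_def three_def)
  next
    case 2
    then show ?thesis using gauge_bounds[of 0] N
      by (simp add: z inv_rot twist_def diff_def prv_def cyc_def three_def)
  next
    case 3
    then show ?thesis using gauge_bounds[of 1] N
      by (simp add: z inv_rot twist_def diff_def prv_def cyc_def three_def)
  qed
qed

lemma mark_lt_N: "e \<le> 2 * r \<Longrightarrow> mark e < N"
  using N mark_le_iff[of e "2 * r"] by linarith

text \<open>Away from the marks the two gauge values agree and cancel; at a mark one of them is
  trivial. So two different involutions are never composed.\<close>

lemma gauge_pair_invol: "gauge p (gauge (p - 1) (gauge p (gauge (p - 1) y))) = y"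
proof (cases "\<exists>e < 2 * r. p = mark e")
  case False
  then show ?thesis using gauge_const[of p] gauge_invol by auto
next
  case True
  then obtain e where e: "e < 2 * r" "p = mark e" by auto
  then have "gauge p = id \<or> gauge (p - 1) = id"
  proof (cases "even e")
    case True
    then obtain k where "e = 2 * k" by auto
    then show ?thesis using e gauge_start(2)[of k] by simp
  next
    case False
    then obtain k where "e = Suc (2 * k)" by (auto elim: oddE)
    then show ?thesis using e gauge_end[of k] by simp
  qed
  then show ?thesis using gauge_invol by auto
qed

lemma diff_order: "(twist \<circ> pinv rot) ^^ 6 = id"
proof
  fix z :: "'y \<times> nat"
  obtain y p where z: "z = (y, p)" by fastforce
  have "(diff ^^ 6) (y, p) = (y, p)"
    by (simp add: eval_nat_numeral diff_def three_def gauge_pair_invol gauge_pair_invol[simplified])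
  then show "((twist \<circ> pinv rot) ^^ 6) z = id z" by (simp add: z twist_rot)
qed

text \<open>Marks lie in the first half of the cycle, so a congruence modulo \<open>N\<close>
  between sums of two marks is an equality.\<close>

lemma marks_less: "x \<in> marks \<Longrightarrow> 2 * x < N"
proof -
  assume "x \<in> marks"
  then consider "x \<le> 2" | e where "x = mark e" "e < 2 * r" by (auto simp: marks_def)
  then show ?thesis
  proof cases
    case 2
    then have "mark e \<le> mark (2 * r)" by (simp add: mark_le_iff)
    then show ?thesis using 2 N by linarith
  qed (use N in linarith)
qed

text \<open>A common site \<open>p\<close> produces two pairs of marks with the same difference; the
  ruler property then leaves \<open>p = 0\<close> only.\<close>

lemma shifted_Int:
  assumes "e < 2 * r" "l < 2 * r" "e \<noteq> l"
  shows "shifted (mark e) \<inter> shifted (mark l) \<subseteq> {0}"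
proof
  fix p assume p: "p \<in> shifted (mark e) \<inter> shifted (mark l)"
  define x y where "x = (p + mark e) mod N" and "y = (p + mark l) mod N"
  have xy: "x \<in> marks" "y \<in> marks" "p < N" using p by (auto simp: shifted_def x_def y_def)
  have me: "mark e \<in> marks" "mark l \<in> marks" using assms by (auto simp: marks_def)
  have "(x + mark l) mod N = (y + mark e) mod N"
    unfolding x_def y_def mod_add_left_eq by (simp add: ac_simps)
  moreover have "x + mark l < N" "y + mark e < N" 
    using marks_less[OF xy(1)] marks_less[OF xy(2)] marks_less[OF me(1)] marks_less[OF me(2)] by linarith+
  ultimately have "x + mark l = y + mark e" by simp
  then have "x = mark e" using xy assms by (intro mark_diff[of x y e l]) (auto simp: marks_def)
  then have "p = 0"
    using xy(3) mark_lt_N[of e] assms(1) unfolding x_def by (cases "p + mark e < N") (auto simp: le_mod_geq)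
  then show "p \<in> {0}" by simp
qed

lemma bij_rot_pow: "bij (rot ^^ m)"
  by (induction m) (simp_all only: funpow.simps bij_id bij_comp bij_rot)

lemma bij_diff: "bij diff"
  unfolding twist_rot[symmetric] by (intro bij_comp bij_twist bij_imp_bij_inv bij_rot)

lemma bij_shift_conj: "bij (shift_conj m)"
  unfolding shift_conj_def by (intro bij_comp bij_imp_bij_inv bij_rot_pow bij_diff)

text \<open>Conjugation by a power of \<open>rot\<close> brings the mark where the interval of
  \<open>w k\<close> begins to site 0. The 3-cycle permutes the translates of 0, 1 and 2 among
  themselves and never reaches site 0, because marks are at least 10.\<close>

lemma supported_shift_conj:
  assumes k: "k < r"
  shows "supported (shift_conj (mark (2 * k))) (shifted (mark (2 * k))) (w k)"
proof -
  define m where "m = mark (2 * k)"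
  have m: "m < N" "3 \<le> m" using mark_lt_N[of "2 * k"] k mark_ge[of "2 * k"] by (auto simp: m_def)
  have sc: "shift_conj m (y, p) = z" if "diff ((rot ^^ m) (y, p)) = (rot ^^ m) z" for y p z
    using that bij_is_inj[OF bij_rot_pow[of m]] by (simp add: shift_conj_def inv_f_f)
  have pm: "(p + m) mod N < N" for p using N by simp
  show ?thesis
    unfolding supported_def m_def[symmetric]
  proof (intro conjI allI impI)
    fix y
    have "(rot ^^ m) (y', 0) = (y', m)" for y' :: 'y using m N by (simp add: rot_funpow nxt_funpow)
    then show "shift_conj m (y, 0) = (w k y, 0)"
      using m gauge_start[OF k] by (intro sc) (simp add: diff_def m_def)
  next
    fix y p assume p: "p \<notin> shifted m"
    show "shift_conj m (y, p) = (y, p)"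
    proof (rule sc)
      show "diff ((rot ^^ m) (y, p)) = (rot ^^ m) (y, p)"
      proof (cases "p < N")
        case False
        then show ?thesis using N by (simp add: rot_funpow nxt_funpow_out diff_def)
      next
        case True
        define x where "x = (p + m) mod N"
        have "x \<notin> marks" using p True by (simp add: shifted_def x_def)
        then have "\<not> x < 3" "\<And>e. e < 2 * r \<Longrightarrow> x \<noteq> mark e" by (auto simp: marks_def)
        then show ?thesis using True gauge_const[of x] gauge_invol
          by (simp add: rot_funpow nxt_funpow diff_def flip: x_def)
      qed
    qed
  next
    fix y p assume p: "p \<in> shifted m - {0}"
    define x where "x = (p + m) mod N"
    have x: "p < N" "x \<in> marks" "x < N" using p pm by (auto simp: shifted_def x_def)
    show "snd (shift_conj m (y, p)) \<in> shifted m - {0}"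
    proof (cases "x < 3")
      case False
      then have "shift_conj m (y, p) = (gauge x (gauge (x - 1) y), p)"
        using x by (intro sc) (simp add: rot_funpow nxt_funpow diff_def flip: x_def)
      then show ?thesis using p by simp
    next
      case True
      define p' where "p' = (three x + (N - m)) mod N"
      have t: "three x < 3" using True by (auto simp: three_def)
      have p': "p' < N" "(p' + m) mod N = three x"
      proof -
        have "(p' + m) mod N = (three x + (N - m) + m) mod N" unfolding p'_def by (simp add: mod_add_left_eq)
        also have "\<dots> = three x" using m t N by simp
        finally show "(p' + m) mod N = three x" .
      qed (use N in \<open>simp add: p'_def\<close>)
      have "shift_conj m (y, p) = (y, p')"
        using x True p' by (intro sc) (simp add: rot_funpow nxt_funpow diff_def flip: x_def)
      moreover have "p' \<noteq> 0"
      proof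
        assume "p' = 0"
        then have "m = three x" using p'(2) m by simp
        then show False using m t by simp
      qed
      moreover have "three x \<in> marks" using t by (auto simp: marks_def)
      ultimately show ?thesis using p' by (simp add: shifted_def)
    qed
  qed
qed

text \<open>Disjoint index pairs give supports that meet at site 0 only. The commutator of the two
  products therefore lives over site 0, and its conjugates by rotations copy it to all
  \<open>N\<close> sites.\<close>

lemma commutator_in_generate:
  assumes k: "i1 < r" "i2 < r" "j1 < r" "j2 < r" "{i1, i2} \<inter> {j1, j2} = {}"
  defines "u \<equiv> w i1 \<circ> w i2" and "v \<equiv> w j1 \<circ> w j2"
  shows "on_sites (pinv u \<circ> pinv v \<circ> u \<circ> v) \<in> generate Perm {rot, twist}"
proof -
  let ?G = "generate Perm {rot, twist}"
  note G = generate_Perm[of "{rot, twist}"]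
  have X: "\<And>f. f \<in> {rot, twist} \<Longrightarrow> bij f" using bij_rot bij_twist by auto
  have rG: "rot \<in> ?G" "twist \<in> ?G" by (auto intro: generate.incl)
  have bw: "bij (w k)" if "k < r" for k using w[OF that] by (rule o_bij[rotated]) (rule w[OF that])
  have buv: "bij u" "bij v" using bw k by (auto simp: u_def v_def intro: bij_comp)
  have dG: "diff \<in> ?G" unfolding twist_rot[symmetric] by (intro G(2,3) X rG)
  have sG: "shift_conj m \<in> ?G" for m unfolding shift_conj_def by (intro G(2,3,5) X rG dG)
  define f where "f = shift_conj (mark (2 * i1)) \<circ> shift_conj (mark (2 * i2))"
  define g where "g = shift_conj (mark (2 * j1)) \<circ> shift_conj (mark (2 * j2))"
  define U where "U = shifted (mark (2 * i1)) \<union> shifted (mark (2 * i2))"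
  define V where "V = shifted (mark (2 * j1)) \<union> shifted (mark (2 * j2))"
  have "supported f U u" "supported g V v"
    unfolding f_def g_def U_def V_def u_def v_def by (intro supported_comp supported_shift_conj k)+
  moreover have "U \<inter> V \<subseteq> {0}"
    using shifted_Int[of "2 * i1" "2 * j1"] shifted_Int[of "2 * i1" "2 * j2"]
      shifted_Int[of "2 * i2" "2 * j1"] shifted_Int[of "2 * i2" "2 * j2"] k
    unfolding U_def V_def by auto
  moreover have "bij f" "bij g" unfolding f_def g_def by (intro bij_comp bij_shift_conj)+
  ultimately have eq: "pinv f \<circ> pinv g \<circ> f \<circ> g = at_zero (pinv u \<circ> pinv v \<circ> u \<circ> v)"
    using buv by (intro supported_commutator)
  define z where "z = pinv u \<circ> pinv v \<circ> u \<circ> v"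
  have "f \<in> ?G" "g \<in> ?G" unfolding f_def g_def by (intro G(2) X sG; assumption)+
  then have zG: "at_zero z \<in> ?G" unfolding z_def eq[symmetric] by (intro G(2,3) X) auto
  \<comment> \<open>The partial copy on the sites below \<open>m\<close>; one further conjugate of
    \<open>at_zero z\<close> is added at a time.\<close>
  define h where "h m = (\<lambda>(y, p). if p < m then (z y, p) else (y, p))" for m :: nat
  have "h m \<in> ?G" if "m \<le> N" for m
    using that
  proof (induction m)
    case 0
    have "h 0 = id" by (auto simp: h_def)
    then show ?case using G(4) X by metis
  next
    case (Suc m)
    have "h (Suc m) = rot ^^ m \<circ> at_zero z \<circ> pinv (rot ^^ m) \<circ> h m"
    proof
      fix yp :: "'y \<times> nat"
      obtain y p where yp: "yp = (y, p)" by fastforce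
      have inv: "pinv (rot ^^ m) ((rot ^^ m) z) = z" for z
        using bij_is_inj[OF bij_rot_pow[of m]] by (simp add: inv_f_f)
      have ri: "(rot ^^ m) (pinv (rot ^^ m) z) = z" for z
        using bij_is_surj[OF bij_rot_pow[of m]] by (simp add: surj_f_inv_f)
      show "h (Suc m) yp = (rot ^^ m \<circ> at_zero z \<circ> pinv (rot ^^ m) \<circ> h m) yp"
      proof (cases "p = m")
        case True
        have r0: "(rot ^^ m) (y', 0) = (y', m)" for y' :: 'y
          using Suc.prems N by (simp add: rot_funpow nxt_funpow)
        have "pinv (rot ^^ m) (y, m) = (y, 0)" using inv[of "(y, 0)"] by (simp add: r0)
        then show ?thesis using True by (simp add: yp h_def at_zero_def r0)
      next
        case False
        obtain y' p' where hm: "h m yp = (y', p')" by fastforce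
        then have p': "p' = p" by (auto simp: h_def yp split: if_splits)
        obtain y'' p'' where iv: "pinv (rot ^^ m) (y', p') = (y'', p'')" by fastforce
        have "p'' \<noteq> 0"
        proof
          assume "p'' = 0"
          then have "(y', p') = (y'', m)" using ri[of "(y', p')"] iv Suc.prems N by (simp add: rot_funpow nxt_funpow)
          then show False using False p' by simp
        qed
        then have "at_zero z (pinv (rot ^^ m) (y', p')) = pinv (rot ^^ m) (y', p')" using iv by (simp add: at_zero_def)
        then have "(rot ^^ m \<circ> at_zero z \<circ> pinv (rot ^^ m) \<circ> h m) yp = (y', p')" using hm ri by simp
        then show ?thesis using hm False by (auto simp: h_def yp split: if_splits)
      qed
    qed
    moreover have "h m \<in> ?G" using Suc by simp
    ultimately show ?case using zG rG(1) by (metis (no_types, lifting) G(2,3,5) X)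
  qed
  from this[of N] have "h N \<in> ?G" by simp
  moreover have "h N = on_sites z" by (simp add: h_def on_sites_def)
  ultimately show ?thesis unfolding z_def by simp
qed

end

end

section \<open>Countability, and kernels of countably infinite rank\<close>

lemma bij_betw_UNIV_nat:
  assumes "countable E" "infinite E"
  shows "\<exists>f :: nat \<Rightarrow> 'e. bij_betw f UNIV E"
  using countableE_infinite[OF assms] bij_betw_inv_into by metis

lemma (in group_pair) countable_P:
  assumes "countable (carrier G)" "countable (carrier H)"
  shows "countable (carrier P)"
proof -
  have "carrier P \<subseteq> lists (Inl ` carrier G \<union> Inr ` carrier H)" by (auto simp: free_product_def)
  then show ?thesis using assms by (meson countable_Un countable_image countable_lists countable_subset)
qed

lemma countable_free_group: "countable S \<Longrightarrow> countable (carrier (free_group S))"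
proof -
  assume S: "countable S"
  have "carrier (free_group S) \<subseteq> lists (S \<times> UNIV)" by (fastforce simp: free_group_def)
  then show ?thesis using S by (meson countable_SIGMA countable_lists countable_subset countableI_type)
qed

lemma (in group) countable_generate: "countable X \<Longrightarrow> X \<subseteq> carrier G \<Longrightarrow> countable (generate G X)"
proof -
  assume X: "countable X" "X \<subseteq> carrier G"
  have "\<exists>l \<in> lists (X \<times> UNIV). g = foldr (\<lambda>(x, e) a. (if e then x else inv\<^bsub>G\<^esub> x) \<otimes>\<^bsub>G\<^esub> a) l \<one>\<^bsub>G\<^esub>"
    if "g \<in> generate G X" for g
    using that
  proof (induction rule: generate.induct)
    case one then show ?case by (intro bexI[of _ "[]"]) auto
  next
    case (incl h) then show ?case using X by (intro bexI[of _ "[(h, True)]"]) auto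
  next
    case (inv h) then show ?case using X by (intro bexI[of _ "[(h, False)]"]) auto
  next
    case (eng h1 h2)
    then obtain l1 l2 where l: "l1 \<in> lists (X \<times> UNIV)" "l2 \<in> lists (X \<times> UNIV)"
      "h1 = foldr (\<lambda>(x, e) a. (if e then x else inv\<^bsub>G\<^esub> x) \<otimes>\<^bsub>G\<^esub> a) l1 \<one>\<^bsub>G\<^esub>"
      "h2 = foldr (\<lambda>(x, e) a. (if e then x else inv\<^bsub>G\<^esub> x) \<otimes>\<^bsub>G\<^esub> a) l2 \<one>\<^bsub>G\<^esub>" by blast
    let ?f = "\<lambda>(x, e) a. (if e then x else inv\<^bsub>G\<^esub> x) \<otimes>\<^bsub>G\<^esub> a"
    have h2: "h2 \<in> carrier G" using generate_in_carrier X eng.hyps by blast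
    have "foldr ?f l h2 = foldr ?f l \<one>\<^bsub>G\<^esub> \<otimes>\<^bsub>G\<^esub> h2 \<and> foldr ?f l \<one>\<^bsub>G\<^esub> \<in> carrier G"
      if "l \<in> lists (X \<times> UNIV)" for l
      using that
    proof (induction l rule: list.induct)
      case (Cons p l)
      obtain x e where p: "p = (x, e)" by (cases p)
      then have "x \<in> carrier G" using Cons.prems X by auto
      then show ?case using Cons h2 p by (auto simp: m_assoc)
    qed (use h2 in simp)
    then have "h1 \<otimes>\<^bsub>G\<^esub> h2 = foldr ?f (l1 @ l2) \<one>\<^bsub>G\<^esub>" using l by simp
    then show ?case using l by (intro bexI[of _ "l1 @ l2"]) auto
  qed
  then have "generate G X \<subseteq> (\<lambda>l. foldr (\<lambda>(x, e) a. (if e then x else inv\<^bsub>G\<^esub> x) \<otimes>\<^bsub>G\<^esub> a) l \<one>\<^bsub>G\<^esub>) ` lists (X \<times> UNIV)"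
    by blast
  then show ?thesis using X by (meson countable_SIGMA countable_lists countable_subset countableI_type countable_image)
qed

lemma free_gen_pow: "free_gen i [^]\<^bsub>free_group S\<^esub> (k :: nat) = replicate k (i, True)"
proof (induction k)
  case 0 show ?case by (simp add: free_group_def)
next
  case (Suc k)
  have "foldr free_cons (replicate k (i, True)) [(i, True)] = replicate (Suc k) (i, True)"
    by (induction k) (auto simp: replicate_app_Cons_same split: list.splits)
  then show ?case using Suc by (simp add: nat_pow_def mult_free_group)
qed

text \<open>The element \<open>gen i0\<close> has infinite order in \<open>P\<close>, but its image
  has finite order. From every vertex of \<open>Q\<close> it thus traces a closed path that a tree
  cannot contain. Each edge outside the tree serves at most \<open>k\<close> vertices, so there are
  infinitely many of them.\<close>

lemma (in free_pair) kernel_free_countable: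
  assumes Q: "group Q" and q: "q \<in> hom P Q" "q ` carrier P = carrier Q" "inj_on q (inr ` carrier H)"
    and inf: "infinite (carrier Q)" and cnt: "countable (carrier P)"
    and i0: "i0 \<in> S" "k > 0" "q (gen i0 [^]\<^bsub>P\<^esub> (k :: nat)) = \<one>\<^bsub>Q\<^esub>"
  shows "\<exists>\<theta>. \<theta> \<in> iso (free_group (UNIV :: nat set)) (P\<lparr>carrier := kernel P Q q\<rparr>)"
proof -
  interpret Q: group Q by (rule Q)
  interpret q: group_hom P Q q using Q q(1) P.group_axioms by (simp add: group_hom_def group_hom_axioms_def)
  have sub: "subgroup (inr ` carrier H) P"
    using group_hom.img_is_subgroup[of H P inr] inr_hom H.group_axioms P.group_axioms
    by (simp add: group_hom_def group_hom_axioms_def)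
  obtain \<tau> where \<tau>: "tree_transversal P Q q (inr ` carrier H) (gen ` S) \<tau>"
    using tree_transversal_exists[OF P.group_axioms Q q(1,2) sub q(3) _ generate_gens] gen_closed by blast
  define E where "E = {(a, i). a \<in> carrier Q \<and> i \<in> S \<and> \<tau> a \<otimes>\<^bsub>P\<^esub> gen i \<noteq> \<tau> (a \<otimes>\<^bsub>Q\<^esub> q (gen i))}"
  obtain \<psi> where \<psi>: "\<psi> \<in> iso (free_group E) (P\<lparr>carrier := kernel P Q q\<rparr>)"
    using kernel_free[OF Q q \<tau>] unfolding E_def by blast
  have closed: "\<tau> a \<in> carrier P" and \<tau>q: "q (\<tau> a) = a" if "a \<in> carrier Q" for a
    using \<tau> that unfolding tree_transversal_def by blast+
  have gen_ne: "gen i0 [^]\<^bsub>P\<^esub> k \<noteq> \<one>\<^bsub>P\<^esub>"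
  proof
    assume *: "gen i0 [^]\<^bsub>P\<^esub> k = \<one>\<^bsub>P\<^esub>"
    interpret inl: group_hom "free_group S" P inl
      using inl_hom P.group_axioms group_free_group by (simp add: group_hom_def group_hom_axioms_def)
    have "inl (free_gen i0 [^]\<^bsub>free_group S\<^esub> k) = \<one>\<^bsub>P\<^esub>"
      using * i0 by (simp add: gen_def inl.hom_nat_pow)
    then have "inl (free_gen i0 [^]\<^bsub>free_group S\<^esub> k) = inl \<one>\<^bsub>free_group S\<^esub>" by (simp only: inl.hom_one)
    then have "free_gen i0 [^]\<^bsub>free_group S\<^esub> k = \<one>\<^bsub>free_group S\<^esub>"
      by (rule inj_onD[OF inj_inl])
        (simp_all only: monoid.nat_pow_closed[OF group.is_monoid[OF group_free_group] free_gen_closed] i0(1)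
          monoid.one_closed[OF group.is_monoid[OF group_free_group]])
    then show False using i0 by (simp add: free_gen_pow one_free_group)
  qed
  \<comment> \<open>If all \<open>k\<close> edges of the path lay in the tree, \<tau> would be
    multiplicative along it, and its closing up would make the power of \<open>gen i0\<close>
    trivial.\<close>
  have hit: "\<exists>j < k. (a \<otimes>\<^bsub>Q\<^esub> q (gen i0) [^]\<^bsub>Q\<^esub> (j :: nat), i0) \<in> E" if a: "a \<in> carrier Q" for a
  proof (rule ccontr)
    assume "\<not> ?thesis"
    then have step: "\<tau> (a \<otimes>\<^bsub>Q\<^esub> q (gen i0) [^]\<^bsub>Q\<^esub> j) \<otimes>\<^bsub>P\<^esub> gen i0 = \<tau> (a \<otimes>\<^bsub>Q\<^esub> q (gen i0) [^]\<^bsub>Q\<^esub> j \<otimes>\<^bsub>Q\<^esub> q (gen i0))"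
      if "j < k" for j using that a i0 by (auto simp: E_def)
    have "j \<le> k \<Longrightarrow> \<tau> (a \<otimes>\<^bsub>Q\<^esub> q (gen i0) [^]\<^bsub>Q\<^esub> j) = \<tau> a \<otimes>\<^bsub>P\<^esub> gen i0 [^]\<^bsub>P\<^esub> j" for j
    proof (induction j)
      case 0 show ?case using a closed by simp
    next
      case (Suc j)
      have "a \<otimes>\<^bsub>Q\<^esub> q (gen i0) [^]\<^bsub>Q\<^esub> Suc j = a \<otimes>\<^bsub>Q\<^esub> q (gen i0) [^]\<^bsub>Q\<^esub> j \<otimes>\<^bsub>Q\<^esub> q (gen i0)"
        using a i0 by (simp add: Q.nat_pow_Suc Q.m_assoc)
      then show ?case using Suc step[of j] a i0 closed by (simp add: P.m_assoc)
    qed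
    from this[of k] have "\<tau> a = \<tau> a \<otimes>\<^bsub>P\<^esub> gen i0 [^]\<^bsub>P\<^esub> k"
      using i0 a q.hom_nat_pow[of "gen i0" k] by simp
    moreover have "gen i0 [^]\<^bsub>P\<^esub> k \<in> carrier P" using i0 by simp
    ultimately have "gen i0 [^]\<^bsub>P\<^esub> k = \<one>\<^bsub>P\<^esub>" using closed[OF a] P.l_cancel_one' by blast
    then show False using gen_ne by blast
  qed
  have "infinite E"
  proof
    assume fin: "finite E"
    have "carrier Q \<subseteq> (\<lambda>((c, i), j :: nat). c \<otimes>\<^bsub>Q\<^esub> inv\<^bsub>Q\<^esub> (q (gen i0) [^]\<^bsub>Q\<^esub> j)) ` (E \<times> {..<k})"
    proof
      fix a assume a: "a \<in> carrier Q"
      then obtain j where "j < k" "(a \<otimes>\<^bsub>Q\<^esub> q (gen i0) [^]\<^bsub>Q\<^esub> j, i0) \<in> E" using hit by blast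
      moreover have "a = a \<otimes>\<^bsub>Q\<^esub> q (gen i0) [^]\<^bsub>Q\<^esub> j \<otimes>\<^bsub>Q\<^esub> inv\<^bsub>Q\<^esub> (q (gen i0) [^]\<^bsub>Q\<^esub> j)"
        using a i0 by (simp add: Q.m_assoc)
      ultimately show "a \<in> (\<lambda>((c, i), j :: nat). c \<otimes>\<^bsub>Q\<^esub> inv\<^bsub>Q\<^esub> (q (gen i0) [^]\<^bsub>Q\<^esub> j)) ` (E \<times> {..<k})"
        by (intro image_eqI[of _ _ "((a \<otimes>\<^bsub>Q\<^esub> q (gen i0) [^]\<^bsub>Q\<^esub> j, i0), j)"]) auto
    qed
    then show False using inf fin by (meson finite_SigmaI finite_imageI finite_lessThan finite_subset)
  qed
  moreover have "countable E"
  proof -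
    have "countable (gen ` S)" by (rule countable_subset[OF _ cnt]) auto
    moreover have "inj_on gen S"
    proof (rule inj_onI)
      fix i j assume "i \<in> S" "j \<in> S" "gen i = gen j"
      then show "i = j" using inj_onD[OF inj_inl, of "free_gen i" "free_gen j"] by (simp add: gen_def free_gen_closed)
    qed
    ultimately have "countable S" by (rule countable_image_inj_on)
    moreover have "countable (carrier Q)" using cnt q(2) by (metis countable_image)
    moreover have "E \<subseteq> carrier Q \<times> S" by (auto simp: E_def)
    ultimately show ?thesis by (meson countable_SIGMA countable_subset)
  qed
  ultimately obtain f :: "nat \<Rightarrow> _" where "bij_betw f UNIV E" using bij_betw_UNIV_nat by blast
  then obtain \<xi> where "\<xi> \<in> iso (free_group (UNIV :: nat set)) (free_group E)"
    using free_group_iso_bij unfolding is_iso_def by blast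
  then show ?thesis using iso_set_trans[OF _ \<psi>] by blast
qed

section \<open>The relators and a model for them\<close>

definition conjugate :: "('g, 'm) monoid_scheme \<Rightarrow> 'g \<Rightarrow> 'g \<Rightarrow> 'g" where
  "conjugate G x y = inv\<^bsub>G\<^esub> y \<otimes>\<^bsub>G\<^esub> x \<otimes>\<^bsub>G\<^esub> y"

definition commutator :: "('g, 'm) monoid_scheme \<Rightarrow> 'g \<Rightarrow> 'g \<Rightarrow> 'g" where
  "commutator G x y = inv\<^bsub>G\<^esub> x \<otimes>\<^bsub>G\<^esub> conjugate G x y"

definition hat :: "('g, 'm) monoid_scheme \<Rightarrow> 'g \<Rightarrow> 'g \<Rightarrow> 'g" where
  "hat G s d = d \<otimes>\<^bsub>G\<^esub> conjugate G d s \<otimes>\<^bsub>G\<^esub> conjugate G d (s \<otimes>\<^bsub>G\<^esub> s)"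

text \<open>\<open>hat G s d\<close> spreads an element over all three regions permuted by \<open>s\<close>; \<open>spread\<close> does the same for
  the letter \<open>x\<close>, and \<open>swindle\<close> is the shift that exhibits \<open>d\<close> as a commutator with \<open>conjugate G d s\<close>.\<close>

definition spread :: "('g, 'm) monoid_scheme \<Rightarrow> 'g \<Rightarrow> 'g \<Rightarrow> 'g \<Rightarrow> 'g" where
  "spread G s x k = hat G (hat G s k) x"

definition swindle :: "('g, 'm) monoid_scheme \<Rightarrow> 'g \<Rightarrow> 'g \<Rightarrow> 'g \<Rightarrow> 'g \<Rightarrow> 'g" where
  "swindle G s x k m = conjugate G (hat G s m) (spread G s x k)"

text \<open>The first set makes the group \<open>D\<close> generated by \<open>b\<close> and \<open>c\<close> perfect when \<open>N\<close> is \<open>1\<close> modulo \<open>6\<close>. The second one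
  is a Baumslag--Solitar relation between \<open>m\<close> and a conjugate of \<open>m\<close>, which forces \<open>m = 1\<close> in finite groups.
  By the third one \<open>s\<close> and \<open>x\<close> die together with \<open>D\<close>. The last two express that the shift \<open>swindle\<close> moves
  the copy of \<open>D\<close> in one region to the product of the copies in two regions, so that \<open>m = 1\<close> kills \<open>D\<close>.\<close>

definition relators :: "('g, 'm) monoid_scheme \<Rightarrow> nat \<Rightarrow> 'g \<Rightarrow> 'g \<Rightarrow> 'g \<Rightarrow> 'g \<Rightarrow> 'g \<Rightarrow> 'g \<Rightarrow> 'g \<Rightarrow> 'g \<Rightarrow> 'g \<Rightarrow> 'g set"
where
  "relators G N b c s x n m k l r =
     {b [^]\<^bsub>G\<^esub> N, c [^]\<^bsub>G\<^esub> (N - 2), (c \<otimes>\<^bsub>G\<^esub> inv\<^bsub>G\<^esub> b) [^]\<^bsub>G\<^esub> (6 :: nat)}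
     \<union> {inv\<^bsub>G\<^esub> (m \<otimes>\<^bsub>G\<^esub> m) \<otimes>\<^bsub>G\<^esub> conjugate G m (inv\<^bsub>G\<^esub> (r \<otimes>\<^bsub>G\<^esub> m \<otimes>\<^bsub>G\<^esub> inv\<^bsub>G\<^esub> r))}
     \<union> {inv\<^bsub>G\<^esub> s \<otimes>\<^bsub>G\<^esub> conjugate G (hat G s n) (spread G s x k),
        inv\<^bsub>G\<^esub> x \<otimes>\<^bsub>G\<^esub> commutator G (conjugate G x (hat G s k)) (hat G s l)}
     \<union> {commutator G b (conjugate G b s), commutator G b (conjugate G c s), commutator G c (conjugate G b s), commutator G c (conjugate G c s)}
     \<union> {inv\<^bsub>G\<^esub> b \<otimes>\<^bsub>G\<^esub> commutator G (conjugate G b s) (swindle G s x k m),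
        inv\<^bsub>G\<^esub> c \<otimes>\<^bsub>G\<^esub> commutator G (conjugate G c s) (swindle G s x k m)}"

lemma finite_relators [simp]: "finite (relators G N b c s x n m k l r)"
  by (simp add: relators_def)

subsection \<open>The swindle\<close>

text \<open>Translation \<open>t\<close> and doubling \<open>c\<close> satisfy the Baumslag-Solitar
  relation, and \<open>r\<close> conjugates one into the other, so a single letter and its conjugate
  suffice. Three regions are cycled by \<open>s\<close>, while \<open>t\<close> absorbs the region
  \<open>in0\<close> into \<open>in1\<close>; this absorption is the swindle.\<close>

lemma swindle_permutations:
  "\<exists>(s :: real \<times> int \<Rightarrow> real \<times> int) t c r in0 in1 in2.
     bij s \<and> bij t \<and> bij c \<and> bij r \<and> r \<circ> t = c \<circ> r \<and> c \<circ> t = t \<circ> t \<circ> c \<and> (\<exists>z. s z \<noteq> z) \<and>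
     (\<forall>z. in0 (s z) = in1 z \<and> in1 (s z) = in2 z \<and> in2 (s z) = in0 z \<and> in1 (t z) = (in1 z \<or> in0 z)) \<and>
     (\<forall>z. (in0 z \<or> in1 z \<or> in2 z) \<and> \<not> (in0 z \<and> in1 z) \<and> \<not> (in0 z \<and> in2 z) \<and> \<not> (in1 z \<and> in2 z))"
proof -
  define t :: "real \<times> int \<Rightarrow> real \<times> int" where "t = (\<lambda>(q, i). (q + 1, i))"
  \<comment> \<open>The shift of the second coordinate makes doubling act freely; on the real line
    alone 0 would be fixed and \<open>c\<close> could not be conjugate to \<open>t\<close>.\<close>
  define c :: "real \<times> int \<Rightarrow> real \<times> int" where "c = (\<lambda>(q, i). (2 * q, i + 1))"
  \<comment> \<open>Each orbit of \<open>t\<close> has one point with first coordinate in the unit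
    interval, each orbit of \<open>c\<close> one point with second coordinate 0. These points are
    matched by sending \<open>(frac q, i)\<close> to \<open>(frac q + i, 0)\<close>, and
    \<open>r\<close> is the equivariant extension.\<close>
  define r :: "real \<times> int \<Rightarrow> real \<times> int" where "r = (\<lambda>(q, i). (2 powi \<lfloor>q\<rfloor> * (frac q + of_int i), \<lfloor>q\<rfloor>))"
  have t: "bij t" by (rule o_bij[of "\<lambda>(q, i). (q - 1, i)"]) (auto simp: t_def)
  have c: "bij c" by (rule o_bij[of "\<lambda>(q, i). (q / 2, i - 1)"]) (auto simp: c_def)
  have r: "bij r"
  proof (rule o_bij[of "\<lambda>(u, j). (frac (u / 2 powi j) + of_int j, \<lfloor>u / 2 powi j\<rfloor>)"])
    show "(\<lambda>(u, j). (frac (u / 2 powi j) + of_int j, \<lfloor>u / 2 powi j\<rfloor>)) \<circ> r = id"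
      by (auto simp: r_def frac_def)
    have "2 powi j * (frac v + of_int \<lfloor>v\<rfloor>) = 2 powi j * v" for v :: real and j by (simp add: frac_def)
    then show "r \<circ> (\<lambda>(u, j). (frac (u / 2 powi j) + of_int j, \<lfloor>u / 2 powi j\<rfloor>)) = id"
      by (auto simp: r_def frac_def)
  qed
  have rt: "r \<circ> t = c \<circ> r" by (auto simp: r_def t_def c_def frac_def power_int_add field_simps)
  have ct: "c \<circ> t = t \<circ> t \<circ> c" by (auto simp: t_def c_def)
  \<comment> \<open>The regions are unions of unit cells, numbered by integer part and second
    coordinate. The second coordinate makes \<open>A0\<close> infinite as well, so that a
    permutation cycling the three regions exists.\<close>
  define A0 A1 A2 :: "(int \<times> int) set" where "A0 = {0} \<times> UNIV" and "A1 = {1..} \<times> UNIV" and "A2 = {..-1} \<times> UNIV"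
  have inf: "infinite A0" "infinite A1" "infinite A2"
    by (auto simp: A0_def A1_def A2_def finite_cartesian_product_iff infinite_UNIV_int)
  have ex: "\<exists>f. bij_betw f A B" if A: "infinite A" and B: "infinite B" for A B :: "(int \<times> int) set"
  proof -
    obtain f where "bij_betw f A (UNIV :: nat set)" using countableE_infinite[OF _ A] by auto
    moreover obtain g where "bij_betw g B (UNIV :: nat set)" using countableE_infinite[OF _ B] by auto
    ultimately show ?thesis using bij_betw_trans bij_betw_inv_into by blast
  qed
  obtain f0 f1 f2 where f: "bij_betw f0 A0 A2" "bij_betw f1 A1 A0" "bij_betw f2 A2 A1"
    using ex inf by metis
  define s2 where "s2 z = (if z \<in> A0 then f0 z else if z \<in> A1 then f1 z else f2 z)" for z
  have disj: "A0 \<inter> A1 = {}" "A0 \<inter> A2 = {}" "A1 \<inter> A2 = {}" and un: "A0 \<union> A1 \<union> A2 = UNIV"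
    by (auto simp: A0_def A1_def A2_def)
  have s2: "bij_betw s2 A0 A2" "bij_betw s2 A1 A0" "bij_betw s2 A2 A1"
  proof -
    have *: "bij_betw s2 A B" if "bij_betw g A B" "\<And>z. z \<in> A \<Longrightarrow> s2 z = g z" for g A B
      using that bij_betw_cong[of A s2 g B] by blast
    show "bij_betw s2 A0 A2" "bij_betw s2 A1 A0" "bij_betw s2 A2 A1"
      by (rule *[OF f(1)], simp add: s2_def, rule *[OF f(2)], use disj in \<open>auto simp: s2_def\<close>)
        (rule *[OF f(3)], use disj in \<open>auto simp: s2_def\<close>)
  qed
  have bij2: "bij s2"
  proof -
    have "bij_betw s2 (A0 \<union> A1 \<union> A2) (A2 \<union> A0 \<union> A1)"
      by (intro bij_betw_combine s2) (use disj in auto)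
    then show ?thesis using un by (simp add: Un_ac)
  qed
  have mem: "s2 z \<in> A2 \<longleftrightarrow> z \<in> A0" "s2 z \<in> A0 \<longleftrightarrow> z \<in> A1" "s2 z \<in> A1 \<longleftrightarrow> z \<in> A2" for z
  proof -
    have z: "z \<in> A0 \<or> z \<in> A1 \<or> z \<in> A2" using un by blast
    have a: "z \<in> A0 \<Longrightarrow> s2 z \<in> A2" "z \<in> A1 \<Longrightarrow> s2 z \<in> A0" "z \<in> A2 \<Longrightarrow> s2 z \<in> A1"
      using bij_betwE[OF s2(1)] bij_betwE[OF s2(2)] bij_betwE[OF s2(3)] by blast+
    show "s2 z \<in> A2 \<longleftrightarrow> z \<in> A0" using z a disj by blast
    show "s2 z \<in> A0 \<longleftrightarrow> z \<in> A1" using z a disj by blast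
    show "s2 z \<in> A1 \<longleftrightarrow> z \<in> A2" using z a disj by blast
  qed
  \<comment> \<open>The permutation of cells is lifted to points by keeping the fractional
    part.\<close>
  define cell :: "real \<times> int \<Rightarrow> int \<times> int" where "cell = (\<lambda>(q, i). (\<lfloor>q\<rfloor>, i))"
  define lift :: "(int \<times> int \<Rightarrow> int \<times> int) \<Rightarrow> real \<times> int \<Rightarrow> real \<times> int"
    where "lift f = (\<lambda>(q, i). (frac q + of_int (fst (f (\<lfloor>q\<rfloor>, i))), snd (f (\<lfloor>q\<rfloor>, i))))" for f
  define s where "s = lift s2"
  have floor_frac: "\<lfloor>frac q + of_int k\<rfloor> = k" "frac (frac q + of_int k) = frac q" for q :: real and k
    by (simp_all add: frac_def)
  have cell_s: "cell (s z) = s2 (cell z)" for z by (cases z) (simp add: cell_def s_def lift_def floor_frac)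
  have lift_lift: "lift f (lift g z) = lift (f \<circ> g) z" for f g z
    by (cases z) (simp add: lift_def floor_frac)
  have lift_id: "lift id z = z" for z by (cases z) (simp add: lift_def frac_def)
  have "bij s"
  proof (rule o_bij[of "lift (pinv s2)"])
    have "pinv s2 \<circ> s2 = id" "s2 \<circ> pinv s2 = id"
      using bij2 by (simp_all add: bij_is_inj bij_is_surj surj_f_inv_f fun_eq_iff)
    then show "lift (pinv s2) \<circ> s = id" "s \<circ> lift (pinv s2) = id"
      unfolding s_def by (auto intro!: ext simp only: comp_apply lift_lift lift_id id_apply)
  qed
  have ne: "\<exists>z. s z \<noteq> z"
  proof -
    have "cell (0, 0) \<in> A0" by (simp add: cell_def A0_def)
    then have "cell (s (0, 0)) \<in> A2" using mem cell_s by simp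
    then have "s (0, 0) \<noteq> (0, 0)" using disj(2) \<open>cell (0, 0) \<in> A0\<close> by (metis IntI empty_iff)
    then show ?thesis by blast
  qed
  have tz: "cell (t z) \<in> A1 \<longleftrightarrow> cell z \<in> A1 \<or> cell z \<in> A0" for z
  proof -
    have "1 \<le> \<lfloor>q + 1\<rfloor> \<longleftrightarrow> 1 \<le> \<lfloor>q\<rfloor> \<or> \<lfloor>q\<rfloor> = 0" for q :: real by linarith
    then show ?thesis by (cases z) (simp add: t_def cell_def A0_def A1_def del: le_floor_iff zero_le_floor one_le_floor)
  qed
  show ?thesis
    by (rule exI[of _ s], rule exI[of _ t], rule exI[of _ c], rule exI[of _ r], rule exI[of _ "\<lambda>z. cell z \<in> A0"],
        rule exI[of _ "\<lambda>z. cell z \<in> A1"], rule exI[of _ "\<lambda>z. cell z \<in> A2"])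
      (intro conjI allI \<open>bij s\<close> t c r rt ct ne; (simp only: mem cell_s tz)?; (use disj un in blast)?)
qed

lemma conj_Perm: "\<lbrakk>bij x; bij y; bij z; x \<circ> y = y \<circ> z\<rbrakk> \<Longrightarrow> conjugate Perm x y = z"
proof -
  assume a: "bij x" "bij y" "bij z" "x \<circ> y = y \<circ> z"
  have xy: "x (y a) = y (z a)" for a using fun_cong[OF a(4), of a] by simp
  have "conjugate Perm x y = pinv y \<circ> x \<circ> y" using a by (simp add: conjugate_def bij_imp_bij_inv bij_comp)
  then show ?thesis using a(2) by (simp add: fun_eq_iff xy bij_is_inj)
qed

lemma (in group) comm_eqI:
  "\<lbrakk>u \<in> carrier G; w \<in> carrier G; conjugate G u v = u \<otimes> w\<rbrakk> \<Longrightarrow> commutator G u v = w"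
  by (simp add: commutator_def)


text \<open>Every conjugate or spread that occurs in a relator is named by its value. The model then
  only has to verify these values and simple commutation equations, instead of normalising nested
  inverses.\<close>

lemma relators_modelI:
  fixes b c s x n m k l r :: "'z \<Rightarrow> 'z"
  assumes bij: "bij b" "bij c" "bij s" "bij x" "bij n" "bij m" "bij k" "bij l" "bij r"
    and ord: "b ^^ N = id" "c ^^ (N - 2) = id" "(c \<circ> pinv b) ^^ 6 = id"
    and hats: "hat Perm s n = n'" "hat Perm s m = m'" "hat Perm s k = k'" "hat Perm s l = l'"
      "bij n'" "bij m'" "bij k'" "bij l'"
    and sp: "hat Perm k' x = x'" "bij x'" "conjugate Perm n' x' = s" "conjugate Perm m' x' = t" "bij t"
    and x1: "conjugate Perm x k' = x1" "bij x1" "conjugate Perm x1 l' = x1 \<circ> x"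
    and bc: "conjugate Perm b s = b1" "bij b1" "conjugate Perm c s = c1" "bij c1"
      "conjugate Perm b1 t = b1 \<circ> b" "conjugate Perm c1 t = c1 \<circ> c"
      "b \<circ> b1 = b1 \<circ> b" "b \<circ> c1 = c1 \<circ> b" "c \<circ> b1 = b1 \<circ> c" "c \<circ> c1 = c1 \<circ> c"
    and q: "bij q" "r \<circ> m = q \<circ> r" "q \<circ> m = m \<circ> m \<circ> q"
  shows "relators Perm N b c s x n m k l r \<subseteq> {\<one>\<^bsub>Perm\<^esub>}"
proof -
  interpret group "BijGroup (UNIV :: 'z set)" by (rule group_Perm)
  have pow: "f [^]\<^bsub>Perm\<^esub> (i :: nat) = f ^^ i" if f: "bij f" for f :: "'z \<Rightarrow> 'z" and i
  proof (induction i)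
    case 0 show ?case by (simp add: one_Perm)
  next
    case (Suc i)
    have "bij (f ^^ i)" by (induction i) (simp_all only: funpow.simps bij_id bij_comp f)
    then show ?case using Suc f by (simp add: nat_pow_Suc funpow_Suc_right del: funpow.simps)
  qed
  have comm1: "commutator Perm u v = \<one>\<^bsub>Perm\<^esub>" if "u \<circ> v = v \<circ> u" "bij u" "bij v" for u v :: "'z \<Rightarrow> 'z"
  proof (rule comm_eqI)
    show "conjugate Perm u v = u \<otimes>\<^bsub>Perm\<^esub> \<one>\<^bsub>Perm\<^esub>" using conj_Perm[OF that(2,3,2,1)] that(2) by (simp add: one_Perm)
  qed (use that in \<open>auto simp: one_Perm\<close>)
  have cl: "v \<in> carrier Perm" if "bij v" for v :: "'z \<Rightarrow> 'z" using that by simp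
  have li: "inv\<^bsub>Perm\<^esub> v \<otimes>\<^bsub>Perm\<^esub> v = \<one>\<^bsub>Perm\<^esub>" if "bij v" for v :: "'z \<Rightarrow> 'z"
    by (rule l_inv[OF cl[OF that]])
  have rq: "r \<otimes>\<^bsub>Perm\<^esub> m \<otimes>\<^bsub>Perm\<^esub> inv\<^bsub>Perm\<^esub> r = q"
  proof -
    have "r \<otimes>\<^bsub>Perm\<^esub> m = q \<otimes>\<^bsub>Perm\<^esub> r" using q bij by simp
    then show ?thesis using bij q(1) by (simp only: m_assoc cl r_inv inv_closed r_one)
  qed
  have kill: "conjugate Perm m (inv\<^bsub>Perm\<^esub> q) = m \<otimes>\<^bsub>Perm\<^esub> m"
  proof -
    have "q \<otimes>\<^bsub>Perm\<^esub> m = m \<otimes>\<^bsub>Perm\<^esub> m \<otimes>\<^bsub>Perm\<^esub> q" using q bij by (simp add: bij_comp)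
    then show ?thesis using bij q(1) unfolding conjugate_def by (simp only: m_assoc cl r_inv inv_closed inv_inv r_one m_closed)
  qed
  have x1c: "commutator Perm x1 l' = x"
    by (rule comm_eqI) (use x1 bij in auto)
  have bt: "commutator Perm b1 t = b" "commutator Perm c1 t = c"
    by (rule comm_eqI; use bc bij in auto)+
  have mm: "bij (m \<circ> m)" using bij bij_comp by blast
  have sw: "swindle Perm s x k m = t" "spread Perm s x k = x'"
    using sp hats by (simp_all add: swindle_def spread_def)
  have c1: "commutator Perm b b1 = \<one>\<^bsub>Perm\<^esub>" "commutator Perm b c1 = \<one>\<^bsub>Perm\<^esub>" "commutator Perm c b1 = \<one>\<^bsub>Perm\<^esub>" "commutator Perm c c1 = \<one>\<^bsub>Perm\<^esub>"
    by (rule comm1; use bc bij in auto)+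
  have o3: "(c \<otimes>\<^bsub>Perm\<^esub> inv\<^bsub>Perm\<^esub> b) [^]\<^bsub>Perm\<^esub> (6 :: nat) = \<one>\<^bsub>Perm\<^esub>"
    using pow[of "c \<circ> pinv b" 6] ord bij by (simp add: one_Perm bij_imp_bij_inv bij_comp)
  have o12: "b [^]\<^bsub>Perm\<^esub> N = \<one>\<^bsub>Perm\<^esub>" "c [^]\<^bsub>Perm\<^esub> (N - 2) = \<one>\<^bsub>Perm\<^esub>"
    using pow ord bij by (simp_all add: one_Perm)
  have mmi: "inv\<^bsub>Perm\<^esub> (m \<otimes>\<^bsub>Perm\<^esub> m) \<otimes>\<^bsub>Perm\<^esub> (m \<otimes>\<^bsub>Perm\<^esub> m) = \<one>\<^bsub>Perm\<^esub>"
    by (rule l_inv) (use mm bij in simp)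
  show ?thesis
    unfolding relators_def rq kill sw hats sp x1 bc x1c bt c1 o3 o12 mmi
    using li[OF bij(3)] li[OF bij(4)] li[OF bij(1)] li[OF bij(2)] by blast
qed


section \<open>The permutation model of the relators\<close>

definition at_region :: "('j \<Rightarrow> bool) \<Rightarrow> ('w \<Rightarrow> 'w) \<Rightarrow> 'w \<times> 'j \<Rightarrow> 'w \<times> 'j" where
  "at_region q g = (\<lambda>(\<omega>, j). if q j then (g \<omega>, j) else (\<omega>, j))"

lemma at_region_comp: "at_region q (g \<circ> h) = at_region q g \<circ> at_region q h"
  by (auto simp: at_region_def)

lemma at_region_id: "at_region q id = id"
  by (auto simp: at_region_def)

lemma at_region_pinv: "bij g \<Longrightarrow> at_region q g \<circ> at_region q (pinv g) = id" "bij g \<Longrightarrow> at_region q (pinv g) \<circ> at_region q g = id"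
  by (auto simp: at_region_def bij_is_inj bij_is_surj surj_f_inv_f)

lemma bij_at_region: "bij g \<Longrightarrow> bij (at_region q g)"
  using at_region_pinv[of g q] by (intro o_bij) auto

lemma pinv_at_region: "bij g \<Longrightarrow> pinv (at_region q g) = at_region q (pinv g)"
  using at_region_pinv[of g q] by (intro inv_eqI) auto

lemma at_region_funpow: "at_region q g ^^ m = at_region q (g ^^ m)"
proof (induction m)
  case 0 show ?case unfolding funpow.simps(1) by (simp only: at_region_id)
next
  case (Suc m) then show ?case unfolding funpow.simps(2) by (simp only: at_region_comp)
qed

lemma at_region_hom: "at_region q \<in> hom Perm Perm"
  by (rule homI) (simp_all add: at_region_comp bij_at_region)

text \<open>The bound on the site is forced: these permutations must arise by conjugation from
  spreads of elements of \<open>D\<close>, which move nothing at the sites from \<open>N\<close>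
  on.\<close>

definition shift_last :: "nat \<Rightarrow> ('j \<Rightarrow> 'j) \<Rightarrow> ('y \<times> nat) \<times> 'j \<Rightarrow> ('y \<times> nat) \<times> 'j" where
  "shift_last N s = (\<lambda>((y, p), j). ((y, p), if p < N then s j else j))"

lemma bij_shift_last: "bij s \<Longrightarrow> bij (shift_last N s)"
  by (rule o_bij[of "shift_last N (pinv s)"]) (auto simp: shift_last_def bij_is_inj bij_is_surj surj_f_inv_f)

lemma at_region_shift_last:
  assumes "\<And>y p. N \<le> p \<Longrightarrow> g (y, p) = (y, p)" "\<And>y p. p < N \<Longrightarrow> snd (g (y, p)) < N"
  shows "at_region q g \<circ> shift_last N s = shift_last N s \<circ> at_region (\<lambda>j. q (s j)) g"
proof
  fix z :: "('a \<times> nat) \<times> 'b"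
  obtain y p j where z: "z = ((y, p), j)" by (metis prod.collapse)
  obtain y' p' where g: "g (y, p) = (y', p')" by fastforce
  show "(at_region q g \<circ> shift_last N s) z = (shift_last N s \<circ> at_region (\<lambda>j. q (s j)) g) z"
    using assms[of p y] g by (cases "p < N") (auto simp: z at_region_def shift_last_def not_less)
qed

text \<open>In a point \<open>((((y, i, g), z), p), j)\<close>, the last entry \<open>j\<close>
  locates the region, \<open>y\<close> is a register of the same type that \<open>D\<close> can
  move, \<open>i\<close> controls \<open>flip\<close>, \<open>g\<close> carries the translations of
  \<Gamma>, \<open>z\<close> is room for writing permutations as commutators, and \<open>p\<close>
  is the site.\<close>

type_synonym ('j, 'a) model = "((('j \<times> 'j \<times> 'a) \<times> int) \<times> nat) \<times> 'j"

text \<open>An exchange of the register \<open>y\<close> with the region coordinate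
  \<open>j\<close>, switched on by \<open>i\<close>. Fully switched on, it conjugates an action on
  the register, available in \<open>D\<close>, into an action on the regions.\<close>

definition flip :: "nat \<Rightarrow> ('j \<Rightarrow> bool) \<Rightarrow> ('j, 'a) model \<Rightarrow> ('j, 'a) model" where
  "flip N q = (\<lambda>((((y, i, g), z), p), j). if p < N \<and> q i then ((((j, i, g), z), p), y) else ((((y, i, g), z), p), j))"

lemma flip_flip: "flip N q \<circ> flip N q = id"
  by (auto simp: flip_def)

lemma bij_flip: "bij (flip N q)"
  by (rule o_bij[OF flip_flip flip_flip])

definition lift_perm :: "nat \<Rightarrow> ('y \<Rightarrow> 'y) \<Rightarrow> ('y \<times> int) \<times> nat \<Rightarrow> ('y \<times> int) \<times> nat" where
  "lift_perm N z = on_sites N (\<lambda>(y, i). (z y, i))"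

lemma lift_perm_comp: "lift_perm N (z \<circ> z') = lift_perm N z \<circ> lift_perm N z'"
  by (auto simp: lift_perm_def on_sites_def)

lemma lift_perm_pinv: "bij z \<Longrightarrow> lift_perm N z \<circ> lift_perm N (pinv z) = id" "bij z \<Longrightarrow> lift_perm N (pinv z) \<circ> lift_perm N z = id"
  by (auto simp: lift_perm_def on_sites_def bij_is_inj bij_is_surj surj_f_inv_f)

lemma bij_lift_perm: "bij z \<Longrightarrow> bij (lift_perm N z)"
  using lift_perm_pinv[of z N] by (intro o_bij) auto

lemma pinv_lift_perm: "bij z \<Longrightarrow> pinv (lift_perm N z) = lift_perm N (pinv z)"
  using lift_perm_pinv[of z N] by (intro inv_eqI) auto

text \<open>The integer coordinate provides room: \<open>z\<close> acting on the points with coordinate \<open>0\<close> only is a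
  commutator of two products of two involutions.\<close>

lemma two_generated_perms:
  fixes zs :: "('y \<Rightarrow> 'y) list"
  assumes "\<forall>z \<in> set zs. bij z"
  shows "\<exists>N (b :: ('y \<times> int) \<times> nat \<Rightarrow> ('y \<times> int) \<times> nat) c. bij b \<and> bij c \<and> N mod 6 = 1 \<and> 6 < N \<and>
    b ^^ N = id \<and> c ^^ (N - 2) = id \<and> (c \<circ> pinv b) ^^ 6 = id \<and>
    (\<forall>y p. N \<le> p \<longrightarrow> b (y, p) = (y, p) \<and> c (y, p) = (y, p)) \<and>
    (\<forall>z \<in> set zs. lift_perm N z \<in> generate Perm {b, c})"
proof -
  interpret P: group "BijGroup (UNIV :: 'y set)" by (rule group_Perm)
  have zs: "\<And>z. z \<in> set zs \<Longrightarrow> bij z" using assms by blast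
  define zp :: "('y \<Rightarrow> 'y) \<Rightarrow> int \<Rightarrow> 'y \<Rightarrow> 'y" where "zp z i = z [^]\<^bsub>Perm\<^esub> i" for z i
  have zp_bij: "bij (zp z i)" if "bij z" for z i
    using P.int_pow_closed[of z i] that by (simp add: zp_def)
  have zp_add: "zp z (i + j) y = zp z i (zp z j y)" if "bij z" for z i j y
    using P.int_pow_mult[of z i j] zp_bij[OF that] that by (simp add: zp_def)
  have zp_0: "zp z 0 = id" for z by (simp add: zp_def one_Perm)
  have zp_1: "zp z 1 = z" if "bij z" for z using that by (simp add: zp_def P.int_pow_1)
  \<comment> \<open>The two reflections compose to a unit translation of the integer
    coordinate.\<close>
  define \<iota>1 \<iota>2 :: "'y \<times> int \<Rightarrow> 'y \<times> int" where "\<iota>1 = (\<lambda>(y, i). (y, - i))" and "\<iota>2 = (\<lambda>(y, i). (y, 1 - i))"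
  \<comment> \<open>A reflection twisted by powers of \<open>z\<close>; it is an involution whatever
    the order of \<open>z\<close>.\<close>
  define \<iota> where "\<iota> z = (\<lambda>(y, i). (zp z i y, - i))" for z
  define r where "r = length zs + 3"
  \<comment> \<open>The reflection \<open>\<iota>1\<close> is listed twice, because the two factors
    of the commutator must use disjoint indices.\<close>
  define w where "w k = (if k < 2 then \<iota>1 else if k = 2 then \<iota>2 else \<iota> (zs ! (k - 3)))" for k
  \<comment> \<open>One more than a multiple of 6, and beyond the bound that prevents sums of marks
    from wrapping around.\<close>
  define N where "N = 6 * (2 * mark (2 * r) + 5) + 1"
  have w: "w k \<circ> w k = id" if "k < r" for k
  proof -
    have "\<iota> z \<circ> \<iota> z = id" if "bij z" for z
      using zp_add[OF that, symmetric] zp_0 by (auto simp: \<iota>_def)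
    then show ?thesis using that zs by (auto simp: w_def \<iota>1_def \<iota>2_def r_def)
  qed
  have N: "2 * mark (2 * r) + 5 < N" by (simp add: N_def)
  let ?G = "generate Perm {rot N, twist w r N}"
  note G = generate_Perm[of "{rot N, twist w r N}"]
  have X: "\<And>f. f \<in> {rot N, twist w r N} \<Longrightarrow> bij f" using bij_rot[OF w N] bij_twist[OF w N] by auto
  have "lift_perm N z \<in> ?G" if z: "z \<in> set zs" for z
  proof -
    have bz: "bij z" using zs z by simp
    obtain k where k: "k < length zs" "z = zs ! k" using z by (auto simp: in_set_conv_nth)
    \<comment> \<open>On level \<open>i\<close> the map \<open>u\<close> acts by the
      \<open>i\<close>-th power of \<open>z\<close>, and \<open>v\<close> lowers the level by one.
      Their commutator is therefore the inverse of \<open>z\<close> on every level.\<close>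
    define u v where "u = w 0 \<circ> w (k + 3)" and "v = w 1 \<circ> w 2"
    have u: "u = (\<lambda>(y, i). (zp z i y, i))" using k by (auto simp: u_def w_def \<iota>1_def \<iota>_def)
    have v: "v = (\<lambda>(y, i). (y, i - 1))" by (auto simp: v_def w_def \<iota>1_def \<iota>2_def)
    have bw: "bij (w k)" if "k < r" for k using w[OF that] by (rule o_bij[rotated]) (rule w[OF that])
    have buv: "bij u" "bij v" unfolding u_def v_def using k by (intro bij_comp bw; simp add: r_def)+
    have "u \<circ> v = v \<circ> u \<circ> (\<lambda>(y, i). (pinv z y, i))"
    proof -
      have "zp z (i - 1) y = zp z i (pinv z y)" for i y
        using zp_add[OF bz, of "i - 1" 1 "pinv z y"] zp_1[OF bz] bz by (simp add: bij_is_surj surj_f_inv_f)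
      then show ?thesis by (auto simp: u v)
    qed
    then have uv: "u (v a) = v (u ((\<lambda>(y, i). (pinv z y, i)) a))" for a by (metis comp_apply)
    have "pinv u \<circ> pinv v \<circ> u \<circ> v = (\<lambda>(y, i). (pinv z y, i))"
      using buv by (auto simp: fun_eq_iff uv bij_is_inj)
    moreover have "on_sites N (pinv u \<circ> pinv v \<circ> u \<circ> v) \<in> ?G"
      unfolding u_def v_def
      by (rule commutator_in_generate[OF w N]) (use k in \<open>auto simp: r_def\<close>)
    ultimately have "lift_perm N (pinv z) \<in> ?G" by (simp add: lift_perm_def)
    then have "pinv (lift_perm N (pinv z)) \<in> ?G" using G(3) X by blast
    then show ?thesis using bz pinv_lift_perm[of "pinv z" N] by (simp add: bij_imp_bij_inv inv_inv_eq)
  qed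
  moreover have "rot N (y, p) = (y, p) \<and> twist w r N (y, p) = (y, p)" if "N \<le> p" for y p
    using that gauge_bounds[OF w N, where p = p] N by (auto simp: rot_def nxt_def twist_def cyc_def)
  moreover have "N mod 6 = 1" "6 < N" unfolding N_def by presburger+
  ultimately have *: "\<forall>z \<in> set zs. lift_perm N z \<in> ?G"
    "\<forall>y p. N \<le> p \<longrightarrow> rot N (y, p) = (y, p) \<and> twist w r N (y, p) = (y, p)" "N mod 6 = 1" "6 < N"
    by blast+
  show ?thesis
  proof (intro exI conjI)
    show "bij (rot N :: ('y \<times> int) \<times> nat \<Rightarrow> _)" "bij (twist w r N)" using X by auto
  qed (rule * rot_order[OF w N] twist_order[OF w N] diff_order[OF w N]; assumption?)+
qed


definition on_first :: "('j \<Rightarrow> 'j) \<Rightarrow> 'j \<times> 'j \<times> 'a \<Rightarrow> 'j \<times> 'j \<times> 'a" where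
  "on_first s = (\<lambda>(y, i, g). (s y, i, g))"

definition on_second :: "('j \<Rightarrow> 'j) \<Rightarrow> 'j \<times> 'j \<times> 'a \<Rightarrow> 'j \<times> 'j \<times> 'a" where
  "on_second s = (\<lambda>(y, i, g). (y, s i, g))"

definition on_third :: "('a \<Rightarrow> 'a) \<Rightarrow> 'j \<times> 'j \<times> 'a \<Rightarrow> 'j \<times> 'j \<times> 'a" where
  "on_third f = (\<lambda>(y, i, g). (y, i, f g))"

lemma bij_on_coordinate:
  "bij s \<Longrightarrow> bij (on_first s)" "bij s \<Longrightarrow> bij (on_second s)" "bij f \<Longrightarrow> bij (on_third f)"
  by (rule o_bij[of "on_first (pinv s)"] o_bij[of "on_second (pinv s)"] o_bij[of "on_third (pinv f)"];
      auto simp: on_first_def on_second_def on_third_def bij_is_inj bij_is_surj surj_f_inv_f)+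

lemma conj_comp_Perm:
  assumes "bij x" "bij y" "x \<circ> y = y \<circ> z" "z \<circ> y = y \<circ> z'" "bij z'"
  shows "conjugate Perm x (y \<otimes>\<^bsub>Perm\<^esub> y) = z'"
proof -
  have "x (y (y a)) = y (y (z' a))" for a using assms(3,4) by (metis comp_apply)
  then show ?thesis using assms by (subst mult_Perm) (auto intro!: conj_Perm bij_comp)
qed

text \<open>The group \<open>D\<close> acts in region \<open>in0\<close> only, and there it imitates
  on the registers whatever is needed on the regions. Spreading by \<open>hat\<close> makes the
  imitation independent of the region, and \<open>flip\<close> transfers it to the region
  coordinate. So \<open>s\<close> and the swindle become conjugates of spreads of elements of
  \<open>D\<close>.\<close>

lemma model_exists:
  fixes \<Gamma> :: "('a, 'e) monoid_scheme"
  assumes "group \<Gamma>" "finite X" "X \<subseteq> carrier \<Gamma>"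
  shows "\<exists>N (b :: (real \<times> int, 'a) model \<Rightarrow> (real \<times> int, 'a) model) c s x n m k l r \<rho>.
    {b, c, s, x} \<subseteq> carrier Perm \<and> {n, m, k, l, r} \<subseteq> generate Perm {b, c} \<and>
    \<rho> \<in> hom \<Gamma> Perm \<and> inj_on \<rho> (carrier \<Gamma>) \<and> \<rho> ` X \<subseteq> generate Perm {b, c} \<and>
    N mod 6 = 1 \<and> 6 < N \<and> s \<noteq> \<one>\<^bsub>Perm\<^esub> \<and>
    relators Perm N b c s x n m k l r \<subseteq> {\<one>\<^bsub>Perm\<^esub>}"
proof -
  interpret \<Gamma>: group \<Gamma> by fact
  from swindle_permutations obtain s1 t1 c1 r1 :: "real \<times> int \<Rightarrow> real \<times> int" and in0 in1 in2 where
    sw: "bij s1 \<and> bij t1 \<and> bij c1 \<and> bij r1 \<and> r1 \<circ> t1 = c1 \<circ> r1 \<and> c1 \<circ> t1 = t1 \<circ> t1 \<circ> c1 \<and> (\<exists>z. s1 z \<noteq> z) \<and>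
     (\<forall>z. in0 (s1 z) = in1 z \<and> in1 (s1 z) = in2 z \<and> in2 (s1 z) = in0 z \<and> in1 (t1 z) = (in1 z \<or> in0 z)) \<and>
     (\<forall>z. (in0 z \<or> in1 z \<or> in2 z) \<and> \<not> (in0 z \<and> in1 z) \<and> \<not> (in0 z \<and> in2 z) \<and> \<not> (in1 z \<and> in2 z))"
    by (elim exE) (rule that)
  then have bij1: "bij s1" "bij t1" "bij c1" "bij r1" and rt: "r1 \<circ> t1 = c1 \<circ> r1" "c1 \<circ> t1 = t1 \<circ> t1 \<circ> c1"
    and ne: "\<exists>z. s1 z \<noteq> z"
    and reg: "\<forall>z. in0 (s1 z) = in1 z \<and> in1 (s1 z) = in2 z \<and> in2 (s1 z) = in0 z \<and> in1 (t1 z) = (in1 z \<or> in0 z)"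
    and part: "\<forall>z. (in0 z \<or> in1 z \<or> in2 z) \<and> \<not> (in0 z \<and> in1 z) \<and> \<not> (in0 z \<and> in2 z) \<and> \<not> (in1 z \<and> in2 z)"
    by - (elim conjE, assumption)+
  \<comment> \<open>Left translation, extended by the identity so as to be a permutation of the
    whole type.\<close>
  define lt where "lt g = (\<lambda>a. if a \<in> carrier \<Gamma> then g \<otimes>\<^bsub>\<Gamma>\<^esub> a else a)" for g
  have lt_mult: "lt (g \<otimes>\<^bsub>\<Gamma>\<^esub> h) = lt g \<circ> lt h" if "g \<in> carrier \<Gamma>" "h \<in> carrier \<Gamma>" for g h
    using that by (auto simp: lt_def \<Gamma>.m_assoc)
  have lt_one: "lt \<one>\<^bsub>\<Gamma>\<^esub> = id" by (auto simp: lt_def)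
  have lt_bij: "bij (lt g)" if g: "g \<in> carrier \<Gamma>" for g
    using lt_mult[of "inv\<^bsub>\<Gamma>\<^esub> g" g] lt_mult[of g "inv\<^bsub>\<Gamma>\<^esub> g"] lt_one g by (intro o_bij[of "lt (inv\<^bsub>\<Gamma>\<^esub> g)"]) auto
  obtain gs where gs: "set gs = X" using finite_list[OF assms(2)] by auto
  \<comment> \<open>Everything that must become a word in \<open>b\<close> and \<open>c\<close>: the
    letters \<open>n\<close>, \<open>m\<close> and \<open>r\<close> on the first register,
    \<open>k\<close> and \<open>l\<close> on the second, and the generators of \<Gamma> on the
    third.\<close>
  define zs :: "((real \<times> int) \<times> (real \<times> int) \<times> 'a \<Rightarrow> (real \<times> int) \<times> (real \<times> int) \<times> 'a) list" where
    "zs = [on_first s1, on_first t1, on_second s1, on_second t1, on_first r1] @ map (\<lambda>g. on_third (lt g)) gs"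
  have zs: "bij z" if "z \<in> set zs" for z
  proof -
    have "bij (on_third (lt g))" if "g \<in> set gs" for g
      using that lt_bij[of g] bij_on_coordinate(3) gs assms(3) by blast
    then show ?thesis using that bij_on_coordinate(1,2) bij1 unfolding zs_def by auto
  qed
  have zs_all: "\<forall>z \<in> set zs. bij z" by (intro ballI zs)
  obtain N and b0 c0 :: "(((real \<times> int) \<times> (real \<times> int) \<times> 'a) \<times> int) \<times> nat \<Rightarrow> _" where
    bc0: "bij b0" "bij c0" and N: "N mod 6 = 1" "6 < N" and
    ord: "b0 ^^ N = id" "c0 ^^ (N - 2) = id" "(c0 \<circ> pinv b0) ^^ 6 = id" and
    out: "\<forall>y p. N \<le> p \<longrightarrow> b0 (y, p) = (y, p) \<and> c0 (y, p) = (y, p)" and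
    mem: "\<forall>z \<in> set zs. lift_perm N z \<in> generate Perm {b0, c0}"
    using two_generated_perms[OF zs_all] by (elim exE conjE) (erule (8) that)
  have in_site: "snd (g (y, p)) < N" if g: "bij g" "\<And>y p. N \<le> p \<Longrightarrow> g (y, p) = (y, p)" and p: "p < N"
    for g :: "(((real \<times> int) \<times> (real \<times> int) \<times> 'a) \<times> int) \<times> nat \<Rightarrow> _" and y p
  proof (rule ccontr)
    assume n: "\<not> snd (g (y, p)) < N"
    obtain y' p' where yp': "g (y, p) = (y', p')" by fastforce
    then have "g (y', p') = g (y, p)" using n g(2) by simp
    then have "(y', p') = (y, p)" using bij_is_inj[OF g(1)] by (auto dest: injD)
    then show False using n p yp' by simp
  qed
  have lift_out: "lift_perm N z (y, p) = (y, p)" if "N \<le> p"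
    for z :: "(real \<times> int) \<times> (real \<times> int) \<times> 'a \<Rightarrow> (real \<times> int) \<times> (real \<times> int) \<times> 'a" and y p
    using that by (simp add: lift_perm_def on_sites_def)
  define Z where "Z z = at_region in0 (lift_perm N z)"
    for z :: "(real \<times> int) \<times> (real \<times> int) \<times> 'a \<Rightarrow> (real \<times> int) \<times> (real \<times> int) \<times> 'a"
  define b c where "b = at_region in0 b0" and "c = at_region in0 c0"
  define S T :: "(real \<times> int, 'a) model \<Rightarrow> (real \<times> int, 'a) model"
    where "S = shift_last N s1" and "T = shift_last N t1"
  define x :: "(real \<times> int, 'a) model \<Rightarrow> (real \<times> int, 'a) model" where "x = flip N in0"
  have bST: "bij S" "bij T" unfolding S_def T_def by (simp_all add: bij_shift_last bij1)
  have bx: "bij (flip N q :: (real \<times> int, 'a) model \<Rightarrow> _)" for q by (rule bij_flip)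
  have in_s: "(\<lambda>j. in0 (s1 j)) = in1" "(\<lambda>j. in1 (s1 j)) = in2" "(\<lambda>j. in2 (s1 j)) = in0"
    "(\<lambda>j. in1 (t1 j)) = (\<lambda>j. in1 j \<or> in0 j)" using reg by auto
  \<comment> \<open>\<open>S\<close> carries a copy of \<open>g\<close> from one region to the next,
    so \<open>hat\<close> collects all three copies. \<open>T\<close> turns the copy over
    \<open>in1\<close> into copies over \<open>in1\<close> and \<open>in0\<close>; the surplus is
    the original, which thereby becomes a commutator.\<close>
  have conj_S: "conjugate Perm (at_region in0 g) S = at_region in1 g" "bij (at_region q g)"
    "conjugate Perm (at_region in1 g) T = at_region in1 g \<circ> at_region in0 g"
    "hat Perm S (at_region in0 g) = at_region (\<lambda>_. True) g"
    if g: "bij g" "\<And>y p. N \<le> p \<Longrightarrow> g (y, p) = (y, p)"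
    for g :: "(((real \<times> int) \<times> (real \<times> int) \<times> 'a) \<times> int) \<times> nat \<Rightarrow> _" and q
  proof -
    note sh = at_region_shift_last[where g = g and N = N, OF g(2) in_site[OF g]]
    show bq: "bij (at_region q g)" for q by (rule bij_at_region[OF g(1)])
    have s01: "at_region in0 g \<circ> S = S \<circ> at_region in1 g" and s12: "at_region in1 g \<circ> S = S \<circ> at_region in2 g"
      unfolding S_def using sh[of in0 s1] sh[of in1 s1] by (simp_all add: in_s)
    show c1: "conjugate Perm (at_region in0 g) S = at_region in1 g" by (rule conj_Perm[OF bq bST(1) bq s01])
    have c2: "conjugate Perm (at_region in0 g) (S \<otimes>\<^bsub>Perm\<^esub> S) = at_region in2 g"
      by (rule conj_comp_Perm[OF bq bST(1) s01 s12 bq])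
    have t: "at_region (\<lambda>j. in1 j \<or> in0 j) g = at_region in1 g \<circ> at_region in0 g"
    proof
      fix v show "at_region (\<lambda>j. in1 j \<or> in0 j) g v = (at_region in1 g \<circ> at_region in0 g) v"
        using part[THEN spec, of "snd v"] by (cases v) (auto simp: at_region_def)
    qed
    show "conjugate Perm (at_region in1 g) T = at_region in1 g \<circ> at_region in0 g"
      by (rule conj_Perm[OF bq bST(2)]) (use sh[of in1 t1] in \<open>simp_all add: T_def in_s t bij_comp bq\<close>)
    have "at_region in0 g \<circ> at_region in1 g \<circ> at_region in2 g = at_region (\<lambda>_. True) g"
    proof
      fix v show "(at_region in0 g \<circ> at_region in1 g \<circ> at_region in2 g) v = at_region (\<lambda>_. True) g v"
        using part[THEN spec, of "snd v"] by (cases v) (auto simp: at_region_def)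
    qed
    then show "hat Perm S (at_region in0 g) = at_region (\<lambda>_. True) g"
      unfolding hat_def c1 c2 by (simp add: bq bij_comp)
  qed
  have Zb: "bij (lift_perm N z)" if "z \<in> set zs" for z by (rule bij_lift_perm[OF zs[OF that]])
  have Zm: "Z z \<in> generate Perm {b, c}" if "z \<in> set zs" for z
  proof -
    interpret at: group_hom "BijGroup UNIV" "BijGroup UNIV"
      "at_region in0 :: ((((real \<times> int) \<times> (real \<times> int) \<times> 'a) \<times> int) \<times> nat \<Rightarrow> _) \<Rightarrow> _"
      by (intro group_hom.intro group_hom_axioms.intro group_Perm at_region_hom)
    have "at_region in0 ` generate Perm {b0, c0} = generate Perm (at_region in0 ` {b0, c0})"
      by (rule at.generate_img[symmetric]) (use bc0 in auto)
    then show ?thesis using mem that by (auto simp: Z_def b_def c_def)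
  qed
  define al where "al z = at_region (\<lambda>_ :: real \<times> int. True) (lift_perm N z)"
    for z :: "(real \<times> int) \<times> (real \<times> int) \<times> 'a \<Rightarrow> (real \<times> int) \<times> (real \<times> int) \<times> 'a"
  have hatZ: "hat Perm S (Z z) = al z" "bij (al z)" "bij (Z z)" if "z \<in> set zs" for z
    using conj_S[OF Zb[OF that] lift_out] by (auto simp: Z_def al_def)
  have in_zs: "on_first s1 \<in> set zs" "on_first t1 \<in> set zs" "on_second s1 \<in> set zs" "on_second t1 \<in> set zs"
    "on_first r1 \<in> set zs" "\<And>g. g \<in> X \<Longrightarrow> on_third (lt g) \<in> set zs"
    by (auto simp: zs_def gs)
  \<comment> \<open>Conjugation by a permutation of the control register only changes the predicate
    that switches the flip on. Thus \<open>k\<close> and \<open>l\<close> play for \<open>x\<close>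
    the role that \<open>S\<close> and \<open>T\<close> play for \<open>b\<close> and
    \<open>c\<close>.\<close>
  have flip_k: "flip N q \<circ> al (on_second f) = al (on_second f) \<circ> flip N (\<lambda>i. q (f i))" for q f
    by (auto simp: flip_def al_def at_region_def lift_perm_def on_sites_def on_second_def split: if_splits)
  have flip_T: "flip N in0 \<circ> flip N in1 \<circ> flip N in2 = (flip N (\<lambda>_. True) :: (real \<times> int, 'a) model \<Rightarrow> _)"
  proof
    fix v show "(flip N in0 \<circ> flip N in1 \<circ> flip N in2) v = (flip N (\<lambda>_. True) :: (real \<times> int, 'a) model \<Rightarrow> _) v"
      using part[THEN spec, of "fst (snd (fst (fst (fst v))))"] by (cases v) (auto simp: flip_def)
  qed
  have flip_10: "flip N (\<lambda>i. in1 i \<or> in0 i) = flip N in1 \<circ> (flip N in0 :: (real \<times> int, 'a) model \<Rightarrow> _)"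
  proof
    fix v show "flip N (\<lambda>i. in1 i \<or> in0 i) v = (flip N in1 \<circ> (flip N in0 :: (real \<times> int, 'a) model \<Rightarrow> _)) v"
      using part[THEN spec, of "fst (snd (fst (fst (fst v))))"] by (cases v) (auto simp: flip_def)
  qed
  have fk: "flip N in0 \<circ> al (on_second s1) = al (on_second s1) \<circ> flip N in1"
    "flip N in1 \<circ> al (on_second s1) = al (on_second s1) \<circ> flip N in2"
    using flip_k[of in0 s1] flip_k[of in1 s1] by (simp_all add: in_s)
  have c1x: "conjugate Perm x (al (on_second s1)) = flip N in1"
    unfolding x_def by (rule conj_Perm[OF bx hatZ(2)[OF in_zs(3)] bx fk(1)])
  have hx: "hat Perm (al (on_second s1)) x = flip N (\<lambda>_. True)"
  proof -
    have "conjugate Perm x (al (on_second s1) \<otimes>\<^bsub>Perm\<^esub> al (on_second s1)) = flip N in2"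
      unfolding x_def by (rule conj_comp_Perm[OF bx hatZ(2)[OF in_zs(3)] fk bx])
    then show ?thesis unfolding hat_def c1x using flip_T by (simp add: x_def bx bij_comp)
  qed
  \<comment> \<open>The full flip exchanges register and region, so it conjugates an action on the
    first register into the same action on the region coordinate.\<close>
  have fl: "al (on_first f) \<circ> flip N (\<lambda>_. True) = flip N (\<lambda>_. True) \<circ> shift_last N f" for f
    by (auto simp: flip_def al_def at_region_def lift_perm_def on_sites_def on_first_def shift_last_def split: if_splits)
  have rel: "relators Perm N b c S x (Z (on_first s1)) (Z (on_first t1)) (Z (on_second s1)) (Z (on_second t1)) (Z (on_first r1))
      \<subseteq> {\<one>\<^bsub>Perm\<^esub>}"
  proof (rule relators_modelI[where n' = "al (on_first s1)" and m' = "al (on_first t1)" and k' = "al (on_second s1)"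
        and l' = "al (on_second t1)" and x' = "flip N (\<lambda>_. True)" and t = T and ?x1.0 = "flip N in1"
        and ?b1.0 = "at_region in1 b0" and ?c1.0 = "at_region in1 c0" and q = "Z (on_first c1)"])
    show "bij b" "bij c" "bij S" "bij x" using bij_at_region bc0 bST bx by (auto simp: b_def c_def x_def)
    show "b ^^ N = id" "c ^^ (N - 2) = id" unfolding b_def c_def at_region_funpow ord by (rule at_region_id)+
    show "(c \<circ> pinv b) ^^ 6 = id"
      unfolding b_def c_def pinv_at_region[OF bc0(1)] at_region_comp[symmetric] at_region_funpow ord by (rule at_region_id)
    show "bij T" by (rule bST)
    show "hat Perm (al (on_second s1)) x = flip N (\<lambda>_. True)" by (rule hx)
    show "bij (flip N (\<lambda>_. True) :: (real \<times> int, 'a) model \<Rightarrow> _)" "bij (flip N in1 :: (real \<times> int, 'a) model \<Rightarrow> _)" by (rule bx)+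
    show "conjugate Perm (al (on_first s1)) (flip N (\<lambda>_. True)) = S" "conjugate Perm (al (on_first t1)) (flip N (\<lambda>_. True)) = T"
      unfolding S_def T_def by (intro conj_Perm bx fl hatZ(2) in_zs bij_shift_last bij1)+
    show "conjugate Perm x (al (on_second s1)) = flip N in1" by (rule c1x)
    show "conjugate Perm (flip N in1) (al (on_second t1)) = flip N in1 \<circ> x"
      unfolding x_def flip_10[symmetric] in_s(4)[symmetric]
      by (intro conj_Perm bx hatZ(2) in_zs flip_k)
    show "conjugate Perm b S = at_region in1 b0" "conjugate Perm c S = at_region in1 c0"
      "bij (at_region in1 b0)" "bij (at_region in1 c0)"
      "conjugate Perm (at_region in1 b0) T = at_region in1 b0 \<circ> b" "conjugate Perm (at_region in1 c0) T = at_region in1 c0 \<circ> c"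
      using conj_S[OF bc0(1)] conj_S[OF bc0(2)] out by (simp_all add: b_def c_def)
    show "b \<circ> at_region in1 b0 = at_region in1 b0 \<circ> b" "b \<circ> at_region in1 c0 = at_region in1 c0 \<circ> b"
      "c \<circ> at_region in1 b0 = at_region in1 b0 \<circ> c" "c \<circ> at_region in1 c0 = at_region in1 c0 \<circ> c"
      using part by (auto simp: b_def c_def at_region_def)
    show "bij (Z (on_first c1))" unfolding Z_def by (intro bij_at_region bij_lift_perm bij_on_coordinate bij1)
    have of: "on_first (f \<circ> g) = on_first f \<circ> on_first g" for f g :: "real \<times> int \<Rightarrow> real \<times> int"
      by (auto simp: on_first_def)
    show "Z (on_first r1) \<circ> Z (on_first t1) = Z (on_first c1) \<circ> Z (on_first r1)"
      "Z (on_first c1) \<circ> Z (on_first t1) = Z (on_first t1) \<circ> Z (on_first t1) \<circ> Z (on_first c1)"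
      unfolding Z_def at_region_comp[symmetric] lift_perm_comp[symmetric] of[symmetric] rt by (rule refl)+
  qed (intro hatZ in_zs)+
  define \<rho> where "\<rho> g = Z (on_third (lt g))" for g
  have \<rho>: "\<rho> \<in> hom \<Gamma> Perm"
  proof (rule homI)
    have "bij (\<rho> g)" if "g \<in> carrier \<Gamma>" for g
      unfolding \<rho>_def Z_def by (intro bij_at_region bij_lift_perm bij_on_coordinate lt_bij that)
    moreover have "(on_third (f \<circ> g) :: (real \<times> int) \<times> (real \<times> int) \<times> 'a \<Rightarrow> _) = on_third f \<circ> on_third g" for f g :: "'a \<Rightarrow> 'a"
      by (auto simp: on_third_def)
    ultimately show "\<rho> (g \<otimes>\<^bsub>\<Gamma>\<^esub> h) = \<rho> g \<otimes>\<^bsub>Perm\<^esub> \<rho> h"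
      if "g \<in> carrier \<Gamma>" "h \<in> carrier \<Gamma>" for g h
      using that by (simp_all add: \<rho>_def lt_mult Z_def lift_perm_comp at_region_comp)
    show "\<rho> g \<in> carrier Perm" if "g \<in> carrier \<Gamma>" for g
      using that \<open>\<And>g. g \<in> carrier \<Gamma> \<Longrightarrow> bij (\<rho> g)\<close> by simp
  qed
  obtain j0 where j0: "in0 j0" using part reg by metis
  have "inj_on \<rho> (carrier \<Gamma>)"
  proof (rule inj_onI)
    fix g h assume gh: "g \<in> carrier \<Gamma>" "h \<in> carrier \<Gamma>" "\<rho> g = \<rho> h"
    then have "\<rho> g ((((j0, j0, \<one>\<^bsub>\<Gamma>\<^esub>), 0), 0), j0) = \<rho> h ((((j0, j0, \<one>\<^bsub>\<Gamma>\<^esub>), 0), 0), j0)" by simp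
    then show "g = h"
      using gh j0 N by (simp add: \<rho>_def Z_def at_region_def lift_perm_def on_sites_def on_third_def lt_def)
  qed
  moreover have "S \<noteq> \<one>\<^bsub>Perm\<^esub>"
  proof
    assume "S = \<one>\<^bsub>Perm\<^esub>"
    moreover obtain z where "s1 z \<noteq> z" using ne by auto
    moreover have "S ((((z, z, \<one>\<^bsub>\<Gamma>\<^esub>), 0), 0), z) = ((((z, z, \<one>\<^bsub>\<Gamma>\<^esub>), 0), 0), s1 z)" using N by (simp add: S_def shift_last_def)
    ultimately show False by (simp add: one_Perm)
  qed
  moreover have "\<rho> ` X \<subseteq> generate Perm {b, c}" using Zm in_zs(6) by (auto simp: \<rho>_def)
  moreover have "{b, c, S, x} \<subseteq> carrier Perm" using bij_at_region bc0 bST bx by (auto simp: b_def c_def x_def)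
  ultimately show ?thesis
    using rel \<rho> N Zm[OF in_zs(1)] Zm[OF in_zs(2)] Zm[OF in_zs(3)] Zm[OF in_zs(4)] Zm[OF in_zs(5)]
    by - (rule exI[of _ N], rule exI[of _ b], rule exI[of _ c], rule exI[of _ S], rule exI[of _ x],
        rule exI[of _ "Z (on_first s1)"], rule exI[of _ "Z (on_first t1)"], rule exI[of _ "Z (on_second s1)"],
        rule exI[of _ "Z (on_second t1)"], rule exI[of _ "Z (on_first r1)"], rule exI[of _ \<rho>], simp only: insert_subset empty_subsetI simp_thms)
qed

section \<open>Finite groups and central extensions\<close>

context group
begin

lemma conj_closed [simp]: "x \<in> carrier G \<Longrightarrow> y \<in> carrier G \<Longrightarrow> conjugate G x y \<in> carrier G"
  by (simp add: conjugate_def)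

lemma comm_closed [simp]: "x \<in> carrier G \<Longrightarrow> y \<in> carrier G \<Longrightarrow> commutator G x y \<in> carrier G"
  by (simp add: commutator_def)

lemma hat_closed [simp]: "s \<in> carrier G \<Longrightarrow> d \<in> carrier G \<Longrightarrow> hat G s d \<in> carrier G"
  by (simp add: hat_def)

lemma spread_closed [simp]: "s \<in> carrier G \<Longrightarrow> x \<in> carrier G \<Longrightarrow> k \<in> carrier G \<Longrightarrow> spread G s x k \<in> carrier G"
  by (simp add: spread_def)

lemma swindle_closed [simp]:
  "s \<in> carrier G \<Longrightarrow> x \<in> carrier G \<Longrightarrow> k \<in> carrier G \<Longrightarrow> m \<in> carrier G \<Longrightarrow> swindle G s x k m \<in> carrier G"
  by (simp add: swindle_def)

lemma conj_mult:
  "x \<in> carrier G \<Longrightarrow> x' \<in> carrier G \<Longrightarrow> y \<in> carrier G \<Longrightarrow> conjugate G (x \<otimes> x') y = conjugate G x y \<otimes> conjugate G x' y"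
  by (simp add: conjugate_def m_assoc inv_mult_cancel)

lemma conj_one [simp]: "y \<in> carrier G \<Longrightarrow> conjugate G \<one> y = \<one>"
  by (simp add: conjugate_def)

lemma conj_by_one [simp]: "x \<in> carrier G \<Longrightarrow> conjugate G x \<one> = x"
  by (simp add: conjugate_def)

lemma conj_inv: "x \<in> carrier G \<Longrightarrow> y \<in> carrier G \<Longrightarrow> conjugate G (inv x) y = inv (conjugate G x y)"
  by (simp add: conjugate_def inv_mult_group m_assoc)

lemma conj_pow: "x \<in> carrier G \<Longrightarrow> y \<in> carrier G \<Longrightarrow> conjugate G (x [^] (i :: nat)) y = conjugate G x y [^] i"
  by (induction i) (simp_all add: conj_mult)

lemma conj_conj: "x \<in> carrier G \<Longrightarrow> y \<in> carrier G \<Longrightarrow> y' \<in> carrier G \<Longrightarrow> conjugate G (conjugate G x y) y' = conjugate G x (y \<otimes> y')"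
  by (simp add: conjugate_def inv_mult_group m_assoc)

lemma conj_comm: "x \<in> carrier G \<Longrightarrow> y \<in> carrier G \<Longrightarrow> conjugate G x y = x \<otimes> commutator G x y"
  by (simp add: commutator_def flip: m_assoc)

lemma conj_commute: "x \<in> carrier G \<Longrightarrow> y \<in> carrier G \<Longrightarrow> x \<otimes> y = y \<otimes> x \<Longrightarrow> conjugate G x y = x"
  unfolding conjugate_def by (metis inv_solve_left' m_assoc inv_closed m_closed)

lemma eq_of_inv_mult: "x \<in> carrier G \<Longrightarrow> y \<in> carrier G \<Longrightarrow> inv x \<otimes> y = \<one> \<longleftrightarrow> x = y"
  by (metis inv_solve_left one_closed r_one)

lemma comm_eq_one_iff: "x \<in> carrier G \<Longrightarrow> y \<in> carrier G \<Longrightarrow> commutator G x y = \<one> \<longleftrightarrow> x \<otimes> y = y \<otimes> x"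
  by (simp add: commutator_def conjugate_def m_assoc eq_of_inv_mult inv_solve_left)

lemma comm_by_one [simp]: "x \<in> carrier G \<Longrightarrow> commutator G x \<one> = \<one>"
  by (simp add: commutator_def)

lemma commute_inv:
  assumes "x \<in> carrier G" "y \<in> carrier G" and eq: "x \<otimes> y = y \<otimes> x"
  shows "x \<otimes> inv y = inv y \<otimes> x"
proof -
  have "inv y \<otimes> x = inv y \<otimes> (x \<otimes> y) \<otimes> inv y" using assms(1,2) by (simp add: m_assoc)
  also have "\<dots> = x \<otimes> inv y" unfolding eq using assms(1,2) by (simp add: m_assoc inv_mult_cancel)
  finally show ?thesis by simp
qed

lemma generate_bc_closed:
  "\<lbrakk>{b, c, s, x} \<subseteq> carrier G; {n, m, k, l, r} \<subseteq> generate G {b, c}\<rbrakk> \<Longrightarrow> {b, c, s, x, n, m, k, l, r} \<subseteq> carrier G"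
  using generate_incl[of "{b, c}"] by auto

lemma relatorsD:
  assumes cl: "{b, c, s, x, n, m, k, l, r} \<subseteq> carrier G" and rel: "relators G N b c s x n m k l r \<subseteq> {\<one>}"
  shows "b [^] N = \<one>" "c [^] (N - 2) = \<one>" "(c \<otimes> inv b) [^] (6 :: nat) = \<one>"
    "conjugate G m (inv (r \<otimes> m \<otimes> inv r)) = m \<otimes> m"
    "conjugate G (hat G s n) (spread G s x k) = s" "commutator G (conjugate G x (hat G s k)) (hat G s l) = x"
    "\<forall>u \<in> {b, c}. \<forall>v \<in> {b, c}. u \<otimes> conjugate G v s = conjugate G v s \<otimes> u"
    "\<forall>u \<in> {b, c}. commutator G (conjugate G u s) (swindle G s x k m) = u"
  using rel cl by (simp_all add: relators_def eq_of_inv_mult comm_eq_one_iff)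

lemma relatorsI:
  assumes cl: "{b, c, s, x, n, m, k, l, r} \<subseteq> carrier G"
    and "b [^] N = \<one>" "c [^] (N - 2) = \<one>" "(c \<otimes> inv b) [^] (6 :: nat) = \<one>"
    "conjugate G m (inv (r \<otimes> m \<otimes> inv r)) = m \<otimes> m"
    "conjugate G (hat G s n) (spread G s x k) = s" "commutator G (conjugate G x (hat G s k)) (hat G s l) = x"
    "\<forall>u \<in> {b, c}. \<forall>v \<in> {b, c}. u \<otimes> conjugate G v s = conjugate G v s \<otimes> u"
    "\<forall>u \<in> {b, c}. commutator G (conjugate G u s) (swindle G s x k m) = u"
  shows "relators G N b c s x n m k l r \<subseteq> {\<one>}"
  using assms by (simp add: relators_def eq_of_inv_mult comm_eq_one_iff)

end

text \<open>The same words are evaluated in \<open>F\<close>, in \<open>Q\<close> and its factor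
  groups, in central extensions and in the permutation model; this lemma moves them along the
  homomorphisms in between.\<close>

lemma (in group_hom) relators_image:
  assumes cl: "{b, c, s, x, n, m, k, l, r} \<subseteq> carrier G"
  shows "relators H N (h b) (h c) (h s) (h x) (h n) (h m) (h k) (h l) (h r) = h ` relators G N b c s x n m k l r"
proof -
  have cj: "h (conjugate G u v) = conjugate H (h u) (h v)" "h (commutator G u v) = commutator H (h u) (h v)"
    "h (hat G u v) = hat H (h u) (h v)" if "u \<in> carrier G" "v \<in> carrier G" for u v
    using that by (simp_all add: conjugate_def commutator_def hat_def)
  have sp: "h (spread G u v w) = spread H (h u) (h v) (h w)"
    if "u \<in> carrier G" "v \<in> carrier G" "w \<in> carrier G" for u v w
    using that by (simp add: spread_def cj)
  have sw: "h (swindle G u v w z) = swindle H (h u) (h v) (h w) (h z)"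
    if "u \<in> carrier G" "v \<in> carrier G" "w \<in> carrier G" "z \<in> carrier G" for u v w z
    using that by (simp add: swindle_def cj sp)
  show ?thesis using cl by (simp add: relators_def image_Un cj sp sw hom_nat_pow)
qed

text \<open>Let \<open>p\<close> be the least prime divisor of \<open>a\<close>. By minimality
  \<open>a\<close> is coprime to \<open>p - 1\<close>; a Bezout identity together with Fermat's
  theorem turns \<open>2 ^ (a * u)\<close> into both 1 and 2 modulo \<open>p\<close>.\<close>

lemma dvd_two_pow_minus_one:
  fixes a :: nat
  assumes "0 < a" "a dvd 2 ^ a - 1"
  shows "a = 1"
proof (rule ccontr)
  assume "a \<noteq> 1"
  then have "\<exists>p. prime p \<and> p dvd a" using prime_factor_nat by blast
  then obtain p where p: "prime p" "p dvd a" and min: "\<And>q. q < p \<Longrightarrow> \<not> (prime q \<and> q dvd a)"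
    using exists_least_iff[of "\<lambda>p. prime p \<and> p dvd a"] by auto
  have p1: "p dvd 2 ^ a - 1" using p(2) assms(2) dvd_trans by blast
  have pa: "[2 ^ a = 1] (mod p)"
  proof -
    obtain k where "(2 :: nat) ^ a - 1 = p * k" using p1 by (elim dvdE)
    moreover have "1 \<le> (2 :: nat) ^ a" by simp
    ultimately have "(2 :: nat) ^ a = 1 + p * k" by linarith
    then have "(2 :: nat) ^ a = 1 + k * p" by (simp only: mult.commute)
    then show ?thesis unfolding cong_def by (simp only: mod_mult_self1)
  qed
  have "gcd a (p - 1) = 1"
  proof (rule ccontr)
    assume "gcd a (p - 1) \<noteq> 1"
    then obtain q where q: "prime q" "q dvd gcd a (p - 1)" using prime_factor_nat by blast
    then have "q dvd p - 1" "q dvd a" by auto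
    moreover have "0 < p - 1" using prime_gt_1_nat[OF p(1)] by simp
    ultimately have "q < p" "q dvd a" using dvd_imp_le[of q "p - 1"] by linarith+
    then show False using min[of q] q(1) by blast
  qed
  then obtain u v where uv: "a * u = (p - 1) * v + 1" using bezout_nat[of a "p - 1"] assms(1) by auto
  have n2: "\<not> p dvd 2"
  proof
    assume "p dvd 2"
    then have "p dvd 2 ^ a" using assms(1) dvd_power_le[of p 2 1 a] by (metis dvd_power dvd_trans)
    then have "p dvd 2 ^ a - (2 ^ a - 1)" using p1 by (rule dvd_diff_nat)
    then show False using p(1) by (simp add: prime_nat_iff)
  qed
  have "[2 ^ (a * u) = 1] (mod p)" using cong_pow[OF pa, of u] by (simp add: power_mult)
  moreover have "[2 ^ ((p - 1) * v) = 1] (mod p)"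
    using cong_pow[OF fermat_theorem[OF p(1) n2], of v] by (simp add: power_mult)
  then have "[2 ^ (a * u) = 2] (mod p)" using cong_scalar_right[of "2 ^ ((p - 1) * v)" 1 p 2] by (simp add: uv mult.commute)
  ultimately have "[1 = 2] (mod p)" using cong_sym cong_trans by blast
  moreover have "2 < p" using n2 prime_gt_1_nat[OF p(1)] by (metis dvd_refl less_2_cases_iff linorder_neqE_nat not_less_iff_gr_or_eq numeral_2_eq_2 less_Suc_eq One_nat_def)
  ultimately show False by (simp add: cong_def)
qed

text \<open>A conjugate of the inverse of \<open>m\<close> squares \<open>m\<close> by conjugation
  and has the same order, so this order \<open>a\<close> divides \<open>2 ^ a - 1\<close> and
  \<open>m\<close> is trivial. Then the swindle is trivial, and so are the commutators equal to
  \<open>b\<close> and \<open>c\<close>. With \<open>D\<close> the letters \<open>n\<close> and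
  \<open>l\<close> vanish, which leaves \<open>s\<close> conjugate to the unit and \<open>x\<close>
  a commutator with the unit.\<close>

lemma (in group) relators_finite_collapse:
  assumes fin: "finite (carrier G)" and cl: "{b, c, s, x} \<subseteq> carrier G" and D: "{n, m, k, l, r} \<subseteq> generate G {b, c}"
    and rel: "relators G N b c s x n m k l r \<subseteq> {\<one>}"
  shows "b = \<one> \<and> c = \<one> \<and> s = \<one> \<and> x = \<one>"
proof -
  note cl' = generate_bc_closed[OF cl D]
  note R = relatorsD[OF cl' rel]
  define z where "z = inv (r \<otimes> m \<otimes> inv r)"
  have mem: "m \<in> carrier G" "r \<in> carrier G" "z \<in> carrier G" using cl' by (auto simp: z_def)
  have zj: "conjugate G m (z [^] j) = m [^] ((2 :: nat) ^ j)" for j :: nat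
  proof (induction j)
    case (Suc j)
    have "conjugate G m (z [^] Suc j) = conjugate G (conjugate G m (z [^] j)) z" using mem by (simp add: conj_conj)
    also have "\<dots> = conjugate G m z [^] ((2 :: nat) ^ j)" using mem Suc by (simp add: conj_pow)
    also have "\<dots> = m [^] ((2 :: nat) ^ Suc j)"
      using R(4) mem by (simp add: z_def nat_pow_pow flip: nat_pow_mult) (simp add: nat_pow_pow pow_mult_distrib nat_pow_mult mult_2)
    finally show ?case .
  qed (use mem in simp)
  \<comment> \<open>As a conjugate of the inverse of \<open>m\<close>, the element \<open>z\<close>
    is killed by the exponent \<open>ord m\<close>.\<close>
  have "z = conjugate G (inv m) (inv r)" using mem by (simp add: z_def conjugate_def inv_mult_group m_assoc)
  then have "z [^] ord m = \<one>" using mem by (simp add: nat_pow_inv flip: conj_pow)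
  then have "m [^] ((2 :: nat) ^ ord m) = m" using zj[of "ord m"] mem by simp
  then have "m [^] ((2 :: nat) ^ ord m - 1) \<otimes> m = \<one> \<otimes> m" using mem by (simp flip: nat_pow_Suc)
  then have "m [^] ((2 :: nat) ^ ord m - 1) = \<one>" using mem by (simp only: l_one nat_pow_closed r_cancel_one)
  then have "ord m dvd 2 ^ ord m - 1" using mem pow_eq_id by blast
  moreover have "0 < ord m" using ord_ge_1[OF fin mem(1)] by simp
  ultimately have "ord m = 1" by (rule dvd_two_pow_minus_one[rotated])
  then have m1: "m = \<one>" using mem ord_eq_1 by blast
  have hat1: "hat G s \<one> = \<one>" using cl by (simp add: hat_def)
  have "swindle G s x k m = \<one>" using cl cl' m1 hat1 by (simp add: swindle_def)
  then have bc: "b = \<one>" "c = \<one>" using R(8) cl by auto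
  have "generate G {\<one>} = {\<one>}" by (rule generate_one)
  then have nl: "n = \<one>" "l = \<one>" using D bc by auto
  have "s = \<one>" using R(5) nl hat1 cl cl' by simp
  moreover have "x = \<one>" using R(6) nl hat1 cl cl' by simp
  ultimately show ?thesis using bc by simp
qed

text \<open>This is perfectness of the group presented by the three torsion relators. The common
  sixth power of \<open>u\<close> and \<open>v\<close> has order dividing both \<open>N\<close> and
  \<open>N - 2\<close>, which are odd and differ by 2; afterwards 6 is coprime to each of
  them.\<close>

lemma (in group) coprime_orders_trivial:
  fixes N :: nat
  assumes cl: "u \<in> carrier G" "v \<in> carrier G" and com: "u \<otimes> v = v \<otimes> u"
    and N: "N mod 6 = 1" "6 < N"
    and ord: "u [^] N = \<one>" "v [^] (N - 2) = \<one>" "(v \<otimes> inv u) [^] (6 :: nat) = \<one>"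
  shows "u = \<one> \<and> v = \<one>"
proof -
  have vu: "v \<otimes> inv u = inv u \<otimes> v" by (rule commute_inv[OF cl(2,1) com[symmetric]])
  then have "inv (u [^] (6 :: nat)) \<otimes> v [^] (6 :: nat) = \<one>"
    using ord(3) cl pow_mult_distrib[of "inv u" v 6] by (simp add: nat_pow_inv)
  then have e6: "v [^] (6 :: nat) = u [^] (6 :: nat)" using cl by (simp add: eq_of_inv_mult)
  define d where "d = u [^] (6 :: nat)"
  have d: "d \<in> carrier G" using cl by (simp add: d_def)
  have "d [^] N = (u [^] N) [^] (6 :: nat)" using cl by (simp add: d_def nat_pow_pow mult.commute)
  then have "d [^] N = \<one>" using ord(1) by simp
  moreover have "d [^] (N - 2) = (v [^] (N - 2)) [^] (6 :: nat)" using cl by (simp add: d_def e6[symmetric] nat_pow_pow mult.commute)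
  then have "d [^] (N - 2) = \<one>" using ord(2) by simp
  ultimately have "group.ord G d dvd N" "group.ord G d dvd N - 2" using d pow_eq_id by blast+
  moreover have "gcd N (N - 2) = 1"
  proof -
    have "gcd N (N - 2) dvd N - (N - 2)" by (rule dvd_diff_nat[OF gcd_dvd1 gcd_dvd2])
    moreover have "N - (N - 2) = 2" using N by simp
    moreover have "odd N" using N by presburger
    ultimately have "gcd N (N - 2) = 1 \<or> gcd N (N - 2) = 2" "gcd N (N - 2) \<noteq> 2"
      using two_is_prime_nat prime_nat_iff gcd_dvd1[of N "N - 2"] by (metis, metis)
    then show ?thesis by blast
  qed
  ultimately have "group.ord G d dvd 1" by (metis gcd_greatest)
  then have "d = \<one>" using d ord_eq_1 by auto
  then have u6: "u [^] (6 :: nat) = \<one>" and v6: "v [^] (6 :: nat) = \<one>" using e6 by (simp_all add: d_def)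
  have c6: "coprime 6 N"
  proof -
    have "gcd 6 N dvd N mod 6" by (simp add: dvd_mod)
    then show ?thesis using N(1) by (simp add: coprime_iff_gcd_eq_1)
  qed
  have c6': "coprime 6 (N - 2)"
  proof -
    have "gcd 6 (N - 2) dvd (N - 2) mod 6" by (simp add: dvd_mod)
    moreover have "(N - 2) mod 6 = 5"
    proof -
      have a: "N = 6 * (N div 6) + 1" using N(1) mult_div_mod_eq[of 6 N] by linarith
      then have "1 \<le> N div 6" using N(2) by linarith
      then have "N - 2 = 5 + 6 * (N div 6 - 1)" using a by linarith
      then show ?thesis by (simp only: mod_mult_self2) simp
    qed
    ultimately have "gcd 6 (N - 2) dvd 6 - 5" by (metis dvd_diff_nat gcd_dvd1)
    then show ?thesis by (simp add: coprime_iff_gcd_eq_1)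
  qed
  have "group.ord G u dvd 6" "group.ord G u dvd N" "group.ord G v dvd 6" "group.ord G v dvd N - 2"
    using u6 v6 ord cl pow_eq_id by blast+
  then have "group.ord G u = 1" "group.ord G v = 1" using c6 c6' coprime_common_divisor_nat by blast+
  then show ?thesis using cl ord_eq_1 by blast
qed


section \<open>Central extensions\<close>

locale central_extension = C: group C + Q: group Q + p: group_hom C Q p
  for C :: "('c, 'm) monoid_scheme" and Q :: "('q, 'n) monoid_scheme" and p +
  assumes p_surj: "p ` carrier C = carrier Q"
    and central: "\<lbrakk>z \<in> carrier C; p z = \<one>\<^bsub>Q\<^esub>; g \<in> carrier C\<rbrakk> \<Longrightarrow> z \<otimes>\<^bsub>C\<^esub> g = g \<otimes>\<^bsub>C\<^esub> z"
begin

lemma p_conj [simp]: "u \<in> carrier C \<Longrightarrow> v \<in> carrier C \<Longrightarrow> p (conjugate C u v) = conjugate Q (p u) (p v)"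
  by (simp add: conjugate_def)

lemma p_comm [simp]: "u \<in> carrier C \<Longrightarrow> v \<in> carrier C \<Longrightarrow> p (commutator C u v) = commutator Q (p u) (p v)"
  by (simp add: commutator_def)

lemma p_hat [simp]: "u \<in> carrier C \<Longrightarrow> v \<in> carrier C \<Longrightarrow> p (hat C u v) = hat Q (p u) (p v)"
  by (simp add: hat_def)

lemma p_spread [simp]:
  "u \<in> carrier C \<Longrightarrow> v \<in> carrier C \<Longrightarrow> w \<in> carrier C \<Longrightarrow> p (spread C u v w) = spread Q (p u) (p v) (p w)"
  by (simp add: spread_def)

lemma p_swindle [simp]:
  "u \<in> carrier C \<Longrightarrow> v \<in> carrier C \<Longrightarrow> w \<in> carrier C \<Longrightarrow> z \<in> carrier C \<Longrightarrow>
    p (swindle C u v w z) = swindle Q (p u) (p v) (p w) (p z)"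
  by (simp add: swindle_def)

lemma central_factor:
  assumes "g \<in> carrier C" "g' \<in> carrier C" "p g = p g'"
  obtains z where "z \<in> carrier C" "p z = \<one>\<^bsub>Q\<^esub>" "g' = z \<otimes>\<^bsub>C\<^esub> g"
proof (rule that)
  show "g' = (g' \<otimes>\<^bsub>C\<^esub> inv\<^bsub>C\<^esub> g) \<otimes>\<^bsub>C\<^esub> g" using assms by (simp add: C.m_assoc)
qed (use assms in simp_all)

lemma conj_cong:
  assumes "g \<in> carrier C" "y \<in> carrier C" "y' \<in> carrier C" "p y = p y'"
  shows "conjugate C g y = conjugate C g y'"
proof -
  obtain z where z: "z \<in> carrier C" "p z = \<one>\<^bsub>Q\<^esub>" "y' = z \<otimes>\<^bsub>C\<^esub> y"
    using central_factor[OF assms(2,3,4)] .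
  have "conjugate C g y' = conjugate C (conjugate C g z) y" using assms z by (simp add: C.conj_conj)
  also have "conjugate C g z = g" using assms z central[OF z(1,2)] by (intro C.conj_commute) auto
  finally show ?thesis by simp
qed

lemma comm_cong:
  assumes cl: "g \<in> carrier C" "g' \<in> carrier C" "y \<in> carrier C" "y' \<in> carrier C" and e: "p g = p g'" "p y = p y'"
  shows "commutator C g y = commutator C g' y'"
proof -
  obtain z where z: "z \<in> carrier C" "p z = \<one>\<^bsub>Q\<^esub>" "g' = z \<otimes>\<^bsub>C\<^esub> g"
    using central_factor[OF cl(1,2) e(1)] .
  have "conjugate C z y' = z" using z cl central[OF z(1,2)] by (intro C.conj_commute) auto
  then have "commutator C g' y' = inv\<^bsub>C\<^esub> g \<otimes>\<^bsub>C\<^esub> inv\<^bsub>C\<^esub> z \<otimes>\<^bsub>C\<^esub> (z \<otimes>\<^bsub>C\<^esub> conjugate C g y')"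
    using z cl by (simp add: commutator_def C.conj_mult C.inv_mult_group)
  also have "\<dots> = commutator C g y'" using z cl by (simp add: commutator_def C.m_assoc)
  also have "\<dots> = commutator C g y" using conj_cong[OF cl(1,3,4) e(2)] by (simp add: commutator_def)
  finally show ?thesis by simp
qed

end

section \<open>Consequences of the relators in a group\<close>

locale relator_solution = Q: group Q for Q :: "('q, 'n) monoid_scheme" +
  fixes N :: nat and b c s x n m k l r
  assumes sol_closed: "{b, c, s, x} \<subseteq> carrier Q" "{n, m, k, l, r} \<subseteq> generate Q {b, c}"
    and N: "N mod 6 = 1" "6 < N"
    and sol: "relators Q N b c s x n m k l r \<subseteq> {\<one>\<^bsub>Q\<^esub>}"
begin

abbreviation "D \<equiv> generate Q {b, c}"

lemmas cl = Q.generate_bc_closed[OF sol_closed]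
lemmas sol_facts = Q.relatorsD[OF cl sol]

lemma D_sub: "subgroup D Q"
  using sol_closed by (intro Q.generate_is_subgroup) auto

lemma D_closed: "u \<in> D \<Longrightarrow> u \<in> carrier Q"
  using subgroup.mem_carrier[OF D_sub] .

lemma commute_generate:
  assumes u: "u \<in> D" and y: "y \<in> carrier Q" "b \<otimes>\<^bsub>Q\<^esub> y = y \<otimes>\<^bsub>Q\<^esub> b" "c \<otimes>\<^bsub>Q\<^esub> y = y \<otimes>\<^bsub>Q\<^esub> c"
  shows "u \<otimes>\<^bsub>Q\<^esub> y = y \<otimes>\<^bsub>Q\<^esub> u"
  using u
proof (induction rule: generate.induct)
  case (inv h)
  then have h: "h \<in> carrier Q" "h \<otimes>\<^bsub>Q\<^esub> y = y \<otimes>\<^bsub>Q\<^esub> h" using sol_closed y by auto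
  then show ?case using Q.commute_inv[OF y(1) h(1)] by simp
next
  case (eng h h')
  then have "h \<in> carrier Q" "h' \<in> carrier Q" using D_closed by auto
  then show ?case using eng y by (simp add: Q.m_assoc) (simp flip: Q.m_assoc)
qed (use y in auto)

lemma commute_conj:
  assumes u: "u \<in> D" and v: "v \<in> D"
  shows "u \<otimes>\<^bsub>Q\<^esub> conjugate Q v s = conjugate Q v s \<otimes>\<^bsub>Q\<^esub> u"
proof -
  have s: "s \<in> carrier Q" using sol_closed by auto
  have *: "u \<otimes>\<^bsub>Q\<^esub> conjugate Q v s = conjugate Q v s \<otimes>\<^bsub>Q\<^esub> u" if "v \<in> {b, c}" "u \<in> D" for u v
  proof (rule commute_generate[OF that(2)])
    show "conjugate Q v s \<in> carrier Q" using that(1) sol_closed s by auto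
  qed (use sol_facts(7) that(1) in blast)+
  show ?thesis using v
  proof (induction rule: generate.induct)
    case one show ?case using D_closed[OF u] s by simp
  next
    case (incl h) then show ?case using * u by blast
  next
    case (inv h)
    then have h: "h \<in> carrier Q" "u \<otimes>\<^bsub>Q\<^esub> conjugate Q h s = conjugate Q h s \<otimes>\<^bsub>Q\<^esub> u" using * u sol_closed by auto
    then have "u \<otimes>\<^bsub>Q\<^esub> inv\<^bsub>Q\<^esub> conjugate Q h s = inv\<^bsub>Q\<^esub> conjugate Q h s \<otimes>\<^bsub>Q\<^esub> u"
      using D_closed[OF u] s by (intro Q.commute_inv) auto
    then show ?case using h s by (simp add: Q.conj_inv)
  next
    case (eng h h')
    have hc: "h \<in> carrier Q" "h' \<in> carrier Q" "u \<in> carrier Q" using eng.hyps D_closed u by auto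
    have "u \<otimes>\<^bsub>Q\<^esub> (conjugate Q h s \<otimes>\<^bsub>Q\<^esub> conjugate Q h' s) = conjugate Q h s \<otimes>\<^bsub>Q\<^esub> (u \<otimes>\<^bsub>Q\<^esub> conjugate Q h' s)"
      using hc s eng.IH(1) by (simp flip: Q.m_assoc)
    also have "\<dots> = conjugate Q h s \<otimes>\<^bsub>Q\<^esub> conjugate Q h' s \<otimes>\<^bsub>Q\<^esub> u" using hc s eng.IH(2) by (simp add: Q.m_assoc)
    finally show ?case using hc s by (simp add: Q.conj_mult)
  qed
qed

abbreviation "t \<equiv> swindle Q s x k m"

text \<open>The relation, imposed for \<open>b\<close> and \<open>c\<close> only, extends to
  \<open>D\<close>: conjugation by \<open>t\<close> multiplies \<open>conjugate Q u s\<close> by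
  \<open>u\<close>, and this is multiplicative in \<open>u\<close> because \<open>D\<close> commutes
  with its conjugate by \<open>s\<close>.\<close>

lemma swindle_comm:
  assumes "u \<in> D"
  shows "commutator Q (conjugate Q u s) t = u"
proof -
  have mem: "s \<in> carrier Q" "t \<in> carrier Q" "b \<in> carrier Q" "c \<in> carrier Q" using cl by auto
  have "conjugate Q (conjugate Q u s) t = conjugate Q u s \<otimes>\<^bsub>Q\<^esub> u" using assms
  proof (induction rule: generate.induct)
    case one show ?case using mem by simp
  next
    case (incl h)
    then have "h \<in> carrier Q" using mem by auto
    then show ?case using incl sol_facts(8) mem Q.conj_comm[of "conjugate Q h s" t] by auto
  next
    case (inv h)
    then have h: "h \<in> carrier Q" "h \<in> D" using mem by (auto intro: generate.incl)
    then have "conjugate Q (conjugate Q h s) t = conjugate Q h s \<otimes>\<^bsub>Q\<^esub> h"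
      using inv sol_facts(8) mem Q.conj_comm[of "conjugate Q h s" t] by auto
    then have "conjugate Q (conjugate Q h s) t = h \<otimes>\<^bsub>Q\<^esub> conjugate Q h s" using commute_conj[OF h(2) h(2)] by simp
    then show ?case using h mem by (simp add: Q.conj_inv Q.inv_mult_group)
  next
    case (eng h h')
    have hc: "h \<in> carrier Q" "h' \<in> carrier Q" using eng.hyps D_closed by auto
    have "conjugate Q (conjugate Q (h \<otimes>\<^bsub>Q\<^esub> h') s) t = conjugate Q h s \<otimes>\<^bsub>Q\<^esub> (h \<otimes>\<^bsub>Q\<^esub> conjugate Q h' s) \<otimes>\<^bsub>Q\<^esub> h'"
      using hc mem eng.IH by (simp add: Q.conj_mult Q.m_assoc)
    also have "h \<otimes>\<^bsub>Q\<^esub> conjugate Q h' s = conjugate Q h' s \<otimes>\<^bsub>Q\<^esub> h" using commute_conj eng.hyps by blast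
    finally show ?case using hc mem by (simp add: Q.conj_mult Q.m_assoc)
  qed
  then show ?thesis using D_closed[OF assms] mem by (simp add: commutator_def flip: Q.m_assoc)
qed

end

section \<open>Lifting a solution of the relators to a central extension\<close>

locale central_relator_solution = central_extension C Q p + relator_solution Q N b c s x n m k l r
  for C :: "('c, 'm) monoid_scheme" and Q :: "('q, 'n) monoid_scheme" and p N b c s x n m k l r
begin

definition lift where "lift u = (SOME g. g \<in> carrier C \<and> p g = u)"

lemma lift: "u \<in> carrier Q \<Longrightarrow> lift u \<in> carrier C" "u \<in> carrier Q \<Longrightarrow> p (lift u) = u"
proof -
  assume "u \<in> carrier Q"
  then have "u \<in> p ` carrier C" using p_surj by simp
  then have "\<exists>g. g \<in> carrier C \<and> p g = u" by blast
  from someI_ex[OF this] show "lift u \<in> carrier C" "p (lift u) = u" by (simp_all add: lift_def)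
qed

text \<open>The commutator pairing of a central extension is bilinear, so it vanishes on the perfect group \<open>D\<close>.\<close>

lemma commute_lift:
  assumes y: "y \<in> carrier C" "b \<otimes>\<^bsub>Q\<^esub> p y = p y \<otimes>\<^bsub>Q\<^esub> b" "c \<otimes>\<^bsub>Q\<^esub> p y = p y \<otimes>\<^bsub>Q\<^esub> c"
    and g: "g \<in> carrier C" "p g \<in> D"
  shows "g \<otimes>\<^bsub>C\<^esub> y = y \<otimes>\<^bsub>C\<^esub> g"
proof -
  have mem: "b \<in> carrier Q" "c \<in> carrier Q" using sol_closed by auto
  define B E where "B = lift b" and "E = lift c"
  have BE: "B \<in> carrier C" "E \<in> carrier C" "p B = b" "p E = c" using lift mem by (auto simp: B_def E_def)
  define u v where "u = commutator C B y" and "v = commutator C E y"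
  have uv: "u \<in> carrier C" "v \<in> carrier C" using BE y by (auto simp: u_def v_def)
  have pu: "p u = \<one>\<^bsub>Q\<^esub>" "p v = \<one>\<^bsub>Q\<^esub>" using BE y mem by (simp_all add: u_def v_def Q.comm_eq_one_iff)
  \<comment> \<open>If conjugation by \<open>y\<close> multiplies \<open>h\<close> by a central
    \<open>w\<close>, it multiplies the \<open>i\<close>-th power of \<open>h\<close> by that of
    \<open>w\<close>. A power of \<open>h\<close> that is central is not changed, so the torsion of
    \<open>b\<close> and \<open>c\<close> passes to the values of the pairing.\<close>
  have power_trivial: "w [^]\<^bsub>C\<^esub> i = \<one>\<^bsub>C\<^esub>"
    if h: "h \<in> carrier C" "w \<in> carrier C" "p w = \<one>\<^bsub>Q\<^esub>" "conjugate C h y = h \<otimes>\<^bsub>C\<^esub> w" "p h [^]\<^bsub>Q\<^esub> i = \<one>\<^bsub>Q\<^esub>"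
    for h w and i :: nat
  proof -
    have "p (h [^]\<^bsub>C\<^esub> i) = \<one>\<^bsub>Q\<^esub>" using h by (simp add: p.hom_nat_pow)
    then have "conjugate C (h [^]\<^bsub>C\<^esub> i) y = h [^]\<^bsub>C\<^esub> i" using central[of "h [^]\<^bsub>C\<^esub> i"] h y by (intro C.conj_commute) auto
    then have "(h \<otimes>\<^bsub>C\<^esub> w) [^]\<^bsub>C\<^esub> i = h [^]\<^bsub>C\<^esub> i" using h y by (simp add: C.conj_pow)
    then have "h [^]\<^bsub>C\<^esub> i \<otimes>\<^bsub>C\<^esub> w [^]\<^bsub>C\<^esub> i = h [^]\<^bsub>C\<^esub> i"
      using C.pow_mult_distrib[of h w i] central[OF h(2,3,1)] h by simp
    then show ?thesis using h by (simp only: C.l_cancel_one C.nat_pow_closed)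
  qed
  have cj: "conjugate C B y = B \<otimes>\<^bsub>C\<^esub> u" "conjugate C E y = E \<otimes>\<^bsub>C\<^esub> v" using BE y by (simp_all add: u_def v_def C.conj_comm)
  have cd: "conjugate C (E \<otimes>\<^bsub>C\<^esub> inv\<^bsub>C\<^esub> B) y = E \<otimes>\<^bsub>C\<^esub> inv\<^bsub>C\<^esub> B \<otimes>\<^bsub>C\<^esub> (v \<otimes>\<^bsub>C\<^esub> inv\<^bsub>C\<^esub> u)"
  proof -
    have "conjugate C (E \<otimes>\<^bsub>C\<^esub> inv\<^bsub>C\<^esub> B) y = E \<otimes>\<^bsub>C\<^esub> v \<otimes>\<^bsub>C\<^esub> (inv\<^bsub>C\<^esub> u \<otimes>\<^bsub>C\<^esub> inv\<^bsub>C\<^esub> B)"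
      using BE y cj uv by (simp add: C.conj_mult C.conj_inv C.inv_mult_group)
    also have "\<dots> = E \<otimes>\<^bsub>C\<^esub> ((v \<otimes>\<^bsub>C\<^esub> inv\<^bsub>C\<^esub> u) \<otimes>\<^bsub>C\<^esub> inv\<^bsub>C\<^esub> B)" using BE uv by (simp add: C.m_assoc)
    also have "(v \<otimes>\<^bsub>C\<^esub> inv\<^bsub>C\<^esub> u) \<otimes>\<^bsub>C\<^esub> inv\<^bsub>C\<^esub> B = inv\<^bsub>C\<^esub> B \<otimes>\<^bsub>C\<^esub> (v \<otimes>\<^bsub>C\<^esub> inv\<^bsub>C\<^esub> u)" by (rule central) (use BE uv pu in auto)
    finally show ?thesis using BE uv by (simp add: C.m_assoc)
  qed
  have "u = \<one>\<^bsub>C\<^esub> \<and> v = \<one>\<^bsub>C\<^esub>"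
  proof (rule C.coprime_orders_trivial[OF uv central[OF uv(1) pu(1) uv(2)] N])
    show "u [^]\<^bsub>C\<^esub> N = \<one>\<^bsub>C\<^esub>" by (rule power_trivial[OF BE(1) uv(1) pu(1) cj(1)]) (use BE sol_facts(1) in simp)
    show "v [^]\<^bsub>C\<^esub> (N - 2) = \<one>\<^bsub>C\<^esub>" by (rule power_trivial[OF BE(2) uv(2) pu(2) cj(2)]) (use BE sol_facts(2) in simp)
    show "(v \<otimes>\<^bsub>C\<^esub> inv\<^bsub>C\<^esub> u) [^]\<^bsub>C\<^esub> (6 :: nat) = \<one>\<^bsub>C\<^esub>"
      by (rule power_trivial[OF _ _ _ cd]) (use BE uv pu sol_facts(3) in simp_all)
  qed
  then have commB: "B \<otimes>\<^bsub>C\<^esub> y = y \<otimes>\<^bsub>C\<^esub> B" "E \<otimes>\<^bsub>C\<^esub> y = y \<otimes>\<^bsub>C\<^esub> E"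
    using BE y by (simp_all add: u_def v_def C.comm_eq_one_iff)
  \<comment> \<open>The centraliser of \<open>y\<close> contains lifts of \<open>b\<close> and
    \<open>c\<close> as well as the whole kernel, hence the full preimage of
    \<open>D\<close>.\<close>
  define Z where "Z = {g \<in> carrier C. conjugate C g y = g}"
  have Zmul: "g \<otimes>\<^bsub>C\<^esub> h \<in> Z" "inv\<^bsub>C\<^esub> g \<in> Z" if "g \<in> Z" "h \<in> Z" for g h
    using that y by (auto simp: Z_def C.conj_mult C.conj_inv)
  have ker: "z \<in> Z" if "z \<in> carrier C" "p z = \<one>\<^bsub>Q\<^esub>" for z
    using that y central[OF that y(1)] by (auto simp: Z_def intro: C.conj_commute)
  have BZ: "B \<in> Z" "E \<in> Z" using BE y commB by (auto simp: Z_def intro: C.conj_commute)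
  have "\<exists>h \<in> Z. p h = w" if "w \<in> D" for w using that
  proof (induction rule: generate.induct)
    case one show ?case using ker[of "\<one>\<^bsub>C\<^esub>"] by (intro bexI[of _ "\<one>\<^bsub>C\<^esub>"]) auto
  next
    case (incl h) then show ?case using BZ BE by auto
  next
    case (inv h)
    then obtain g where "g \<in> Z" "p g = h" using BZ BE by auto
    then show ?case using Zmul(2) by (intro bexI[of _ "inv\<^bsub>C\<^esub> g"]) (auto simp: Z_def)
  next
    case (eng h h')
    then obtain g g' where "g \<in> Z" "p g = h" "g' \<in> Z" "p g' = h'" by blast
    then show ?case using Zmul(1) by (intro bexI[of _ "g \<otimes>\<^bsub>C\<^esub> g'"]) (auto simp: Z_def)
  qed
  then obtain h where h: "h \<in> Z" "p h = p g" using g by blast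
  then obtain z where "z \<in> carrier C" "p z = \<one>\<^bsub>Q\<^esub>" "g = z \<otimes>\<^bsub>C\<^esub> h"
    using central_factor[of h g] g by (auto simp: Z_def)
  then have "g \<in> Z" using Zmul(1) ker h by auto
  then have "y \<otimes>\<^bsub>C\<^esub> g = y \<otimes>\<^bsub>C\<^esub> conjugate C g y" by (simp add: Z_def)
  then show ?thesis using g y by (simp add: conjugate_def C.m_assoc C.inv_mult_cancel)
qed

lemma commute_lift_conj:
  assumes "g \<in> carrier C" "p g \<in> D" "h \<in> carrier C" "p h \<in> D" "y \<in> carrier C" "p y = s"
  shows "g \<otimes>\<^bsub>C\<^esub> conjugate C h y = conjugate C h y \<otimes>\<^bsub>C\<^esub> g"
  using assms commute_conj[of b "p h"] commute_conj[of c "p h"]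
  by (intro commute_lift) (auto intro: generate.incl)

text \<open>The commutator relation satisfied by \<open>u\<close>, read in \<open>C\<close> at
  arbitrary lifts; by \<open>comm_cong\<close> the choices do not matter.\<close>

definition splitting where "splitting u = commutator C (conjugate C (lift u) (lift s)) (lift t)"

lemma splitting_eq:
  assumes "g \<in> carrier C" "y \<in> carrier C" "w \<in> carrier C" "p y = s" "p w = t"
  shows "splitting (p g) = commutator C (conjugate C g y) w"
  unfolding splitting_def using assms lift[of "p g"] lift[of s] lift[of t] p.hom_closed[of y] p.hom_closed[of w]
  by (intro comm_cong) simp_all

lemma st: "s \<in> carrier Q" "t \<in> carrier Q" using cl by auto

lemma splitting_closed: "u \<in> D \<Longrightarrow> splitting u \<in> carrier C"
  using lift[OF D_closed] lift[OF st(1)] lift[OF st(2)] by (simp add: splitting_def)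

lemma p_splitting: "u \<in> D \<Longrightarrow> p (splitting u) = u"
  using lift[OF D_closed] lift[OF st(1)] lift[OF st(2)] swindle_comm by (simp add: splitting_def)

text \<open>The commutator identity for a product leaves a conjugation of \<open>splitting u\<close>
  by a lift of \<open>conjugate Q v s\<close>. By \<open>commute_lift_conj\<close> these two
  commute, so the conjugation disappears.\<close>

lemma splitting_mult: "u \<in> D \<Longrightarrow> v \<in> D \<Longrightarrow> splitting (u \<otimes>\<^bsub>Q\<^esub> v) = splitting u \<otimes>\<^bsub>C\<^esub> splitting v"
proof -
  assume u: "u \<in> D" and v: "v \<in> D"
  note L = lift[OF D_closed[OF u]] lift[OF D_closed[OF v]] lift[OF st(1)] lift[OF st(2)]
  let ?u = "conjugate C (lift u) (lift s)" and ?v = "conjugate C (lift v) (lift s)"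
  have "splitting (u \<otimes>\<^bsub>Q\<^esub> v) = commutator C (conjugate C (lift u \<otimes>\<^bsub>C\<^esub> lift v) (lift s)) (lift t)"
    using splitting_eq[of "lift u \<otimes>\<^bsub>C\<^esub> lift v" "lift s" "lift t"] L by simp
  also have "\<dots> = commutator C (?u \<otimes>\<^bsub>C\<^esub> ?v) (lift t)" using L by (simp add: C.conj_mult)
  also have "\<dots> = inv\<^bsub>C\<^esub> ?v \<otimes>\<^bsub>C\<^esub> (splitting u \<otimes>\<^bsub>C\<^esub> ?v) \<otimes>\<^bsub>C\<^esub> splitting v"
    using L by (simp add: commutator_def splitting_def C.conj_mult C.inv_mult_group C.m_assoc C.inv_mult_cancel)
  also have "splitting u \<otimes>\<^bsub>C\<^esub> ?v = ?v \<otimes>\<^bsub>C\<^esub> splitting u"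
    using L u v splitting_closed p_splitting by (intro commute_lift_conj) simp_all
  finally show ?thesis using L splitting_closed u v by (simp add: C.m_assoc C.inv_mult_cancel)
qed

lemma splitting_one: "splitting \<one>\<^bsub>Q\<^esub> = \<one>\<^bsub>C\<^esub>"
  using splitting_mult[of "\<one>\<^bsub>Q\<^esub>" "\<one>\<^bsub>Q\<^esub>"] splitting_closed[of "\<one>\<^bsub>Q\<^esub>"] by (simp add: generate.one)

lemma splitting_inv: "u \<in> D \<Longrightarrow> splitting (inv\<^bsub>Q\<^esub> u) = inv\<^bsub>C\<^esub> splitting u"
proof -
  assume u: "u \<in> D"
  then have u': "inv\<^bsub>Q\<^esub> u \<in> D" using subgroup.m_inv_closed[OF D_sub] by blast
  have "splitting (inv\<^bsub>Q\<^esub> u) \<otimes>\<^bsub>C\<^esub> splitting u = \<one>\<^bsub>C\<^esub>"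
    using splitting_mult[OF u' u] D_closed[OF u] by (simp add: splitting_one)
  then show ?thesis using splitting_closed u u' by (metis C.inv_equality)
qed

lemma splitting_pow: "u \<in> D \<Longrightarrow> splitting (u [^]\<^bsub>Q\<^esub> (i :: nat)) = splitting u [^]\<^bsub>C\<^esub> i"
proof (induction i)
  case (Suc i)
  have "u [^]\<^bsub>Q\<^esub> j \<in> D" for j :: nat
    by (induction j) (use Suc.prems in \<open>auto intro: generate.one generate.eng\<close>)
  then show ?case using Suc splitting_mult by simp
qed (simp add: splitting_one)

text \<open>Relators inside \<open>D\<close> hold because \<open>splitting\<close> is
  multiplicative. The relators giving \<open>b\<close> and \<open>c\<close> as commutators hold for
  whatever lifts of \<open>s\<close> and \<open>x\<close>, by the definition of
  \<open>splitting\<close>. The relators for \<open>s\<close> and \<open>x\<close> select the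
  lifts.\<close>

lemma central_lift:
  "\<exists>s' x'. s' \<in> carrier C \<and> x' \<in> carrier C \<and> p s' = s \<and> p x' = x \<and>
    relators C N (splitting b) (splitting c) s' x' (splitting n) (splitting m) (splitting k) (splitting l) (splitting r) \<subseteq> {\<one>\<^bsub>C\<^esub>}"
proof -
  have bD: "b \<in> D" "c \<in> D" by (auto intro: generate.incl)
  have nD: "n \<in> D" "m \<in> D" "k \<in> D" "l \<in> D" "r \<in> D" using sol_closed by auto
  have x: "x \<in> carrier Q" using cl by auto
  note sc [simp] = splitting_closed[OF bD(1)] splitting_closed[OF bD(2)] splitting_closed[OF nD(1)] splitting_closed[OF nD(2)]
    splitting_closed[OF nD(3)] splitting_closed[OF nD(4)] splitting_closed[OF nD(5)]
  note sp [simp] = p_splitting[OF bD(1)] p_splitting[OF bD(2)] p_splitting[OF nD(1)] p_splitting[OF nD(2)]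
    p_splitting[OF nD(3)] p_splitting[OF nD(4)] p_splitting[OF nD(5)]
  note L [simp] = lift[OF st(1)] lift[OF x]
  \<comment> \<open>The right-hand side of the relation for \<open>s\<close> at arbitrary lifts.
    Replacing these lifts by \<open>s'\<close> and \<open>x'\<close> changes only conjugators, by
    central factors, so the value stays the same; \<open>x'\<close> works likewise through a
    commutator.\<close>
  define s' where "s' = conjugate C (hat C (lift s) (splitting n)) (spread C (lift s) (lift x) (splitting k))"
  define x' where "x' = commutator C (conjugate C (lift x) (hat C (lift s) (splitting k))) (hat C (lift s) (splitting l))"
  have s' [simp]: "s' \<in> carrier C" "p s' = s" using sol_facts(5) by (simp_all add: s'_def)
  have x' [simp]: "x' \<in> carrier C" "p x' = x" using sol_facts(6) by (simp_all add: x'_def)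
  have hat_s: "hat C s' u = hat C (lift s) u" if "u \<in> carrier C" for u
  proof -
    have "conjugate C u s' = conjugate C u (lift s)" "conjugate C u (s' \<otimes>\<^bsub>C\<^esub> s') = conjugate C u (lift s \<otimes>\<^bsub>C\<^esub> lift s)"
      by (rule conj_cong; use that in simp)+
    then show ?thesis by (simp add: hat_def)
  qed
  have rm: "splitting (r \<otimes>\<^bsub>Q\<^esub> m \<otimes>\<^bsub>Q\<^esub> inv\<^bsub>Q\<^esub> r) = splitting r \<otimes>\<^bsub>C\<^esub> splitting m \<otimes>\<^bsub>C\<^esub> inv\<^bsub>C\<^esub> splitting r"
    "r \<otimes>\<^bsub>Q\<^esub> m \<otimes>\<^bsub>Q\<^esub> inv\<^bsub>Q\<^esub> r \<in> D"
  proof -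
    have i: "inv\<^bsub>Q\<^esub> r \<in> D" "r \<otimes>\<^bsub>Q\<^esub> m \<in> D" using nD subgroup.m_inv_closed[OF D_sub] by (auto intro: generate.eng)
    then show "splitting (r \<otimes>\<^bsub>Q\<^esub> m \<otimes>\<^bsub>Q\<^esub> inv\<^bsub>Q\<^esub> r) = splitting r \<otimes>\<^bsub>C\<^esub> splitting m \<otimes>\<^bsub>C\<^esub> inv\<^bsub>C\<^esub> splitting r"
      using nD by (simp add: splitting_mult splitting_inv)
    show "r \<otimes>\<^bsub>Q\<^esub> m \<otimes>\<^bsub>Q\<^esub> inv\<^bsub>Q\<^esub> r \<in> D" using i by (auto intro: generate.eng)
  qed
  have "relators C N (splitting b) (splitting c) s' x' (splitting n) (splitting m) (splitting k) (splitting l) (splitting r) \<subseteq> {\<one>\<^bsub>C\<^esub>}"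
  proof (rule C.relatorsI)
    show "splitting b [^]\<^bsub>C\<^esub> N = \<one>\<^bsub>C\<^esub>" "splitting c [^]\<^bsub>C\<^esub> (N - 2) = \<one>\<^bsub>C\<^esub>"
      using sol_facts(1,2) splitting_pow[OF bD(1), of N] splitting_pow[OF bD(2), of "N - 2"] by (simp_all add: splitting_one)
    have "inv\<^bsub>Q\<^esub> b \<in> D" using bD subgroup.m_inv_closed[OF D_sub] by blast
    moreover from this have "c \<otimes>\<^bsub>Q\<^esub> inv\<^bsub>Q\<^esub> b \<in> D" using bD by (blast intro: generate.eng)
    ultimately show "(splitting c \<otimes>\<^bsub>C\<^esub> inv\<^bsub>C\<^esub> splitting b) [^]\<^bsub>C\<^esub> (6 :: nat) = \<one>\<^bsub>C\<^esub>"
      using sol_facts(3) splitting_pow[of "c \<otimes>\<^bsub>Q\<^esub> inv\<^bsub>Q\<^esub> b" 6] bD by (simp add: splitting_one splitting_mult splitting_inv)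
    show "conjugate C (splitting m) (inv\<^bsub>C\<^esub> (splitting r \<otimes>\<^bsub>C\<^esub> splitting m \<otimes>\<^bsub>C\<^esub> inv\<^bsub>C\<^esub> splitting r)) = splitting m \<otimes>\<^bsub>C\<^esub> splitting m"
    proof -
      let ?q = "r \<otimes>\<^bsub>Q\<^esub> m \<otimes>\<^bsub>Q\<^esub> inv\<^bsub>Q\<^esub> r"
      have i: "inv\<^bsub>Q\<^esub> ?q \<in> D" "?q \<in> carrier Q" using rm(2) D_closed subgroup.m_inv_closed[OF D_sub] by blast+
      have "splitting (m \<otimes>\<^bsub>Q\<^esub> m) = splitting (?q \<otimes>\<^bsub>Q\<^esub> m \<otimes>\<^bsub>Q\<^esub> inv\<^bsub>Q\<^esub> ?q)"
        using sol_facts(4) i by (simp add: conjugate_def)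
      also have "\<dots> = splitting ?q \<otimes>\<^bsub>C\<^esub> splitting m \<otimes>\<^bsub>C\<^esub> inv\<^bsub>C\<^esub> splitting ?q"
        using i(1) rm(2) nD generate.eng[OF rm(2) nD(2)] by (simp only: splitting_mult splitting_inv)
      finally show ?thesis using nD splitting_closed[OF rm(2)] by (simp add: splitting_mult conjugate_def flip: rm(1))
    qed
    show "conjugate C (hat C s' (splitting n)) (spread C s' x' (splitting k)) = s'"
      unfolding hat_s[OF sc(3)] s'_def[symmetric]
      by (subst s'_def) (rule conj_cong, simp_all)
    show "commutator C (conjugate C x' (hat C s' (splitting k))) (hat C s' (splitting l)) = x'"
      unfolding hat_s[OF sc(5)] hat_s[OF sc(6)] by (subst (2) x'_def) (rule comm_cong, simp_all)
    show "\<forall>u \<in> {splitting b, splitting c}. \<forall>v \<in> {splitting b, splitting c}. u \<otimes>\<^bsub>C\<^esub> conjugate C v s' = conjugate C v s' \<otimes>\<^bsub>C\<^esub> u"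
      using commute_lift_conj bD by auto
    show "\<forall>u \<in> {splitting b, splitting c}. commutator C (conjugate C u s') (swindle C s' x' (splitting k) (splitting m)) = u"
      using splitting_eq[of "splitting b" s' "swindle C s' x' (splitting k) (splitting m)"]
        splitting_eq[of "splitting c" s' "swindle C s' x' (splitting k) (splitting m)"] by simp
  qed simp
  then show ?thesis using s' x' by blast
qed

end

section \<open>Splitting finite extensions\<close>

lemma finite_index_image:
  assumes "group G" "group K" "h \<in> hom G K" and surj: "h ` carrier G = carrier K" and V: "V \<in> finite_index_normal G"
  shows "h ` V \<in> finite_index_normal K"
proof -
  interpret h: group_hom G K h using assms by (simp add: group_hom_def group_hom_axioms_def)
  have nV: "V \<lhd> G" using V finite_index_normalD by blast
  interpret V: normal V G by (rule nV)
  have Vc: "V \<subseteq> carrier G" using subgroup.subset[OF V.is_subgroup] .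
  have sub: "subgroup (h ` V) K" by (rule h.subgroup_img_is_subgroup[OF V.is_subgroup])
  have "h ` V \<lhd> K"
    unfolding h.H.normal_inv_iff
  proof (intro conjI sub ballI)
    fix a u assume "a \<in> carrier K" "u \<in> h ` V"
    then obtain g v where gv: "g \<in> carrier G" "a = h g" "v \<in> V" "u = h v" using surj by blast
    then have "g \<otimes>\<^bsub>G\<^esub> v \<otimes>\<^bsub>G\<^esub> inv\<^bsub>G\<^esub> g \<in> V" by (intro V.inv_op_closed2)
    moreover have "h (g \<otimes>\<^bsub>G\<^esub> v \<otimes>\<^bsub>G\<^esub> inv\<^bsub>G\<^esub> g) = a \<otimes>\<^bsub>K\<^esub> u \<otimes>\<^bsub>K\<^esub> inv\<^bsub>K\<^esub> a" using gv Vc by auto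
    ultimately show "a \<otimes>\<^bsub>K\<^esub> u \<otimes>\<^bsub>K\<^esub> inv\<^bsub>K\<^esub> a \<in> h ` V" by (metis image_eqI)
  qed
  moreover have "finite (rcosets\<^bsub>K\<^esub> (h ` V))"
  proof -
    define r where "r a = (SOME g. g \<in> carrier G \<and> h g = a)" for a
    have r: "r a \<in> carrier G \<and> h (r a) = a" if "a \<in> carrier K" for a
    proof -
      have "a \<in> h ` carrier G" using that surj by simp
      then have "\<exists>g. g \<in> carrier G \<and> h g = a" by blast
      from someI_ex[OF this] show ?thesis by (simp add: r_def)
    qed
    show ?thesis
    proof (rule finite_rcosetsI[OF assms(2) sub, where h = "\<lambda>a. V #>\<^bsub>G\<^esub> r a"])
      show "finite ((\<lambda>a. V #>\<^bsub>G\<^esub> r a) ` carrier K)"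
        by (rule finite_subset[OF _ coset_image_finite[OF V]]) (use r in auto)
    next
      fix a a' assume a: "a \<in> carrier K" "a' \<in> carrier K" "V #>\<^bsub>G\<^esub> r a = V #>\<^bsub>G\<^esub> r a'"
      then have "r a \<otimes>\<^bsub>G\<^esub> inv\<^bsub>G\<^esub> r a' \<in> V" using coset_eq_iff[OF nV] r by blast
      then have "h (r a \<otimes>\<^bsub>G\<^esub> inv\<^bsub>G\<^esub> r a') \<in> h ` V" by blast
      then show "a \<otimes>\<^bsub>K\<^esub> inv\<^bsub>K\<^esub> a' \<in> h ` V" using r[OF a(1)] r[OF a(2)] by simp
    qed
  qed
  ultimately show ?thesis by (simp add: finite_index_normal_def)
qed

section \<open>Absence of finite quotients\<close>

locale generated_solution = relator_solution Q N b c s x n m k l r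
  for Q :: "('q, 'n) monoid_scheme" and N b c s x n m k l r +
  assumes gens: "generate Q {b, c, s, x} = carrier Q"
begin

lemma no_finite_quotient:
  assumes Y: "Y \<in> finite_index_normal Q"
  shows "Y = carrier Q"
proof -
  have nY: "Y \<lhd> Q" using Y finite_index_normalD by blast
  interpret Y: normal Y Q by (rule nY)
  interpret R: group "Q Mod Y" by (rule Y.factorgroup_is_group)
  interpret \<pi>: group_hom Q "Q Mod Y" "\<lambda>u. Y #>\<^bsub>Q\<^esub> u" by unfold_locales (rule hom_coset[OF nY])
  have gc: "generate (Q Mod Y) {Y #>\<^bsub>Q\<^esub> b, Y #>\<^bsub>Q\<^esub> c} = (\<lambda>u. Y #>\<^bsub>Q\<^esub> u) ` D"
    using \<pi>.generate_img[of "{b, c}"] sol_closed by simp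
  have "Y #>\<^bsub>Q\<^esub> b = \<one>\<^bsub>Q Mod Y\<^esub> \<and> Y #>\<^bsub>Q\<^esub> c = \<one>\<^bsub>Q Mod Y\<^esub> \<and> Y #>\<^bsub>Q\<^esub> s = \<one>\<^bsub>Q Mod Y\<^esub> \<and> Y #>\<^bsub>Q\<^esub> x = \<one>\<^bsub>Q Mod Y\<^esub>"
  proof (rule R.relators_finite_collapse[where N = N])
    show "finite (carrier (Q Mod Y))" unfolding carrier_Mod by (rule coset_image_finite[OF Y])
    show "{Y #>\<^bsub>Q\<^esub> b, Y #>\<^bsub>Q\<^esub> c, Y #>\<^bsub>Q\<^esub> s, Y #>\<^bsub>Q\<^esub> x} \<subseteq> carrier (Q Mod Y)"
      using sol_closed by (simp add: carrier_Mod)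
    show "{Y #>\<^bsub>Q\<^esub> n, Y #>\<^bsub>Q\<^esub> m, Y #>\<^bsub>Q\<^esub> k, Y #>\<^bsub>Q\<^esub> l, Y #>\<^bsub>Q\<^esub> r} \<subseteq> generate (Q Mod Y) {Y #>\<^bsub>Q\<^esub> b, Y #>\<^bsub>Q\<^esub> c}"
      unfolding gc using sol_closed by simp
    show "relators (Q Mod Y) N (Y #>\<^bsub>Q\<^esub> b) (Y #>\<^bsub>Q\<^esub> c) (Y #>\<^bsub>Q\<^esub> s) (Y #>\<^bsub>Q\<^esub> x) (Y #>\<^bsub>Q\<^esub> n) (Y #>\<^bsub>Q\<^esub> m)
        (Y #>\<^bsub>Q\<^esub> k) (Y #>\<^bsub>Q\<^esub> l) (Y #>\<^bsub>Q\<^esub> r) \<subseteq> {\<one>\<^bsub>Q Mod Y\<^esub>}"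
      unfolding \<pi>.relators_image[OF cl, of N] using sol \<pi>.hom_one by auto
  qed
  then have "{b, c, s, x} \<subseteq> Y" using coset_eq_self_iff[OF nY] sol_closed by (simp add: one_Mod)
  then show ?thesis
    using Q.generate_subgroup_incl[OF _ Y.is_subgroup] gens subgroup.subset[OF Y.is_subgroup] by blast
qed

text \<open>In a finite group the trivial subgroup would have finite index, against
  \<open>no_finite_quotient\<close> as soon as one generator is non-trivial.\<close>

lemma infinite_carrier: "s \<noteq> \<one>\<^bsub>Q\<^esub> \<Longrightarrow> infinite (carrier Q)"
proof
  assume s: "s \<noteq> \<one>\<^bsub>Q\<^esub>" and fin: "finite (carrier Q)"
  have "finite (rcosets\<^bsub>Q\<^esub> {\<one>\<^bsub>Q\<^esub>})"
    by (rule finite_rcosetsI[OF Q.group_axioms Q.triv_subgroup, where h = id]) (use fin in auto)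
  then have "{\<one>\<^bsub>Q\<^esub>} \<in> finite_index_normal Q" by (simp add: finite_index_normal_def Q.one_is_normal)
  then have "s \<in> {\<one>\<^bsub>Q\<^esub>}" using no_finite_quotient sol_closed by auto
  then show False using s by simp
qed

text \<open>The form in which the absence of finite quotients is used throughout: passing to a
  normal subgroup of finite index does not lose surjectivity onto \<open>Q\<close>.\<close>

lemma finite_index_onto:
  assumes "group G" "h \<in> hom G Q" "h ` carrier G = carrier Q" "V \<in> finite_index_normal G"
  shows "h ` V = carrier Q"
  by (rule no_finite_quotient[OF finite_index_image[OF assms(1) Q.group_axioms assms(2-4)]])

end

lemma (in group) normal_closure:
  assumes "R \<subseteq> carrier G"
  shows "normal_closure G R \<lhd> G" "R \<subseteq> normal_closure G R"
    "\<And>K. K \<lhd> G \<Longrightarrow> R \<subseteq> K \<Longrightarrow> normal_closure G R \<subseteq> K"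
proof -
  have "subgroup (normal_closure G R) G"
    unfolding normal_closure_def
    by (rule subgroups_Inter) (use assms normal_self normal_imp_subgroup in blast)+
  then show "normal_closure G R \<lhd> G"
    by (auto simp: normal_inv_iff) (auto simp: normal_closure_def normal_inv_iff)
qed (auto simp: normal_closure_def)

section \<open>The quotient of the free product and its finite extensions\<close>

locale encoding = free_pair H "{..<4 :: nat}" for H :: "('b, 'e) monoid_scheme" +
  fixes X and N :: nat and w n m k l r
  assumes X: "X \<subseteq> carrier H" "generate H X = carrier H"
    and words: "{n, m, k, l, r} \<subseteq> generate (free_group {..<4 :: nat}) {free_gen 0, free_gen 1}"
      "w ` X \<subseteq> generate (free_group {..<4 :: nat}) {free_gen 0, free_gen 1}"
    and N: "N mod 6 = 1" "6 < N"
begin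

abbreviation F where "F \<equiv> free_group {..<4 :: nat}"

definition F_rels where "F_rels = relators F N (free_gen 0) (free_gen 1) (free_gen 2) (free_gen 3) n m k l r"

text \<open>The first family identifies each generator of \<Gamma> with a word in the first two free
  generators. It puts the image of \<Gamma> inside \<open>D\<close> and makes \<open>F\<close> alone
  map onto \<open>Q\<close>.\<close>

definition R where "R = (\<lambda>g. inv\<^bsub>P\<^esub> inr g \<otimes>\<^bsub>P\<^esub> inl (w g)) ` X \<union> inl ` F_rels"

definition N1 where "N1 = normal_closure P R"

definition Q where "Q = P Mod N1"

definition q where "q a = N1 #>\<^bsub>P\<^esub> a"

sublocale inl: group_hom F P inl by unfold_locales (rule inl_hom)

lemma fg_closed: "i < 4 \<Longrightarrow> free_gen i \<in> carrier F"
  by (rule free_gen_closed) simp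

lemma F_cl: "{free_gen 0, free_gen 1, free_gen 2, free_gen 3, n, m, k, l, r} \<subseteq> carrier F"
  using fg_closed by (intro G.generate_bc_closed[OF _ words(1)]) simp

lemma w_closed: "g \<in> X \<Longrightarrow> w g \<in> carrier F"
  using words(2) G.generate_incl[of "{free_gen 0, free_gen 1}"] fg_closed by auto

lemma F_rels_closed: "F_rels \<subseteq> carrier F"
  using F_cl by (simp add: F_rels_def relators_def)

lemma R_closed: "R \<subseteq> carrier P"
  using F_rels_closed w_closed X by (auto simp: R_def)

lemma finite_R: "finite X \<Longrightarrow> finite R"
  by (simp add: R_def F_rels_def)

lemmas N1_normal = P.normal_closure(1)[OF R_closed, folded N1_def]
lemmas R_N1 = P.normal_closure(2)[OF R_closed, folded N1_def]
lemmas N1_least = P.normal_closure(3)[OF R_closed, folded N1_def]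

lemma N1_sub: "subgroup N1 P" by (rule normal_imp_subgroup[OF N1_normal])

lemma N1_closed: "v \<in> N1 \<Longrightarrow> v \<in> carrier P" using subgroup.mem_carrier[OF N1_sub] .

sublocale Q: group Q unfolding Q_def by (rule normal.factorgroup_is_group[OF N1_normal])

sublocale q: group_hom P Q q
  by unfold_locales (use hom_coset[OF N1_normal] in \<open>simp add: q_def[abs_def] Q_def\<close>)

lemma q_surj: "q ` carrier P = carrier Q" by (simp add: carrier_Mod q_def[abs_def] Q_def)

lemma q_one_iff: "a \<in> carrier P \<Longrightarrow> q a = \<one>\<^bsub>Q\<^esub> \<longleftrightarrow> a \<in> N1"
  using coset_eq_self_iff[OF N1_normal] by (simp add: q_def Q_def one_Mod)

lemma kernel_q: "kernel P Q q = N1"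
  using q_one_iff N1_closed by (auto simp: kernel_def)

lemma q_inr: "g \<in> X \<Longrightarrow> q (inr g) = q (inl (w g))"
proof -
  assume g: "g \<in> X"
  then have cl: "inr g \<in> carrier P" "inl (w g) \<in> carrier P" using X w_closed by auto
  have "inv\<^bsub>P\<^esub> inr g \<otimes>\<^bsub>P\<^esub> inl (w g) \<in> N1" using g R_N1 by (auto simp: R_def)
  then have "q (inv\<^bsub>P\<^esub> inr g \<otimes>\<^bsub>P\<^esub> inl (w g)) = \<one>\<^bsub>Q\<^esub>" using cl by (simp only: q_one_iff P.m_closed P.inv_closed)
  then have "inv\<^bsub>Q\<^esub> q (inr g) \<otimes>\<^bsub>Q\<^esub> q (inl (w g)) = \<one>\<^bsub>Q\<^esub>" using cl by simp
  then show ?thesis using cl by (simp only: Q.eq_of_inv_mult q.hom_closed)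
qed

lemma qinl_generate:
  assumes "U \<subseteq> carrier F"
  shows "(\<lambda>u. q (inl u)) ` generate F U = generate Q ((\<lambda>u. q (inl u)) ` U)"
proof -
  interpret qi: group_hom F Q "\<lambda>u. q (inl u)"
    by unfold_locales (use hom_compose[OF inl.homh q.homh] in \<open>simp add: comp_def\<close>)
  show ?thesis using assms by (simp add: qi.generate_img)
qed

lemma qinl_D: "(\<lambda>u. q (inl u)) ` generate F {free_gen 0, free_gen 1} = generate Q {q (inl (free_gen 0)), q (inl (free_gen 1))}"
  using qinl_generate[of "{free_gen 0, free_gen 1}"] fg_closed by simp

lemma q_inr_D: "g \<in> carrier H \<Longrightarrow> q (inr g) \<in> generate Q {q (inl (free_gen 0)), q (inl (free_gen 1))}"
proof -
  let ?D = "generate Q {q (inl (free_gen 0)), q (inl (free_gen 1))}"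
  interpret qr: group_hom H Q "\<lambda>u. q (inr u)"
    by unfold_locales (use hom_compose[OF inr_hom q.homh] in \<open>simp add: comp_def\<close>)
  assume "g \<in> carrier H"
  then have "q (inr g) \<in> (\<lambda>u. q (inr u)) ` generate H X" using X by simp
  also have "\<dots> = generate Q ((\<lambda>u. q (inr u)) ` X)" using X by (simp add: qr.generate_img)
  also have "\<dots> \<subseteq> ?D"
  proof (rule Q.generate_subgroup_incl)
    show "(\<lambda>u. q (inr u)) ` X \<subseteq> ?D" using q_inr words(2) unfolding qinl_D[symmetric] by fastforce
    show "subgroup ?D Q" by (rule Q.generate_is_subgroup) (use fg_closed in simp)
  qed
  finally show ?thesis .
qed

sublocale generated_solution Q N "q (inl (free_gen 0))" "q (inl (free_gen 1))" "q (inl (free_gen 2))" "q (inl (free_gen 3))"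
  "q (inl n)" "q (inl m)" "q (inl k)" "q (inl l)" "q (inl r)"
proof (unfold_locales)
  let ?h = "\<lambda>u. q (inl u)"
  interpret qi: group_hom F Q ?h
    by unfold_locales (use hom_compose[OF inl.homh q.homh] in \<open>simp add: comp_def\<close>)
  show "{?h (free_gen 0), ?h (free_gen 1), ?h (free_gen 2), ?h (free_gen 3)} \<subseteq> carrier Q" using fg_closed by simp
  show "{?h n, ?h m, ?h k, ?h l, ?h r} \<subseteq> generate Q {?h (free_gen 0), ?h (free_gen 1)}"
    using words(1) unfolding qinl_D[symmetric] by auto
  show "N mod 6 = 1" "6 < N" by (rule N)+
  have "?h ` F_rels \<subseteq> {\<one>\<^bsub>Q\<^esub>}"
  proof
    fix z assume "z \<in> ?h ` F_rels"
    then obtain u where u: "u \<in> F_rels" "z = q (inl u)" by blast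
    then have "inl u \<in> N1" using R_N1 by (auto simp: R_def)
    then show "z \<in> {\<one>\<^bsub>Q\<^esub>}" using u q_one_iff N1_closed by simp
  qed
  then show "relators Q N (?h (free_gen 0)) (?h (free_gen 1)) (?h (free_gen 2)) (?h (free_gen 3)) (?h n) (?h m) (?h k) (?h l) (?h r) \<subseteq> {\<one>\<^bsub>Q\<^esub>}"
    unfolding qi.relators_image[OF F_cl] F_rels_def by simp
  let ?U = "{?h (free_gen 0), ?h (free_gen 1), ?h (free_gen 2), ?h (free_gen 3)}"
  have sub: "subgroup (generate Q ?U) Q" by (rule Q.generate_is_subgroup) (use fg_closed in simp)
  have "q ` (gen ` {..<4} \<union> inr ` carrier H) \<subseteq> generate Q ?U"
  proof -
    have "q (gen i) \<in> generate Q ?U" if "i < 4" for i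
    proof -
      have "i = 0 \<or> i = 1 \<or> i = 2 \<or> i = 3" using that by linarith
      then show ?thesis by (auto simp: gen_def intro: generate.incl)
    qed
    moreover have "q (inr g) \<in> generate Q ?U" if "g \<in> carrier H" for g
      using q_inr_D[OF that] Q.mono_generate[of "{?h (free_gen 0), ?h (free_gen 1)}" ?U] by blast
    ultimately show ?thesis by auto
  qed
  then have "generate Q (q ` (gen ` {..<4} \<union> inr ` carrier H)) \<subseteq> generate Q ?U"
    by (rule Q.generate_subgroup_incl[OF _ sub])
  moreover have "generate Q (q ` (gen ` {..<4} \<union> inr ` carrier H)) = carrier Q"
  proof -
    have "gen ` {..<4} \<union> inr ` carrier H \<subseteq> carrier P" by auto
    then show ?thesis by (simp only: q.generate_img generate_gens q_surj)
  qed
  ultimately show "generate Q ?U = carrier Q" using subgroup.subset[OF sub] by blast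
qed

lemma qinl_surj: "(\<lambda>u. q (inl u)) ` carrier F = carrier Q"
proof -
  have "generate Q {q (inl (free_gen 0)), q (inl (free_gen 1)), q (inl (free_gen 2)), q (inl (free_gen 3))} \<subseteq> (\<lambda>u. q (inl u)) ` carrier F"
  proof -
    have "(\<lambda>u. q (inl u)) ` generate F {free_gen 0, free_gen 1, free_gen 2, free_gen 3}
        = generate Q ((\<lambda>u. q (inl u)) ` {free_gen 0, free_gen 1, free_gen 2, free_gen 3})"
      by (rule qinl_generate) (use fg_closed in simp)
    moreover have "generate F {free_gen 0, free_gen 1, free_gen 2, free_gen 3} \<subseteq> carrier F"
      by (rule G.generate_incl) (use fg_closed in simp)
    ultimately have "generate Q ((\<lambda>u. q (inl u)) ` {free_gen 0, free_gen 1, free_gen 2, free_gen 3}) \<subseteq> (\<lambda>u. q (inl u)) ` carrier F"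
      by (metis image_mono)
    then show ?thesis by (simp only: image_insert image_empty)
  qed
  then have "carrier Q \<subseteq> (\<lambda>u. q (inl u)) ` carrier F" using gens by simp
  moreover have "q (inl u) \<in> carrier Q" if "u \<in> carrier F" for u using that by simp
  ultimately show ?thesis by blast
qed

text \<open>The extension acts by conjugation on its finite kernel, so the centraliser
  \<open>Z\<close> of the kernel has finite index and still maps onto \<open>Q\<close>. Restricted
  to \<open>Z\<close> the extension is central, and the lifted solution of the relators there
  defines \<Psi>.\<close>

lemma lift_through_finite_kernel:
  fixes E :: "('x, 'y) monoid_scheme"
  assumes "group E" and ph: "p \<in> hom E Q" and ps: "p ` carrier E = carrier Q" and fin: "finite (kernel E Q p)"
  shows "\<exists>\<Psi> \<in> hom P E. (\<forall>a \<in> carrier P. p (\<Psi> a) = q a) \<and> (\<forall>a \<in> N1. \<Psi> a = \<one>\<^bsub>E\<^esub>) \<and>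
    (\<forall>a \<in> carrier P. \<forall>z \<in> kernel E Q p. \<Psi> a \<otimes>\<^bsub>E\<^esub> z = z \<otimes>\<^bsub>E\<^esub> \<Psi> a)"
proof -
  interpret E: group E by fact
  interpret p: group_hom E Q p by unfold_locales (rule ph)
  let ?K = "kernel E Q p"
  have Kc: "z \<in> carrier E" "p z = \<one>\<^bsub>Q\<^esub>" if "z \<in> ?K" for z using that by (auto simp: kernel_def)
  define act where "act = (\<lambda>e z. e \<otimes>\<^bsub>E\<^esub> z \<otimes>\<^bsub>E\<^esub> inv\<^bsub>E\<^esub> e)"
  have act: "(\<lambda>e. restrict (act e) ?K) \<in> hom E (BijGroup ?K)"
  proof (rule hom_BijGroupI[OF assms(1)])
    show "act e z \<in> ?K" if "e \<in> carrier E" "z \<in> ?K" for e z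
      using that Kc[OF that(2)] by (simp add: act_def kernel_def)
    show "act \<one>\<^bsub>E\<^esub> z = z" if "z \<in> ?K" for z using Kc[OF that] by (simp add: act_def)
    show "act (a \<otimes>\<^bsub>E\<^esub> b) u = act a (act b u)" if "a \<in> carrier E" "b \<in> carrier E" "u \<in> ?K" for a b u
      using that Kc[OF that(3)] by (simp add: act_def E.m_assoc E.inv_mult_group)
  qed
  define Z where "Z = {e \<in> carrier E. \<forall>z \<in> ?K. e \<otimes>\<^bsub>E\<^esub> z = z \<otimes>\<^bsub>E\<^esub> e}"
  have "kernel E (BijGroup ?K) (\<lambda>e. restrict (act e) ?K) = Z"
  proof -
    have "restrict (act e) ?K = \<one>\<^bsub>BijGroup ?K\<^esub> \<longleftrightarrow> (\<forall>z \<in> ?K. e \<otimes>\<^bsub>E\<^esub> z = z \<otimes>\<^bsub>E\<^esub> e)" if e: "e \<in> carrier E" for e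
    proof -
      have "restrict (act e) ?K = \<one>\<^bsub>BijGroup ?K\<^esub> \<longleftrightarrow> (\<forall>z \<in> ?K. act e z = z)"
        by (auto simp: BijGroup_def restrict_def fun_eq_iff)
      moreover have "act e z = z \<longleftrightarrow> e \<otimes>\<^bsub>E\<^esub> z = z \<otimes>\<^bsub>E\<^esub> e" if z: "z \<in> ?K" for z
        using E.inv_solve_right'[of z "e \<otimes>\<^bsub>E\<^esub> z" e] e Kc[OF z] by (auto simp: act_def)
      ultimately show ?thesis by auto
    qed
    then show ?thesis by (auto simp: kernel_def Z_def)
  qed
  moreover have "kernel E (BijGroup ?K) (\<lambda>e. restrict (act e) ?K) \<in> finite_index_normal E"
  proof (rule finite_index_kernel[OF assms(1) group_BijGroup act])
    show "finite ((\<lambda>e. restrict (act e) ?K) ` carrier E)"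
      by (rule finite_subset[OF _ finite_carrier_BijGroup[OF fin]]) (use hom_in_carrier[OF act] in auto)
  qed
  ultimately have Zf: "Z \<in> finite_index_normal E" by simp
  have pZ: "p ` Z = carrier Q" by (rule finite_index_onto[OF assms(1) ph ps Zf])
  have Zsub: "subgroup Z E" using Zf finite_index_normalD(1) normal_imp_subgroup by blast
  let ?C = "E\<lparr>carrier := Z\<rparr>"
  interpret C: group ?C by (rule E.subgroup_imp_group[OF Zsub])
  have Zc: "z \<in> carrier E" if "z \<in> Z" for z using that by (simp add: Z_def)
  interpret ce: central_relator_solution ?C Q p N "q (inl (free_gen 0))" "q (inl (free_gen 1))" "q (inl (free_gen 2))" "q (inl (free_gen 3))"
    "q (inl n)" "q (inl m)" "q (inl k)" "q (inl l)" "q (inl r)"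
  proof unfold_locales
    show "p \<in> hom ?C Q" using ph Zc by (auto simp: hom_def)
    show "p ` carrier ?C = carrier Q" using pZ by simp
    show "z \<otimes>\<^bsub>?C\<^esub> g = g \<otimes>\<^bsub>?C\<^esub> z" if "z \<in> carrier ?C" "p z = \<one>\<^bsub>Q\<^esub>" "g \<in> carrier ?C" for z g
    proof -
      have "z \<in> ?K" using that Zc by (simp add: kernel_def)
      then show ?thesis using that by (simp add: Z_def)
    qed
  qed
  obtain s' x' where s': "s' \<in> Z" "x' \<in> Z" "p s' = q (inl (free_gen 2))" "p x' = q (inl (free_gen 3))" and
    rel: "relators ?C N (ce.splitting (q (inl (free_gen 0)))) (ce.splitting (q (inl (free_gen 1)))) s' x'
      (ce.splitting (q (inl n))) (ce.splitting (q (inl m))) (ce.splitting (q (inl k))) (ce.splitting (q (inl l)))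
      (ce.splitting (q (inl r))) \<subseteq> {\<one>\<^bsub>?C\<^esub>}"
    using ce.central_lift by auto
  define ys where "ys i = (if i = 0 then ce.splitting (q (inl (free_gen 0))) else if i = 1 then ce.splitting (q (inl (free_gen 1)))
    else if i = 2 then s' else x')" for i :: nat
  have D01: "q (inl (free_gen 0)) \<in> D" "q (inl (free_gen 1)) \<in> D" by (auto intro: generate.incl)
  have ys: "ys i \<in> carrier ?C" for i
    using ce.splitting_closed[OF D01(1)] ce.splitting_closed[OF D01(2)] s' by (simp add: ys_def)
  have fr: "free_hom ?C ys \<in> hom F ?C" by (rule free_hom_hom[OF C.group_axioms]) (rule ys)
  have gr: "(\<lambda>g. ce.splitting (q (inr g))) \<in> hom H ?C"
  proof (rule homI)
    show "ce.splitting (q (inr g)) \<in> carrier ?C" if "g \<in> carrier H" for g using ce.splitting_closed[OF q_inr_D[OF that]] .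
    show "ce.splitting (q (inr (g \<otimes>\<^bsub>H\<^esub> h))) = ce.splitting (q (inr g)) \<otimes>\<^bsub>?C\<^esub> ce.splitting (q (inr h))"
      if "g \<in> carrier H" "h \<in> carrier H" for g h
      using ce.splitting_mult[OF q_inr_D[OF that(1)] q_inr_D[OF that(2)]] that by (simp add: inr_mult)
  qed
  define \<Psi> where "\<Psi> = fp_hom ?C (free_hom ?C ys) (\<lambda>g. ce.splitting (q (inr g)))"
  have \<Psi>: "\<Psi> \<in> hom P ?C" unfolding \<Psi>_def by (rule fp_hom_hom[OF C.group_axioms fr gr])
  interpret \<Psi>: group_hom P ?C \<Psi> by unfold_locales (rule \<Psi>)
  have \<Psi>r: "\<Psi> (inr g) = ce.splitting (q (inr g))" if "g \<in> carrier H" for g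
    unfolding \<Psi>_def by (rule fp_hom_inr[OF C.group_axioms fr gr that])
  have \<Psi>g: "\<Psi> (inl (free_gen i)) = ys i" if "i < 4" for i
    unfolding \<Psi>_def using fp_hom_inl[OF C.group_axioms fr gr fg_closed[OF that]]
      free_hom_gen[OF C.group_axioms ys, of i "{..<4}"] that by simp
  interpret \<Psi>i: group_hom F ?C "\<lambda>u. \<Psi> (inl u)"
    by unfold_locales (use hom_compose[OF inl.homh \<Psi>.homh] in \<open>simp add: comp_def\<close>)
  \<comment> \<open>On words in the first two generators \<Psi> agrees with
    \<open>splitting\<close>, which was also used to define it on \<Gamma>. Hence the relators tying
    \<Gamma> to words are respected.\<close>
  have \<Psi>D: "\<Psi> (inl u) = ce.splitting (q (inl u))" if "u \<in> generate F {free_gen 0, free_gen 1}" for u using that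
  proof (induction rule: generate.induct)
    case one show ?case by (simp only: inl.hom_one q.hom_one \<Psi>.hom_one ce.splitting_one)
  next
    case (incl h) then show ?case using \<Psi>g[of 0] \<Psi>g[of 1] by (auto simp: ys_def)
  next
    case (inv h)
    then have h: "h \<in> carrier F" "q (inl h) \<in> D" "\<Psi> (inl h) = ce.splitting (q (inl h))"
      using fg_closed \<Psi>g[of 0] \<Psi>g[of 1] D01 by (auto simp: ys_def)
    then show ?case using \<Psi>i.hom_inv[OF h(1)] ce.splitting_inv[OF h(2)] by simp
  next
    case (eng h h')
    have h: "h \<in> carrier F" "h' \<in> carrier F"
      using eng.hyps G.generate_incl[of "{free_gen 0, free_gen 1}"] fg_closed by auto
    have "q (inl h) \<in> D" "q (inl h') \<in> D" using eng.hyps unfolding qinl_D[symmetric] by auto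
    then show ?case using \<Psi>i.hom_mult[OF h] eng.IH ce.splitting_mult h by simp
  qed
  have "R \<subseteq> kernel P ?C \<Psi>"
  proof -
    have "inv\<^bsub>P\<^esub> inr g \<otimes>\<^bsub>P\<^esub> inl (w g) \<in> kernel P ?C \<Psi>" if g: "g \<in> X" for g
    proof -
      have c: "inr g \<in> carrier P" "inl (w g) \<in> carrier P" using g X w_closed by auto
      have "g \<in> carrier H" "w g \<in> generate F {free_gen 0, free_gen 1}" using g X words(2) by blast+
      then have "\<Psi> (inr g) = \<Psi> (inl (w g))" by (simp only: \<Psi>r \<Psi>D q_inr[OF g])
      then have "\<Psi> (inv\<^bsub>P\<^esub> inr g \<otimes>\<^bsub>P\<^esub> inl (w g)) = inv\<^bsub>?C\<^esub> \<Psi> (inl (w g)) \<otimes>\<^bsub>?C\<^esub> \<Psi> (inl (w g))"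
        using c \<Psi>.hom_mult[of "inv\<^bsub>P\<^esub> inr g" "inl (w g)"] \<Psi>.hom_inv[of "inr g"] by (simp only: P.inv_closed)
      also have "\<dots> = \<one>\<^bsub>?C\<^esub>" by (rule C.l_inv[OF \<Psi>.hom_closed[OF c(2)]])
      finally show ?thesis using c by (simp add: kernel_def)
    qed
    moreover have "inl u \<in> kernel P ?C \<Psi>" if u: "u \<in> F_rels" for u
    proof -
      have "(\<lambda>u. \<Psi> (inl u)) ` F_rels \<subseteq> {\<one>\<^bsub>?C\<^esub>}"
        unfolding F_rels_def \<Psi>i.relators_image[OF F_cl, symmetric]
        using rel \<Psi>g[of 0] \<Psi>g[of 1] \<Psi>g[of 2] \<Psi>g[of 3] \<Psi>D[of n] \<Psi>D[of m] \<Psi>D[of k] \<Psi>D[of l] \<Psi>D[of r] words(1)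
        by (simp add: ys_def)
      then show ?thesis using u F_rels_closed by (auto simp: kernel_def)
    qed
    ultimately show ?thesis by (auto simp: R_def)
  qed
  then have N1k: "N1 \<subseteq> kernel P ?C \<Psi>" by (rule N1_least[OF \<Psi>.normal_kernel])
  have "p (\<Psi> a) = q a" if a: "a \<in> carrier P" for a
  proof (rule hom_eq_on_generate[where f = "\<lambda>a. p (\<Psi> a)" and g = q and G = P and H = Q and S = "gen ` {..<4} \<union> inr ` carrier H"])
    show "(\<lambda>a. p (\<Psi> a)) \<in> hom P Q" using hom_compose[OF \<Psi> ce.p.homh] by (simp add: comp_def)
    show "q \<in> hom P Q" by (rule q.homh)
    show "gen ` {..<4} \<union> inr ` carrier H \<subseteq> carrier P" by auto
    show "a \<in> generate P (gen ` {..<4} \<union> inr ` carrier H)" using a generate_gens by simp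
    show "p (\<Psi> z) = q z" if "z \<in> gen ` {..<4} \<union> inr ` carrier H" for z
    proof -
      have "p (ys i) = q (inl (free_gen i))" if "i < 4" for i
      proof -
        have "i = 0 \<or> i = 1 \<or> i = 2 \<or> i = 3" using that by linarith
        then show ?thesis using s' ce.p_splitting[OF D01(1)] ce.p_splitting[OF D01(2)] by (auto simp: ys_def)
      qed
      then show ?thesis using that \<Psi>g \<Psi>r ce.p_splitting[OF q_inr_D] by (auto simp: gen_def)
    qed
  qed (rule P.group_axioms Q.group_axioms)+
  moreover have "\<Psi> a = \<one>\<^bsub>E\<^esub>" if "a \<in> N1" for a using N1k that by (auto simp: kernel_def)
  moreover have "\<Psi> a \<in> Z" if "a \<in> carrier P" for a using \<Psi>.hom_closed[OF that] by simp
  moreover from this have "\<Psi> \<in> hom P E" using \<Psi> Zc by (auto simp: hom_def)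
  ultimately show ?thesis by (intro bexI[of _ \<Psi>]) (auto simp: Z_def)
qed

text \<open>Modulo \<open>L\<close> the group is the direct product of the finite kernel over
  \<open>Q\<close> and the image of \<Psi>; the preimage of that image is the required subgroup. The
  homomorphism \<open>f\<close> is arbitrary because the lemma is applied both to \<open>P\<close>
  itself and to \<open>F\<close> through \<open>inl\<close>.\<close>

lemma finite_index_complement:
  assumes "group G" and f: "f \<in> hom G P" and onto: "(\<lambda>g. q (f g)) ` carrier G = carrier Q"
    and L: "L \<lhd> G" "\<And>g. g \<in> L \<Longrightarrow> f g \<in> N1"
    and fin: "finite ((\<lambda>g. L #>\<^bsub>G\<^esub> g) ` {g \<in> carrier G. f g \<in> N1})"
  shows "\<exists>K \<in> finite_index_normal G. \<forall>g \<in> K. f g \<in> N1 \<longrightarrow> g \<in> L"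
proof -
  interpret GG: group G by fact
  interpret L: normal L G by (rule L(1))
  interpret f: group_hom G P f by unfold_locales (rule f)
  define E where "E = G Mod L"
  have carrier_E: "carrier E = (\<lambda>g. L #>\<^bsub>G\<^esub> g) ` carrier G" and one_E: "\<one>\<^bsub>E\<^esub> = L" by (simp_all add: E_def carrier_Mod one_Mod)
  interpret E: group E unfolding E_def by (rule L.factorgroup_is_group)
  interpret \<pi>: group_hom G E "\<lambda>g. L #>\<^bsub>G\<^esub> g" unfolding E_def
    by (intro group_hom.intro group_hom_axioms.intro GG.group_axioms L.factorgroup_is_group hom_coset[OF L(1)])
  have qf: "q (f g) = \<one>\<^bsub>Q\<^esub> \<longleftrightarrow> f g \<in> N1" if "g \<in> carrier G" for g using q_one_iff that by simp
  have qeq: "q (f g) = q (f g') \<longleftrightarrow> f (g \<otimes>\<^bsub>G\<^esub> inv\<^bsub>G\<^esub> g') \<in> N1" if "g \<in> carrier G" "g' \<in> carrier G" for g g'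
    using coset_eq_iff[OF N1_normal, of "f g" "f g'"] that by (simp add: q_def)
  define p where "p C = q (f (SOME g. g \<in> carrier G \<and> C = L #>\<^bsub>G\<^esub> g))" for C
  have p: "p (L #>\<^bsub>G\<^esub> g) = q (f g)" if g: "g \<in> carrier G" for g
  proof -
    define g' where "g' = (SOME g'. g' \<in> carrier G \<and> L #>\<^bsub>G\<^esub> g = L #>\<^bsub>G\<^esub> g')"
    have "\<exists>g'. g' \<in> carrier G \<and> L #>\<^bsub>G\<^esub> g = L #>\<^bsub>G\<^esub> g'" using g by blast
    from someI_ex[OF this] have g': "g' \<in> carrier G" "L #>\<^bsub>G\<^esub> g = L #>\<^bsub>G\<^esub> g'" by (auto simp: g'_def)
    then have "g' \<otimes>\<^bsub>G\<^esub> inv\<^bsub>G\<^esub> g \<in> L" using coset_eq_iff[OF L(1) g'(1) g] by simp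
    then have "q (f g') = q (f g)" using qeq[OF g'(1) g] L(2) by blast
    then show ?thesis by (simp add: p_def g'_def)
  qed
  have ph: "p \<in> hom E Q"
  proof (rule homI)
    show "p C \<in> carrier Q" if "C \<in> carrier E" for C using that p by (auto simp: carrier_E)
    show "p (C \<otimes>\<^bsub>E\<^esub> C') = p C \<otimes>\<^bsub>Q\<^esub> p C'" if CC: "C \<in> carrier E" "C' \<in> carrier E" for C C'
    proof -
      obtain g g' where g: "g \<in> carrier G" "C = L #>\<^bsub>G\<^esub> g" "g' \<in> carrier G" "C' = L #>\<^bsub>G\<^esub> g'"
        using CC by (auto simp: carrier_E)
      then have eq: "C \<otimes>\<^bsub>E\<^esub> C' = L #>\<^bsub>G\<^esub> (g \<otimes>\<^bsub>G\<^esub> g')" using \<pi>.hom_mult by simp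
      have "p (C \<otimes>\<^bsub>E\<^esub> C') = q (f (g \<otimes>\<^bsub>G\<^esub> g'))" unfolding eq using g by (intro p) simp
      then show ?thesis using g p by simp
    qed
  qed
  have ps: "p ` carrier E = carrier Q"
    unfolding carrier_E image_image onto[symmetric] by (rule image_cong) (simp_all add: p)
  have ker: "kernel E Q p = (\<lambda>g. L #>\<^bsub>G\<^esub> g) ` {g \<in> carrier G. f g \<in> N1}"
    using p qf by (auto simp: kernel_def carrier_E)
  obtain \<Psi> where \<Psi>: "\<Psi> \<in> hom P E" "\<forall>a \<in> carrier P. p (\<Psi> a) = q a" "\<forall>a \<in> N1. \<Psi> a = \<one>\<^bsub>E\<^esub>"
    "\<forall>a \<in> carrier P. \<forall>z \<in> kernel E Q p. \<Psi> a \<otimes>\<^bsub>E\<^esub> z = z \<otimes>\<^bsub>E\<^esub> \<Psi> a"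
    using lift_through_finite_kernel[OF E.group_axioms ph ps] fin unfolding ker by blast
  interpret \<Psi>: group_hom P E \<Psi> by unfold_locales (rule \<Psi>(1))
  define K where "K = {g \<in> carrier G. L #>\<^bsub>G\<^esub> g \<in> \<Psi> ` carrier P}"
  have imgsub: "subgroup (\<Psi> ` carrier P) E" by (rule \<Psi>.img_is_subgroup)
  have sub: "subgroup K G"
  proof (rule GG.subgroupI)
    show "K \<noteq> {}" using \<pi>.hom_one subgroup.one_closed[OF imgsub] by (auto simp: K_def)
    show "inv\<^bsub>G\<^esub> a \<in> K" if aK: "a \<in> K" for a
    proof -
      have a: "a \<in> carrier G" "L #>\<^bsub>G\<^esub> a \<in> \<Psi> ` carrier P" using aK by (auto simp: K_def)
      show ?thesis using subgroup.m_inv_closed[OF imgsub a(2)]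
        by (simp only: K_def mem_Collect_eq \<pi>.hom_inv[OF a(1)] GG.inv_closed[OF a(1)] simp_thms)
    qed
    show "a \<otimes>\<^bsub>G\<^esub> b \<in> K" if abK: "a \<in> K" "b \<in> K" for a b
    proof -
      have a: "a \<in> carrier G" "L #>\<^bsub>G\<^esub> a \<in> \<Psi> ` carrier P" using abK by (auto simp: K_def)
      have b: "b \<in> carrier G" "L #>\<^bsub>G\<^esub> b \<in> \<Psi> ` carrier P" using abK by (auto simp: K_def)
      show ?thesis using subgroup.m_closed[OF imgsub a(2) b(2)]
        by (simp only: K_def mem_Collect_eq \<pi>.hom_mult[OF a(1) b(1)] GG.m_closed[OF a(1) b(1)] simp_thms)
    qed
  qed (auto simp: K_def)
  \<comment> \<open>\<Psi> hits every class of \<open>Q\<close>, so \<open>K\<close> and the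
    preimage of \<open>N1\<close> together make up \<open>G\<close>. Normality of \<open>K\<close>
    then reduces to conjugation by the preimage of \<open>N1\<close>, which centralises
    \<open>K\<close> modulo \<open>L\<close>.\<close>
  have decomp: "\<exists>h \<in> K. \<exists>v \<in> carrier G. f v \<in> N1 \<and> g = h \<otimes>\<^bsub>G\<^esub> v" if g: "g \<in> carrier G" for g
  proof -
    have "q (f g) \<in> q ` carrier P" using g by simp
    then obtain a where a: "a \<in> carrier P" "q a = q (f g)" by auto
    have "\<Psi> a \<in> carrier E" using a by simp
    then obtain h where h: "h \<in> carrier G" "\<Psi> a = L #>\<^bsub>G\<^esub> h" by (auto simp: carrier_E)
    then have "h \<in> K" using a by (auto simp: K_def)
    moreover have "q (f h) = q (f g)" using a h \<Psi>(2) p by metis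
    then have "q (f (inv\<^bsub>G\<^esub> h \<otimes>\<^bsub>G\<^esub> g)) = \<one>\<^bsub>Q\<^esub>" using g h by simp
    then have "f (inv\<^bsub>G\<^esub> h \<otimes>\<^bsub>G\<^esub> g) \<in> N1"
      using qf[OF GG.m_closed[OF GG.inv_closed[OF h(1)] g]] by blast
    ultimately show ?thesis using g h by (intro bexI[of _ h] bexI[of _ "inv\<^bsub>G\<^esub> h \<otimes>\<^bsub>G\<^esub> g"]) (auto simp flip: GG.m_assoc)
  qed
  have Kc: "h \<in> carrier G" if "h \<in> K" for h using that by (simp add: K_def)
  have commutes: "L #>\<^bsub>G\<^esub> (v \<otimes>\<^bsub>G\<^esub> h \<otimes>\<^bsub>G\<^esub> inv\<^bsub>G\<^esub> v) = L #>\<^bsub>G\<^esub> h"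
    if hv: "h \<in> K" "v \<in> carrier G" "f v \<in> N1" for h v
  proof -
    obtain a where a: "a \<in> carrier P" "L #>\<^bsub>G\<^esub> h = \<Psi> a" using hv(1) by (auto simp: K_def)
    have "L #>\<^bsub>G\<^esub> v \<in> kernel E Q p" unfolding ker using hv by blast
    then have "(L #>\<^bsub>G\<^esub> h) \<otimes>\<^bsub>E\<^esub> (L #>\<^bsub>G\<^esub> v) = (L #>\<^bsub>G\<^esub> v) \<otimes>\<^bsub>E\<^esub> (L #>\<^bsub>G\<^esub> h)" using \<Psi>(4) a by metis
    then have "(L #>\<^bsub>G\<^esub> v) \<otimes>\<^bsub>E\<^esub> (L #>\<^bsub>G\<^esub> h) \<otimes>\<^bsub>E\<^esub> inv\<^bsub>E\<^esub> (L #>\<^bsub>G\<^esub> v) = L #>\<^bsub>G\<^esub> h"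
      using \<pi>.hom_closed[OF hv(2)] \<pi>.hom_closed[OF Kc[OF hv(1)]] by (metis E.inv_solve_right E.m_closed)
    then show ?thesis using hv(2) Kc[OF hv(1)] \<pi>.hom_mult \<pi>.hom_inv by simp
  qed
  have "K \<lhd> G"
    unfolding GG.normal_inv_iff
  proof (intro conjI sub ballI)
    fix g u assume g: "g \<in> carrier G" and u: "u \<in> K"
    obtain h v where hv: "h \<in> K" "v \<in> carrier G" "f v \<in> N1" "g = h \<otimes>\<^bsub>G\<^esub> v" using decomp[OF g] by blast
    have vu: "v \<otimes>\<^bsub>G\<^esub> u \<otimes>\<^bsub>G\<^esub> inv\<^bsub>G\<^esub> v \<in> carrier G" using hv(2) Kc[OF u] by simp
    have "L #>\<^bsub>G\<^esub> u \<in> \<Psi> ` carrier P" using u unfolding K_def by blast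
    then have "v \<otimes>\<^bsub>G\<^esub> u \<otimes>\<^bsub>G\<^esub> inv\<^bsub>G\<^esub> v \<in> K"
      using vu unfolding K_def mem_Collect_eq commutes[OF u hv(2,3)] by blast
    then have "h \<otimes>\<^bsub>G\<^esub> (v \<otimes>\<^bsub>G\<^esub> u \<otimes>\<^bsub>G\<^esub> inv\<^bsub>G\<^esub> v) \<otimes>\<^bsub>G\<^esub> inv\<^bsub>G\<^esub> h \<in> K"
      using hv(1) subgroup.m_closed[OF sub] subgroup.m_inv_closed[OF sub] by blast
    then show "g \<otimes>\<^bsub>G\<^esub> u \<otimes>\<^bsub>G\<^esub> inv\<^bsub>G\<^esub> g \<in> K" using hv u Kc by (simp add: GG.m_assoc GG.inv_mult_group)
  qed
  moreover have "finite (rcosets\<^bsub>G\<^esub> K)"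
  proof -
    \<comment> \<open>The coset of \<open>K\<close> is determined by the class modulo
      \<open>L\<close> of the second factor, and there are finitely many such classes.\<close>
    define v where "v g = (SOME v. v \<in> carrier G \<and> f v \<in> N1 \<and> (\<exists>h \<in> K. g = h \<otimes>\<^bsub>G\<^esub> v))" for g
    have v: "v g \<in> carrier G \<and> f (v g) \<in> N1 \<and> (\<exists>h \<in> K. g = h \<otimes>\<^bsub>G\<^esub> v g)" if "g \<in> carrier G" for g
      unfolding v_def by (rule someI_ex) (use decomp[OF that] in blast)
    have LK: "L \<subseteq> K"
    proof
      fix g assume g: "g \<in> L"
      then have gc: "g \<in> carrier G" using subgroup.mem_carrier[OF L.is_subgroup] by blast
      then have "L #>\<^bsub>G\<^esub> g = \<one>\<^bsub>E\<^esub>" using coset_eq_self_iff[OF L(1) gc] g by (simp add: one_E)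
      then show "g \<in> K" using gc subgroup.one_closed[OF imgsub] by (simp add: K_def)
    qed
    show ?thesis
    proof (rule finite_rcosetsI[OF assms(1) sub, where h = "\<lambda>g. L #>\<^bsub>G\<^esub> v g"])
      show "finite ((\<lambda>g. L #>\<^bsub>G\<^esub> v g) ` carrier G)" by (rule finite_subset[OF _ fin]) (use v in blast)
    next
      fix g g' assume g: "g \<in> carrier G" "g' \<in> carrier G" "L #>\<^bsub>G\<^esub> v g = L #>\<^bsub>G\<^esub> v g'"
      obtain h h' where h: "h \<in> K" "g = h \<otimes>\<^bsub>G\<^esub> v g" "h' \<in> K" "g' = h' \<otimes>\<^bsub>G\<^esub> v g'" using v g by blast
      have vc: "v g \<in> carrier G" "v g' \<in> carrier G" using v g by auto
      have "v g \<otimes>\<^bsub>G\<^esub> inv\<^bsub>G\<^esub> v g' \<in> K" using coset_eq_iff[OF L(1) vc] g(3) LK by blast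
      then have "h \<otimes>\<^bsub>G\<^esub> (v g \<otimes>\<^bsub>G\<^esub> inv\<^bsub>G\<^esub> v g') \<otimes>\<^bsub>G\<^esub> inv\<^bsub>G\<^esub> h' \<in> K"
        using h subgroup.m_closed[OF sub] subgroup.m_inv_closed[OF sub] by blast
      moreover have "g \<otimes>\<^bsub>G\<^esub> inv\<^bsub>G\<^esub> g' = h \<otimes>\<^bsub>G\<^esub> (v g \<otimes>\<^bsub>G\<^esub> inv\<^bsub>G\<^esub> v g') \<otimes>\<^bsub>G\<^esub> inv\<^bsub>G\<^esub> h'"
      proof -
        have "g \<otimes>\<^bsub>G\<^esub> inv\<^bsub>G\<^esub> g' = (h \<otimes>\<^bsub>G\<^esub> v g) \<otimes>\<^bsub>G\<^esub> inv\<^bsub>G\<^esub> (h' \<otimes>\<^bsub>G\<^esub> v g')" using h(2,4) by simp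
        then show ?thesis using Kc[OF h(1)] Kc[OF h(3)] vc by (simp only: GG.m_assoc GG.inv_mult_group GG.inv_closed GG.m_closed)
      qed
      ultimately show "g \<otimes>\<^bsub>G\<^esub> inv\<^bsub>G\<^esub> g' \<in> K" by simp
    qed
  qed
  moreover have "g \<in> L" if g: "g \<in> K" "f g \<in> N1" for g
  proof -
    obtain a where a: "a \<in> carrier P" "L #>\<^bsub>G\<^esub> g = \<Psi> a" using g(1) by (auto simp: K_def)
    then have "q a = q (f g)" using \<Psi>(2) p Kc[OF g(1)] by metis
    then have "a \<in> N1" using q_one_iff[OF a(1)] qf[OF Kc[OF g(1)]] g(2) by simp
    then have "L #>\<^bsub>G\<^esub> g = L" using a \<Psi>(3) by (simp add: one_E)
    then show ?thesis using coset_eq_self_iff[OF L(1) Kc[OF g(1)]] by simp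
  qed
  ultimately show ?thesis by (intro bexI[of _ K]) (auto simp: finite_index_normal_def)
qed

end

section \<open>The semidirect product\<close>

lemma finite_index_preimage:
  assumes "group G" "group K" "h \<in> hom G K" "V \<in> finite_index_normal K"
  shows "{g \<in> carrier G. h g \<in> V} \<in> finite_index_normal G"
proof -
  have nV: "V \<lhd> K" using assms(4) finite_index_normalD by blast
  define E where "E = K Mod V"
  have E: "group E" "\<one>\<^bsub>E\<^esub> = V" unfolding E_def by (rule normal.factorgroup_is_group[OF nV], simp add: one_Mod)
  have hom: "(\<lambda>g. V #>\<^bsub>K\<^esub> h g) \<in> hom G E"
    using hom_compose[OF assms(3) hom_coset[OF nV]] by (simp add: comp_def E_def)
  have "kernel G E (\<lambda>g. V #>\<^bsub>K\<^esub> h g) \<in> finite_index_normal G"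
  proof (rule finite_index_kernel[OF assms(1) E(1) hom])
    show "finite ((\<lambda>g. V #>\<^bsub>K\<^esub> h g) ` carrier G)"
      by (rule finite_subset[OF _ coset_image_finite[OF assms(4)]]) (use hom_in_carrier[OF assms(3)] in blast)
  qed
  moreover have "kernel G E (\<lambda>g. V #>\<^bsub>K\<^esub> h g) = {g \<in> carrier G. h g \<in> V}"
    using coset_eq_self_iff[OF nV] hom_in_carrier[OF assms(3)] by (auto simp: kernel_def E(2))
  ultimately show ?thesis by simp
qed

lemma finite_image_factor:
  assumes "finite (g ` A)" "\<And>x y. \<lbrakk>x \<in> A; y \<in> A; g x = g y\<rbrakk> \<Longrightarrow> h x = h y"
  shows "finite (h ` A)"
proof -
  have "h ` A \<subseteq> (\<lambda>z. h (SOME x. x \<in> A \<and> g x = z)) ` g ` A"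
  proof
    fix w assume "w \<in> h ` A"
    then obtain x where x: "x \<in> A" "w = h x" by blast
    have "(SOME x'. x' \<in> A \<and> g x' = g x) \<in> A \<and> g (SOME x'. x' \<in> A \<and> g x' = g x) = g x"
      by (rule someI[of _ x]) (use x in simp)
    then have "h (SOME x'. x' \<in> A \<and> g x' = g x) = w" using assms(2) x by blast
    then show "w \<in> (\<lambda>z. h (SOME x. x \<in> A \<and> g x = z)) ` g ` A" using x by blast
  qed
  then show ?thesis using assms(1) by (meson finite_imageI finite_subset)
qed

text \<open>\<open>is_free_group\<close> asks for a basis in the type of the group, so an abstract
  basis is replaced by its image.\<close>

lemma is_free_groupI:
  assumes "group G" "free_group S \<cong> G"
  shows "is_free_group G"
proof -
  obtain h where h: "h \<in> iso (free_group S) G" using assms(2) by (auto simp: is_iso_def)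
  have inj: "inj_on h (carrier (free_group S))" using h by (simp add: iso_def bij_betw_def)
  have "inj_on (\<lambda>i. h (free_gen i)) S"
  proof (rule inj_onI)
    fix i j assume "i \<in> S" "j \<in> S" "h (free_gen i) = h (free_gen j)"
    then have "free_gen i = (free_gen j :: (_ \<times> bool) list)" by (intro inj_onD[OF inj] free_gen_closed)
    then show "i = j" by simp
  qed
  then have "free_group S \<cong> free_group ((\<lambda>i. h (free_gen i)) ` S)"
    by (intro free_group_iso_bij) (simp add: bij_betw_def)
  moreover have "G \<cong> free_group S" by (rule group.iso_sym[OF group_free_group assms(2)])
  ultimately have "G \<cong> free_group ((\<lambda>i. h (free_gen i)) ` S)" using iso_trans by blast
  then show ?thesis using assms(1) by (auto simp: is_free_group_def)
qed

section \<open>The fibre product, written as a semidirect product\<close>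

locale realized_encoding = encoding H X N w n m k l r
  for H :: "('b, 'e) monoid_scheme" and X N w n m k l r +
  fixes \<theta>
  assumes \<theta>: "\<theta> \<in> iso (free_group (UNIV :: nat set)) (P\<lparr>carrier := N1\<rparr>)"
begin

abbreviation Finf where "Finf \<equiv> free_group (UNIV :: nat set)"

sublocale Finf: group Finf by (rule group_free_group)

lemma bij_\<theta>: "bij_betw \<theta> (carrier Finf) N1" using \<theta> by (simp add: iso_def)

lemma \<theta>_mult: "u \<in> carrier Finf \<Longrightarrow> v \<in> carrier Finf \<Longrightarrow> \<theta> (u \<otimes>\<^bsub>Finf\<^esub> v) = \<theta> u \<otimes>\<^bsub>P\<^esub> \<theta> v"
  using hom_mult[of \<theta> Finf "P\<lparr>carrier := N1\<rparr>" u v] \<theta> by (simp add: iso_def)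

lemma \<theta>_N1: "u \<in> carrier Finf \<Longrightarrow> \<theta> u \<in> N1" using bij_betwE[OF bij_\<theta>] by blast

lemma \<theta>_closed [simp]: "u \<in> carrier Finf \<Longrightarrow> \<theta> u \<in> carrier P" using \<theta>_N1 N1_closed by blast

lemma \<theta>_inj: "u \<in> carrier Finf \<Longrightarrow> v \<in> carrier Finf \<Longrightarrow> \<theta> u = \<theta> v \<Longrightarrow> u = v"
  using inj_onD[OF bij_betw_imp_inj_on[OF bij_\<theta>]] by blast

definition \<theta>i where "\<theta>i = inv_into (carrier Finf) \<theta>"

lemma \<theta>i: "v \<in> N1 \<Longrightarrow> \<theta>i v \<in> carrier Finf" "v \<in> N1 \<Longrightarrow> \<theta> (\<theta>i v) = v"
  using bij_betw_imp_surj_on[OF bij_\<theta>] by (auto simp: \<theta>i_def intro: inv_into_into f_inv_into_f)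

lemma \<theta>i_\<theta>: "u \<in> carrier Finf \<Longrightarrow> \<theta>i (\<theta> u) = u"
  using \<theta>_inj \<theta>i \<theta>_N1 by blast

lemma N1_conj: "a \<in> carrier P \<Longrightarrow> v \<in> N1 \<Longrightarrow> a \<otimes>\<^bsub>P\<^esub> v \<otimes>\<^bsub>P\<^esub> inv\<^bsub>P\<^esub> a \<in> N1"
  using N1_normal P.normal_inv_iff by blast

definition act where "act f u = \<theta>i (inl f \<otimes>\<^bsub>P\<^esub> \<theta> u \<otimes>\<^bsub>P\<^esub> inv\<^bsub>P\<^esub> inl f)"

definition \<alpha> where "\<alpha> f = restrict (act f) (carrier Finf)"

lemma act: "f \<in> carrier F \<Longrightarrow> u \<in> carrier Finf \<Longrightarrow> act f u \<in> carrier Finf"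
  "f \<in> carrier F \<Longrightarrow> u \<in> carrier Finf \<Longrightarrow> \<theta> (act f u) = inl f \<otimes>\<^bsub>P\<^esub> \<theta> u \<otimes>\<^bsub>P\<^esub> inv\<^bsub>P\<^esub> inl f"
  unfolding act_def by (rule \<theta>i; rule N1_conj; simp add: \<theta>_N1)+

lemma \<alpha>_hom: "\<alpha> \<in> hom F (AutoGroup Finf)"
proof -
  have b: "\<alpha> \<in> hom F (BijGroup (carrier Finf))"
    unfolding \<alpha>_def[abs_def]
  proof (rule hom_BijGroupI[OF group_free_group])
    show "act \<one>\<^bsub>F\<^esub> u = u" if "u \<in> carrier Finf" for u
      using that unfolding act_def inl.hom_one by (simp add: \<theta>i_\<theta>)
    show "act (a \<otimes>\<^bsub>F\<^esub> b) u = act a (act b u)" if "a \<in> carrier F" "b \<in> carrier F" "u \<in> carrier Finf" for a b u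
    proof (rule \<theta>_inj)
      have "inl a \<in> carrier P" "inl b \<in> carrier P" using that by auto
      then show "\<theta> (act (a \<otimes>\<^bsub>F\<^esub> b) u) = \<theta> (act a (act b u))"
        using that act by (simp add: P.m_assoc P.inv_mult_group)
    qed (use that act in auto)
  qed (rule act)
  moreover have "\<alpha> f \<in> hom Finf Finf" if f: "f \<in> carrier F" for f
  proof (rule homI)
    show "\<alpha> f (u \<otimes>\<^bsub>Finf\<^esub> v) = \<alpha> f u \<otimes>\<^bsub>Finf\<^esub> \<alpha> f v" if uv: "u \<in> carrier Finf" "v \<in> carrier Finf" for u v
    proof -
      have "act f (u \<otimes>\<^bsub>Finf\<^esub> v) = act f u \<otimes>\<^bsub>Finf\<^esub> act f v"
      proof (rule \<theta>_inj)
        have "inl f \<in> carrier P" using f by simp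
        then show "\<theta> (act f (u \<otimes>\<^bsub>Finf\<^esub> v)) = \<theta> (act f u \<otimes>\<^bsub>Finf\<^esub> act f v)"
          using uv f act Finf.m_closed[OF uv] by (simp add: \<theta>_mult P.m_assoc P.inv_mult_cancel)
      qed (use uv act f in \<open>auto intro: Finf.m_closed\<close>)
      then show ?thesis using uv Finf.m_closed[OF uv] by (simp only: \<alpha>_def restrict_apply')
    qed
  qed (use act f in \<open>simp add: \<alpha>_def\<close>)
  ultimately show ?thesis by (auto simp: hom_def AutoGroup_def auto_def carrier_BijGroup)
qed

definition M where "M = semidirect_product Finf F \<alpha>"

definition \<phi> where "\<phi> = (\<lambda>(u, f). (\<theta> u \<otimes>\<^bsub>P\<^esub> inl f, f))"

abbreviation PF where "PF \<equiv> P \<times>\<times> F"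

sublocale PF: group PF by (rule DirProd_group[OF P.group_axioms group_free_group])

text \<open>The fibre product of \<open>q\<close> and \<open>q\<close> after \<open>inl\<close>. It
  is the image of \<phi>, and most statements about \<open>M\<close> are proved there, where
  multiplication is componentwise.\<close>

definition I where "I = {(a, f). a \<in> carrier P \<and> f \<in> carrier F \<and> q a = q (inl f)}"

lemma carrier_M: "carrier M = carrier Finf \<times> carrier F" by (simp add: M_def semidirect_product_def)

lemma carrier_PF: "carrier PF = carrier P \<times> carrier F" by (simp add: DirProd_def)

lemma mult_PF: "(a, f) \<otimes>\<^bsub>PF\<^esub> (b, g) = (a \<otimes>\<^bsub>P\<^esub> b, f \<otimes>\<^bsub>F\<^esub> g)" by (simp add: DirProd_def)

lemma inv_PF: "a \<in> carrier P \<Longrightarrow> f \<in> carrier F \<Longrightarrow> inv\<^bsub>PF\<^esub> (a, f) = (inv\<^bsub>P\<^esub> a, inv\<^bsub>F\<^esub> f)"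
  by (rule inv_DirProd[OF P.group_axioms group_free_group])

lemma one_PF: "\<one>\<^bsub>PF\<^esub> = (\<one>\<^bsub>P\<^esub>, \<one>\<^bsub>F\<^esub>)" by (simp add: DirProd_def)

lemma q_eq_iff: "a \<in> carrier P \<Longrightarrow> b \<in> carrier P \<Longrightarrow> q a = q b \<longleftrightarrow> a \<otimes>\<^bsub>P\<^esub> inv\<^bsub>P\<^esub> b \<in> N1"
  unfolding q_def by (rule coset_eq_iff[OF N1_normal])

lemma I_sub: "subgroup I PF"
proof (rule PF.subgroupI)
  show "I \<subseteq> carrier PF" by (auto simp: I_def carrier_PF)
  have "q \<one>\<^bsub>P\<^esub> = q (inl \<one>\<^bsub>F\<^esub>)" by (simp only: inl.hom_one)
  then have "(\<one>\<^bsub>P\<^esub>, \<one>\<^bsub>F\<^esub>) \<in> I" by (simp add: I_def del: one_free_group)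
  then show "I \<noteq> {}" by blast
  show "inv\<^bsub>PF\<^esub> y \<in> I" if yI: "y \<in> I" for y
  proof -
    obtain a f where y: "y = (a, f)" "a \<in> carrier P" "f \<in> carrier F" "q a = q (inl f)" using yI by (auto simp: I_def)
    have "q (inl (inv\<^bsub>F\<^esub> f)) = inv\<^bsub>Q\<^esub> q (inl f)" using y(3) by (simp only: inl.hom_inv q.hom_inv inl.hom_closed)
    then show ?thesis using y inv_PF[OF y(2,3)] G.inv_closed[OF y(3)] by (simp add: I_def)
  qed
  show "y \<otimes>\<^bsub>PF\<^esub> z \<in> I" if yI: "y \<in> I" "z \<in> I" for y z
  proof -
    obtain a f where y: "y = (a, f)" "a \<in> carrier P" "f \<in> carrier F" "q a = q (inl f)" using yI by (auto simp: I_def)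
    obtain b g where z: "z = (b, g)" "b \<in> carrier P" "g \<in> carrier F" "q b = q (inl g)" using yI by (auto simp: I_def)
    have "q (inl (f \<otimes>\<^bsub>F\<^esub> g)) = q (inl f) \<otimes>\<^bsub>Q\<^esub> q (inl g)" using y(3) z(3) by (simp only: inl.hom_mult q.hom_mult inl.hom_closed)
    then show ?thesis using y z G.m_closed[OF y(3) z(3)] by (simp add: I_def mult_PF)
  qed
qed

lemma I_closed: "y \<in> I \<Longrightarrow> y \<in> carrier PF" using subgroup.mem_carrier[OF I_sub] .

lemma \<phi>_I: "y \<in> carrier M \<Longrightarrow> \<phi> y \<in> I"
proof -
  assume "y \<in> carrier M"
  then obtain u f where y: "y = (u, f)" "u \<in> carrier Finf" "f \<in> carrier F" by (auto simp: carrier_M)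
  have "inl f \<in> carrier P" using y by simp
  moreover have "q (\<theta> u \<otimes>\<^bsub>P\<^esub> inl f) = q (inl f)" using y \<theta>_N1[OF y(2)] q_one_iff[of "\<theta> u"] by simp
  ultimately show ?thesis using y by (simp add: \<phi>_def I_def)
qed

definition \<psi> where "\<psi> = (\<lambda>(a, f). (\<theta>i (a \<otimes>\<^bsub>P\<^esub> inv\<^bsub>P\<^esub> inl f), f))"

lemma \<psi>: "y \<in> I \<Longrightarrow> \<psi> y \<in> carrier M" "y \<in> I \<Longrightarrow> \<phi> (\<psi> y) = y"
proof -
  assume "y \<in> I"
  then obtain a f where y: "y = (a, f)" "a \<in> carrier P" "f \<in> carrier F" "q a = q (inl f)" by (auto simp: I_def)
  have c: "inl f \<in> carrier P" using y by simp
  then have v: "a \<otimes>\<^bsub>P\<^esub> inv\<^bsub>P\<^esub> inl f \<in> N1" using q_eq_iff y by blast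
  show "\<psi> y \<in> carrier M" using y \<theta>i(1)[OF v] by (simp add: \<psi>_def carrier_M)
  show "\<phi> (\<psi> y) = y" using y c \<theta>i(2)[OF v] by (simp add: \<psi>_def \<phi>_def P.m_assoc)
qed

lemma \<phi>_inj: "inj_on \<phi> (carrier M)"
proof (rule inj_onI)
  fix y z assume yz: "y \<in> carrier M" "z \<in> carrier M" "\<phi> y = \<phi> z"
  obtain u f where y: "y = (u, f)" "u \<in> carrier Finf" "f \<in> carrier F" using yz by (auto simp: carrier_M)
  obtain v g where z: "z = (v, g)" "v \<in> carrier Finf" "g \<in> carrier F" using yz by (auto simp: carrier_M)
  have "f = g" "\<theta> u \<otimes>\<^bsub>P\<^esub> inl f = \<theta> v \<otimes>\<^bsub>P\<^esub> inl g" using yz(3) y z by (auto simp: \<phi>_def)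
  then have "\<theta> u = \<theta> v" using y z by simp
  then show "y = z" using \<open>f = g\<close> y z \<theta>_inj by blast
qed

lemma M_closed: "y \<in> carrier M \<Longrightarrow> z \<in> carrier M \<Longrightarrow> y \<otimes>\<^bsub>M\<^esub> z \<in> carrier M"
  and \<phi>_mult: "y \<in> carrier M \<Longrightarrow> z \<in> carrier M \<Longrightarrow> \<phi> (y \<otimes>\<^bsub>M\<^esub> z) = \<phi> y \<otimes>\<^bsub>PF\<^esub> \<phi> z"
proof -
  assume yz: "y \<in> carrier M" "z \<in> carrier M"
  obtain u f where y: "y = (u, f)" "u \<in> carrier Finf" "f \<in> carrier F" using yz by (auto simp: carrier_M)
  obtain v g where z: "z = (v, g)" "v \<in> carrier Finf" "g \<in> carrier F" using yz by (auto simp: carrier_M)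
  have mult: "y \<otimes>\<^bsub>M\<^esub> z = (u \<otimes>\<^bsub>Finf\<^esub> act f v, f \<otimes>\<^bsub>F\<^esub> g)"
    using y z by (simp add: M_def semidirect_product_def \<alpha>_def)
  note a = act[OF y(3) z(2)]
  show "y \<otimes>\<^bsub>M\<^esub> z \<in> carrier M"
    unfolding mult carrier_M using Finf.m_closed[OF y(2) a(1)] G.m_closed[OF y(3) z(3)] by blast
  have c: "inl f \<in> carrier P" "inl g \<in> carrier P" using y z by auto
  have "\<theta> (u \<otimes>\<^bsub>Finf\<^esub> act f v) \<otimes>\<^bsub>P\<^esub> inl (f \<otimes>\<^bsub>F\<^esub> g) = \<theta> u \<otimes>\<^bsub>P\<^esub> (inl f \<otimes>\<^bsub>P\<^esub> \<theta> v \<otimes>\<^bsub>P\<^esub> inv\<^bsub>P\<^esub> inl f) \<otimes>\<^bsub>P\<^esub> (inl f \<otimes>\<^bsub>P\<^esub> inl g)"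
    by (simp only: \<theta>_mult[OF y(2) a(1)] a(2) inl.hom_mult[OF y(3) z(3)])
  also have "\<dots> = (\<theta> u \<otimes>\<^bsub>P\<^esub> inl f) \<otimes>\<^bsub>P\<^esub> (\<theta> v \<otimes>\<^bsub>P\<^esub> inl g)"
    using c y z by (simp add: P.m_assoc P.inv_mult_cancel)
  finally show "\<phi> (y \<otimes>\<^bsub>M\<^esub> z) = \<phi> y \<otimes>\<^bsub>PF\<^esub> \<phi> z"
    unfolding mult by (simp add: \<phi>_def y z mult_PF)
qed

lemma one_M: "\<one>\<^bsub>M\<^esub> \<in> carrier M" "\<phi> \<one>\<^bsub>M\<^esub> = \<one>\<^bsub>PF\<^esub>"
proof -
  have o: "\<one>\<^bsub>M\<^esub> = (\<one>\<^bsub>Finf\<^esub>, \<one>\<^bsub>F\<^esub>)" by (simp add: M_def semidirect_product_def)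
  show "\<one>\<^bsub>M\<^esub> \<in> carrier M" unfolding o carrier_M by (blast intro: Finf.one_closed G.one_closed)
  have "\<theta> \<one>\<^bsub>Finf\<^esub> \<otimes>\<^bsub>P\<^esub> \<theta> \<one>\<^bsub>Finf\<^esub> = \<theta> \<one>\<^bsub>Finf\<^esub>"
    by (simp only: Finf.l_one Finf.one_closed flip: \<theta>_mult)
  then have "\<theta> \<one>\<^bsub>Finf\<^esub> = \<one>\<^bsub>P\<^esub>" using P.l_cancel_one[OF \<theta>_closed \<theta>_closed] Finf.one_closed by blast
  then show "\<phi> \<one>\<^bsub>M\<^esub> = \<one>\<^bsub>PF\<^esub>" unfolding o by (simp only: \<phi>_def case_prod_conv inl.hom_one one_PF P.l_one P.one_closed)
qed

lemma \<phi>_eqI: "y \<in> carrier M \<Longrightarrow> z \<in> carrier M \<Longrightarrow> \<phi> y = \<phi> z \<Longrightarrow> y = z"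
  using inj_onD[OF \<phi>_inj] by blast

lemma \<phi>_closed: "y \<in> carrier M \<Longrightarrow> \<phi> y \<in> carrier PF" using \<phi>_I I_closed by blast

text \<open>All group laws are pulled back from \<open>PF\<close> along the injective map
  \<phi>.\<close>

lemma group_M: "group M"
proof (rule groupI)
  show "x \<otimes>\<^bsub>M\<^esub> y \<otimes>\<^bsub>M\<^esub> z = x \<otimes>\<^bsub>M\<^esub> (y \<otimes>\<^bsub>M\<^esub> z)" if "x \<in> carrier M" "y \<in> carrier M" "z \<in> carrier M" for x y z
    by (rule \<phi>_eqI) (simp_all only: that M_closed \<phi>_mult \<phi>_closed PF.m_assoc)
  show "\<one>\<^bsub>M\<^esub> \<otimes>\<^bsub>M\<^esub> y = y" if "y \<in> carrier M" for y
    by (rule \<phi>_eqI) (simp_all only: that M_closed \<phi>_mult \<phi>_closed one_M PF.l_one)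
  show "\<exists>y \<in> carrier M. y \<otimes>\<^bsub>M\<^esub> x = \<one>\<^bsub>M\<^esub>" if x: "x \<in> carrier M" for x
  proof -
    have i: "inv\<^bsub>PF\<^esub> \<phi> x \<in> I" using subgroup.m_inv_closed[OF I_sub \<phi>_I[OF x]] .
    have "\<psi> (inv\<^bsub>PF\<^esub> \<phi> x) \<otimes>\<^bsub>M\<^esub> x = \<one>\<^bsub>M\<^esub>"
      by (rule \<phi>_eqI) (simp_all only: x i \<psi> M_closed \<phi>_mult \<phi>_closed one_M PF.l_inv)
    then show ?thesis using \<psi>(1)[OF i] by blast
  qed
qed (simp_all add: M_closed one_M)

sublocale M: group M by (rule group_M)

sublocale \<phi>: group_hom M PF \<phi>
  by unfold_locales (rule homI, simp_all only: \<phi>_mult \<phi>_closed)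

lemma \<phi>_mon: "\<phi> \<in> mon M PF" using \<phi>.homh \<phi>_inj by (simp add: mon_def)

lemma \<phi>_image: "\<phi> ` carrier M = I"
  using \<phi>_I \<psi> by (metis image_subsetI image_eqI subsetI subset_antisym)

lemma \<psi>_mult: "y \<in> I \<Longrightarrow> z \<in> I \<Longrightarrow> \<psi> (y \<otimes>\<^bsub>PF\<^esub> z) = \<psi> y \<otimes>\<^bsub>M\<^esub> \<psi> z"
  by (rule \<phi>_eqI) (simp_all only: \<psi> M_closed \<phi>_mult subgroup.m_closed[OF I_sub])

lemma \<psi>_inv: "y \<in> I \<Longrightarrow> \<psi> (inv\<^bsub>PF\<^esub> y) = inv\<^bsub>M\<^esub> \<psi> y"
  by (rule \<phi>_eqI) (simp_all only: \<psi> M.inv_closed \<phi>.hom_inv subgroup.m_inv_closed[OF I_sub])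

lemma residually_finite_M: "residually_finite H \<Longrightarrow> residually_finite M"
  by (rule residually_finite_mon[OF group_M PF.group_axioms \<phi>_mon])
    (intro residually_finite_DirProd P.group_axioms group_free_group residually_finite_P residually_finite_free_group)

lemma N1_I: "v \<in> N1 \<Longrightarrow> (v, \<one>\<^bsub>F\<^esub>) \<in> I"
proof -
  assume v: "v \<in> N1"
  have "q (inl \<one>\<^bsub>F\<^esub>) = \<one>\<^bsub>Q\<^esub>" by (simp only: inl.hom_one q.hom_one)
  moreover have "q v = \<one>\<^bsub>Q\<^esub>" using v q_one_iff N1_closed by blast
  ultimately have "q v = q (inl \<one>\<^bsub>F\<^esub>)" by simp
  then show ?thesis using N1_closed[OF v] G.one_closed unfolding I_def by blast
qed

lemma diag_I: "f \<in> carrier F \<Longrightarrow> (inl f, f) \<in> I"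
  by (simp add: I_def)

lemma fst_hom: "fst \<in> hom PF P" and snd_hom: "snd \<in> hom PF F"
  by (auto simp: hom_def DirProd_def)

lemma diag_hom: "(\<lambda>f. (inl f, f)) \<in> hom F PF"
  by (rule homI) (simp_all add: carrier_PF mult_PF inl.hom_mult)

text \<open>Finite normal generation of \<open>N1\<close> in \<open>P\<close> suffices: the first
  coordinates of the group \<open>W\<close> generated by \<open>S\<close> exhaust \<open>P\<close>,
  so conjugation inside \<open>W\<close> already realises every conjugation by
  \<open>P\<close>.\<close>

lemma finitely_generated_M:
  assumes "finite X"
  shows "finitely_generated M"
proof -
  define S where "S = (\<lambda>\<rho>. (\<rho>, \<one>\<^bsub>F\<^esub>)) ` R \<union> (\<lambda>f. (inl f, f)) ` free_gen ` {..<4}"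
  have fg: "free_gen ` {..<4} \<subseteq> carrier F" using fg_closed by auto
  have SI: "S \<subseteq> I" using R_N1 N1_I diag_I fg unfolding S_def by blast
  have Sc: "S \<subseteq> carrier PF" using SI I_closed by blast
  define W where "W = generate PF S"
  have W: "subgroup W PF" unfolding W_def by (rule PF.generate_is_subgroup[OF Sc])
  have WI: "W \<subseteq> I" unfolding W_def by (rule PF.generate_subgroup_incl[OF SI I_sub])
  have diag: "(inl f, f) \<in> W" if f: "f \<in> carrier F" for f
  proof -
    interpret d: group_hom F PF "\<lambda>f. (inl f, f)" by unfold_locales (rule diag_hom)
    have "(\<lambda>f. (inl f, f)) ` generate F (free_gen ` {..<4}) = generate PF ((\<lambda>f. (inl f, f)) ` free_gen ` {..<4})"
      by (rule d.generate_img[OF fg, symmetric])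
    also have "\<dots> \<subseteq> W" unfolding W_def by (rule PF.mono_generate) (auto simp: S_def)
    finally show ?thesis using f by (auto simp: generate_free_group)
  qed
  have fstW: "a \<in> fst ` W" if a: "a \<in> carrier P" for a
  proof -
    interpret fst: group_hom PF P fst by unfold_locales (rule fst_hom)
    have sub: "subgroup (fst ` W) P" by (rule fst.subgroup_img_is_subgroup[OF W])
    have inlW: "inl f \<in> fst ` W" if "f \<in> carrier F" for f using diag[OF that] by force
    have RW: "\<rho> \<in> fst ` W" if "\<rho> \<in> R" for \<rho>
      using that generate.incl[of "(\<rho>, \<one>\<^bsub>F\<^esub>)" S PF] unfolding W_def S_def by force
    \<comment> \<open>A generator of \<Gamma> is recovered from its relator and from the word in
      \<open>F\<close> that the relator equates with it.\<close>
    have inrX: "inr ` X \<subseteq> fst ` W"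
    proof
      fix z assume "z \<in> inr ` X"
      then obtain g where g: "g \<in> X" "z = inr g" by blast
      have c: "inr g \<in> carrier P" "inl (w g) \<in> carrier P" using g X w_closed by auto
      let ?\<rho> = "inv\<^bsub>P\<^esub> inr g \<otimes>\<^bsub>P\<^esub> inl (w g)"
      have "?\<rho> \<in> fst ` W" by (rule RW) (use g in \<open>auto simp: R_def\<close>)
      then have "inl (w g) \<otimes>\<^bsub>P\<^esub> inv\<^bsub>P\<^esub> ?\<rho> \<in> fst ` W"
        by (rule subgroup.m_closed[OF sub inlW[OF w_closed[OF g(1)]] subgroup.m_inv_closed[OF sub]])
      moreover have "inl (w g) \<otimes>\<^bsub>P\<^esub> inv\<^bsub>P\<^esub> ?\<rho> = inr g" using c by (simp add: P.inv_mult_group flip: P.m_assoc)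
      ultimately show "z \<in> fst ` W" using g by simp
    qed
    interpret inr: group_hom H P inr by unfold_locales (rule inr_hom)
    have "inr ` carrier H = generate P (inr ` X)" using inr.generate_img[OF X(1)] X(2) by simp
    also have "\<dots> \<subseteq> fst ` W" by (rule P.generate_subgroup_incl[OF inrX sub])
    finally have "inl ` carrier F \<union> inr ` carrier H \<subseteq> fst ` W" using inlW by blast
    then have "generate P (inl ` carrier F \<union> inr ` carrier H) \<subseteq> fst ` W" by (rule P.generate_subgroup_incl[OF _ sub])
    then show ?thesis using a generate_P by blast
  qed
  \<comment> \<open>The part of \<open>W\<close> over the unit of \<open>F\<close>. Once it is known
    to be normal in \<open>P\<close>, it contains \<open>N1\<close> because it contains
    \<open>R\<close>.\<close>
  define V where "V = {v \<in> carrier P. (v, \<one>\<^bsub>F\<^esub>) \<in> W}"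
  have "V \<lhd> P"
    unfolding P.normal_inv_iff
  proof (intro conjI ballI)
    show "subgroup V P"
    proof (rule P.subgroupI)
      show "V \<noteq> {}" using subgroup.one_closed[OF W] unfolding one_PF V_def by blast
      show "inv\<^bsub>P\<^esub> v \<in> V" if "v \<in> V" for v
      proof -
        have v: "v \<in> carrier P" "(v, \<one>\<^bsub>F\<^esub>) \<in> W" using that by (auto simp: V_def)
        then show ?thesis using subgroup.m_inv_closed[OF W v(2)] inv_PF[OF v(1) G.one_closed] by (simp only: V_def G.inv_one) simp
      qed
      show "v \<otimes>\<^bsub>P\<^esub> v' \<in> V" if "v \<in> V" "v' \<in> V" for v v'
      proof -
        have v: "v \<in> carrier P" "(v, \<one>\<^bsub>F\<^esub>) \<in> W" "v' \<in> carrier P" "(v', \<one>\<^bsub>F\<^esub>) \<in> W" using that by (auto simp: V_def)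
        then show ?thesis using subgroup.m_closed[OF W v(2,4)]
          by (simp only: V_def mult_PF G.l_one G.one_closed) simp
      qed
    qed (auto simp: V_def)
    fix a v assume a: "a \<in> carrier P" and vV: "v \<in> V"
    then have v: "v \<in> carrier P" "(v, \<one>\<^bsub>F\<^esub>) \<in> W" by (auto simp: V_def)
    obtain f where f: "(a, f) \<in> W" using fstW[OF a] by auto
    then have fc: "f \<in> carrier F" using subgroup.mem_carrier[OF W f] by (simp add: carrier_PF)
    have "(a, f) \<otimes>\<^bsub>PF\<^esub> (v, \<one>\<^bsub>F\<^esub>) \<otimes>\<^bsub>PF\<^esub> inv\<^bsub>PF\<^esub> (a, f) \<in> W"
      using f v(2) subgroup.m_closed[OF W] subgroup.m_inv_closed[OF W] by blast
    then have "(a \<otimes>\<^bsub>P\<^esub> v \<otimes>\<^bsub>P\<^esub> inv\<^bsub>P\<^esub> a, \<one>\<^bsub>F\<^esub>) \<in> W"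
      by (simp only: inv_PF[OF a fc] mult_PF G.r_one[OF fc] G.r_inv[OF fc])
    then show "a \<otimes>\<^bsub>P\<^esub> v \<otimes>\<^bsub>P\<^esub> inv\<^bsub>P\<^esub> a \<in> V" using a v by (simp add: V_def)
  qed
  moreover have "R \<subseteq> V"
  proof
    fix \<rho> assume \<rho>: "\<rho> \<in> R"
    then have "(\<rho>, \<one>\<^bsub>F\<^esub>) \<in> W" unfolding W_def S_def by (intro generate.incl) blast
    then show "\<rho> \<in> V" using \<rho> R_closed unfolding V_def by blast
  qed
  ultimately have N1V: "N1 \<subseteq> V" by (rule N1_least)
  have "I \<subseteq> W"
  proof
    fix y assume "y \<in> I"
    then obtain a f where y: "y = (a, f)" "a \<in> carrier P" "f \<in> carrier F" "q a = q (inl f)" by (auto simp: I_def)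
    have c: "inl f \<in> carrier P" using y by simp
    then have "a \<otimes>\<^bsub>P\<^esub> inv\<^bsub>P\<^esub> inl f \<in> V" using q_eq_iff y N1V by blast
    then have "(a \<otimes>\<^bsub>P\<^esub> inv\<^bsub>P\<^esub> inl f, \<one>\<^bsub>F\<^esub>) \<in> W" unfolding V_def by blast
    then have "(a \<otimes>\<^bsub>P\<^esub> inv\<^bsub>P\<^esub> inl f, \<one>\<^bsub>F\<^esub>) \<otimes>\<^bsub>PF\<^esub> (inl f, f) \<in> W"
      by (rule subgroup.m_closed[OF W _ diag[OF y(3)]])
    moreover have "(a \<otimes>\<^bsub>P\<^esub> inv\<^bsub>P\<^esub> inl f, \<one>\<^bsub>F\<^esub>) \<otimes>\<^bsub>PF\<^esub> (inl f, f) = y"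
      using y(2) c by (simp only: mult_PF G.l_one[OF y(3)] y(1)) (simp add: P.m_assoc)
    ultimately show "y \<in> W" by simp
  qed
  then have WI: "W = I" using WI by blast
  have psS: "\<psi> ` S \<subseteq> carrier M" using SI \<psi>(1) by blast
  have "\<phi> ` \<psi> ` S = S" using SI \<psi>(2) by (force simp: image_image)
  then have "\<phi> ` generate M (\<psi> ` S) = \<phi> ` carrier M"
    using \<phi>.generate_img[OF psS] WI \<phi>_image by (simp add: W_def)
  then have "generate M (\<psi> ` S) = carrier M"
    using inj_on_image_eq_iff[OF \<phi>_inj M.generate_incl[OF psS] subset_refl] by blast
  moreover have "finite S" using finite_R[OF assms] by (simp add: S_def)
  ultimately show ?thesis unfolding finitely_generated_def using psS by blast
qed

lemma free_by_free_M: "free_by_free M"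
proof -
  have sh: "snd \<in> hom M F" by (auto simp: hom_def M_def semidirect_product_def)
  interpret s: group_hom M F snd by (intro group_hom.intro group_hom_axioms.intro group_M group_free_group sh)
  define K where "K = kernel M F snd"
  have K: "K = carrier Finf \<times> {\<one>\<^bsub>F\<^esub>}"
    using G.one_closed by (auto simp: K_def kernel_def carrier_M)
  have Ksub: "subgroup K M" unfolding K_def by (rule s.subgroup_kernel)
  have "K \<lhd> M" unfolding K_def by (rule s.normal_kernel)
  moreover have "is_free_group (M\<lparr>carrier := K\<rparr>)"
  proof (rule is_free_groupI)
    show "group (M\<lparr>carrier := K\<rparr>)" by (rule M.subgroup_imp_group[OF Ksub])
    have "(\<lambda>u. (u, \<one>\<^bsub>F\<^esub>)) \<in> iso Finf (M\<lparr>carrier := K\<rparr>)"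
    proof (rule isoI)
      show "(\<lambda>u. (u, \<one>\<^bsub>F\<^esub>)) \<in> hom Finf (M\<lparr>carrier := K\<rparr>)"
      proof (rule homI)
        fix u v assume uv: "u \<in> carrier Finf" "v \<in> carrier Finf"
        have "act \<one>\<^bsub>F\<^esub> v = v" using uv unfolding act_def inl.hom_one by (simp add: \<theta>i_\<theta>)
        then have "\<alpha> \<one>\<^bsub>F\<^esub> v = v" using uv by (simp add: \<alpha>_def del: one_free_group)
        then show "(u \<otimes>\<^bsub>Finf\<^esub> v, \<one>\<^bsub>F\<^esub>) = (u, \<one>\<^bsub>F\<^esub>) \<otimes>\<^bsub>M\<lparr>carrier := K\<rparr>\<^esub> (v, \<one>\<^bsub>F\<^esub>)"
          using G.l_one[OF G.one_closed] by (simp add: M_def semidirect_product_def del: one_free_group)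
      qed (simp add: K)
      show "bij_betw (\<lambda>u. (u, \<one>\<^bsub>F\<^esub>)) (carrier Finf) (carrier (M\<lparr>carrier := K\<rparr>))"
        by (auto simp: K bij_betw_def inj_on_def)
    qed
    then show "Finf \<cong> M\<lparr>carrier := K\<rparr>" by (auto simp: is_iso_def)
  qed
  moreover have "is_free_group (M Mod K)"
  proof (rule is_free_groupI)
    have g: "group (M Mod K)" unfolding K_def by (rule normal.factorgroup_is_group[OF s.normal_kernel])
    then show "group (M Mod K)" .
    have "snd ` carrier M = carrier F" unfolding carrier_M using Finf.one_closed by force
    then have "M Mod K \<cong> F" unfolding K_def by (rule s.FactGroup_iso)
    then show "F \<cong> M Mod K" by (rule group.iso_sym[OF g])
  qed
  ultimately show ?thesis unfolding free_by_free_def by blast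
qed

text \<open>Only the first coordinate of \<open>y\<close> has to be corrected, by some
  \<open>u\<close> with \<open>(u, \<one>)\<close> in \<open>K\<close>. Such \<open>u\<close> form a
  subgroup of finite index in \<open>P\<close>, which maps onto \<open>Q\<close>, so the defect of
  \<open>y\<close> from lying in \<open>I\<close> can be matched.\<close>

lemma dense:
  assumes K: "K \<in> finite_index_normal PF" and y: "y \<in> carrier PF"
  shows "\<exists>z \<in> carrier M. K #>\<^bsub>PF\<^esub> y = K #>\<^bsub>PF\<^esub> \<phi> z"
proof -
  have nK: "K \<lhd> PF" using K finite_index_normalD by blast
  obtain a f where af: "y = (a, f)" "a \<in> carrier P" "f \<in> carrier F" using y by (auto simp: carrier_PF)
  have ih: "(\<lambda>a. (a, \<one>\<^bsub>F\<^esub>)) \<in> hom P PF"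
    using G.l_one[OF G.one_closed] G.one_closed
    by (intro homI) (simp_all add: carrier_PF mult_PF del: one_free_group)
  define U where "U = {u \<in> carrier P. (u, \<one>\<^bsub>F\<^esub>) \<in> K}"
  have "U \<in> finite_index_normal P"
    unfolding U_def by (rule finite_index_preimage[OF P.group_axioms PF.group_axioms ih K])
  then have "q ` U = carrier Q" by (rule finite_index_onto[OF P.group_axioms q.homh q_surj])
  moreover have c: "inl f \<in> carrier P" using af by simp
  then have "a \<otimes>\<^bsub>P\<^esub> inv\<^bsub>P\<^esub> inl f \<in> carrier P" using af by (intro P.m_closed P.inv_closed)
  then have "q (a \<otimes>\<^bsub>P\<^esub> inv\<^bsub>P\<^esub> inl f) \<in> carrier Q" by (rule q.hom_closed)
  ultimately have "q (a \<otimes>\<^bsub>P\<^esub> inv\<^bsub>P\<^esub> inl f) \<in> q ` U" by (simp only:)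
  then obtain u where u: "u \<in> U" "q u = q (a \<otimes>\<^bsub>P\<^esub> inv\<^bsub>P\<^esub> inl f)" by (elim imageE) (metis)
  have uc: "u \<in> carrier P" "(u, \<one>\<^bsub>F\<^esub>) \<in> K" using u by (auto simp: U_def)
  define b where "b = inv\<^bsub>P\<^esub> u \<otimes>\<^bsub>P\<^esub> a"
  have b: "b \<in> carrier P" using af uc by (simp add: b_def)
  have "q b = q (inl f)" using af uc u(2) c by (simp add: b_def Q.inv_mult_group Q.m_assoc)
  then have bI: "(b, f) \<in> I" using b af by (simp add: I_def)
  have "y \<otimes>\<^bsub>PF\<^esub> inv\<^bsub>PF\<^esub> (b, f) = (u, \<one>\<^bsub>F\<^esub>)"
    by (simp only: af(1) inv_PF[OF b af(3)] mult_PF G.r_inv[OF af(3)])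
      (use af uc in \<open>simp add: b_def P.inv_mult_group flip: P.m_assoc\<close>)
  then have "K #>\<^bsub>PF\<^esub> y = K #>\<^bsub>PF\<^esub> (b, f)"
    using coset_eq_iff[OF nK y I_closed[OF bI]] uc by simp
  then show ?thesis using \<psi>[OF bI] by metis
qed

text \<open>\<open>L\<close> is controlled on the two coordinate kernels separately, where
  \<open>finite_index_complement\<close> extends it to subgroups \<open>K1\<close> of
  \<open>P\<close> and \<open>K2\<close> of \<open>F\<close>. The remaining part of the fibre
  product, seen in \<open>Q\<close>, needs no control since \<open>Q\<close> has no finite
  quotients.\<close>

lemma cofinal:
  assumes L: "L \<in> finite_index_normal M"
  shows "\<exists>K \<in> finite_index_normal PF. {z \<in> carrier M. \<phi> z \<in> K} \<subseteq> L"
proof -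
  have nL: "L \<lhd> M" using L finite_index_normalD by blast
  have Ls: "subgroup L M" by (rule normal_imp_subgroup[OF nL])
  have Lconj: "g \<otimes>\<^bsub>M\<^esub> z \<otimes>\<^bsub>M\<^esub> inv\<^bsub>M\<^esub> g \<in> L" if "g \<in> carrier M" "z \<in> L" for g z
    using that nL M.normal_inv_iff by blast
  have Lfin: "finite ((\<lambda>z. L #>\<^bsub>M\<^esub> \<psi> z) ` A)" if "A \<subseteq> I" for A
    by (rule finite_subset[OF _ coset_image_finite[OF L]]) (use that \<psi>(1) in blast)
  define J where "J = {y \<in> I. \<psi> y \<in> L}"
  have Jm: "y \<otimes>\<^bsub>PF\<^esub> z \<in> J" if "y \<in> J" "z \<in> J" for y z
    using that \<psi>_mult subgroup.m_closed[OF I_sub] subgroup.m_closed[OF Ls] by (simp add: J_def)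
  have Ji: "inv\<^bsub>PF\<^esub> y \<in> J" if "y \<in> J" for y
    using that \<psi>_inv subgroup.m_inv_closed[OF I_sub] subgroup.m_inv_closed[OF Ls] by (simp add: J_def)
  have J1: "\<one>\<^bsub>PF\<^esub> \<in> J"
  proof -
    have "\<psi> \<one>\<^bsub>PF\<^esub> = \<one>\<^bsub>M\<^esub>" by (rule \<phi>_eqI) (simp_all only: \<psi> one_M subgroup.one_closed[OF I_sub])
    then show ?thesis using subgroup.one_closed[OF Ls] subgroup.one_closed[OF I_sub] by (simp only: J_def mem_Collect_eq)
  qed
  have Jc: "g \<otimes>\<^bsub>PF\<^esub> y \<otimes>\<^bsub>PF\<^esub> inv\<^bsub>PF\<^esub> g \<in> J" if g: "g \<in> I" and y: "y \<in> J" for g y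
  proof -
    have yI: "y \<in> I" "\<psi> y \<in> L" using y by (auto simp: J_def)
    have gi: "inv\<^bsub>PF\<^esub> g \<in> I" "g \<otimes>\<^bsub>PF\<^esub> y \<in> I"
      using subgroup.m_inv_closed[OF I_sub g] subgroup.m_closed[OF I_sub g yI(1)] by blast+
    have "\<psi> (g \<otimes>\<^bsub>PF\<^esub> y \<otimes>\<^bsub>PF\<^esub> inv\<^bsub>PF\<^esub> g) = \<psi> g \<otimes>\<^bsub>M\<^esub> \<psi> y \<otimes>\<^bsub>M\<^esub> inv\<^bsub>M\<^esub> \<psi> g"
      by (simp only: \<psi>_mult[OF gi(2,1)] \<psi>_mult[OF g yI(1)] \<psi>_inv[OF g])
    also have "\<dots> \<in> L" by (rule Lconj[OF \<psi>(1)[OF g] yI(2)])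
    finally show ?thesis using subgroup.m_closed[OF I_sub gi(2,1)] unfolding J_def by blast
  qed
  have Jeq: "y \<otimes>\<^bsub>PF\<^esub> inv\<^bsub>PF\<^esub> z \<in> J" if "y \<in> I" "z \<in> I" "L #>\<^bsub>M\<^esub> \<psi> y = L #>\<^bsub>M\<^esub> \<psi> z" for y z
  proof -
    have zi: "inv\<^bsub>PF\<^esub> z \<in> I" using subgroup.m_inv_closed[OF I_sub that(2)] .
    have "\<psi> y \<otimes>\<^bsub>M\<^esub> inv\<^bsub>M\<^esub> \<psi> z \<in> L" using that coset_eq_iff[OF nL \<psi>(1) \<psi>(1)] by blast
    then have "\<psi> (y \<otimes>\<^bsub>PF\<^esub> inv\<^bsub>PF\<^esub> z) \<in> L" by (simp only: \<psi>_mult[OF that(1) zi] \<psi>_inv[OF that(2)])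
    then show ?thesis using subgroup.m_closed[OF I_sub that(1) zi] unfolding J_def by blast
  qed
  have oo: "\<one>\<^bsub>F\<^esub> \<otimes>\<^bsub>F\<^esub> \<one>\<^bsub>F\<^esub> = \<one>\<^bsub>F\<^esub>" "inv\<^bsub>F\<^esub> \<one>\<^bsub>F\<^esub> = \<one>\<^bsub>F\<^esub>" "\<one>\<^bsub>P\<^esub> \<otimes>\<^bsub>P\<^esub> \<one>\<^bsub>P\<^esub> = \<one>\<^bsub>P\<^esub>" "inv\<^bsub>P\<^esub> \<one>\<^bsub>P\<^esub> = \<one>\<^bsub>P\<^esub>"
    by (rule G.l_one[OF G.one_closed] G.inv_one P.l_one[OF P.one_closed] P.inv_one)+
  define L1 where "L1 = {v. (v, \<one>\<^bsub>F\<^esub>) \<in> J}"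
  have JI: "y \<in> I" if "y \<in> J" for y using that by (simp add: J_def)
  have L1c: "v \<in> carrier P" "v \<in> N1" if "v \<in> L1" for v
  proof -
    have v: "(v, \<one>\<^bsub>F\<^esub>) \<in> I" using that JI unfolding L1_def by blast
    then show "v \<in> carrier P" unfolding I_def by blast
    moreover have "q v = q (inl \<one>\<^bsub>F\<^esub>)" using v unfolding I_def by blast
    then have "q v = \<one>\<^bsub>Q\<^esub>" by (simp only: inl.hom_one q.hom_one)
    ultimately show "v \<in> N1" using q_one_iff by blast
  qed
  \<comment> \<open>Normality in the whole of \<open>P\<close>, not merely under \<open>N1\<close>:
    every element of \<open>P\<close> is the first coordinate of some element of \<open>I\<close>,
    because \<open>F\<close> maps onto \<open>Q\<close>.\<close>
  have nL1: "L1 \<lhd> P"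
    unfolding P.normal_inv_iff
  proof (intro conjI ballI)
    show "subgroup L1 P"
    proof (rule P.subgroupI)
      show "L1 \<noteq> {}" using J1 unfolding one_PF L1_def by blast
      show "inv\<^bsub>P\<^esub> v \<in> L1" if "v \<in> L1" for v
        using that Ji[of "(v, \<one>\<^bsub>F\<^esub>)"] inv_PF[OF L1c(1)[OF that] G.one_closed] unfolding L1_def by (simp only: oo mem_Collect_eq)
      show "v \<otimes>\<^bsub>P\<^esub> v' \<in> L1" if "v \<in> L1" "v' \<in> L1" for v v'
        using that Jm[of "(v, \<one>\<^bsub>F\<^esub>)" "(v', \<one>\<^bsub>F\<^esub>)"] unfolding L1_def by (simp only: oo mult_PF mem_Collect_eq)
    qed (use L1c in blast)
    fix a v assume a: "a \<in> carrier P" and v: "v \<in> L1"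
    have "q a \<in> (\<lambda>u. q (inl u)) ` carrier F" unfolding qinl_surj using a by simp
    then obtain f where f: "f \<in> carrier F" "q a = q (inl f)" by blast
    then have af: "(a, f) \<in> I" using a by (simp add: I_def)
    have "(a, f) \<otimes>\<^bsub>PF\<^esub> (v, \<one>\<^bsub>F\<^esub>) \<otimes>\<^bsub>PF\<^esub> inv\<^bsub>PF\<^esub> (a, f) \<in> J" by (rule Jc[OF af]) (use v in \<open>simp only: L1_def mem_Collect_eq\<close>)
    then show "a \<otimes>\<^bsub>P\<^esub> v \<otimes>\<^bsub>P\<^esub> inv\<^bsub>P\<^esub> a \<in> L1"
      unfolding L1_def by (simp only: inv_PF[OF a f(1)] mult_PF G.r_one[OF f(1)] G.r_inv[OF f(1)] mem_Collect_eq)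
  qed
  have fin1: "finite ((\<lambda>v. L1 #>\<^bsub>P\<^esub> v) ` {v \<in> carrier P. v \<in> N1})"
  proof (rule finite_image_factor)
    show "finite ((\<lambda>v. L #>\<^bsub>M\<^esub> \<psi> (v, \<one>\<^bsub>F\<^esub>)) ` {v \<in> carrier P. v \<in> N1})"
      using Lfin[of "(\<lambda>v. (v, \<one>\<^bsub>F\<^esub>)) ` {v \<in> carrier P. v \<in> N1}"] N1_I by (auto simp: image_image simp del: one_free_group)
    fix v v' assume v: "v \<in> {v \<in> carrier P. v \<in> N1}" "v' \<in> {v \<in> carrier P. v \<in> N1}"
      and e: "L #>\<^bsub>M\<^esub> \<psi> (v, \<one>\<^bsub>F\<^esub>) = L #>\<^bsub>M\<^esub> \<psi> (v', \<one>\<^bsub>F\<^esub>)"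
    have "(v, \<one>\<^bsub>F\<^esub>) \<otimes>\<^bsub>PF\<^esub> inv\<^bsub>PF\<^esub> (v', \<one>\<^bsub>F\<^esub>) \<in> J" by (rule Jeq[OF _ _ e]) (use v N1_I in blast)+
    moreover have "v' \<in> carrier P" using v by blast
    ultimately have "v \<otimes>\<^bsub>P\<^esub> inv\<^bsub>P\<^esub> v' \<in> L1" unfolding L1_def by (simp only: inv_PF[OF _ G.one_closed] mult_PF oo mem_Collect_eq)
    then show "L1 #>\<^bsub>P\<^esub> v = L1 #>\<^bsub>P\<^esub> v'" using coset_eq_iff[OF nL1] v by blast
  qed
  have "\<exists>K \<in> finite_index_normal P. \<forall>g \<in> K. g \<in> N1 \<longrightarrow> g \<in> L1"
  proof (rule finite_index_complement[where f = "\<lambda>a. a", OF P.group_axioms])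
    show "(\<lambda>a. a) \<in> hom P P" by (simp add: hom_def)
    show "q ` carrier P = carrier Q" by (rule q_surj)
  qed (rule nL1, erule L1c(2), rule fin1)
  then obtain K1 where K1: "K1 \<in> finite_index_normal P" "\<And>g. g \<in> K1 \<Longrightarrow> g \<in> N1 \<Longrightarrow> (g, \<one>\<^bsub>F\<^esub>) \<in> J"
    unfolding L1_def by blast
  \<comment> \<open>The same on the other side, the intersection of \<open>J\<close> with the second
    factor; diagonal elements provide the conjugations.\<close>
  define L2 where "L2 = {f. (\<one>\<^bsub>P\<^esub>, f) \<in> J}"
  have I1: "(\<one>\<^bsub>P\<^esub>, f) \<in> I \<longleftrightarrow> f \<in> carrier F \<and> inl f \<in> N1" for f
    using q_one_iff[of "inl f"] by (auto simp: I_def)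
  have L2c: "f \<in> carrier F" "inl f \<in> N1" if "f \<in> L2" for f using that JI I1 unfolding L2_def by blast+
  have nL2: "L2 \<lhd> F"
    unfolding G.normal_inv_iff
  proof (intro conjI ballI)
    show "subgroup L2 F"
    proof (rule G.subgroupI)
      show "L2 \<noteq> {}" using J1 unfolding one_PF L2_def by blast
      show "inv\<^bsub>F\<^esub> f \<in> L2" if "f \<in> L2" for f
        using that Ji[of "(\<one>\<^bsub>P\<^esub>, f)"] inv_PF[OF P.one_closed L2c(1)[OF that]] unfolding L2_def by (simp only: oo mem_Collect_eq)
      show "f \<otimes>\<^bsub>F\<^esub> f' \<in> L2" if "f \<in> L2" "f' \<in> L2" for f f'
        using that Jm[of "(\<one>\<^bsub>P\<^esub>, f)" "(\<one>\<^bsub>P\<^esub>, f')"] unfolding L2_def by (simp only: oo mult_PF mem_Collect_eq)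
    qed (use L2c in blast)
    fix g f assume g: "g \<in> carrier F" and f: "f \<in> L2"
    have gc: "inl g \<in> carrier P" using g by simp
    have "(inl g, g) \<otimes>\<^bsub>PF\<^esub> (\<one>\<^bsub>P\<^esub>, f) \<otimes>\<^bsub>PF\<^esub> inv\<^bsub>PF\<^esub> (inl g, g) \<in> J"
      by (rule Jc[OF diag_I[OF g]]) (use f in \<open>simp only: L2_def mem_Collect_eq\<close>)
    then show "g \<otimes>\<^bsub>F\<^esub> f \<otimes>\<^bsub>F\<^esub> inv\<^bsub>F\<^esub> g \<in> L2"
      unfolding L2_def by (simp only: inv_PF[OF gc g] mult_PF P.r_one[OF gc] P.r_inv[OF gc] mem_Collect_eq)
  qed
  have fin2: "finite ((\<lambda>f. L2 #>\<^bsub>F\<^esub> f) ` {f \<in> carrier F. inl f \<in> N1})"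
  proof (rule finite_image_factor)
    show "finite ((\<lambda>f. L #>\<^bsub>M\<^esub> \<psi> (\<one>\<^bsub>P\<^esub>, f)) ` {f \<in> carrier F. inl f \<in> N1})"
      using Lfin[of "(\<lambda>f. (\<one>\<^bsub>P\<^esub>, f)) ` {f \<in> carrier F. inl f \<in> N1}"] I1 by (auto simp: image_image)
    fix f f' assume f: "f \<in> {f \<in> carrier F. inl f \<in> N1}" "f' \<in> {f \<in> carrier F. inl f \<in> N1}"
      and e: "L #>\<^bsub>M\<^esub> \<psi> (\<one>\<^bsub>P\<^esub>, f) = L #>\<^bsub>M\<^esub> \<psi> (\<one>\<^bsub>P\<^esub>, f')"
    have "(\<one>\<^bsub>P\<^esub>, f) \<otimes>\<^bsub>PF\<^esub> inv\<^bsub>PF\<^esub> (\<one>\<^bsub>P\<^esub>, f') \<in> J" by (rule Jeq[OF _ _ e]) (use f I1 in blast)+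
    moreover have "f' \<in> carrier F" using f by blast
    ultimately have "f \<otimes>\<^bsub>F\<^esub> inv\<^bsub>F\<^esub> f' \<in> L2" unfolding L2_def by (simp only: inv_PF[OF P.one_closed] mult_PF oo mem_Collect_eq)
    then show "L2 #>\<^bsub>F\<^esub> f = L2 #>\<^bsub>F\<^esub> f'" using coset_eq_iff[OF nL2] f by blast
  qed
  have "\<exists>K \<in> finite_index_normal F. \<forall>g \<in> K. inl g \<in> N1 \<longrightarrow> g \<in> L2"
    by (rule finite_index_complement[OF group_free_group inl.homh qinl_surj nL2 L2c(2) fin2])
  then obtain K2 where K2: "K2 \<in> finite_index_normal F" "\<And>g. g \<in> K2 \<Longrightarrow> inl g \<in> N1 \<Longrightarrow> (\<one>\<^bsub>P\<^esub>, g) \<in> J"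
    unfolding L2_def by blast
  define K where "K = {y \<in> carrier PF. fst y \<in> K1} \<inter> {y \<in> carrier PF. snd y \<in> K2}"
  have K: "K \<in> finite_index_normal PF"
    unfolding K_def
    by (intro finite_index_Int PF.group_axioms finite_index_preimage[OF PF.group_axioms P.group_axioms fst_hom K1(1)]
        finite_index_preimage[OF PF.group_axioms group_free_group snd_hom K2(1)])
  define W where "W = {z \<in> carrier M. \<phi> z \<in> K}"
  have Wf: "W \<in> finite_index_normal M"
    unfolding W_def by (rule finite_index_preimage[OF group_M PF.group_axioms \<phi>.homh K])
  have Ws: "subgroup W M" using Wf finite_index_normalD(1) normal_imp_subgroup by blast
  interpret h: group_hom M Q "\<lambda>z. q (fst (\<phi> z))"
    by unfold_locales (use hom_compose[OF hom_compose[OF \<phi>.homh fst_hom] q.homh] in \<open>simp add: comp_def\<close>)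
  have hs: "(\<lambda>z. q (fst (\<phi> z))) ` carrier M = carrier Q"
  proof
    show "(\<lambda>z. q (fst (\<phi> z))) ` carrier M \<subseteq> carrier Q" using h.hom_closed by blast
    show "carrier Q \<subseteq> (\<lambda>z. q (fst (\<phi> z))) ` carrier M"
    proof
      fix a assume "a \<in> carrier Q"
      then obtain f where f: "f \<in> carrier F" "a = q (inl f)" unfolding qinl_surj[symmetric] by blast
      then show "a \<in> (\<lambda>z. q (fst (\<phi> z))) ` carrier M"
        using \<psi>[OF diag_I[OF f(1)]] by (intro image_eqI[of _ _ "\<psi> (inl f, f)"]) auto
    qed
  qed
  \<comment> \<open>An element of \<open>W\<close> can thus be divided by an element of
    \<open>W \<inter> L\<close> with the same image in \<open>Q\<close>. The quotient has both
    coordinates over the unit of \<open>Q\<close> and splits into two factors controlled by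
    \<open>K1\<close> and \<open>K2\<close>.\<close>
  have onto: "(\<lambda>z. q (fst (\<phi> z))) ` (W \<inter> L) = carrier Q"
    by (rule finite_index_onto[OF group_M h.homh hs finite_index_Int[OF group_M Wf L]])
  have "W \<subseteq> L"
  proof
    fix z assume z: "z \<in> W"
    then have zc: "z \<in> carrier M" by (simp add: W_def)
    then have "q (fst (\<phi> z)) \<in> (\<lambda>z. q (fst (\<phi> z))) ` (W \<inter> L)" unfolding onto by (rule h.hom_closed)
    then obtain z' where z': "z' \<in> W" "z' \<in> L" "q (fst (\<phi> z)) = q (fst (\<phi> z'))" by blast
    then have zc': "z' \<in> carrier M" by (simp add: W_def)
    define d where "d = z \<otimes>\<^bsub>M\<^esub> inv\<^bsub>M\<^esub> z'"
    have dc: "d \<in> carrier M" using zc zc' by (simp add: d_def)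
    have dW: "d \<in> W" unfolding d_def using z z' subgroup.m_closed[OF Ws] subgroup.m_inv_closed[OF Ws] by blast
    have "q (fst (\<phi> d)) = q (fst (\<phi> z')) \<otimes>\<^bsub>Q\<^esub> inv\<^bsub>Q\<^esub> q (fst (\<phi> z'))"
      unfolding d_def by (simp only: h.hom_mult[OF zc M.inv_closed[OF zc']] h.hom_inv[OF zc'] z'(3))
    then have qd: "q (fst (\<phi> d)) = \<one>\<^bsub>Q\<^esub>" by (simp only: Q.r_inv[OF h.hom_closed[OF zc']])
    obtain a f where af: "\<phi> d = (a, f)" "a \<in> carrier P" "f \<in> carrier F" "q a = q (inl f)"
      using \<phi>_I[OF dc] unfolding I_def by blast
    have aN: "a \<in> N1" "inl f \<in> N1" using qd af q_one_iff[of a] q_one_iff[of "inl f"] by auto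
    have "a \<in> K1" "f \<in> K2" using dW af by (auto simp: W_def K_def)
    then have j: "(a, \<one>\<^bsub>F\<^esub>) \<in> J" "(\<one>\<^bsub>P\<^esub>, f) \<in> J" using K1(2) K2(2) aN by blast+
    have "\<phi> d = (a, \<one>\<^bsub>F\<^esub>) \<otimes>\<^bsub>PF\<^esub> (\<one>\<^bsub>P\<^esub>, f)"
      by (simp only: af(1) mult_PF G.l_one[OF af(3)] P.r_one[OF af(2)])
    then have "\<phi> d \<in> J" using Jm[OF j] by simp
    moreover have "\<psi> (\<phi> d) = d" by (rule \<phi>_eqI) (use \<psi>[OF \<phi>_I[OF dc]] dc in auto)
    ultimately have dL: "d \<in> L" unfolding J_def by auto
    have "z = d \<otimes>\<^bsub>M\<^esub> z'" using zc zc' by (simp add: d_def M.m_assoc)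
    then show "z \<in> L" using subgroup.m_closed[OF Ls dL z'(2)] by simp
  qed
  then show ?thesis using K unfolding W_def by blast
qed

lemma profinite_iso: "induces_profinite_iso M PF \<phi>"
  by (rule induces_profinite_isoI[OF group_M PF.group_axioms \<phi>.homh dense cofinal])

end


theorem theorem1:
  fixes \<Gamma> :: "'a monoid"
  assumes "group \<Gamma>"
    and "finitely_generated \<Gamma>"
    and "recursively_presented \<Gamma>"
    and "residually_finite \<Gamma>"
  shows "\<exists>M \<alpha> \<phi>.
           \<alpha> \<in> hom (free_group {..<4::nat}) (AutoGroup (free_group (UNIV :: nat set)))
         \<and> M = semidirect_product (free_group (UNIV :: nat set)) (free_group {..<4::nat}) \<alpha>
         \<and> group M
         \<and> finitely_generated M
         \<and> residually_finite M
         \<and> free_by_free M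
         \<and> \<phi> \<in> mon M (free_product (free_group {..<4::nat}) \<Gamma> \<times>\<times> free_group {..<4::nat})
         \<and> induces_profinite_iso M
              (free_product (free_group {..<4::nat}) \<Gamma> \<times>\<times> free_group {..<4::nat}) \<phi>"
proof -
  let ?F = "free_group {..<4 :: nat}"
  let ?E = "generate ?F {free_gen 0, free_gen 1}"
  obtain X where X: "finite X" "X \<subseteq> carrier \<Gamma>" "generate \<Gamma> X = carrier \<Gamma>"
    using assms(2) by (auto simp: finitely_generated_def)
  interpret \<Gamma>: group \<Gamma> by fact
  interpret Perm: group "BijGroup (UNIV :: (real \<times> int, 'a) model set)" by (rule group_Perm)
  obtain N and b c s x n m k l r :: "(real \<times> int, 'a) model \<Rightarrow> (real \<times> int, 'a) model" and \<rho> where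
    model: "{b, c, s, x} \<subseteq> carrier Perm \<and> {n, m, k, l, r} \<subseteq> generate Perm {b, c} \<and>
    \<rho> \<in> hom \<Gamma> Perm \<and> inj_on \<rho> (carrier \<Gamma>) \<and> \<rho> ` X \<subseteq> generate Perm {b, c} \<and>
    N mod 6 = 1 \<and> 6 < N \<and> s \<noteq> \<one>\<^bsub>Perm\<^esub> \<and> relators Perm N b c s x n m k l r \<subseteq> {\<one>\<^bsub>Perm\<^esub>}"
    using model_exists[OF assms(1) X(1,2)] by (elim exE) (rule that)
  then have md: "{b, c, s, x} \<subseteq> carrier Perm" "{n, m, k, l, r} \<subseteq> generate Perm {b, c}" and
    \<rho>: "\<rho> \<in> hom \<Gamma> Perm" "inj_on \<rho> (carrier \<Gamma>)" "\<rho> ` X \<subseteq> generate Perm {b, c}" and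
    N: "N mod 6 = 1" "6 < N" and s1: "s \<noteq> \<one>\<^bsub>Perm\<^esub>" and rel: "relators Perm N b c s x n m k l r \<subseteq> {\<one>\<^bsub>Perm\<^esub>}"
    by - (elim conjE, assumption)+
  \<comment> \<open>The first two free generators model \<open>b\<close> and \<open>c\<close>, the
    other two \<open>s\<close> and \<open>x\<close>; this is where rank four comes from.\<close>
  define ys where "ys i = (if i = 0 then b else if i = 1 then c else if i = 2 then s else x)" for i :: nat
  have ys: "ys i \<in> carrier Perm" for i using md(1) unfolding ys_def by (simp only: insert_subset split: if_split) blast
  define \<sigma> where "\<sigma> = free_hom Perm ys"
  have \<sigma>: "\<sigma> \<in> hom ?F Perm" unfolding \<sigma>_def by (rule free_hom_hom[OF group_Perm ys])
  have \<sigma>g: "\<sigma> (free_gen i) = ys i" if "i < 4" for i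
    unfolding \<sigma>_def using free_hom_gen[OF group_Perm ys, of i "{..<4}"] that by simp
  have y01: "ys 0 = b" "ys 1 = c" "ys 2 = s" "ys 3 = x" by (simp_all add: ys_def)
  interpret \<sigma>: group_hom ?F Perm \<sigma> by (intro group_hom.intro group_hom_axioms.intro group_free_group group_Perm \<sigma>)
  have \<sigma>E: "\<sigma> ` ?E = generate Perm {b, c}"
  proof -
    have "{free_gen 0, free_gen 1} \<subseteq> carrier ?F" using free_gen_closed[of _ "{..<4 :: nat}"] by simp
    then have "\<sigma> ` ?E = generate Perm (\<sigma> ` {free_gen 0, free_gen 1})" by (rule \<sigma>.generate_img[symmetric])
    then show ?thesis using \<sigma>g[of 0] \<sigma>g[of 1] y01 by simp
  qed
  have word: "\<exists>u. u \<in> ?E \<and> \<sigma> u = z" if "z \<in> generate Perm {b, c}" for z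
    using that unfolding \<sigma>E[symmetric] by blast
  \<comment> \<open>The model supplies the words: each generator of \<Gamma> acts as an element
    generated by \<open>b\<close> and \<open>c\<close>, and any word for it serves in the
    relator.\<close>
  define w where "w g = (SOME u. u \<in> ?E \<and> \<sigma> u = \<rho> g)" for g
  have w: "w g \<in> ?E \<and> \<sigma> (w g) = \<rho> g" if "g \<in> X" for g
    unfolding w_def by (rule someI_ex, rule word) (use \<rho>(3) that in blast)
  obtain n' where n': "n' \<in> ?E" "\<sigma> n' = n" using word md(2) by blast
  obtain m' where m': "m' \<in> ?E" "\<sigma> m' = m" using word md(2) by blast
  obtain k' where k': "k' \<in> ?E" "\<sigma> k' = k" using word md(2) by blast
  obtain l' where l': "l' \<in> ?E" "\<sigma> l' = l" using word md(2) by blast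
  obtain r' where r': "r' \<in> ?E" "\<sigma> r' = r" using word md(2) by blast
  interpret enc: encoding \<Gamma> X N w n' m' k' l' r'
  proof unfold_locales
    show "{n', m', k', l', r'} \<subseteq> ?E" using n'(1) m'(1) k'(1) l'(1) r'(1) by blast
    show "w ` X \<subseteq> ?E" using w by blast
  qed (rule X N)+
  define \<mu> where "\<mu> = fp_hom Perm \<sigma> \<rho>"
  have \<mu>: "\<mu> \<in> hom enc.P Perm" unfolding \<mu>_def by (rule enc.fp_hom_hom[OF group_Perm \<sigma> \<rho>(1)])
  have \<mu>l: "\<mu> (enc.inl u) = \<sigma> u" if "u \<in> carrier ?F" for u
    unfolding \<mu>_def by (rule enc.fp_hom_inl[OF group_Perm \<sigma> \<rho>(1) that])
  have \<mu>r: "\<mu> (enc.inr g) = \<rho> g" if "g \<in> carrier \<Gamma>" for g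
    unfolding \<mu>_def by (rule enc.fp_hom_inr[OF group_Perm \<sigma> \<rho>(1) that])
  interpret \<mu>: group_hom enc.P Perm \<mu>
    by (intro group_hom.intro group_hom_axioms.intro enc.P.group_axioms group_Perm \<mu>)
  have "enc.R \<subseteq> kernel enc.P Perm \<mu>"
  proof -
    have "\<mu> (inv\<^bsub>enc.P\<^esub> enc.inr g \<otimes>\<^bsub>enc.P\<^esub> enc.inl (w g)) = \<one>\<^bsub>Perm\<^esub>" if g: "g \<in> X" for g
    proof -
      have c: "enc.inr g \<in> carrier enc.P" "enc.inl (w g) \<in> carrier enc.P" using g X enc.w_closed by auto
      have "\<mu> (enc.inr g) = \<mu> (enc.inl (w g))" using \<mu>r \<mu>l[OF enc.w_closed[OF g]] w[OF g] g X(2) by auto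
      then show ?thesis
        by (simp only: \<mu>.hom_mult[OF enc.P.inv_closed[OF c(1)] c(2)] \<mu>.hom_inv[OF c(1)] Perm.l_inv[OF \<mu>.hom_closed[OF c(2)]])
    qed
    moreover have "\<mu> (enc.inl u) = \<one>\<^bsub>Perm\<^esub>" if u: "u \<in> enc.F_rels" for u
    proof -
      have "\<sigma> ` enc.F_rels \<subseteq> {\<one>\<^bsub>Perm\<^esub>}"
        unfolding enc.F_rels_def \<sigma>.relators_image[OF enc.F_cl, symmetric]
        using rel \<sigma>g[of 0] \<sigma>g[of 1] \<sigma>g[of 2] \<sigma>g[of 3] y01 n' m' k' l' r' by simp
      then show ?thesis using u \<mu>l enc.F_rels_closed by blast
    qed
    ultimately have "\<mu> z = \<one>\<^bsub>Perm\<^esub>" if "z \<in> enc.R" for z using that unfolding enc.R_def by blast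
    then show ?thesis using enc.R_closed unfolding kernel_def by blast
  qed
  then have ker: "enc.N1 \<subseteq> kernel enc.P Perm \<mu>" by (rule enc.N1_least[OF \<mu>.normal_kernel])
  \<comment> \<open>The model factors through \<open>Q\<close>, so whatever is distinguished by
    permutations is already distinct in \<open>Q\<close>. This gives both that \<open>s\<close>
    survives and that \<Gamma> embeds.\<close>
  have mu_q: "\<mu> a = \<mu> a'" if a: "a \<in> carrier enc.P" "a' \<in> carrier enc.P" "enc.q a = enc.q a'" for a a'
  proof -
    have "a \<otimes>\<^bsub>enc.P\<^esub> inv\<^bsub>enc.P\<^esub> a' \<in> enc.N1"
      using a coset_eq_iff[OF enc.N1_normal a(1,2)] unfolding enc.q_def by blast
    then have "\<mu> (a \<otimes>\<^bsub>enc.P\<^esub> inv\<^bsub>enc.P\<^esub> a') = \<one>\<^bsub>Perm\<^esub>" using ker unfolding kernel_def by blast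
    then have "\<mu> a \<otimes>\<^bsub>Perm\<^esub> inv\<^bsub>Perm\<^esub> \<mu> a' = \<one>\<^bsub>Perm\<^esub>"
      by (simp only: \<mu>.hom_mult[OF a(1) enc.P.inv_closed[OF a(2)]] \<mu>.hom_inv[OF a(2)])
    then show ?thesis using Perm.right_cancel Perm.inv_equality[of "\<mu> a" "inv\<^bsub>Perm\<^esub> \<mu> a'"]
        Perm.inv_inv[OF \<mu>.hom_closed[OF a(2)]] Perm.inv_closed[OF \<mu>.hom_closed[OF a(2)]] \<mu>.hom_closed[OF a(1)] by metis
  qed
  have fc: "free_gen i \<in> carrier ?F" if "i < 4" for i :: nat using free_gen_closed[of i "{..<4 :: nat}"] that by simp
  have "enc.q (enc.inl (free_gen 2)) \<noteq> \<one>\<^bsub>enc.Q\<^esub>"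
  proof
    assume "enc.q (enc.inl (free_gen 2)) = \<one>\<^bsub>enc.Q\<^esub>"
    then have "enc.q (enc.inl (free_gen 2)) = enc.q \<one>\<^bsub>enc.P\<^esub>" by (simp only: enc.q.hom_one)
    then have "\<mu> (enc.inl (free_gen 2)) = \<mu> \<one>\<^bsub>enc.P\<^esub>" using fc[of 2] by (intro mu_q) auto
    then show False using s1 \<mu>l[OF fc[of 2]] \<sigma>g[of 2] y01 \<mu>.hom_one by simp
  qed
  then have inf: "infinite (carrier enc.Q)" by (rule enc.infinite_carrier)
  have inj: "inj_on enc.q (enc.inr ` carrier \<Gamma>)"
  proof (rule inj_onI)
    fix z z' assume zz: "z \<in> enc.inr ` carrier \<Gamma>" "z' \<in> enc.inr ` carrier \<Gamma>" "enc.q z = enc.q z'"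
    then obtain g h where gh: "g \<in> carrier \<Gamma>" "h \<in> carrier \<Gamma>" "z = enc.inr g" "z' = enc.inr h" by blast
    have "\<mu> z = \<mu> z'" by (rule mu_q[OF _ _ zz(3)]) (use gh in auto)
    then have "\<rho> g = \<rho> h" using \<mu>r gh by simp
    then show "z = z'" using inj_onD[OF \<rho>(2) _ gh(1,2)] gh(3,4) by blast
  qed
  have "countable (carrier \<Gamma>)" using \<Gamma>.countable_generate[OF countable_finite[OF X(1)] X(2)] X(3) by simp
  then have cnt: "countable (carrier enc.P)"
    by (intro enc.countable_P countable_free_group) auto
  have g0: "enc.gen 0 \<in> carrier enc.P" by simp
  \<comment> \<open>The first generator has infinite order in \<open>P\<close> but is torsion in
    \<open>Q\<close>, as required for a kernel of infinite rank.\<close>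
  have pow: "enc.q (enc.gen 0 [^]\<^bsub>enc.P\<^esub> N) = \<one>\<^bsub>enc.Q\<^esub>"
    using enc.sol_facts(1) enc.q.hom_nat_pow[OF g0] by (simp add: enc.gen_def)
  have "\<exists>\<theta>. \<theta> \<in> iso (free_group (UNIV :: nat set)) (enc.P\<lparr>carrier := kernel enc.P enc.Q enc.q\<rparr>)"
    by (rule enc.kernel_free_countable[OF enc.Q.group_axioms enc.q.homh enc.q_surj inj inf cnt _ _ pow]) (use N in simp_all)
  then obtain \<theta> where "\<theta> \<in> iso (free_group (UNIV :: nat set)) (enc.P\<lparr>carrier := enc.N1\<rparr>)"
    unfolding enc.kernel_q by blast
  then interpret real: realized_encoding \<Gamma> X N w n' m' k' l' r' \<theta>
    by unfold_locales
  show ?thesis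
    using real.\<alpha>_hom real.M_def real.group_M real.finitely_generated_M[OF X(1)] real.residually_finite_M[OF assms(4)]
      real.free_by_free_M real.\<phi>_mon real.profinite_iso
    by blast
qed

end
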